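(* Let $k$ be a field and let $A$ and $B$ be $k$-algebras. Then: (a) If $A\otimes_k B$ is LFD, then so are $A$ and $B$, and either $t.d.(A/p:k)<\infty$ for each prime ideal $p$ of $A$ or $t.d.(B/q:k)<\infty$ for each prime ideal $q$ of $B$. (b) If both $A$ and $B$ are LFD and either $t.d.(A:k)<\infty$ or $t.d.(B:k)<\infty$, then $A\otimes_k B$ is LFD. The converse holds provided $A$ and $B$ are domains (that is, if $A$ and $B$ are domains and $A\otimes_k B$ is LFD, then both $A$ and $B$ are LFD and either $t.d.(A:k)<\infty$ or $t.d.(B:k)<\infty$).
   Context: All rings and algebras are commutative with identity and non-zero. For a domain $D$ containing $k$, $t.d.(D:k)$ is the transcendence degree over $k$ of the quotient field of $D$; for an arbitrary $k$-algebra $A$, $t.d.(A:k)=\sup\{t.d.(A/p:k): p\in \mathrm{Spec}(A)\}$. A ring is LFD (locally finite-dimensional) if its localization at every prime ideal has finite Krull dimension. *)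

theory Defs
  imports "HOL-Algebra.Algebra" "HOL-Library.Extended_Nat"
begin

section \<open>Rings of fractions and Krull dimension\<close>

definition frac_rel :: "('a, 'm) ring_scheme \<Rightarrow> 'a set \<Rightarrow> (('a \<times> 'a) \<times> ('a \<times> 'a)) set"
  where "frac_rel R S =
    {((a, s), (b, t)) | a s b t. a \<in> carrier R \<and> b \<in> carrier R \<and> s \<in> S \<and> t \<in> S \<and>
       (\<exists>u\<in>S. u \<otimes>\<^bsub>R\<^esub> (a \<otimes>\<^bsub>R\<^esub> t) = u \<otimes>\<^bsub>R\<^esub> (b \<otimes>\<^bsub>R\<^esub> s))}"

definition frac_of :: "('a, 'm) ring_scheme \<Rightarrow> 'a set \<Rightarrow> 'a \<Rightarrow> 'a \<Rightarrow> ('a \<times> 'a) set"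
  where "frac_of R S a s = frac_rel R S `` {(a, s)}"

text \<open>In the sum and product below all members of the unions coincide, cf.
  \<open>ring_of_fracs_mult\<close> and \<open>ring_of_fracs_add\<close>.\<close>

definition ring_of_fracs :: "('a, 'm) ring_scheme \<Rightarrow> 'a set \<Rightarrow> ('a \<times> 'a) set ring"
  where "ring_of_fracs R S =
    \<lparr>carrier = (carrier R \<times> S) // frac_rel R S,
     monoid.mult = (\<lambda>x y. \<Union>(a, s)\<in>x. \<Union>(b, t)\<in>y. frac_of R S (a \<otimes>\<^bsub>R\<^esub> b) (s \<otimes>\<^bsub>R\<^esub> t)),
     one = frac_of R S \<one>\<^bsub>R\<^esub> \<one>\<^bsub>R\<^esub>,
     ring.zero = frac_of R S \<zero>\<^bsub>R\<^esub> \<one>\<^bsub>R\<^esub>,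
     add = (\<lambda>x y. \<Union>(a, s)\<in>x. \<Union>(b, t)\<in>y.
              frac_of R S (a \<otimes>\<^bsub>R\<^esub> t \<oplus>\<^bsub>R\<^esub> b \<otimes>\<^bsub>R\<^esub> s) (s \<otimes>\<^bsub>R\<^esub> t))\<rparr>"

definition localization_at :: "('a, 'm) ring_scheme \<Rightarrow> 'a set \<Rightarrow> ('a \<times> 'a) set ring"
  where "localization_at R P = ring_of_fracs R (carrier R - P)"

definition quotient_field :: "('a, 'm) ring_scheme \<Rightarrow> ('a \<times> 'a) set ring"
  where "quotient_field D = ring_of_fracs D (carrier D - {\<zero>\<^bsub>D\<^esub>})"

definition quotient_field_embed :: "('a, 'm) ring_scheme \<Rightarrow> 'a \<Rightarrow> ('a \<times> 'a) set"
  where "quotient_field_embed D x = frac_of D (carrier D - {\<zero>\<^bsub>D\<^esub>}) x \<one>\<^bsub>D\<^esub>"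

context cring begin

context
  fixes S
  assumes S: "submonoid S R"
begin

lemma denom_carrier: "s \<in> S \<Longrightarrow> s \<in> carrier R"
  using submonoid.subset[OF S] by blast
lemma denom_mult: "s \<in> S \<Longrightarrow> t \<in> S \<Longrightarrow> s \<otimes> t \<in> S"
  using submonoid.m_closed[OF S] by blast
lemma denom_one: "\<one> \<in> S"
  using submonoid.one_closed[OF S] by blast

lemma frac_relI:
  "\<lbrakk>a \<in> carrier R; b \<in> carrier R; s \<in> S; t \<in> S; u \<in> S; u \<otimes> (a \<otimes> t) = u \<otimes> (b \<otimes> s)\<rbrakk>
    \<Longrightarrow> ((a, s), (b, t)) \<in> frac_rel R S"
  unfolding frac_rel_def by blast

lemma frac_relE:
  assumes "((a, s), (b, t)) \<in> frac_rel R S"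
  obtains u where "a \<in> carrier R" "b \<in> carrier R" "s \<in> S" "t \<in> S" "u \<in> S"
    "u \<otimes> (a \<otimes> t) = u \<otimes> (b \<otimes> s)"
  using assms unfolding frac_rel_def by blast

lemma equiv_frac_rel: "equiv (carrier R \<times> S) (frac_rel R S)"
proof (rule equivI)
  show "frac_rel R S \<subseteq> (carrier R \<times> S) \<times> carrier R \<times> S"
    unfolding frac_rel_def by blast
  show "refl_on (carrier R \<times> S) (frac_rel R S)"
    unfolding refl_on_def using frac_relI denom_one by auto
  show "sym (frac_rel R S)"
  proof (rule symI)
    fix x y assume "(x, y) \<in> frac_rel R S"
    then show "(y, x) \<in> frac_rel R S"
      by (cases x; cases y) (metis frac_relE frac_relI)
  qed
  show "trans (frac_rel R S)"
  proof (rule transI)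
    fix x y z assume xy: "(x, y) \<in> frac_rel R S" and yz: "(y, z) \<in> frac_rel R S"
    obtain a s b t c r where e: "x = (a, s)" "y = (b, t)" "z = (c, r)"
      by (cases x; cases y; cases z) auto
    obtain u where u: "a \<in> carrier R" "b \<in> carrier R" "s \<in> S" "t \<in> S" "u \<in> S"
      "u \<otimes> (a \<otimes> t) = u \<otimes> (b \<otimes> s)"
      using xy e by (auto elim: frac_relE)
    obtain v where v: "c \<in> carrier R" "r \<in> S" "v \<in> S" "v \<otimes> (b \<otimes> r) = v \<otimes> (c \<otimes> t)"
      using yz e by (auto elim: frac_relE)
    note C = u(1,2) v(1) denom_carrier[OF u(3)] denom_carrier[OF u(4)] denom_carrier[OF u(5)] denom_carrier[OF v(2)]
      denom_carrier[OF v(3)]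
    have "(u \<otimes> v \<otimes> t) \<otimes> (a \<otimes> r) = (v \<otimes> r) \<otimes> (u \<otimes> (a \<otimes> t))"
      using C by (simp add: m_ac)
    also have "\<dots> = (u \<otimes> s) \<otimes> (v \<otimes> (b \<otimes> r))"
      unfolding u(6) using C by (simp add: m_ac)
    also have "\<dots> = (u \<otimes> v \<otimes> t) \<otimes> (c \<otimes> s)"
      unfolding v(4) using C by (simp add: m_ac)
    finally show "(x, z) \<in> frac_rel R S"
      unfolding e
      by (rule frac_relI[rotated -1]) (simp_all only: u(1-5) v(1-3) denom_mult)
  qed
qed

lemma frac_of_eq_iff:
  assumes "a \<in> carrier R" "s \<in> S" "b \<in> carrier R" "t \<in> S"
  shows "frac_of R S a s = frac_of R S b t \<longleftrightarrow> (\<exists>u\<in>S. u \<otimes> (a \<otimes> t) = u \<otimes> (b \<otimes> s))"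
  using eq_equiv_class_iff[OF equiv_frac_rel, of "(a, s)" "(b, t)"] assms
  by (auto simp: frac_of_def frac_rel_def)

lemma frac_of_eqI:
  assumes "a \<in> carrier R" "s \<in> S" "b \<in> carrier R" "t \<in> S" "u \<in> S"
    "u \<otimes> (a \<otimes> t) = u \<otimes> (b \<otimes> s)"
  shows "frac_of R S a s = frac_of R S b t"
  using assms frac_of_eq_iff by blast

lemma ring_of_fracs_mult:
  assumes "a \<in> carrier R" "s \<in> S" "b \<in> carrier R" "t \<in> S"
  shows "frac_of R S a s \<otimes>\<^bsub>ring_of_fracs R S\<^esub> frac_of R S b t = frac_of R S (a \<otimes> b) (s \<otimes> t)"
proof -
  let ?f = "\<lambda>(a, s) (b, t). frac_of R S (a \<otimes> b) (s \<otimes> t)"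
  have "congruent2 (frac_rel R S) (frac_rel R S) ?f"
  proof (rule congruent2I')
    fix x x' y y' assume "(x, x') \<in> frac_rel R S" "(y, y') \<in> frac_rel R S"
    moreover obtain a s a' s' b t b' t'
      where e: "x = (a, s)" "x' = (a', s')" "y = (b, t)" "y' = (b', t')"
      by (cases x; cases x'; cases y; cases y') auto
    ultimately obtain u v where u: "a \<in> carrier R" "a' \<in> carrier R" "s \<in> S" "s' \<in> S" "u \<in> S"
      "u \<otimes> (a \<otimes> s') = u \<otimes> (a' \<otimes> s)"
      and v: "b \<in> carrier R" "b' \<in> carrier R" "t \<in> S" "t' \<in> S" "v \<in> S"
      "v \<otimes> (b \<otimes> t') = v \<otimes> (b' \<otimes> t)"
      by (auto elim!: frac_relE)
    note C = u(1,2) v(1,2) u(3-5)[THEN denom_carrier] v(3-5)[THEN denom_carrier]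
    have "(u \<otimes> v) \<otimes> ((a \<otimes> b) \<otimes> (s' \<otimes> t')) = (u \<otimes> (a \<otimes> s')) \<otimes> (v \<otimes> (b \<otimes> t'))"
      using C by (simp add: m_ac)
    also have "\<dots> = (u \<otimes> v) \<otimes> ((a' \<otimes> b') \<otimes> (s \<otimes> t))"
      unfolding u(6) v(6) using C by (simp add: m_ac)
    finally show "?f x y = ?f x' y'"
      unfolding e prod.case
      by (rule frac_of_eqI[rotated -1]) (simp_all only: C m_closed u(3-5) v(3-5) denom_mult)
  qed
  from UN_equiv_class2[OF equiv_frac_rel equiv_frac_rel this, of "(a, s)" "(b, t)"] assms
  show ?thesis
    by (simp add: ring_of_fracs_def frac_of_def split_def)
qed

lemma ring_of_fracs_add:
  assumes "a \<in> carrier R" "s \<in> S" "b \<in> carrier R" "t \<in> S"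
  shows "frac_of R S a s \<oplus>\<^bsub>ring_of_fracs R S\<^esub> frac_of R S b t
    = frac_of R S (a \<otimes> t \<oplus> b \<otimes> s) (s \<otimes> t)"
proof -
  let ?f = "\<lambda>(a, s) (b, t). frac_of R S (a \<otimes> t \<oplus> b \<otimes> s) (s \<otimes> t)"
  have "congruent2 (frac_rel R S) (frac_rel R S) ?f"
  proof (rule congruent2I')
    fix x x' y y' assume "(x, x') \<in> frac_rel R S" "(y, y') \<in> frac_rel R S"
    moreover obtain a s a' s' b t b' t'
      where e: "x = (a, s)" "x' = (a', s')" "y = (b, t)" "y' = (b', t')"
      by (cases x; cases x'; cases y; cases y') auto
    ultimately obtain u v where u: "a \<in> carrier R" "a' \<in> carrier R" "s \<in> S" "s' \<in> S" "u \<in> S"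
      "u \<otimes> (a \<otimes> s') = u \<otimes> (a' \<otimes> s)"
      and v: "b \<in> carrier R" "b' \<in> carrier R" "t \<in> S" "t' \<in> S" "v \<in> S"
      "v \<otimes> (b \<otimes> t') = v \<otimes> (b' \<otimes> t)"
      by (auto elim!: frac_relE)
    note C = u(1,2) v(1,2) u(3-5)[THEN denom_carrier] v(3-5)[THEN denom_carrier]
    have "(u \<otimes> v) \<otimes> ((a \<otimes> t \<oplus> b \<otimes> s) \<otimes> (s' \<otimes> t'))
        = (u \<otimes> (a \<otimes> s')) \<otimes> (v \<otimes> t \<otimes> t') \<oplus> (v \<otimes> (b \<otimes> t')) \<otimes> (u \<otimes> s \<otimes> s')"
      using C by (simp add: m_ac l_distr r_distr)
    also have "\<dots> = (u \<otimes> v) \<otimes> ((a' \<otimes> t' \<oplus> b' \<otimes> s') \<otimes> (s \<otimes> t))"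
      unfolding u(6) v(6) using C by (simp add: m_ac l_distr r_distr)
    finally show "?f x y = ?f x' y'"
      unfolding e prod.case
      by (rule frac_of_eqI[rotated -1])
        (simp_all only: C m_closed a_closed u(3-5) v(3-5) denom_mult)
  qed
  from UN_equiv_class2[OF equiv_frac_rel equiv_frac_rel this, of "(a, s)" "(b, t)"] assms
  show ?thesis
    by (simp add: ring_of_fracs_def frac_of_def split_def)
qed

lemma ring_of_fracs_carrier:
  "carrier (ring_of_fracs R S) = {frac_of R S a s | a s. a \<in> carrier R \<and> s \<in> S}"
  by (auto simp: ring_of_fracs_def quotient_def frac_of_def)

lemma frac_of_cancel:
  assumes "a \<in> carrier R" "s \<in> S" "b \<in> carrier R" "t \<in> S" "a \<otimes> t = b \<otimes> s"
  shows "frac_of R S a s = frac_of R S b t"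
  using assms denom_one frac_of_eq_iff by auto

lemma cring_ring_of_fracs: "cring (ring_of_fracs R S)"
proof -
  let ?Q = "ring_of_fracs R S"
  note C = denom_carrier denom_mult denom_one ring_of_fracs_add ring_of_fracs_mult
  have one: "\<one>\<^bsub>?Q\<^esub> = frac_of R S \<one> \<one>" and zero: "\<zero>\<^bsub>?Q\<^esub> = frac_of R S \<zero> \<one>"
    by (simp_all add: ring_of_fracs_def)
  have minus: "\<exists>y\<in>carrier ?Q. y \<oplus>\<^bsub>?Q\<^esub> x = \<zero>\<^bsub>?Q\<^esub>" if x0: "x \<in> carrier ?Q" for x
  proof -
    obtain a s where x: "x = frac_of R S a s" "a \<in> carrier R" "s \<in> S"
      using x0 unfolding ring_of_fracs_carrier by auto
    have "frac_of R S (\<ominus> a) s \<oplus>\<^bsub>?Q\<^esub> x = \<zero>\<^bsub>?Q\<^esub>"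
      unfolding zero x(1) using x(2,3)
      by (simp add: C) (rule frac_of_cancel; simp add: C l_minus l_neg)
    then show ?thesis
      using x(2,3) unfolding ring_of_fracs_carrier by blast
  qed
  show ?thesis
  proof (rule cringI)
    show "abelian_group ?Q"
    proof (rule abelian_groupI)
      fix x y z assume "x \<in> carrier ?Q" "y \<in> carrier ?Q" "z \<in> carrier ?Q"
      then obtain a s b t c r where e: "x = frac_of R S a s" "y = frac_of R S b t"
          "z = frac_of R S c r" and D: "a \<in> carrier R" "s \<in> S" "b \<in> carrier R" "t \<in> S"
          "c \<in> carrier R" "r \<in> S"
        unfolding ring_of_fracs_carrier by auto
      show "x \<oplus>\<^bsub>?Q\<^esub> y \<oplus>\<^bsub>?Q\<^esub> z = x \<oplus>\<^bsub>?Q\<^esub> (y \<oplus>\<^bsub>?Q\<^esub> z)"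
        unfolding e using D by (simp add: C) (rule frac_of_cancel; simp add: C m_ac a_ac l_distr r_distr)
    next
      fix x y assume "x \<in> carrier ?Q" "y \<in> carrier ?Q"
      then obtain a s b t where e: "x = frac_of R S a s" "y = frac_of R S b t"
        and D: "a \<in> carrier R" "s \<in> S" "b \<in> carrier R" "t \<in> S"
        unfolding ring_of_fracs_carrier by auto
      have "x \<oplus>\<^bsub>?Q\<^esub> y = frac_of R S (a \<otimes> t \<oplus> b \<otimes> s) (s \<otimes> t)"
        unfolding e using D by (simp add: C)
      then show "x \<oplus>\<^bsub>?Q\<^esub> y \<in> carrier ?Q"
        unfolding ring_of_fracs_carrier
        using D by (blast intro: denom_carrier denom_mult m_closed a_closed)
      show "x \<oplus>\<^bsub>?Q\<^esub> y = y \<oplus>\<^bsub>?Q\<^esub> x"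
        unfolding e using D by (simp add: C m_ac a_ac)
    next
      fix x assume "x \<in> carrier ?Q"
      then obtain a s where e: "x = frac_of R S a s" and D: "a \<in> carrier R" "s \<in> S"
        unfolding ring_of_fracs_carrier by auto
      show "\<zero>\<^bsub>?Q\<^esub> \<oplus>\<^bsub>?Q\<^esub> x = x"
        unfolding e zero using D by (simp add: C)
    qed (use minus zero denom_one in \<open>auto simp: ring_of_fracs_carrier\<close>)
    show "comm_monoid ?Q"
    proof (rule comm_monoidI)
      fix x y z assume "x \<in> carrier ?Q" "y \<in> carrier ?Q" "z \<in> carrier ?Q"
      then obtain a s b t c r where e: "x = frac_of R S a s" "y = frac_of R S b t"
          "z = frac_of R S c r" and D: "a \<in> carrier R" "s \<in> S" "b \<in> carrier R" "t \<in> S"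
          "c \<in> carrier R" "r \<in> S"
        unfolding ring_of_fracs_carrier by auto
      show "x \<otimes>\<^bsub>?Q\<^esub> y \<otimes>\<^bsub>?Q\<^esub> z = x \<otimes>\<^bsub>?Q\<^esub> (y \<otimes>\<^bsub>?Q\<^esub> z)"
        unfolding e using D by (simp add: C m_ac)
    next
      fix x y assume "x \<in> carrier ?Q" "y \<in> carrier ?Q"
      then obtain a s b t where e: "x = frac_of R S a s" "y = frac_of R S b t"
        and D: "a \<in> carrier R" "s \<in> S" "b \<in> carrier R" "t \<in> S"
        unfolding ring_of_fracs_carrier by auto
      have "x \<otimes>\<^bsub>?Q\<^esub> y = frac_of R S (a \<otimes> b) (s \<otimes> t)"
        unfolding e using D by (simp add: C)
      then show "x \<otimes>\<^bsub>?Q\<^esub> y \<in> carrier ?Q"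
        unfolding ring_of_fracs_carrier
        using D by (blast intro: denom_carrier denom_mult m_closed a_closed)
      show "x \<otimes>\<^bsub>?Q\<^esub> y = y \<otimes>\<^bsub>?Q\<^esub> x"
        unfolding e using D by (simp add: C m_ac)
    next
      fix x assume "x \<in> carrier ?Q"
      then obtain a s where e: "x = frac_of R S a s" and D: "a \<in> carrier R" "s \<in> S"
        unfolding ring_of_fracs_carrier by auto
      show "\<one>\<^bsub>?Q\<^esub> \<otimes>\<^bsub>?Q\<^esub> x = x"
        unfolding e one using D by (simp add: C)
    qed (use one denom_one in \<open>auto simp: ring_of_fracs_carrier\<close>)
    fix x y z assume "x \<in> carrier ?Q" "y \<in> carrier ?Q" "z \<in> carrier ?Q"
    then obtain a s b t c r where e: "x = frac_of R S a s" "y = frac_of R S b t"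
        "z = frac_of R S c r" and D: "a \<in> carrier R" "s \<in> S" "b \<in> carrier R" "t \<in> S"
        "c \<in> carrier R" "r \<in> S"
      unfolding ring_of_fracs_carrier by auto
    show "(x \<oplus>\<^bsub>?Q\<^esub> y) \<otimes>\<^bsub>?Q\<^esub> z = x \<otimes>\<^bsub>?Q\<^esub> z \<oplus>\<^bsub>?Q\<^esub> y \<otimes>\<^bsub>?Q\<^esub> z"
      unfolding e using D by (simp add: C) (rule frac_of_cancel; simp add: C m_ac a_ac l_distr r_distr)
  qed
qed

end

end

lemma (in domain) quotient_field_is_field: "field (quotient_field R)"
proof -
  let ?S = "carrier R - {\<zero>}"
  let ?Q = "ring_of_fracs R ?S"
  have S: "submonoid ?S R"
    by (rule submonoid.intro) (auto simp: integral_iff)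
  interpret Q: cring ?Q by (rule cring_ring_of_fracs[OF S])
  have one: "\<one>\<^bsub>?Q\<^esub> = frac_of R ?S \<one> \<one>" and zero: "\<zero>\<^bsub>?Q\<^esub> = frac_of R ?S \<zero> \<one>"
    by (simp_all add: ring_of_fracs_def)
  have eq0: "frac_of R ?S a s = \<zero>\<^bsub>?Q\<^esub> \<longleftrightarrow> a = \<zero>" if "a \<in> carrier R" "s \<in> ?S" for a s
    unfolding zero using that by (auto simp: frac_of_eq_iff[OF S] integral_iff)
  have "field ?Q"
  proof (rule Q.cring_fieldI2)
    show "\<zero>\<^bsub>?Q\<^esub> \<noteq> \<one>\<^bsub>?Q\<^esub>"
      using eq0[of \<one> \<one>] one by auto
    fix x assume x: "x \<in> carrier ?Q" "x \<noteq> \<zero>\<^bsub>?Q\<^esub>"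
    then obtain a s where e: "x = frac_of R ?S a s" and D: "a \<in> carrier R" "s \<in> ?S"
      unfolding ring_of_fracs_carrier[OF S] by auto
    have a: "a \<in> ?S" using x e D eq0 by auto
    have "frac_of R ?S (a \<otimes> s) (s \<otimes> a) = frac_of R ?S \<one> \<one>"
      by (rule frac_of_cancel[OF S]) (use D a in \<open>auto simp: m_comm integral_iff\<close>)
    then have "x \<otimes>\<^bsub>?Q\<^esub> frac_of R ?S s a = \<one>\<^bsub>?Q\<^esub>"
      unfolding e one using D a by (subst ring_of_fracs_mult[OF S]) auto
    then show "\<exists>y\<in>carrier ?Q. x \<otimes>\<^bsub>?Q\<^esub> y = \<one>\<^bsub>?Q\<^esub>"
      using D a unfolding ring_of_fracs_carrier[OF S] by auto
  qed
  then show ?thesis by (simp add: quotient_field_def)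
qed

lemma (in primeideal) cring_localization_at: "cring (localization_at R I)"
proof -
  have "submonoid (carrier R - I) R"
    using I_prime I_notcarr one_imp_carrier by (auto intro!: submonoid.intro)
  then show ?thesis unfolding localization_at_def by (rule cring_ring_of_fracs)
qed

text \<open>The zero ring, which has no prime ideals, gets dimension \<open>0\<close>.\<close>

definition krull_dim :: "('a, 'm) ring_scheme \<Rightarrow> enat"
  where "krull_dim R =
    (SUP n \<in> {n. \<exists>p :: nat \<Rightarrow> 'a set.
        (\<forall>i\<le>n. primeideal (p i) R) \<and> (\<forall>i<n. p i \<subset> p (Suc i))}. enat n)"

definition LFD :: "('a, 'm) ring_scheme \<Rightarrow> bool"
  where "LFD R \<longleftrightarrow> (\<forall>P. primeideal P R \<longrightarrow> krull_dim (localization_at R P) < \<infinity>)"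


section \<open>Transcendence degree\<close>

definition mset_monomial :: "('a, 'm) ring_scheme \<Rightarrow> 'a multiset \<Rightarrow> 'a"
  where "mset_monomial R m = (\<Otimes>\<^bsub>R\<^esub>x\<in>set_mset m. x [^]\<^bsub>R\<^esub> count m x)"

text \<open>A polynomial in indeterminates indexed by \<open>S\<close>, with coefficients in \<open>F\<close>, is given by a
  finite set \<open>M\<close> of monomials, i.e. multisets over \<open>S\<close>, and a coefficient function on \<open>M\<close>.\<close>

definition algebraically_indep :: "('a, 'm) ring_scheme \<Rightarrow> 'a set \<Rightarrow> 'a set \<Rightarrow> bool"
  where "algebraically_indep L F S \<longleftrightarrow> S \<subseteq> carrier L \<and>
    (\<forall>M c. finite M \<and> (\<forall>m\<in>M. set_mset m \<subseteq> S) \<and> c \<in> M \<rightarrow> F \<and>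
       (\<Oplus>\<^bsub>L\<^esub>m\<in>M. c m \<otimes>\<^bsub>L\<^esub> mset_monomial L m) = \<zero>\<^bsub>L\<^esub> \<longrightarrow> (\<forall>m\<in>M. c m = \<zero>\<^bsub>L\<^esub>))"

text \<open>Transcendence degree of a field \<open>L\<close> over a subfield \<open>F\<close>; infinite cardinals are not
  distinguished.\<close>

definition field_trdeg :: "('a, 'm) ring_scheme \<Rightarrow> 'a set \<Rightarrow> enat"
  where "field_trdeg L F =
    (SUP S \<in> {S. algebraically_indep L F S}. if finite S then enat (card S) else \<infinity>)"

definition domain_trdeg :: "('a, 'm) ring_scheme \<Rightarrow> 'a set \<Rightarrow> enat"
  where "domain_trdeg D F = field_trdeg (quotient_field D) (quotient_field_embed D ` F)"

text \<open>\<open>quot_trdeg k A p\<close> is \<open>t.d.(A/p : k)\<close>, with \<open>k\<close> identified with its image in \<open>A/p\<close>.\<close>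

definition quot_trdeg :: "('k, 'u) ring_scheme \<Rightarrow> ('k, 'a, 'm) module_scheme \<Rightarrow> 'a set \<Rightarrow> enat"
  where "quot_trdeg k A p =
    domain_trdeg (A Quot p) ((\<lambda>c. p +>\<^bsub>A\<^esub> (c \<odot>\<^bsub>A\<^esub> \<one>\<^bsub>A\<^esub>)) ` carrier k)"

definition algebra_trdeg :: "('k, 'u) ring_scheme \<Rightarrow> ('k, 'a, 'm) module_scheme \<Rightarrow> enat"
  where "algebra_trdeg k A = (SUP p \<in> {p. primeideal p A}. quot_trdeg k A p)"


section \<open>Tensor product of algebras\<close>

text \<open>The free abelian group on \<open>A \<times> B\<close>, with the biadditive product for which
  \<open>(a, b) (a', b') = (a a', b b')\<close>.\<close>

definition free_pair_ring ::
    "('a, 'm) ring_scheme \<Rightarrow> ('b, 'n) ring_scheme \<Rightarrow> (('a \<times> 'b) \<Rightarrow>\<^sub>0 int) ring"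
  where "free_pair_ring A B =
    \<lparr>carrier = {f. Poly_Mapping.keys f \<subseteq> carrier A \<times> carrier B},
     monoid.mult = (\<lambda>f g. frag_extend (\<lambda>(a, b). frag_extend (\<lambda>(a', b').
               frag_of (a \<otimes>\<^bsub>A\<^esub> a', b \<otimes>\<^bsub>B\<^esub> b')) g) f),
     one = frag_of (\<one>\<^bsub>A\<^esub>, \<one>\<^bsub>B\<^esub>),
     ring.zero = 0,
     add = (+)\<rparr>"

definition tensor_relators :: "('k, 'u) ring_scheme \<Rightarrow> ('k, 'a, 'm) module_scheme \<Rightarrow>
    ('k, 'b, 'n) module_scheme \<Rightarrow> (('a \<times> 'b) \<Rightarrow>\<^sub>0 int) set"
  where "tensor_relators k A B =
      {frag_of (a \<oplus>\<^bsub>A\<^esub> a', b) - frag_of (a, b) - frag_of (a', b) | a a' b.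
         a \<in> carrier A \<and> a' \<in> carrier A \<and> b \<in> carrier B}
    \<union> {frag_of (a, b \<oplus>\<^bsub>B\<^esub> b') - frag_of (a, b) - frag_of (a, b') | a b b'.
         a \<in> carrier A \<and> b \<in> carrier B \<and> b' \<in> carrier B}
    \<union> {frag_of (c \<odot>\<^bsub>A\<^esub> a, b) - frag_of (a, c \<odot>\<^bsub>B\<^esub> b) | a b c.
         a \<in> carrier A \<and> b \<in> carrier B \<and> c \<in> carrier k}"

text \<open>Multiplication by a pair maps relators to relators, so the ideal they generate is just the
  additive subgroup they generate. Only the ring structure of the tensor product is recorded.\<close>

definition tensor_product :: "('k, 'u) ring_scheme \<Rightarrow> ('k, 'a, 'm) module_scheme \<Rightarrow>
    ('k, 'b, 'n) module_scheme \<Rightarrow> (('a \<times> 'b) \<Rightarrow>\<^sub>0 int) set ring"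
  where "tensor_product k A B =
    free_pair_ring A B Quot (Idl\<^bsub>free_pair_ring A B\<^esub> (tensor_relators k A B))"

lemma frag_extend_diff_fun:
  fixes F G :: "'b \<Rightarrow> 'a \<Rightarrow>\<^sub>0 int"
  shows "frag_extend (\<lambda>x. F x - G x) f = frag_extend F f - frag_extend G f"
proof -
  have "frag_cmul c (x - y) = frag_cmul c x - frag_cmul c y" for c and x y :: "'a \<Rightarrow>\<^sub>0 int"
    by (simp add: poly_mapping_eqI lookup_minus right_diff_distrib)
  then show ?thesis by (simp add: frag_extend_def sum_subtractf)
qed

lemma free_pair_ring_mult_of [simp]:
  "frag_of (a, b) \<otimes>\<^bsub>free_pair_ring A B\<^esub> frag_of (a', b')
    = frag_of (a \<otimes>\<^bsub>A\<^esub> a', b \<otimes>\<^bsub>B\<^esub> b')"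
  by (simp add: free_pair_ring_def)

lemma free_pair_ring_diff_left:
  "(f - f') \<otimes>\<^bsub>free_pair_ring A B\<^esub> g
    = f \<otimes>\<^bsub>free_pair_ring A B\<^esub> g - f' \<otimes>\<^bsub>free_pair_ring A B\<^esub> g"
  by (simp add: free_pair_ring_def frag_extend_diff)

lemma free_pair_ring_diff_right:
  "f \<otimes>\<^bsub>free_pair_ring A B\<^esub> (g - g')
    = f \<otimes>\<^bsub>free_pair_ring A B\<^esub> g - f \<otimes>\<^bsub>free_pair_ring A B\<^esub> g'"
  by (simp add: free_pair_ring_def frag_extend_diff split_def frag_extend_diff_fun)

lemma free_pair_ring_zero_mult [simp]:
  "0 \<otimes>\<^bsub>free_pair_ring A B\<^esub> g = 0" "f \<otimes>\<^bsub>free_pair_ring A B\<^esub> 0 = 0"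
  by (auto simp: free_pair_ring_def frag_extend_eq_0)

lemma free_pair_ring_simps:
  "carrier (free_pair_ring A B) = {f. Poly_Mapping.keys f \<subseteq> carrier A \<times> carrier B}"
  "\<one>\<^bsub>free_pair_ring A B\<^esub> = frag_of (\<one>\<^bsub>A\<^esub>, \<one>\<^bsub>B\<^esub>)"
  "\<zero>\<^bsub>free_pair_ring A B\<^esub> = 0"
  "f \<oplus>\<^bsub>free_pair_ring A B\<^esub> g = f + g"
  by (simp_all add: free_pair_ring_def)

lemma free_pair_ring_induct [consumes 1, case_names zero one diff]:
  assumes "f \<in> carrier (free_pair_ring A B)"
    and "P 0"
    and "\<And>a b. a \<in> carrier A \<Longrightarrow> b \<in> carrier B \<Longrightarrow> P (frag_of (a, b))"
    and "\<And>f g. \<lbrakk>f \<in> carrier (free_pair_ring A B); g \<in> carrier (free_pair_ring A B); P f; P g\<rbrakk>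
      \<Longrightarrow> P (f - g)"
  shows "P f"
  using assms unfolding free_pair_ring_simps
  by (auto intro: free_Abelian_group_induct[of f "carrier A \<times> carrier B" P])

lemma free_pair_ring_diff_closed:
  assumes "f \<in> carrier (free_pair_ring A B)" "g \<in> carrier (free_pair_ring A B)"
  shows "f - g \<in> carrier (free_pair_ring A B)"
  using assms keys_diff[of f g] unfolding free_pair_ring_simps by blast

lemma cring_free_pair_ring:
  assumes "cring A" "cring B"
  shows "cring (free_pair_ring A B)"
proof -
  interpret A: cring A by fact
  interpret B: cring B by fact
  let ?F = "free_pair_ring A B"
  note D = free_pair_ring_diff_left free_pair_ring_diff_right
  have of_closed: "frag_of (a, b) \<in> carrier ?F" if "a \<in> carrier A" "b \<in> carrier B" for a b
    using that by (simp add: free_pair_ring_simps)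
  have closed: "f \<otimes>\<^bsub>?F\<^esub> g \<in> carrier ?F" if "f \<in> carrier ?F" "g \<in> carrier ?F" for f g
    using that(1)
  proof (induction f rule: free_pair_ring_induct)
    case zero then show ?case by (simp add: free_pair_ring_simps)
  next
    case (one a b)
    from that(2) show ?case
    proof (induction g rule: free_pair_ring_induct)
      case zero then show ?case by (simp add: free_pair_ring_simps)
    next
      case (one a' b') then show ?case
        using \<open>a \<in> carrier A\<close> \<open>b \<in> carrier B\<close> by (simp add: of_closed)
    next
      case (diff f g) then show ?case by (simp add: D free_pair_ring_diff_closed)
    qed
  next
    case (diff f f') then show ?case by (simp add: D free_pair_ring_diff_closed)
  qed
  have comm: "f \<otimes>\<^bsub>?F\<^esub> g = g \<otimes>\<^bsub>?F\<^esub> f" if "f \<in> carrier ?F" "g \<in> carrier ?F" for f g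
    using that(1)
  proof (induction f rule: free_pair_ring_induct)
    case (one a b)
    from that(2) show ?case
    proof (induction g rule: free_pair_ring_induct)
      case (one a' b') then show ?case
        using \<open>a \<in> carrier A\<close> \<open>b \<in> carrier B\<close> by (simp add: A.m_comm B.m_comm)
    qed (simp_all add: D)
  qed (simp_all add: D)
  have assoc: "f \<otimes>\<^bsub>?F\<^esub> g \<otimes>\<^bsub>?F\<^esub> h = f \<otimes>\<^bsub>?F\<^esub> (g \<otimes>\<^bsub>?F\<^esub> h)"
    if "f \<in> carrier ?F" "g \<in> carrier ?F" "h \<in> carrier ?F" for f g h
    using that(1)
  proof (induction f rule: free_pair_ring_induct)
    case f: (one a b)
    from that(2) show ?case
    proof (induction g rule: free_pair_ring_induct)
      case g: (one a' b')
      from that(3) show ?case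
      proof (induction h rule: free_pair_ring_induct)
        case (one a'' b'')
        then show ?case using f g by (simp add: A.m_assoc B.m_assoc)
      qed (simp_all add: D)
    qed (simp_all add: D)
  qed (simp_all add: D)
  have l_one: "\<one>\<^bsub>?F\<^esub> \<otimes>\<^bsub>?F\<^esub> f = f" if "f \<in> carrier ?F" for f
    using that by (induction f rule: free_pair_ring_induct) (simp_all add: D free_pair_ring_simps(2))
  show ?thesis
  proof (rule cringI)
    show "abelian_group ?F"
    proof (rule abelian_groupI)
      fix x y assume "x \<in> carrier ?F" "y \<in> carrier ?F"
      then show "x \<oplus>\<^bsub>?F\<^esub> y \<in> carrier ?F"
        using keys_add[of x y] by (auto simp: free_pair_ring_simps)
    next
      fix x assume "x \<in> carrier ?F"
      then show "\<exists>y\<in>carrier ?F. y \<oplus>\<^bsub>?F\<^esub> x = \<zero>\<^bsub>?F\<^esub>"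
        by (intro bexI[of _ "- x"]) (auto simp: free_pair_ring_simps)
    qed (auto simp: free_pair_ring_simps)
    show "comm_monoid ?F"
      proof (rule comm_monoidI)
      show "\<one>\<^bsub>?F\<^esub> \<in> carrier ?F" by (simp add: free_pair_ring_simps)
    qed (fact closed assoc l_one comm)+
    fix x y z
    show "(x \<oplus>\<^bsub>?F\<^esub> y) \<otimes>\<^bsub>?F\<^esub> z = x \<otimes>\<^bsub>?F\<^esub> z \<oplus>\<^bsub>?F\<^esub> y \<otimes>\<^bsub>?F\<^esub> z"
      by (simp add: free_pair_ring_def frag_extend_add)
  qed
qed

lemma tensor_relators_closed:
  assumes "algebra k A" "algebra k B"
  shows "tensor_relators k A B \<subseteq> carrier (free_pair_ring A B)"
proof -
  interpret A: algebra k A by fact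
  interpret B: algebra k B by fact
  have of_closed: "frag_of (a, b) \<in> carrier (free_pair_ring A B)"
    if "a \<in> carrier A" "b \<in> carrier B" for a b
    using that by (simp add: free_pair_ring_simps)
  show ?thesis
    unfolding tensor_relators_def by (auto intro!: free_pair_ring_diff_closed of_closed)
qed

lemma cring_tensor_product:
  assumes "algebra k A" "algebra k B"
  shows "cring (tensor_product k A B)"
proof -
  have "cring A" "cring B" using assms by (auto simp: algebra_def)
  then interpret F: cring "free_pair_ring A B" by (rule cring_free_pair_ring)
  show ?thesis
    unfolding tensor_product_def
    by (rule ideal.quotient_is_cring[OF F.genideal_ideal[OF tensor_relators_closed[OF assms]] F.is_cring])
qed

definition pure_tensor :: "('k, 'u) ring_scheme \<Rightarrow> ('k, 'a, 'm) module_scheme \<Rightarrow>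
    ('k, 'b, 'n) module_scheme \<Rightarrow> 'a \<Rightarrow> 'b \<Rightarrow> (('a \<times> 'b) \<Rightarrow>\<^sub>0 int) set"
  where "pure_tensor k A B a b =
    Idl\<^bsub>free_pair_ring A B\<^esub> (tensor_relators k A B) +>\<^bsub>free_pair_ring A B\<^esub> frag_of (a, b)"

text \<open>The tensor product is the coproduct of \<open>k\<close>-algebras.\<close>

theorem tensor_product_universal:
  assumes alg: "algebra k A" "algebra k B" and C: "cring C"
    and f: "f \<in> ring_hom A C" and g: "g \<in> ring_hom B C"
    and agree: "\<And>c. c \<in> carrier k \<Longrightarrow> f (c \<odot>\<^bsub>A\<^esub> \<one>\<^bsub>A\<^esub>) = g (c \<odot>\<^bsub>B\<^esub> \<one>\<^bsub>B\<^esub>)"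
  obtains h where "h \<in> ring_hom (tensor_product k A B) C"
    "\<And>a b. \<lbrakk>a \<in> carrier A; b \<in> carrier B\<rbrakk> \<Longrightarrow> h (pure_tensor k A B a b) = f a \<otimes>\<^bsub>C\<^esub> g b"
    "\<And>h' x. \<lbrakk>h' \<in> ring_hom (tensor_product k A B) C;
        \<And>a b. \<lbrakk>a \<in> carrier A; b \<in> carrier B\<rbrakk>
          \<Longrightarrow> h' (pure_tensor k A B a b) = f a \<otimes>\<^bsub>C\<^esub> g b;
        x \<in> carrier (tensor_product k A B)\<rbrakk> \<Longrightarrow> h' x = h x"
proof -
  interpret A: algebra k A by fact
  interpret B: algebra k B by fact
  interpret C: cring C by fact
  let ?F = "free_pair_ring A B" and ?T = "tensor_product k A B"
  define I where "I = Idl\<^bsub>?F\<^esub> (tensor_relators k A B)"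
  interpret F: cring ?F
    by (rule cring_free_pair_ring) (use alg in \<open>auto simp: algebra_def\<close>)
  interpret I: ideal I ?F
    unfolding I_def by (rule F.genideal_ideal[OF tensor_relators_closed[OF alg]])
  interpret T: cring ?T by (rule cring_tensor_product[OF alg])
  have T: "?T = ?F Quot I" by (simp add: tensor_product_def I_def)
  note D = free_pair_ring_diff_left free_pair_ring_diff_right
  have of_closed: "frag_of (a, b) \<in> carrier ?F" if "a \<in> carrier A" "b \<in> carrier B" for a b
    using that by (simp add: free_pair_ring_simps)
  have diff: "x - y = x \<ominus>\<^bsub>?F\<^esub> y" if "x \<in> carrier ?F" "y \<in> carrier ?F" for x y
  proof -
    have "(x \<ominus>\<^bsub>?F\<^esub> y) \<oplus>\<^bsub>?F\<^esub> y = x" using that by (simp only: a_minus_def F.a_assoc F.l_neg F.r_zero F.a_inv_closed)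
    then show ?thesis by (simp add: free_pair_ring_simps(4) flip: eq_diff_eq)
  qed
  note fc = ring_hom_closed[OF f] and gc = ring_hom_closed[OF g]
  have "(\<lambda>(a, b). f a \<otimes>\<^bsub>C\<^esub> g b) ` (carrier A \<times> carrier B) \<subseteq> carrier (add_monoid C)"
    using fc gc by auto
  then obtain \<phi> where \<phi>: "\<phi> \<in> hom (free_Abelian_group (carrier A \<times> carrier B)) (add_monoid C)"
    and \<phi>_of': "\<And>x. x \<in> carrier A \<times> carrier B \<Longrightarrow> \<phi> (frag_of x) = (\<lambda>(a, b). f a \<otimes>\<^bsub>C\<^esub> g b) x"
    using comm_group.free_Abelian_group_universal[OF C.a_comm_group] by metis
  have \<phi>_of: "\<phi> (frag_of (a, b)) = f a \<otimes>\<^bsub>C\<^esub> g b" if "a \<in> carrier A" "b \<in> carrier B" for a b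
    using \<phi>_of'[of "(a, b)"] that by simp
  have \<phi>_closed: "\<phi> x \<in> carrier C" if "x \<in> carrier ?F" for x
    using \<phi> that by (auto simp: hom_def free_Abelian_group_def free_pair_ring_simps)
  have \<phi>_add: "\<phi> (x + y) = \<phi> x \<oplus>\<^bsub>C\<^esub> \<phi> y" if "x \<in> carrier ?F" "y \<in> carrier ?F" for x y
    using \<phi> that by (auto simp: hom_def free_Abelian_group_def free_pair_ring_simps)
  have \<phi>_diff: "\<phi> (x - y) = \<phi> x \<ominus>\<^bsub>C\<^esub> \<phi> y" if "x \<in> carrier ?F" "y \<in> carrier ?F" for x y
  proof -
    have xy: "x - y \<in> carrier ?F" using that by (rule free_pair_ring_diff_closed)
    have "\<phi> x = \<phi> (x - y) \<oplus>\<^bsub>C\<^esub> \<phi> y" using \<phi>_add[OF xy that(2)] by simp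
    then show ?thesis
      using \<phi>_closed[OF xy] \<phi>_closed[OF that(2)] by (simp add: a_minus_def C.a_assoc C.r_neg)
  qed
  have \<phi>_0: "\<phi> 0 = \<zero>\<^bsub>C\<^esub>"
    using \<phi>_diff[of 0 0] \<phi>_closed[of 0] by (simp add: free_pair_ring_simps C.r_neg a_minus_def)
  have \<phi>_mult: "\<phi> (x \<otimes>\<^bsub>?F\<^esub> y) = \<phi> x \<otimes>\<^bsub>C\<^esub> \<phi> y" if "x \<in> carrier ?F" "y \<in> carrier ?F" for x y
    using that(1)
  proof (induction x rule: free_pair_ring_induct)
    case zero then show ?case using \<phi>_closed[OF that(2)] by (simp add: \<phi>_0)
  next
    case x: (one a b)
    from that(2) show ?case
    proof (induction y rule: free_pair_ring_induct)
      case zero then show ?case using x by (simp add: \<phi>_0 \<phi>_of fc gc)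
    next
      case (one a' b')
      then show ?case using x fc gc
        by (simp add: \<phi>_of ring_hom_mult[OF f] ring_hom_mult[OF g] C.m_ac)
    next
      case (diff y y')
      then show ?case using x
        by (simp add: D \<phi>_diff F.m_closed of_closed \<phi>_closed C.r_minus C.r_distr a_minus_def)
    qed
  next
    case (diff x x')
    then show ?case using that(2)
      by (simp add: D \<phi>_diff F.m_closed \<phi>_closed C.l_minus C.l_distr a_minus_def)
  qed
  have \<phi>_one: "\<phi> \<one>\<^bsub>?F\<^esub> = \<one>\<^bsub>C\<^esub>"
    by (simp add: free_pair_ring_simps \<phi>_of ring_hom_one[OF f] ring_hom_one[OF g])
  have \<phi>_hom: "\<phi> \<in> ring_hom ?F C"
    using \<phi>_closed \<phi>_mult \<phi>_add \<phi>_one by (auto intro!: ring_hom_memI simp: free_pair_ring_simps(4))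
  interpret \<phi>: ring_hom_ring ?F C \<phi>
    by (rule ring_hom_ringI2) (simp_all add: F.ring_axioms C.ring_axioms \<phi>_hom)
  have smA: "f (c \<odot>\<^bsub>A\<^esub> a) = f (c \<odot>\<^bsub>A\<^esub> \<one>\<^bsub>A\<^esub>) \<otimes>\<^bsub>C\<^esub> f a"
    if "c \<in> carrier k" "a \<in> carrier A" for c a
    using that A.smult_assoc2[of c "\<one>\<^bsub>A\<^esub>" a] ring_hom_mult[OF f, of "c \<odot>\<^bsub>A\<^esub> \<one>\<^bsub>A\<^esub>" a]
    by simp
  have smB: "g (c \<odot>\<^bsub>B\<^esub> b) = g (c \<odot>\<^bsub>B\<^esub> \<one>\<^bsub>B\<^esub>) \<otimes>\<^bsub>C\<^esub> g b"
    if "c \<in> carrier k" "b \<in> carrier B" for c b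
    using that B.smult_assoc2[of c "\<one>\<^bsub>B\<^esub>" b] ring_hom_mult[OF g, of "c \<odot>\<^bsub>B\<^esub> \<one>\<^bsub>B\<^esub>" b]
    by simp
  have cancel: "x \<oplus>\<^bsub>C\<^esub> y \<ominus>\<^bsub>C\<^esub> x \<ominus>\<^bsub>C\<^esub> y = \<zero>\<^bsub>C\<^esub>" if "x \<in> carrier C" "y \<in> carrier C" for x y
  proof -
    have "x \<oplus>\<^bsub>C\<^esub> y \<ominus>\<^bsub>C\<^esub> x = y"
      using that by (simp only: C.a_comm[of x y] a_minus_def C.a_assoc C.r_neg C.r_zero C.a_inv_closed)
    then show ?thesis using that by (simp add: a_minus_def C.r_neg)
  qed
  have rel1: "\<phi> (frag_of (a \<oplus>\<^bsub>A\<^esub> a', b) - frag_of (a, b) - frag_of (a', b)) = \<zero>\<^bsub>C\<^esub>"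
    if "a \<in> carrier A" "a' \<in> carrier A" "b \<in> carrier B" for a a' b
    using that by (simp add: \<phi>_diff of_closed free_pair_ring_diff_closed \<phi>_of
        ring_hom_add[OF f] fc gc C.l_distr cancel)
  have rel2: "\<phi> (frag_of (a, b \<oplus>\<^bsub>B\<^esub> b') - frag_of (a, b) - frag_of (a, b')) = \<zero>\<^bsub>C\<^esub>"
    if "a \<in> carrier A" "b \<in> carrier B" "b' \<in> carrier B" for a b b'
    using that by (simp add: \<phi>_diff of_closed free_pair_ring_diff_closed \<phi>_of
        ring_hom_add[OF g] fc gc C.r_distr cancel)
  have rel3: "\<phi> (frag_of (c \<odot>\<^bsub>A\<^esub> a, b) - frag_of (a, c \<odot>\<^bsub>B\<^esub> b)) = \<zero>\<^bsub>C\<^esub>"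
    if ab: "a \<in> carrier A" "b \<in> carrier B" and c: "c \<in> carrier k" for a b c
  proof -
    have k: "f (c \<odot>\<^bsub>A\<^esub> \<one>\<^bsub>A\<^esub>) \<in> carrier C" "g (c \<odot>\<^bsub>B\<^esub> \<one>\<^bsub>B\<^esub>) \<in> carrier C"
      using c fc gc by auto
    have "f (c \<odot>\<^bsub>A\<^esub> a) \<otimes>\<^bsub>C\<^esub> g b = f a \<otimes>\<^bsub>C\<^esub> g (c \<odot>\<^bsub>B\<^esub> b)"
      unfolding smA[OF c ab(1)] smB[OF c ab(2)] agree[OF c]
      using ab k fc gc by (simp add: C.m_ac)
    then show ?thesis
      using ab c fc gc by (simp add: \<phi>_diff of_closed \<phi>_of C.r_neg a_minus_def)
  qed
  note rel = rel1 rel2 rel3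
  have "tensor_relators k A B \<subseteq> a_kernel ?F C \<phi>"
  proof
    fix r assume "r \<in> tensor_relators k A B"
    then have "\<phi> r = \<zero>\<^bsub>C\<^esub>"
      unfolding tensor_relators_def
      by (elim UnE CollectE exE conjE) (simp_all only: rel)
    moreover have "r \<in> carrier ?F"
      using tensor_relators_closed[OF alg] \<open>r \<in> tensor_relators k A B\<close> by (rule subsetD)
    ultimately show "r \<in> a_kernel ?F C \<phi>"
      unfolding a_kernel_def' by (intro CollectI conjI)
  qed
  then have ker: "I \<subseteq> a_kernel ?F C \<phi>"
    unfolding I_def by (rule F.genideal_minimal[OF \<phi>.kernel_is_ideal])
  define h where "h w = the_elem (\<phi> ` w)" for w
  have h_coset: "h (I +>\<^bsub>?F\<^esub> x) = \<phi> x" if "x \<in> carrier ?F" for x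
  proof -
    have "\<phi> y = \<phi> x" if "y \<in> I +>\<^bsub>?F\<^esub> x" for y
    proof -
      obtain i where "i \<in> I" "y = i \<oplus>\<^bsub>?F\<^esub> x" using \<open>y \<in> I +>\<^bsub>?F\<^esub> x\<close> by (auto simp: a_r_coset_def')
      moreover have "\<phi> i = \<zero>\<^bsub>C\<^esub>" "i \<in> carrier ?F"
        using subsetD[OF ker \<open>i \<in> I\<close>] unfolding a_kernel_def' mem_Collect_eq by blast+
      ultimately show ?thesis
        using \<open>x \<in> carrier ?F\<close> by (simp only: \<phi>.hom_add \<phi>_closed C.l_zero)
    qed
    moreover have "x \<in> I +>\<^bsub>?F\<^esub> x" using that I.a_rcos_self by simp
    ultimately have "\<phi> ` (I +>\<^bsub>?F\<^esub> x) = {\<phi> x}" by blast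
    then show ?thesis by (simp add: h_def)
  qed
  have Tc: "carrier ?T = (\<lambda>x. I +>\<^bsub>?F\<^esub> x) ` carrier ?F"
    by (auto simp: T FactRing_def A_RCOSETS_def')
  have q: "(+>\<^bsub>?F\<^esub>) I \<in> ring_hom ?F ?T" unfolding T by (rule I.rcos_ring_hom)
  have "h \<in> ring_hom ?T C"
  proof (rule ring_hom_memI)
    show "h \<one>\<^bsub>?T\<^esub> = \<one>\<^bsub>C\<^esub>"
      using ring_hom_one[OF q] h_coset[of "\<one>\<^bsub>?F\<^esub>"] \<phi>_one by simp
  next
    fix w assume "w \<in> carrier ?T" then show "h w \<in> carrier C"
      using h_coset \<phi>_closed by (auto simp: Tc)
  next
    fix w z assume "w \<in> carrier ?T" "z \<in> carrier ?T"
    then obtain x y where xy: "x \<in> carrier ?F" "y \<in> carrier ?F" "w = I +>\<^bsub>?F\<^esub> x" "z = I +>\<^bsub>?F\<^esub> y"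
      by (auto simp: Tc)
    show "h (w \<otimes>\<^bsub>?T\<^esub> z) = h w \<otimes>\<^bsub>C\<^esub> h z" "h (w \<oplus>\<^bsub>?T\<^esub> z) = h w \<oplus>\<^bsub>C\<^esub> h z"
      using xy h_coset[of "x \<otimes>\<^bsub>?F\<^esub> y"] h_coset[of "x \<oplus>\<^bsub>?F\<^esub> y"]
      by (simp_all add: h_coset ring_hom_mult[OF q] ring_hom_add[OF q])
  qed
  moreover have "h (pure_tensor k A B a b) = f a \<otimes>\<^bsub>C\<^esub> g b" if "a \<in> carrier A" "b \<in> carrier B" for a b
    using h_coset[OF of_closed[OF that]] \<phi>_of[OF that] by (simp add: pure_tensor_def I_def)
  moreover have "h' w = h w" if h': "h' \<in> ring_hom ?T C"
      and p: "\<And>a b. \<lbrakk>a \<in> carrier A; b \<in> carrier B\<rbrakk> \<Longrightarrow> h' (pure_tensor k A B a b) = f a \<otimes>\<^bsub>C\<^esub> g b"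
      and w: "w \<in> carrier ?T" for h' w
  proof -
    interpret h': ring_hom_ring ?F C "h' \<circ> (+>\<^bsub>?F\<^esub>) I"
      by (rule ring_hom_ringI2) (simp_all add: F.ring_axioms C.ring_axioms ring_hom_trans[OF q h'])
    obtain x where x: "x \<in> carrier ?F" "w = I +>\<^bsub>?F\<^esub> x" using w by (auto simp: Tc)
    from x(1) have "(h' \<circ> (+>\<^bsub>?F\<^esub>) I) x = \<phi> x"
    proof (induction x rule: free_pair_ring_induct)
      case zero then show ?case using h'.hom_zero \<phi>_0 by (simp add: free_pair_ring_simps(3))
    next
      case (one a b) then show ?case using p \<phi>_of by (simp add: pure_tensor_def I_def)
    next
      case d: (diff x y)
      have "(h' \<circ> (+>\<^bsub>?F\<^esub>) I) (x \<ominus>\<^bsub>?F\<^esub> y) = \<phi> (x \<ominus>\<^bsub>?F\<^esub> y)"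
        using d h'.hom_add h'.hom_a_inv by (simp add: a_minus_def del: o_apply)
      then show ?case using d(1,2) by (simp only: diff)
    qed
    then show ?thesis using x h_coset by simp
  qed
  ultimately show ?thesis by (rule that)
qed

end

theory Submission
  imports Defs
begin

text \<open>
  Write \<open>T\<close> for the tensor product of \<open>A\<close> and \<open>B\<close> over \<open>k\<close>. Since \<open>T\<close> is free over \<open>A\<close> and over \<open>B\<close>, primes lie over
  and go down along \<open>A \<rightarrow> T\<close> and \<open>B \<rightarrow> T\<close>, so \<open>A\<close> and \<open>B\<close> are LFD when \<open>T\<close> is.

  For the sufficient condition, consider a chain of primes of \<open>T\<close> with constant contractions \<open>p\<close>
  and \<open>q\<close> to \<open>A\<close> and \<open>B\<close>. Elements witnessing its \<open>n\<close> strict inclusions are algebraically independent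
  over \<open>B/q\<close> modulo the smallest prime \<open>P\<close>. But \<open>T/P\<close> is generated over \<open>B/q\<close> by the image of \<open>A/p\<close>, whose
  finitely generated subalgebras grow polynomially of degree at most \<open>d = t.d.(A/p:k)\<close>; counting
  monomials gives \<open>n \<le> d\<close>. Chains below a prime \<open>Q\<close> are thus bounded in terms of \<open>d\<close> and of the heights
  of the contractions of \<open>Q\<close>.

  If \<open>A/p\<close> and \<open>B/q\<close> both have infinite transcendence degree, let \<open>K\<close> and \<open>L\<close> be their quotient fields,
  and \<open>x\<^sub>i\<close>, \<open>y\<^sub>i\<close> independent sequences in them. Let \<open>C\<close> be the local ring of the origin of
  \<open>L[v\<^sub>0, v\<^sub>1, \<dots>]\<close>, whose maximal ideal has infinite height. As the \<open>y\<^sub>i\<close> are independent,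
  \<open>x\<^sub>i \<mapsto> v\<^sub>i + y\<^sub>i\<close> defines an embedding of \<open>k(x\<^sub>0, x\<^sub>1, \<dots>)\<close> into \<open>C\<close>. The tensor product of \<open>K\<close> and \<open>C\<close> over this
  field is a localization of a quotient of \<open>T\<close>; were \<open>T\<close> LFD, so would be this product, hence \<open>C\<close>.
\<close>


section \<open>Prime ideals, localization and local finite-dimensionality\<close>

text \<open>Freeness enters without bases: a linear functional on B induces an A-linear slice T ->
  A, and an element lies in the extension of p exactly when all its slices lie in p.
  Torsion-freeness over A/p is then immediate.

  Growth is counted because the bound d must survive the change of coefficients from k to B/q:
  algebraic relations over k stay relations over B/q, so the growth exponent carries over.
  Coefficients lie in a subring, so denominators are cleared rather than inverted.

  In the infinite case, sending x_i to v_i alone would send x_i to a non-unit. After the shift by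
  y_i, each non-zero polynomial in the x_i has a non-zero value at the origin and so becomes a unit
  of the local ring. Conversely, v_i is the difference of v_i + y_i, which comes from K, and y_i,
  which comes from L; hence K and L generate the product up to fractions. LFD descends to C because
  the product is free over C, K being a vector space over the common subfield.\<close>

lemma (in cring) cring_idealI:
  assumes "I \<subseteq> carrier R" "\<zero> \<in> I"
    and add: "\<And>a b. a \<in> I \<Longrightarrow> b \<in> I \<Longrightarrow> a \<oplus> b \<in> I"
    and mult: "\<And>a x. a \<in> I \<Longrightarrow> x \<in> carrier R \<Longrightarrow> x \<otimes> a \<in> I"
  shows "ideal I R"
proof (rule idealI)
  have neg: "\<ominus> a \<in> I" if "a \<in> I" for a
    using mult[OF that, of "\<ominus> \<one>"] that assms(1) by (auto simp: l_minus)
  show "subgroup I (add_monoid R)"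
    by (rule add.subgroupI) (use assms neg in auto)
  show "a \<otimes> x \<in> I" if "a \<in> I" "x \<in> carrier R" for a x
    using mult[OF that] that assms(1) m_comm by (metis subsetD)
qed (use mult ring_axioms in auto)

lemma (in cring) cring_primeidealI:
  assumes "ideal I R" "\<one> \<notin> I"
    and "\<And>a b. \<lbrakk>a \<in> carrier R; b \<in> carrier R; a \<otimes> b \<in> I\<rbrakk> \<Longrightarrow> a \<in> I \<or> b \<in> I"
  shows "primeideal I R"
  by (rule primeidealI) (use assms is_cring in auto)

lemma primeideal_subset: "primeideal P R \<Longrightarrow> P \<subseteq> carrier R"
  by (simp add: primeideal_def ideal_def additive_subgroup.a_subset)

lemma (in primeideal) one_notin: "\<one> \<notin> I"
  using I_notcarr one_imp_carrier by blast

lemma (in primeideal) mult_notin: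
  "\<lbrakk>a \<in> carrier R; b \<in> carrier R; a \<notin> I; b \<notin> I\<rbrakk> \<Longrightarrow> a \<otimes> b \<notin> I"
  using I_prime by blast

lemma (in primeideal) pow_notin:
  "\<lbrakk>a \<in> carrier R; a \<notin> I\<rbrakk> \<Longrightarrow> a [^] (n::nat) \<notin> I"
  by (induction n) (auto simp: one_notin mult_notin)

lemma (in primeideal) compl_submonoid: "submonoid (carrier R - I) R"
  using one_notin mult_notin by (auto intro!: submonoid.intro)

lemma primeideal_vimage:
  assumes "cring R" "cring S" and h: "h \<in> ring_hom R S" and "primeideal P S"
  shows "primeideal {r \<in> carrier R. h r \<in> P} R"
proof -
  interpret R: cring R by fact
  interpret P: primeideal P S by fact
  interpret h: ring_hom_cring R S h by unfold_locales (rule h)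
  show ?thesis
    by (rule R.cring_primeidealI[OF R.cring_idealI])
      (auto simp: P.I_l_closed P.one_notin dest: P.I_prime[rotated -1])
qed

text \<open>Zorn's lemma gives an ideal \<open>M\<close> maximal among those containing
  \<open>I\<close> and avoiding \<open>S\<close>. If neither \<open>a\<close> nor \<open>b\<close>
  is in \<open>M\<close>, both \<open>M + (a)\<close> and \<open>M + (b)\<close> meet
  \<open>S\<close>, and the product of two such elements lies in \<open>M + (ab)\<close>; if
  \<open>a \<otimes> b\<close> were in \<open>M\<close>, so would be that product.\<close>

lemma (in cring) primeideal_extends_ideal:
  assumes I: "ideal I R" and S: "submonoid S R" and disj: "I \<inter> S = {}"
  obtains P where "primeideal P R" "I \<subseteq> P" "P \<inter> S = {}"
proof -
  define A where "A = {J. ideal J R \<and> I \<subseteq> J \<and> J \<inter> S = {}}"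
  have "\<exists>M\<in>A. \<forall>U\<in>A. M \<subseteq> U \<longrightarrow> U = M"
  proof (rule subset_Zorn_nonempty)
    show "A \<noteq> {}" using I disj by (auto simp: A_def)
    fix C assume C: "C \<noteq> {}" "subset.chain A C"
    have mem: "J \<in> A" if "J \<in> C" for J using C that by (auto simp: subset_chain_def)
    have "ideal (\<Union>C) R"
    proof (rule cring_idealI)
      show "\<Union>C \<subseteq> carrier R" using mem by (auto simp: A_def ideal_def dest!: additive_subgroup.a_subset)
      obtain J where "J \<in> C" using C(1) by blast
      then show "\<zero> \<in> \<Union>C"
        using mem[of J] by (auto simp: A_def ideal_def dest!: additive_subgroup.zero_closed)
      fix a b assume "a \<in> \<Union>C" "b \<in> \<Union>C"
      then obtain J J' where J: "a \<in> J" "b \<in> J'" "J \<in> C" "J' \<in> C" by blast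
      then obtain K where "K \<in> C" "a \<in> K" "b \<in> K"
        using C(2) unfolding subset_chain_def by (metis subsetD)
      then show "a \<oplus> b \<in> \<Union>C"
        using mem[of K] by (auto simp: A_def ideal_def dest!: additive_subgroup.a_closed[of K R a b])
    next
      fix a x assume "a \<in> \<Union>C" "x \<in> carrier R"
      then obtain J where "J \<in> C" "a \<in> J" by blast
      then show "x \<otimes> a \<in> \<Union>C"
        using mem[of J] ideal.I_l_closed[of J R a x] \<open>x \<in> carrier R\<close> by (auto simp: A_def)
    qed
    then show "\<Union>C \<in> A" using C(1) mem unfolding A_def by blast
  qed
  then obtain M where MA: "M \<in> A" and max': "\<forall>U\<in>A. M \<subseteq> U \<longrightarrow> U = M" by (rule bexE)
  have M: "ideal M R" "I \<subseteq> M" "M \<inter> S = {}" using MA by (simp_all add: A_def)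
  have max: "U = M" if "ideal U R" "M \<subseteq> U" "U \<inter> S = {}" for U
    using max' that M(2) by (simp add: A_def)
  interpret M: ideal M R by fact
  have meets: "\<exists>m\<in>M. \<exists>r\<in>carrier R. m \<oplus> r \<otimes> a \<in> S" if "a \<in> carrier R" "a \<notin> M" for a
  proof -
    define U where "U = {m \<oplus> r \<otimes> a | m r. m \<in> M \<and> r \<in> carrier R}"
    have "ideal U R"
    proof (rule cring_idealI)
      show "U \<subseteq> carrier R" using that M.a_subset by (auto simp: U_def)
      show "\<zero> \<in> U" using that unfolding U_def
        by (intro CollectI exI[of _ \<zero>]) auto
    next
      fix x y assume "x \<in> U" "y \<in> U"
      then obtain m r m' r' where e: "x = m \<oplus> r \<otimes> a" "y = m' \<oplus> r' \<otimes> a"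
        "m \<in> M" "m' \<in> M" "r \<in> carrier R" "r' \<in> carrier R" by (auto simp: U_def)
      then have "x \<oplus> y = (m \<oplus> m') \<oplus> (r \<oplus> r') \<otimes> a"
        using that M.a_Hcarr by (simp add: l_distr a_ac)
      then show "x \<oplus> y \<in> U" using e unfolding U_def by blast
    next
      fix x y assume "x \<in> U" "y \<in> carrier R"
      then obtain m r where e: "x = m \<oplus> r \<otimes> a" "m \<in> M" "r \<in> carrier R" by (auto simp: U_def)
      then have "y \<otimes> x = (y \<otimes> m) \<oplus> (y \<otimes> r) \<otimes> a"
        using that M.a_Hcarr \<open>y \<in> carrier R\<close> by (simp add: r_distr m_assoc)
      then show "y \<otimes> x \<in> U" using e M.I_l_closed \<open>y \<in> carrier R\<close> unfolding U_def by blast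
    qed
    moreover have "M \<subseteq> U"
    proof
      fix m assume "m \<in> M"
      then have "m = m \<oplus> \<zero> \<otimes> a" using that M.a_Hcarr by simp
      then show "m \<in> U" using \<open>m \<in> M\<close> unfolding U_def by blast
    qed
    moreover have "a \<in> U"
    proof -
      have "a = \<zero> \<oplus> \<one> \<otimes> a" using that by simp
      then show ?thesis using M.zero_closed unfolding U_def by blast
    qed
    ultimately have "U \<inter> S \<noteq> {}" using max[of U] that(2) by metis
    then show ?thesis unfolding U_def by blast
  qed
  have "primeideal M R"
  proof (rule cring_primeidealI[OF M(1)])
    show "\<one> \<notin> M" using M(3) submonoid.one_closed[OF S] by blast
    fix a b assume ab: "a \<in> carrier R" "b \<in> carrier R" "a \<otimes> b \<in> M"
    show "a \<in> M \<or> b \<in> M"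
    proof (rule ccontr)
      assume "\<not> ?thesis"
      then obtain m r m' r' where e: "m \<in> M" "m' \<in> M" "r \<in> carrier R" "r' \<in> carrier R"
        "m \<oplus> r \<otimes> a \<in> S" "m' \<oplus> r' \<otimes> b \<in> S" using meets ab by metis
      note C = ab(1,2) e(3,4) M.a_Hcarr[OF e(1)] M.a_Hcarr[OF e(2)]
      have "(m \<oplus> r \<otimes> a) \<otimes> (m' \<oplus> r' \<otimes> b)
          = (m' \<oplus> r' \<otimes> b) \<otimes> m \<oplus> ((r \<otimes> a) \<otimes> m' \<oplus> (r \<otimes> r') \<otimes> (a \<otimes> b))"
        using C by (simp add: l_distr r_distr m_ac a_ac)
      also have "\<dots> \<in> M"
        by (rule M.a_closed[OF M.I_l_closed[OF e(1)] M.a_closed[OF M.I_l_closed[OF e(2)]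
              M.I_l_closed[OF ab(3)]]]) (use C in auto)
      finally show False using M(3) submonoid.m_closed[OF S e(5,6)] by blast
    qed
  qed
  then show ?thesis using that M(2,3) by blast
qed

text \<open>A bound on the height of \<open>P\<close> read off in \<open>R\<close> itself, so that
  it can be moved along homomorphisms without forming localizations. Here \<open>n\<close> counts
  the inclusions of the chain, not its members.\<close>

definition ht_le :: "('a, 'm) ring_scheme \<Rightarrow> 'a set \<Rightarrow> nat \<Rightarrow> bool"
  where "ht_le R P N \<longleftrightarrow> (\<forall>n p. (\<forall>i\<le>n. primeideal (p i) R) \<and> (\<forall>i<n. p i \<subset> p (Suc i)) \<and> p n \<subseteq> P
    \<longrightarrow> n \<le> N)"

lemma ht_leD:
  assumes "ht_le R P N" "\<And>i. i \<le> n \<Longrightarrow> primeideal (p i) R" "\<And>i. i < n \<Longrightarrow> p i \<subset> p (Suc i)"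
    "p n \<subseteq> P"
  shows "n \<le> N"
  using assms unfolding ht_le_def by blast

lemma krull_dim_le_iff:
  "krull_dim R \<le> enat N \<longleftrightarrow> (\<forall>n p. (\<forall>i\<le>n. primeideal (p i) R) \<and> (\<forall>i<n. p i \<subset> p (Suc i)) \<longrightarrow> n \<le> N)"
  unfolding krull_dim_def by (auto simp: SUP_le_iff)

lemma enat_less_infinity_iff: "x < \<infinity> \<longleftrightarrow> (\<exists>n. x \<le> enat n)"
  by (cases x) auto

text \<open>These are the homomorphisms that, up to isomorphism, pass to a localization of a quotient.\<close>

definition dense_hom :: "('a, 'm) ring_scheme \<Rightarrow> ('b, 'n) ring_scheme \<Rightarrow> ('a \<Rightarrow> 'b) \<Rightarrow> bool"
  where "dense_hom R S h \<longleftrightarrow> h \<in> ring_hom R S \<and>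
    (\<forall>w\<in>carrier S. \<exists>s\<in>carrier R. \<exists>r\<in>carrier R. h s \<in> Units S \<and> h s \<otimes>\<^bsub>S\<^esub> w = h r)"

text \<open>An element \<open>w\<close> of \<open>P'\<close> outside \<open>P\<close> is, up to the
  unit \<open>h s\<close>, the image \<open>h r\<close>. Units do not affect membership in an ideal,
  so \<open>r\<close> separates the two contractions.\<close>

lemma dense_hom_vimage_mono:
  assumes "cring R" "cring S" and h: "dense_hom R S h" and "primeideal P S" "primeideal P' S"
    and "P \<subset> P'"
  shows "{r \<in> carrier R. h r \<in> P} \<subset> {r \<in> carrier R. h r \<in> P'}"
proof -
  interpret S: cring S by fact
  interpret P: primeideal P S by fact
  interpret P': primeideal P' S by fact
  obtain w where w: "w \<in> P'" "w \<notin> P" using assms(6) by blast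
  have wc: "w \<in> carrier S" using w P'.a_Hcarr by blast
  then obtain s r where s: "s \<in> carrier R" "r \<in> carrier R" "h s \<in> Units S" "h s \<otimes>\<^bsub>S\<^esub> w = h r"
    using h unfolding dense_hom_def by blast
  have "h r \<in> P'"
    using P'.I_l_closed[OF w(1) S.Units_closed[OF s(3)]] s(4) by simp
  moreover have "h r \<notin> P"
  proof
    assume "h r \<in> P"
    then have "inv\<^bsub>S\<^esub> (h s) \<otimes>\<^bsub>S\<^esub> (h s \<otimes>\<^bsub>S\<^esub> w) \<in> P"
      unfolding s(4) by (rule P.I_l_closed[OF _ S.Units_inv_closed[OF s(3)]])
    moreover have "inv\<^bsub>S\<^esub> (h s) \<otimes>\<^bsub>S\<^esub> (h s \<otimes>\<^bsub>S\<^esub> w) = w"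
      using s(3) wc by (simp add: S.Units_closed S.Units_l_inv flip: S.m_assoc)
    ultimately show False using w by simp
  qed
  ultimately show ?thesis using assms(6) s(2) by blast
qed

lemma dense_hom_ht_le:
  assumes "cring R" "cring S" and h: "dense_hom R S h"
    and ht: "ht_le R {r \<in> carrier R. h r \<in> P} N"
  shows "ht_le S P N"
  unfolding ht_le_def
proof (intro allI impI, elim conjE)
  fix n p assume p: "\<forall>i\<le>n. primeideal (p i) S" "\<forall>i<n. p i \<subset> p (Suc i)" "p n \<subseteq> P"
  show "n \<le> N"
  proof (rule ht_leD[OF ht, of _ "\<lambda>i. {r \<in> carrier R. h r \<in> p i}"])
    fix i assume "i < n"
    then show "{r \<in> carrier R. h r \<in> p i} \<subset> {r \<in> carrier R. h r \<in> p (Suc i)}"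
      using dense_hom_vimage_mono[OF assms(1-3)] p by (simp add: Suc_le_eq)
  qed (use p primeideal_vimage[OF assms(1,2)] h in \<open>auto simp: dense_hom_def\<close>)
qed

lemma (in cring) frac_of_mem_Units:
  assumes S: "submonoid S R" and "s \<in> S" "t \<in> S"
  shows "frac_of R S s t \<in> Units (ring_of_fracs R S)"
proof -
  interpret Q: cring "ring_of_fracs R S" by (rule cring_ring_of_fracs[OF S])
  note C = denom_carrier[OF S] denom_mult[OF S] denom_one[OF S]
  have "frac_of R S s t \<otimes>\<^bsub>ring_of_fracs R S\<^esub> frac_of R S t s = \<one>\<^bsub>ring_of_fracs R S\<^esub>"
    (is "_ = ?one")
  proof -
    have "frac_of R S (s \<otimes> t) (t \<otimes> s) = frac_of R S \<one> \<one>"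
      by (rule frac_of_cancel[OF S]) (use assms C in \<open>auto simp: m_comm\<close>)
    also have "\<dots> = ?one" by (simp add: ring_of_fracs_def)
    finally show ?thesis using assms C by (simp add: ring_of_fracs_mult[OF S])
  qed
  moreover have "frac_of R S s t \<in> carrier (ring_of_fracs R S)"
    "frac_of R S t s \<in> carrier (ring_of_fracs R S)"
    using assms C unfolding ring_of_fracs_carrier[OF S] by blast+
  ultimately show ?thesis using Q.m_comm unfolding Units_def by fastforce
qed

lemma (in cring) frac_of_hom:
  assumes S: "submonoid S R"
  shows "(\<lambda>a. frac_of R S a \<one>) \<in> ring_hom R (ring_of_fracs R S)"
proof (rule ring_hom_memI)
  note C = denom_one[OF S]
  show "frac_of R S \<one> \<one> = \<one>\<^bsub>ring_of_fracs R S\<^esub>" by (simp add: ring_of_fracs_def)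
  show "frac_of R S a \<one> \<in> carrier (ring_of_fracs R S)" if "a \<in> carrier R" for a
    unfolding ring_of_fracs_carrier[OF S] using that C by blast
  fix a b assume ab: "a \<in> carrier R" "b \<in> carrier R"
  show "frac_of R S (a \<otimes> b) \<one> = frac_of R S a \<one> \<otimes>\<^bsub>ring_of_fracs R S\<^esub> frac_of R S b \<one>"
    using ab C by (simp add: ring_of_fracs_mult[OF S])
  show "frac_of R S (a \<oplus> b) \<one> = frac_of R S a \<one> \<oplus>\<^bsub>ring_of_fracs R S\<^esub> frac_of R S b \<one>"
    using ab C by (simp add: ring_of_fracs_add[OF S])
qed

lemma (in cring) frac_of_split:
  assumes S: "submonoid S R" and "a \<in> carrier R" "s \<in> S"
  shows "frac_of R S s \<one> \<otimes>\<^bsub>ring_of_fracs R S\<^esub> frac_of R S a s = frac_of R S a \<one>"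
proof -
  note C = denom_carrier[OF S] denom_mult[OF S] denom_one[OF S]
  have "frac_of R S (s \<otimes> a) (\<one> \<otimes> s) = frac_of R S a \<one>"
    by (rule frac_of_cancel[OF S]) (use assms C in \<open>auto simp: m_comm\<close>)
  then show ?thesis using assms C by (simp add: ring_of_fracs_mult[OF S])
qed

lemma (in cring) dense_hom_frac:
  assumes S: "submonoid S R"
  shows "dense_hom R (ring_of_fracs R S) (\<lambda>a. frac_of R S a \<one>)"
  unfolding dense_hom_def
proof (intro conjI ballI frac_of_hom[OF S])
  fix w assume "w \<in> carrier (ring_of_fracs R S)"
  then obtain a s where "w = frac_of R S a s" "a \<in> carrier R" "s \<in> S"
    unfolding ring_of_fracs_carrier[OF S] by blast
  then show "\<exists>s\<in>carrier R. \<exists>r\<in>carrier R. frac_of R S s \<one> \<in> Units (ring_of_fracs R S) \<and>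
      frac_of R S s \<one> \<otimes>\<^bsub>ring_of_fracs R S\<^esub> w = frac_of R S r \<one>"
    using frac_of_split[OF S] frac_of_mem_Units[OF S] denom_carrier[OF S] denom_one[OF S] by blast
qed

definition frac_ideal :: "('a, 'm) ring_scheme \<Rightarrow> 'a set \<Rightarrow> 'a set \<Rightarrow> ('a \<times> 'a) set set"
  where "frac_ideal R S P = {frac_of R S a s | a s. a \<in> P \<and> s \<in> S}"

text \<open>Independence of the representative comes from primality: equality of fractions puts a
  multiple \<open>u \<otimes> (a \<otimes> t)\<close> into \<open>P\<close>, and \<open>u\<close>
  and \<open>t\<close> lie in \<open>S\<close>, hence outside \<open>P\<close>.\<close>

lemma (in cring) frac_of_mem_frac_ideal_iff:
  assumes S: "submonoid S R" and P: "primeideal P R" and "P \<inter> S = {}"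
    and "a \<in> carrier R" "s \<in> S"
  shows "frac_of R S a s \<in> frac_ideal R S P \<longleftrightarrow> a \<in> P"
proof
  interpret P: primeideal P R by fact
  assume "frac_of R S a s \<in> frac_ideal R S P"
  then obtain b t where "frac_of R S a s = frac_of R S b t" "b \<in> P" "t \<in> S"
    unfolding frac_ideal_def by blast
  then obtain u where u: "u \<in> S" "u \<otimes> (a \<otimes> t) = u \<otimes> (b \<otimes> s)"
    using frac_of_eq_iff[OF S, of a s b t] assms(4,5) P.a_Hcarr by auto
  have "u \<otimes> (b \<otimes> s) \<in> P"
    using \<open>b \<in> P\<close> u(1) assms(5) denom_carrier[OF S] by (intro P.I_l_closed P.I_r_closed) auto
  then have "u \<otimes> (a \<otimes> t) \<in> P" using u by simp
  then show "a \<in> P"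
    using P.I_prime[of u "a \<otimes> t"] P.I_prime[of a t] u(1) \<open>t \<in> S\<close> assms(3,4) denom_carrier[OF S]
    by auto
qed (use assms in \<open>auto simp: frac_ideal_def\<close>)

lemma (in cring) primeideal_frac_ideal:
  assumes S: "submonoid S R" and P: "primeideal P R" and disj: "P \<inter> S = {}"
  shows "primeideal (frac_ideal R S P) (ring_of_fracs R S)"
proof -
  let ?Q = "ring_of_fracs R S"
  interpret P: primeideal P R by fact
  interpret Q: cring ?Q by (rule cring_ring_of_fracs[OF S])
  note C = denom_carrier[OF S] denom_mult[OF S] denom_one[OF S]
  note mem = frac_of_mem_frac_ideal_iff[OF S P disj]
  have sub: "frac_ideal R S P \<subseteq> carrier ?Q"
    unfolding frac_ideal_def ring_of_fracs_carrier[OF S] using P.a_Hcarr by blast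
  have one: "\<one>\<^bsub>?Q\<^esub> = frac_of R S \<one> \<one>" and zero: "\<zero>\<^bsub>?Q\<^esub> = frac_of R S \<zero> \<one>"
    by (simp_all add: ring_of_fracs_def)
  show ?thesis
  proof (rule Q.cring_primeidealI[OF Q.cring_idealI[OF sub]])
    show "\<zero>\<^bsub>?Q\<^esub> \<in> frac_ideal R S P" using mem C by (simp add: zero)
    show "\<one>\<^bsub>?Q\<^esub> \<notin> frac_ideal R S P" using mem C P.one_notin by (simp add: one)
  next
    fix x y assume "x \<in> frac_ideal R S P" "y \<in> frac_ideal R S P"
    then obtain a s b t where e: "x = frac_of R S a s" "y = frac_of R S b t" "a \<in> P" "b \<in> P"
      "s \<in> S" "t \<in> S" unfolding frac_ideal_def by blast
    then show "x \<oplus>\<^bsub>?Q\<^esub> y \<in> frac_ideal R S P"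
      using C P.a_Hcarr by (simp add: ring_of_fracs_add[OF S] mem P.I_r_closed)
  next
    fix x y assume "x \<in> frac_ideal R S P" "y \<in> carrier ?Q"
    then obtain a s b t where e: "x = frac_of R S a s" "y = frac_of R S b t" "a \<in> P"
      "b \<in> carrier R" "s \<in> S" "t \<in> S" unfolding frac_ideal_def ring_of_fracs_carrier[OF S] by blast
    then show "y \<otimes>\<^bsub>?Q\<^esub> x \<in> frac_ideal R S P"
      using C P.a_Hcarr by (simp add: ring_of_fracs_mult[OF S] mem P.I_l_closed)
  next
    fix x y assume xy: "x \<in> carrier ?Q" "y \<in> carrier ?Q" "x \<otimes>\<^bsub>?Q\<^esub> y \<in> frac_ideal R S P"
    then obtain a s b t where e: "x = frac_of R S a s" "y = frac_of R S b t" "a \<in> carrier R"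
      "b \<in> carrier R" "s \<in> S" "t \<in> S" unfolding ring_of_fracs_carrier[OF S] by blast
    then show "x \<in> frac_ideal R S P \<or> y \<in> frac_ideal R S P"
      using C xy(3) P.I_prime by (simp add: ring_of_fracs_mult[OF S] mem)
  qed
qed

lemma (in cring) frac_ideal_strict_mono:
  assumes S: "submonoid S R" and "primeideal P R" "P \<inter> S = {}" "primeideal P' R" "P' \<inter> S = {}"
    and "P \<subset> P'"
  shows "frac_ideal R S P \<subset> frac_ideal R S P'"
proof -
  obtain a where "a \<in> P'" "a \<notin> P" using assms(6) by blast
  then have "frac_of R S a \<one> \<in> frac_ideal R S P'" "frac_of R S a \<one> \<notin> frac_ideal R S P"
    using assms frac_of_mem_frac_ideal_iff[OF S] primeideal_subset denom_one[OF S] by blast+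
  moreover have "frac_ideal R S P \<subseteq> frac_ideal R S P'"
    using assms(6) unfolding frac_ideal_def by blast
  ultimately show ?thesis by blast
qed

text \<open>Chains below \<open>P\<close> extend to the localization through
  \<open>frac_ideal\<close>; chains of the localization contract to \<open>R\<close> along the dense
  map to fractions. From here on LFD is handled as a bound on heights.\<close>

lemma (in cring) LFD_iff_ht_le: "LFD R \<longleftrightarrow> (\<forall>P. primeideal P R \<longrightarrow> (\<exists>N. ht_le R P N))"
proof -
  have "(krull_dim (localization_at R P) < \<infinity>) \<longleftrightarrow> (\<exists>N. ht_le R P N)" if P: "primeideal P R" for P
  proof -
    interpret P: primeideal P R by fact
    let ?S = "carrier R - P"
    have S: "submonoid ?S R" by (rule P.compl_submonoid)
    have "ht_le R P N" if le: "krull_dim (localization_at R P) \<le> enat N" for N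
      unfolding ht_le_def
    proof (intro allI impI, elim conjE)
      fix n p assume p: "\<forall>i\<le>n. primeideal (p i) R" "\<forall>i<n. p i \<subset> p (Suc i)" "p n \<subseteq> P"
      have sub: "p i \<subseteq> P" if "i \<le> n" for i
        using that p(2,3) by (induction rule: inc_induct) auto
      then have disj: "p i \<inter> ?S = {}" if "i \<le> n" for i using that by blast
      have "primeideal (frac_ideal R ?S (p i)) (localization_at R P)" if "i \<le> n" for i
        unfolding localization_at_def using primeideal_frac_ideal[OF S] p(1) disj that by blast
      moreover have "frac_ideal R ?S (p i) \<subset> frac_ideal R ?S (p (Suc i))" if "i < n" for i
        using frac_ideal_strict_mono[OF S] p disj that by (simp add: Suc_le_eq)
      ultimately show "n \<le> N"
        using le[unfolded krull_dim_le_iff, rule_format, of n "\<lambda>i. frac_ideal R ?S (p i)"] by blast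
    qed
    moreover have "krull_dim (localization_at R P) \<le> enat N" if ht: "ht_le R P N" for N
      unfolding krull_dim_le_iff
    proof (intro allI impI, elim conjE)
      fix n p assume p: "\<forall>i\<le>n. primeideal (p i) (localization_at R P)" "\<forall>i<n. p i \<subset> p (Suc i)"
      let ?h = "\<lambda>a. frac_of R ?S a \<one>"
      interpret pn: primeideal "p n" "localization_at R P" using p by blast
      \<comment> \<open>An element of \<open>R\<close> outside \<open>P\<close> becomes a unit, so
        it cannot lie in the contraction of a proper ideal.\<close>
      have "{r \<in> carrier R. ?h r \<in> p n} \<subseteq> P"
      proof (rule subsetI, rule ccontr)
        fix r assume "r \<in> {r \<in> carrier R. ?h r \<in> p n}" "r \<notin> P"
        then have "?h r \<in> Units (localization_at R P)" "?h r \<in> p n"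
          unfolding localization_at_def using frac_of_mem_Units[OF S] denom_one[OF S] by blast+
        then have "\<one>\<^bsub>localization_at R P\<^esub> \<in> p n"
          by (metis pn.I_r_closed pn.Units_r_inv pn.Units_inv_closed)
        then show False using pn.one_notin by blast
      qed
      then have "ht_le R {r \<in> carrier R. ?h r \<in> p n} N"
        using ht unfolding ht_le_def by (meson order_trans)
      then have "ht_le (localization_at R P) (p n) N"
        unfolding localization_at_def
        using dense_hom_ht_le[OF is_cring cring_ring_of_fracs[OF S] dense_hom_frac[OF S]] by blast
      then show "n \<le> N" using p unfolding ht_le_def by blast
    qed
    ultimately show ?thesis unfolding enat_less_infinity_iff by blast
  qed
  then show ?thesis unfolding LFD_def by blast
qed

lemma LFD_dense_hom:
  assumes "cring R" "cring S" and h: "dense_hom R S h" and "LFD R"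
  shows "LFD S"
  unfolding cring.LFD_iff_ht_le[OF assms(2)]
proof (intro allI impI)
  fix P assume "primeideal P S"
  moreover have "h \<in> ring_hom R S" using h by (simp add: dense_hom_def)
  ultimately have "primeideal {r \<in> carrier R. h r \<in> P} R"
    using primeideal_vimage[OF assms(1,2)] by blast
  then obtain N where "ht_le R {r \<in> carrier R. h r \<in> P} N"
    using assms(4) unfolding cring.LFD_iff_ht_le[OF assms(1)] by blast
  then show "\<exists>N. ht_le S P N" using dense_hom_ht_le[OF assms(1,2) h] by blast
qed


section \<open>Tensor products over a field\<close>

lemma (in module) submodule_memI:
  assumes "H \<subseteq> carrier M" "\<zero>\<^bsub>M\<^esub> \<in> H" and add: "\<And>a b. \<lbrakk>a \<in> H; b \<in> H\<rbrakk> \<Longrightarrow> a \<oplus>\<^bsub>M\<^esub> b \<in> H"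
    and smult: "\<And>a x. \<lbrakk>a \<in> carrier R; x \<in> H\<rbrakk> \<Longrightarrow> a \<odot>\<^bsub>M\<^esub> x \<in> H"
  shows "submodule H R M"
proof (rule submoduleI[OF assms(1,2) _ add smult])
  fix a assume a: "a \<in> H"
  then have "(\<ominus> \<one>) \<odot>\<^bsub>M\<^esub> a = \<ominus>\<^bsub>M\<^esub> a"
    using assms(1) by (subst smult_l_minus) auto
  then show "\<ominus>\<^bsub>M\<^esub> a \<in> H" using smult[of "\<ominus> \<one>" a] a by simp
qed

lemma (in module) submodule_zero: "submodule H R M \<Longrightarrow> \<zero>\<^bsub>M\<^esub> \<in> H"
  using subgroup.one_closed[OF submodule.axioms(1)] by fastforce

definition linear_functional :: "('k, 'u) ring_scheme \<Rightarrow> ('k, 'b, 'n) module_scheme \<Rightarrow> ('b \<Rightarrow> 'k) \<Rightarrow> bool"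
  where "linear_functional k B l \<longleftrightarrow> l \<in> carrier B \<rightarrow> carrier k \<and>
    (\<forall>x\<in>carrier B. \<forall>y\<in>carrier B. l (x \<oplus>\<^bsub>B\<^esub> y) = l x \<oplus>\<^bsub>k\<^esub> l y) \<and>
    (\<forall>c\<in>carrier k. \<forall>x\<in>carrier B. l (c \<odot>\<^bsub>B\<^esub> x) = c \<otimes>\<^bsub>k\<^esub> l x)"

lemma linear_functionalD:
  assumes "linear_functional k B l" "x \<in> carrier B"
  shows "l x \<in> carrier k"
    and "y \<in> carrier B \<Longrightarrow> l (x \<oplus>\<^bsub>B\<^esub> y) = l x \<oplus>\<^bsub>k\<^esub> l y"
    and "c \<in> carrier k \<Longrightarrow> l (c \<odot>\<^bsub>B\<^esub> x) = c \<otimes>\<^bsub>k\<^esub> l x"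
  using assms unfolding linear_functional_def by auto

text \<open>A submodule that is maximal among those avoiding \<open>b\<close> has codimension one.\<close>

lemma linear_functional_separates:
  assumes "field k" "module k B" "submodule W k B" "b \<in> carrier B" "b \<notin> W"
  obtains l where "linear_functional k B l" "l b = \<one>\<^bsub>k\<^esub>" "\<And>w. w \<in> W \<Longrightarrow> l w = \<zero>\<^bsub>k\<^esub>"
proof -
  interpret k: field k by fact
  interpret B: module k B by fact
  define A where "A = {U. submodule U k B \<and> W \<subseteq> U \<and> b \<notin> U}"
  have "\<exists>M\<in>A. \<forall>U\<in>A. M \<subseteq> U \<longrightarrow> U = M"
  proof (rule subset_Zorn_nonempty)
    show "A \<noteq> {}" using assms by (auto simp: A_def)
    fix C assume C: "C \<noteq> {}" "subset.chain A C"
    have mem: "submodule J k B \<and> W \<subseteq> J \<and> b \<notin> J" if "J \<in> C" for J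
      using C that by (auto simp: subset_chain_def A_def)
    have "submodule (\<Union>C) k B"
    proof (rule B.submodule_memI)
      show "\<Union>C \<subseteq> carrier B" using mem B.submoduleE(1) by blast
      show "\<zero>\<^bsub>B\<^esub> \<in> \<Union>C" using C(1) mem B.submodule_zero by blast
      fix x y assume "x \<in> \<Union>C" "y \<in> \<Union>C"
      then obtain J J' where J: "x \<in> J" "y \<in> J'" "J \<in> C" "J' \<in> C" by blast
      then obtain K where "K \<in> C" "x \<in> K" "y \<in> K"
        using C(2) unfolding subset_chain_def by (metis subsetD)
      then show "x \<oplus>\<^bsub>B\<^esub> y \<in> \<Union>C" using mem B.submoduleE(5) by blast
    next
      fix c x assume "c \<in> carrier k" "x \<in> \<Union>C"
      then show "c \<odot>\<^bsub>B\<^esub> x \<in> \<Union>C" using mem B.submoduleE(4) by blast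
    qed
    then show "\<Union>C \<in> A" using C(1) mem unfolding A_def by blast
  qed
  then obtain M where MA: "M \<in> A" and max': "\<forall>U\<in>A. M \<subseteq> U \<longrightarrow> U = M" by (rule bexE)
  have M: "submodule M k B" "W \<subseteq> M" "b \<notin> M" using MA by (simp_all add: A_def)
  have max: "U = M" if "submodule U k B" "b \<notin> U" "M \<subseteq> U" for U
    using max' that M(2) by (simp add: A_def)
  note Mc = subsetD[OF B.submoduleE(1)[OF M(1)]] and Madd = B.submoduleE(5)[OF M(1)]
    and Msm = B.submoduleE(4)[OF M(1)] and Mneg = B.submoduleE(3)[OF M(1)]
  \<comment> \<open>For \<open>v\<close> outside \<open>M\<close>, maximality puts \<open>b\<close>
    into \<open>M + k v\<close>. The coefficient of \<open>v\<close> is non-zero because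
    \<open>b\<close> is not in \<open>M\<close>, so the equation can be solved for
    \<open>v\<close>.\<close>
  have decomp: "\<exists>c\<in>carrier k. \<exists>m\<in>M. v = m \<oplus>\<^bsub>B\<^esub> c \<odot>\<^bsub>B\<^esub> b" if v: "v \<in> carrier B" for v
  proof (cases "v \<in> M")
    case True
    then have "v = v \<oplus>\<^bsub>B\<^esub> \<zero>\<^bsub>k\<^esub> \<odot>\<^bsub>B\<^esub> b" using v assms(4) by simp
    then show ?thesis using True by blast
  next
    case False
    define U where "U = {m \<oplus>\<^bsub>B\<^esub> c \<odot>\<^bsub>B\<^esub> v | m c. m \<in> M \<and> c \<in> carrier k}"
    have "submodule U k B"
    proof (rule B.submodule_memI)
      show "U \<subseteq> carrier B" using v Mc by (auto simp: U_def)
      have "\<zero>\<^bsub>B\<^esub> = \<zero>\<^bsub>B\<^esub> \<oplus>\<^bsub>B\<^esub> \<zero>\<^bsub>k\<^esub> \<odot>\<^bsub>B\<^esub> v" using v by simp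
      then show "\<zero>\<^bsub>B\<^esub> \<in> U" using B.submodule_zero[OF M(1)] unfolding U_def by blast
    next
      fix x y assume "x \<in> U" "y \<in> U"
      then obtain m c m' c' where e: "x = m \<oplus>\<^bsub>B\<^esub> c \<odot>\<^bsub>B\<^esub> v" "y = m' \<oplus>\<^bsub>B\<^esub> c' \<odot>\<^bsub>B\<^esub> v"
        "m \<in> M" "m' \<in> M" "c \<in> carrier k" "c' \<in> carrier k" by (auto simp: U_def)
      then have "x \<oplus>\<^bsub>B\<^esub> y = (m \<oplus>\<^bsub>B\<^esub> m') \<oplus>\<^bsub>B\<^esub> (c \<oplus>\<^bsub>k\<^esub> c') \<odot>\<^bsub>B\<^esub> v"
        using v Mc by (simp add: B.smult_l_distr B.M.a_ac)
      then show "x \<oplus>\<^bsub>B\<^esub> y \<in> U" using e Madd unfolding U_def by blast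
    next
      fix d x assume d: "d \<in> carrier k" and "x \<in> U"
      then obtain m c where e: "x = m \<oplus>\<^bsub>B\<^esub> c \<odot>\<^bsub>B\<^esub> v" "m \<in> M" "c \<in> carrier k" by (auto simp: U_def)
      then have "d \<odot>\<^bsub>B\<^esub> x = d \<odot>\<^bsub>B\<^esub> m \<oplus>\<^bsub>B\<^esub> (d \<otimes>\<^bsub>k\<^esub> c) \<odot>\<^bsub>B\<^esub> v"
        using v d Mc by (simp add: B.smult_r_distr B.smult_assoc1)
      then show "d \<odot>\<^bsub>B\<^esub> x \<in> U" using e d Msm unfolding U_def by blast
    qed
    moreover have "M \<subseteq> U"
    proof
      fix m assume "m \<in> M"
      then have "m = m \<oplus>\<^bsub>B\<^esub> \<zero>\<^bsub>k\<^esub> \<odot>\<^bsub>B\<^esub> v" using v Mc by simp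
      then show "m \<in> U" using \<open>m \<in> M\<close> unfolding U_def by blast
    qed
    moreover have "v \<in> U"
    proof -
      have "v = \<zero>\<^bsub>B\<^esub> \<oplus>\<^bsub>B\<^esub> \<one>\<^bsub>k\<^esub> \<odot>\<^bsub>B\<^esub> v" using v by simp
      then show ?thesis using B.submodule_zero[OF M(1)] unfolding U_def by blast
    qed
    ultimately have "b \<in> U" using max[of U] False by blast
    then obtain m c where e: "b = m \<oplus>\<^bsub>B\<^esub> c \<odot>\<^bsub>B\<^esub> v" "m \<in> M" "c \<in> carrier k" by (auto simp: U_def)
    have "c \<noteq> \<zero>\<^bsub>k\<^esub>" using e M(3) v Mc by auto
    then have c: "inv\<^bsub>k\<^esub> c \<in> carrier k" "inv\<^bsub>k\<^esub> c \<otimes>\<^bsub>k\<^esub> c = \<one>\<^bsub>k\<^esub>"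
      using e(3) k.field_Units by auto
    have "inv\<^bsub>k\<^esub> c \<odot>\<^bsub>B\<^esub> b = inv\<^bsub>k\<^esub> c \<odot>\<^bsub>B\<^esub> m \<oplus>\<^bsub>B\<^esub> v"
      unfolding e(1) using c e v Mc by (simp add: B.smult_r_distr flip: B.smult_assoc1)
    then have "v = \<ominus>\<^bsub>B\<^esub> (inv\<^bsub>k\<^esub> c \<odot>\<^bsub>B\<^esub> m) \<oplus>\<^bsub>B\<^esub> inv\<^bsub>k\<^esub> c \<odot>\<^bsub>B\<^esub> b"
      using v c e Mc by (simp add: B.M.r_neg1)
    then show ?thesis using Mneg[OF Msm[OF c(1) e(2)]] c(1) by blast
  qed
  have uniq: "c = c'" if "m \<oplus>\<^bsub>B\<^esub> c \<odot>\<^bsub>B\<^esub> b = m' \<oplus>\<^bsub>B\<^esub> c' \<odot>\<^bsub>B\<^esub> b" "m \<in> M" "m' \<in> M"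
    "c \<in> carrier k" "c' \<in> carrier k" for c c' m m'
  proof (rule ccontr)
    assume ne: "c \<noteq> c'"
    define d where "d = c \<ominus>\<^bsub>k\<^esub> c'"
    have d: "d \<in> carrier k" "d \<noteq> \<zero>\<^bsub>k\<^esub>" using that ne by (auto simp: d_def)
    have "d \<odot>\<^bsub>B\<^esub> b = c \<odot>\<^bsub>B\<^esub> b \<oplus>\<^bsub>B\<^esub> \<ominus>\<^bsub>B\<^esub> (c' \<odot>\<^bsub>B\<^esub> b)"
      using that assms(4) by (simp add: d_def a_minus_def B.smult_l_distr B.smult_l_minus)
    also have "\<dots> = \<ominus>\<^bsub>B\<^esub> m \<oplus>\<^bsub>B\<^esub> (m \<oplus>\<^bsub>B\<^esub> c \<odot>\<^bsub>B\<^esub> b) \<oplus>\<^bsub>B\<^esub> \<ominus>\<^bsub>B\<^esub> (c' \<odot>\<^bsub>B\<^esub> b)"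
      using that(2-) assms(4) Mc by (simp add: B.M.r_neg1)
    also have "\<dots> = \<ominus>\<^bsub>B\<^esub> m \<oplus>\<^bsub>B\<^esub> m'"
      unfolding that(1) using that(2-) assms(4) Mc by (simp add: B.M.a_assoc B.M.r_neg)
    finally have "d \<odot>\<^bsub>B\<^esub> b \<in> M" using Madd Mneg that by metis
    then have "inv\<^bsub>k\<^esub> d \<odot>\<^bsub>B\<^esub> (d \<odot>\<^bsub>B\<^esub> b) \<in> M" using Msm d k.field_Units by auto
    moreover have "inv\<^bsub>k\<^esub> d \<odot>\<^bsub>B\<^esub> (d \<odot>\<^bsub>B\<^esub> b) = b"
      using d k.field_Units assms(4) by (simp flip: B.smult_assoc1)
    ultimately show False using M(3) by simp
  qed
  define l where "l v = (SOME c. c \<in> carrier k \<and> (\<exists>m\<in>M. v = m \<oplus>\<^bsub>B\<^esub> c \<odot>\<^bsub>B\<^esub> b))" for v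
  have l: "l v \<in> carrier k \<and> (\<exists>m\<in>M. v = m \<oplus>\<^bsub>B\<^esub> l v \<odot>\<^bsub>B\<^esub> b)" if "v \<in> carrier B" for v
    unfolding l_def by (rule someI_ex) (use decomp[OF that] in blast)
  have l_eq: "l v = c" if "v = m \<oplus>\<^bsub>B\<^esub> c \<odot>\<^bsub>B\<^esub> b" "m \<in> M" "c \<in> carrier k" for v c m
  proof -
    have "v \<in> carrier B" using that Mc assms(4) by simp
    then obtain m' where "m' \<in> M" "v = m' \<oplus>\<^bsub>B\<^esub> l v \<odot>\<^bsub>B\<^esub> b" using l by blast
    then show ?thesis using uniq[of m' "l v" m c] that l[OF \<open>v \<in> carrier B\<close>] by simp
  qed
  show thesis
  proof (rule that[of l])
    show "linear_functional k B l"
      unfolding linear_functional_def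
    proof (intro conjI ballI)
      show "l \<in> carrier B \<rightarrow> carrier k" using l by blast
      fix x y assume xy: "x \<in> carrier B" "y \<in> carrier B"
      then obtain m m' where e: "m \<in> M" "m' \<in> M" "x = m \<oplus>\<^bsub>B\<^esub> l x \<odot>\<^bsub>B\<^esub> b" "y = m' \<oplus>\<^bsub>B\<^esub> l y \<odot>\<^bsub>B\<^esub> b"
        using l by blast
      have "x \<oplus>\<^bsub>B\<^esub> y = (m \<oplus>\<^bsub>B\<^esub> l x \<odot>\<^bsub>B\<^esub> b) \<oplus>\<^bsub>B\<^esub> (m' \<oplus>\<^bsub>B\<^esub> l y \<odot>\<^bsub>B\<^esub> b)" using e by metis
      also have "\<dots> = (m \<oplus>\<^bsub>B\<^esub> m') \<oplus>\<^bsub>B\<^esub> (l x \<oplus>\<^bsub>k\<^esub> l y) \<odot>\<^bsub>B\<^esub> b"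
        using e(1,2) l xy assms(4) Mc by (simp add: B.smult_l_distr B.M.a_ac)
      finally show "l (x \<oplus>\<^bsub>B\<^esub> y) = l x \<oplus>\<^bsub>k\<^esub> l y" using l_eq Madd e(1,2) l xy by simp
    next
      fix c x assume cx: "c \<in> carrier k" "x \<in> carrier B"
      then obtain m where e: "m \<in> M" "x = m \<oplus>\<^bsub>B\<^esub> l x \<odot>\<^bsub>B\<^esub> b" using l by blast
      have "c \<odot>\<^bsub>B\<^esub> x = c \<odot>\<^bsub>B\<^esub> (m \<oplus>\<^bsub>B\<^esub> l x \<odot>\<^bsub>B\<^esub> b)" using e by metis
      also have "\<dots> = c \<odot>\<^bsub>B\<^esub> m \<oplus>\<^bsub>B\<^esub> (c \<otimes>\<^bsub>k\<^esub> l x) \<odot>\<^bsub>B\<^esub> b"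
        using e(1) l cx assms(4) Mc by (simp add: B.smult_r_distr B.smult_assoc1)
      finally show "l (c \<odot>\<^bsub>B\<^esub> x) = c \<otimes>\<^bsub>k\<^esub> l x" using l_eq Msm e(1) l cx by simp
    qed
    show "l b = \<one>\<^bsub>k\<^esub>"
      using l_eq[of b "\<zero>\<^bsub>B\<^esub>" "\<one>\<^bsub>k\<^esub>"] B.submodule_zero[OF M(1)] assms(4) by simp
    show "l w = \<zero>\<^bsub>k\<^esub>" if "w \<in> W" for w
      using l_eq[of w w "\<zero>\<^bsub>k\<^esub>"] M(2) that Mc assms(4) by auto
  qed
qed

section \<open>Pure tensors and additive maps out of the tensor product\<close>

locale tensor =
  fixes k :: "('k, 'u) ring_scheme"
    and A :: "('k, 'a, 'm) module_scheme"
    and B :: "('k, 'b, 'n) module_scheme"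
  assumes field_k: "field k" and alg_A: "algebra k A" and alg_B: "algebra k B"
begin

sublocale k: field k by (rule field_k)
sublocale A: algebra k A by (rule alg_A)
sublocale B: algebra k B by (rule alg_B)

abbreviation T where "T \<equiv> tensor_product k A B"
abbreviation pt where "pt \<equiv> pure_tensor k A B"
abbreviation inA where "inA a \<equiv> pt a \<one>\<^bsub>B\<^esub>"
abbreviation inB where "inB b \<equiv> pt \<one>\<^bsub>A\<^esub> b"
abbreviation free where "free \<equiv> free_pair_ring A B"
abbreviation rel_ideal where "rel_ideal \<equiv> Idl\<^bsub>free\<^esub> (tensor_relators k A B)"

sublocale T: cring T by (rule cring_tensor_product[OF alg_A alg_B])
sublocale free: cring free by (rule cring_free_pair_ring) (rule A.M_cring B.M_cring)+
sublocale rel: ideal rel_ideal free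
  by (rule free.genideal_ideal[OF tensor_relators_closed[OF alg_A alg_B]])

lemma T_eq: "T = free Quot rel_ideal"
  by (simp add: tensor_product_def)

lemma coset_hom: "(+>\<^bsub>free\<^esub>) rel_ideal \<in> ring_hom free T"
  unfolding T_eq by (rule rel.rcos_ring_hom)

lemma carrier_T: "carrier T = (\<lambda>x. rel_ideal +>\<^bsub>free\<^esub> x) ` carrier free"
  by (auto simp: T_eq FactRing_def A_RCOSETS_def')

lemma frag_of_closed: "\<lbrakk>a \<in> carrier A; b \<in> carrier B\<rbrakk> \<Longrightarrow> frag_of (a, b) \<in> carrier free"
  by (simp add: free_pair_ring_simps)

lemma pt_closed [simp, intro]: "\<lbrakk>a \<in> carrier A; b \<in> carrier B\<rbrakk> \<Longrightarrow> pt a b \<in> carrier T"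
  unfolding pure_tensor_def using ring_hom_closed[OF coset_hom frag_of_closed] .

lemma pt_mult:
  "\<lbrakk>a \<in> carrier A; b \<in> carrier B; a' \<in> carrier A; b' \<in> carrier B\<rbrakk>
    \<Longrightarrow> pt a b \<otimes>\<^bsub>T\<^esub> pt a' b' = pt (a \<otimes>\<^bsub>A\<^esub> a') (b \<otimes>\<^bsub>B\<^esub> b')"
  unfolding pure_tensor_def
  using ring_hom_mult[OF coset_hom frag_of_closed[of a b] frag_of_closed[of a' b']] by simp

lemma pt_one: "pt \<one>\<^bsub>A\<^esub> \<one>\<^bsub>B\<^esub> = \<one>\<^bsub>T\<^esub>"
  unfolding pure_tensor_def using ring_hom_one[OF coset_hom] by (simp add: free_pair_ring_simps)

lemma free_minus: "\<lbrakk>x \<in> carrier free; y \<in> carrier free\<rbrakk> \<Longrightarrow> x \<ominus>\<^bsub>free\<^esub> y = x - y"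
  by (metis add_diff_cancel_right' free.minus_closed free.minus_eq free.r_neg2 free.a_comm
      free.a_inv_closed free_pair_ring_simps(4) free.minus_add free.r_neg1)

lemma relator_coset:
  assumes "x \<in> carrier free" "y \<in> carrier free" "x - y \<in> tensor_relators k A B"
  shows "rel_ideal +>\<^bsub>free\<^esub> x = rel_ideal +>\<^bsub>free\<^esub> y"
proof -
  have "x \<ominus>\<^bsub>free\<^esub> y \<in> rel_ideal"
    using assms free.genideal_self[OF tensor_relators_closed[OF alg_A alg_B]]
    by (auto simp: free_minus)
  then show ?thesis
    using assms free.quotient_eq_iff_same_a_r_cos[OF rel.is_ideal] by simp
qed

lemma pt_add_left:
  assumes "a \<in> carrier A" "a' \<in> carrier A" "b \<in> carrier B"
  shows "pt (a \<oplus>\<^bsub>A\<^esub> a') b = pt a b \<oplus>\<^bsub>T\<^esub> pt a' b"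
proof -
  note c = frag_of_closed[OF assms(1,3)] frag_of_closed[OF assms(2,3)]
  have "rel_ideal +>\<^bsub>free\<^esub> frag_of (a \<oplus>\<^bsub>A\<^esub> a', b)
      = rel_ideal +>\<^bsub>free\<^esub> (frag_of (a, b) \<oplus>\<^bsub>free\<^esub> frag_of (a', b))"
    using assms c
    by (intro relator_coset free.add.m_closed frag_of_closed)
      (auto simp: free_pair_ring_simps(4) tensor_relators_def diff_diff_eq)
  then show ?thesis
    unfolding pure_tensor_def using ring_hom_add[OF coset_hom c] by simp
qed

lemma pt_add_right:
  assumes "a \<in> carrier A" "b \<in> carrier B" "b' \<in> carrier B"
  shows "pt a (b \<oplus>\<^bsub>B\<^esub> b') = pt a b \<oplus>\<^bsub>T\<^esub> pt a b'"
proof -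
  note c = frag_of_closed[OF assms(1,2)] frag_of_closed[OF assms(1,3)]
  have "rel_ideal +>\<^bsub>free\<^esub> frag_of (a, b \<oplus>\<^bsub>B\<^esub> b')
      = rel_ideal +>\<^bsub>free\<^esub> (frag_of (a, b) \<oplus>\<^bsub>free\<^esub> frag_of (a, b'))"
    using assms c
    by (intro relator_coset free.add.m_closed frag_of_closed)
      (auto simp: free_pair_ring_simps(4) tensor_relators_def diff_diff_eq)
  then show ?thesis
    unfolding pure_tensor_def using ring_hom_add[OF coset_hom c] by simp
qed

lemma pt_smult:
  assumes "a \<in> carrier A" "b \<in> carrier B" "c \<in> carrier k"
  shows "pt (c \<odot>\<^bsub>A\<^esub> a) b = pt a (c \<odot>\<^bsub>B\<^esub> b)"
  unfolding pure_tensor_def using assms frag_of_closed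
  by (intro relator_coset) (auto simp: tensor_relators_def)

lemma pt_split: "\<lbrakk>a \<in> carrier A; b \<in> carrier B\<rbrakk> \<Longrightarrow> pt a b = inA a \<otimes>\<^bsub>T\<^esub> inB b"
  by (simp add: pt_mult)

lemma inA_hom: "(\<lambda>a. inA a) \<in> ring_hom A T"
  by (rule ring_hom_memI) (simp_all add: pt_mult pt_add_left pt_one)

lemma inB_hom: "(\<lambda>b. inB b) \<in> ring_hom B T"
  by (rule ring_hom_memI) (simp_all add: pt_mult pt_add_right pt_one)

sublocale inA: ring_hom_cring A T "\<lambda>a. inA a"
  by unfold_locales (rule inA_hom)
sublocale inB: ring_hom_cring B T "\<lambda>b. inB b"
  by unfold_locales (rule inB_hom)

lemma inA_smult_one: "c \<in> carrier k \<Longrightarrow> inA (c \<odot>\<^bsub>A\<^esub> \<one>\<^bsub>A\<^esub>) = inB (c \<odot>\<^bsub>B\<^esub> \<one>\<^bsub>B\<^esub>)"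
  by (simp add: pt_smult)

lemma tensor_induct [consumes 1, case_names zero pure add]:
  assumes "w \<in> carrier T" and zero: "P \<zero>\<^bsub>T\<^esub>"
    and pure: "\<And>a b. \<lbrakk>a \<in> carrier A; b \<in> carrier B\<rbrakk> \<Longrightarrow> P (pt a b)"
    and add: "\<And>v w. \<lbrakk>v \<in> carrier T; w \<in> carrier T; P v; P w\<rbrakk> \<Longrightarrow> P (v \<oplus>\<^bsub>T\<^esub> w)"
  shows "P w"
proof -
  let ?q = "(+>\<^bsub>free\<^esub>) rel_ideal"
  interpret q: ring_hom_cring free T ?q by unfold_locales (rule coset_hom)
  \<comment> \<open>Induction on the free group yields differences, while \<open>P\<close> is only
    closed under sums, so the claim is carried for the negative as well; the negative of a pure
    tensor is again pure.\<close>
  have "P (?q f) \<and> P (\<ominus>\<^bsub>T\<^esub> ?q f)" if "f \<in> carrier free" for f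
    using that
  proof (induction f rule: free_pair_ring_induct)
    case zero
    then show ?case using q.hom_zero assms(2) by (simp add: free_pair_ring_simps(3))
  next
    case (one a b)
    have "\<ominus>\<^bsub>T\<^esub> pt a b = pt (\<ominus>\<^bsub>A\<^esub> a) b"
    proof (rule T.minus_equality)
      have "pt (\<ominus>\<^bsub>A\<^esub> a) b \<oplus>\<^bsub>T\<^esub> pt a b = pt \<zero>\<^bsub>A\<^esub> b"
        using one by (simp add: A.l_neg flip: pt_add_left)
      also have "\<dots> = \<zero>\<^bsub>T\<^esub>"
        using one pt_split[of "\<zero>\<^bsub>A\<^esub>" b] inA.hom_zero by simp
      finally show "pt (\<ominus>\<^bsub>A\<^esub> a) b \<oplus>\<^bsub>T\<^esub> pt a b = \<zero>\<^bsub>T\<^esub>" .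
    qed (use one in auto)
    then show ?case using pure one by (simp flip: pure_tensor_def)
  next
    case (diff f g)
    have "?q (f - g) = ?q f \<oplus>\<^bsub>T\<^esub> \<ominus>\<^bsub>T\<^esub> ?q g"
      using diff by (simp flip: free_minus add: a_minus_def)
    moreover have "\<ominus>\<^bsub>T\<^esub> (?q f \<oplus>\<^bsub>T\<^esub> \<ominus>\<^bsub>T\<^esub> ?q g) = \<ominus>\<^bsub>T\<^esub> ?q f \<oplus>\<^bsub>T\<^esub> ?q g"
      using diff by (simp add: T.minus_add T.minus_minus)
    ultimately show ?case using diff by (auto intro!: add)
  qed
  then show ?thesis using assms(1) unfolding carrier_T by blast
qed

text \<open>The universal property in \<open>tensor_product_universal\<close> concerns ring
  homomorphisms only. Slices are merely additive and need this version for balanced biadditive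
  maps.\<close>

lemma tensor_biadditive:
  fixes C :: "('c, 'z) ring_scheme"
  assumes C: "abelian_group C"
    and closed: "\<And>a b. \<lbrakk>a \<in> carrier A; b \<in> carrier B\<rbrakk> \<Longrightarrow> \<beta> a b \<in> carrier C"
    and left: "\<And>a a' b. \<lbrakk>a \<in> carrier A; a' \<in> carrier A; b \<in> carrier B\<rbrakk>
      \<Longrightarrow> \<beta> (a \<oplus>\<^bsub>A\<^esub> a') b = \<beta> a b \<oplus>\<^bsub>C\<^esub> \<beta> a' b"
    and right: "\<And>a b b'. \<lbrakk>a \<in> carrier A; b \<in> carrier B; b' \<in> carrier B\<rbrakk>
      \<Longrightarrow> \<beta> a (b \<oplus>\<^bsub>B\<^esub> b') = \<beta> a b \<oplus>\<^bsub>C\<^esub> \<beta> a b'"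
    and balanced: "\<And>a b c. \<lbrakk>a \<in> carrier A; b \<in> carrier B; c \<in> carrier k\<rbrakk>
      \<Longrightarrow> \<beta> (c \<odot>\<^bsub>A\<^esub> a) b = \<beta> a (c \<odot>\<^bsub>B\<^esub> b)"
  shows "\<exists>\<psi>. \<psi> \<in> carrier T \<rightarrow> carrier C
    \<and> (\<forall>v\<in>carrier T. \<forall>w\<in>carrier T. \<psi> (v \<oplus>\<^bsub>T\<^esub> w) = \<psi> v \<oplus>\<^bsub>C\<^esub> \<psi> w)
    \<and> (\<forall>a\<in>carrier A. \<forall>b\<in>carrier B. \<psi> (pt a b) = \<beta> a b)"
proof -
  interpret C: abelian_group C by fact
  note D = free_pair_ring_diff_left free_pair_ring_diff_right
  have "(\<lambda>(a, b). \<beta> a b) ` (carrier A \<times> carrier B) \<subseteq> carrier (add_monoid C)"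
    using closed by auto
  then obtain \<phi> where \<phi>: "\<phi> \<in> hom (free_Abelian_group (carrier A \<times> carrier B)) (add_monoid C)"
    and \<phi>_of': "\<And>x. x \<in> carrier A \<times> carrier B \<Longrightarrow> \<phi> (frag_of x) = (\<lambda>(a, b). \<beta> a b) x"
    using comm_group.free_Abelian_group_universal[OF C.a_comm_group] by metis
  have \<phi>_of: "\<phi> (frag_of (a, b)) = \<beta> a b" if "a \<in> carrier A" "b \<in> carrier B" for a b
    using \<phi>_of'[of "(a, b)"] that by simp
  have \<phi>_closed: "\<phi> x \<in> carrier C" if "x \<in> carrier free" for x
    using \<phi> that by (auto simp: hom_def free_Abelian_group_def free_pair_ring_simps)
  have \<phi>_add: "\<phi> (x + y) = \<phi> x \<oplus>\<^bsub>C\<^esub> \<phi> y" if "x \<in> carrier free" "y \<in> carrier free" for x y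
    using \<phi> that by (auto simp: hom_def free_Abelian_group_def free_pair_ring_simps)
  have \<phi>_diff: "\<phi> (x - y) = \<phi> x \<ominus>\<^bsub>C\<^esub> \<phi> y" if "x \<in> carrier free" "y \<in> carrier free" for x y
  proof -
    have xy: "x - y \<in> carrier free" using that by (rule free_pair_ring_diff_closed)
    have "\<phi> x = \<phi> (x - y) \<oplus>\<^bsub>C\<^esub> \<phi> y" using \<phi>_add[OF xy that(2)] by simp
    then show ?thesis
      using \<phi>_closed[OF xy] \<phi>_closed[OF that(2)] by (simp add: a_minus_def C.a_assoc C.r_neg)
  qed
  have zero_in: "0 \<in> carrier free" by (simp add: free_pair_ring_simps)
  have \<phi>_0: "\<phi> 0 = \<zero>\<^bsub>C\<^esub>"
    using \<phi>_diff[OF zero_in zero_in] \<phi>_closed[OF zero_in] by (simp add: C.r_neg a_minus_def)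
  \<comment> \<open>The relators generate \<open>rel_ideal\<close> as an ideal, but
    \<open>\<phi>\<close> is only additive, so its kernel need not be an ideal. \<open>K\<close>
    asks instead that all multiples by pairs are killed; this is an ideal, contains the relators,
    and lies in the kernel (take the pair of identities).\<close>
  define K where "K = {f \<in> carrier free. \<forall>a\<in>carrier A. \<forall>b\<in>carrier B.
    \<phi> (frag_of (a, b) \<otimes>\<^bsub>free\<^esub> f) = \<zero>\<^bsub>C\<^esub>}"
  have K_ideal: "ideal K free"
  proof (rule free.cring_idealI)
    show "K \<subseteq> carrier free" by (auto simp: K_def)
    show "\<zero>\<^bsub>free\<^esub> \<in> K" by (simp add: K_def free_pair_ring_simps(3) zero_in \<phi>_0)
    show "x \<oplus>\<^bsub>free\<^esub> y \<in> K" if "x \<in> K" "y \<in> K" for x y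
    proof -
      have "\<phi> (frag_of (a, b) \<otimes>\<^bsub>free\<^esub> (x \<oplus>\<^bsub>free\<^esub> y)) = \<zero>\<^bsub>C\<^esub>"
        if "a \<in> carrier A" "b \<in> carrier B" for a b
        using that \<open>x \<in> K\<close> \<open>y \<in> K\<close> frag_of_closed[OF that]
          \<phi>_add[of "frag_of (a, b) \<otimes>\<^bsub>free\<^esub> x" "frag_of (a, b) \<otimes>\<^bsub>free\<^esub> y"]
        by (simp add: K_def free.r_distr) (simp add: free_pair_ring_simps(4))
      then show ?thesis using that by (simp add: K_def)
    qed
    show "g \<otimes>\<^bsub>free\<^esub> f \<in> K" if f: "f \<in> K" and g: "g \<in> carrier free" for f g
    proof -
      have fc: "f \<in> carrier free" using f by (simp add: K_def)
      have "\<phi> (frag_of (a, b) \<otimes>\<^bsub>free\<^esub> (g \<otimes>\<^bsub>free\<^esub> f)) = \<zero>\<^bsub>C\<^esub>"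
        if "a \<in> carrier A" "b \<in> carrier B" for a b
        using g
      proof (induction g rule: free_pair_ring_induct)
        case zero
        then show ?case by (simp add: \<phi>_0)
      next
        case (one a' b')
        then have "frag_of (a, b) \<otimes>\<^bsub>free\<^esub> (frag_of (a', b') \<otimes>\<^bsub>free\<^esub> f)
            = frag_of (a \<otimes>\<^bsub>A\<^esub> a', b \<otimes>\<^bsub>B\<^esub> b') \<otimes>\<^bsub>free\<^esub> f"
          using that fc frag_of_closed by (simp flip: free.m_assoc)
        then show ?case using one that f by (simp add: K_def)
      next
        case (diff g h)
        then show ?case
          using that fc frag_of_closed[OF that]
          by (simp add: D \<phi>_diff a_minus_def C.r_neg)
      qed
      then show ?thesis using fc g by (simp add: K_def)
    qed
  qed
  have cancel: "x \<oplus>\<^bsub>C\<^esub> y \<ominus>\<^bsub>C\<^esub> x \<ominus>\<^bsub>C\<^esub> y = \<zero>\<^bsub>C\<^esub>" if "x \<in> carrier C" "y \<in> carrier C" for x y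
  proof -
    have "x \<oplus>\<^bsub>C\<^esub> y \<ominus>\<^bsub>C\<^esub> x = y"
      using that by (simp only: C.a_comm[of x y] a_minus_def C.a_assoc C.r_neg C.r_zero C.a_inv_closed)
    then show ?thesis using that by (simp add: a_minus_def C.r_neg)
  qed
  have rel1: "\<phi> (frag_of (a \<oplus>\<^bsub>A\<^esub> a', b) - frag_of (a, b) - frag_of (a', b)) = \<zero>\<^bsub>C\<^esub>"
    if "a \<in> carrier A" "a' \<in> carrier A" "b \<in> carrier B" for a a' b
    using that by (simp add: \<phi>_diff frag_of_closed free_pair_ring_diff_closed \<phi>_of left closed cancel)
  have rel2: "\<phi> (frag_of (a, b \<oplus>\<^bsub>B\<^esub> b') - frag_of (a, b) - frag_of (a, b')) = \<zero>\<^bsub>C\<^esub>"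
    if "a \<in> carrier A" "b \<in> carrier B" "b' \<in> carrier B" for a b b'
    using that by (simp add: \<phi>_diff frag_of_closed free_pair_ring_diff_closed \<phi>_of right closed cancel)
  have rel3: "\<phi> (frag_of (c \<odot>\<^bsub>A\<^esub> a, b) - frag_of (a, c \<odot>\<^bsub>B\<^esub> b)) = \<zero>\<^bsub>C\<^esub>"
    if "a \<in> carrier A" "b \<in> carrier B" "c \<in> carrier k" for a b c
    using that closed[of a "c \<odot>\<^bsub>B\<^esub> b"]
    by (simp add: \<phi>_diff frag_of_closed \<phi>_of balanced C.r_neg a_minus_def)
  have smA: "u \<otimes>\<^bsub>A\<^esub> (c \<odot>\<^bsub>A\<^esub> v) = c \<odot>\<^bsub>A\<^esub> (u \<otimes>\<^bsub>A\<^esub> v)"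
    if "c \<in> carrier k" "u \<in> carrier A" "v \<in> carrier A" for c u v
    using that A.smult_assoc2[of c v u] by (simp add: A.m_comm)
  have smB: "u \<otimes>\<^bsub>B\<^esub> (c \<odot>\<^bsub>B\<^esub> v) = c \<odot>\<^bsub>B\<^esub> (u \<otimes>\<^bsub>B\<^esub> v)"
    if "c \<in> carrier k" "u \<in> carrier B" "v \<in> carrier B" for c u v
    using that B.smult_assoc2[of c v u] by (simp add: B.m_comm)
  have "tensor_relators k A B \<subseteq> K"
  proof
    fix r assume r: "r \<in> tensor_relators k A B"
    have "\<phi> (frag_of (x, y) \<otimes>\<^bsub>free\<^esub> r) = \<zero>\<^bsub>C\<^esub>" if "x \<in> carrier A" "y \<in> carrier B" for x y
      using r that unfolding tensor_relators_def
      by (elim UnE CollectE exE conjE)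
        (simp_all add: D A.r_distr B.r_distr smA smB rel1 rel2 rel3)
    then show "r \<in> K"
      using tensor_relators_closed[OF alg_A alg_B] r by (auto simp: K_def)
  qed
  then have ker: "rel_ideal \<subseteq> K" by (rule free.genideal_minimal[OF K_ideal])
  have \<phi>_rel: "\<phi> i = \<zero>\<^bsub>C\<^esub>" if "i \<in> rel_ideal" for i
  proof -
    have i: "i \<in> K" using ker that by blast
    then have "\<phi> (\<one>\<^bsub>free\<^esub> \<otimes>\<^bsub>free\<^esub> i) = \<zero>\<^bsub>C\<^esub>" unfolding free_pair_ring_simps(2) by (simp add: K_def)
    then show ?thesis using i by (simp add: K_def)
  qed
  define h where "h w = the_elem (\<phi> ` w)" for w
  have h_coset: "h (rel_ideal +>\<^bsub>free\<^esub> x) = \<phi> x" if x: "x \<in> carrier free" for x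
  proof -
    have "\<phi> y = \<phi> x" if y: "y \<in> rel_ideal +>\<^bsub>free\<^esub> x" for y
    proof -
      obtain i where "i \<in> rel_ideal" "y = i \<oplus>\<^bsub>free\<^esub> x"
        using y by (auto simp: a_r_coset_def')
      then show ?thesis
        using x rel.a_Hcarr \<phi>_rel \<phi>_closed by (simp add: free_pair_ring_simps(4) \<phi>_add)
    qed
    moreover have "x \<in> rel_ideal +>\<^bsub>free\<^esub> x" using x rel.a_rcos_self by simp
    ultimately have "\<phi> ` (rel_ideal +>\<^bsub>free\<^esub> x) = {\<phi> x}" by blast
    then show ?thesis by (simp add: h_def)
  qed
  show ?thesis
  proof (intro exI[of _ h] conjI ballI)
    show "h \<in> carrier T \<rightarrow> carrier C" using h_coset \<phi>_closed by (auto simp: carrier_T)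
    fix v w assume "v \<in> carrier T" "w \<in> carrier T"
    then obtain x y where xy: "x \<in> carrier free" "y \<in> carrier free"
      and e: "v = rel_ideal +>\<^bsub>free\<^esub> x" "w = rel_ideal +>\<^bsub>free\<^esub> y" by (auto simp: carrier_T)
    have "h (v \<oplus>\<^bsub>T\<^esub> w) = h (rel_ideal +>\<^bsub>free\<^esub> (x \<oplus>\<^bsub>free\<^esub> y))"
      unfolding e using ring_hom_add[OF coset_hom xy] by simp
    also have "\<dots> = \<phi> (x + y)"
      using h_coset[OF free.a_closed[OF xy]] by (simp add: free_pair_ring_simps(4))
    finally show "h (v \<oplus>\<^bsub>T\<^esub> w) = h v \<oplus>\<^bsub>C\<^esub> h w"
      unfolding e using \<phi>_add[OF xy] h_coset xy by simp
  next
    fix a b assume "a \<in> carrier A" "b \<in> carrier B"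
    then show "h (pt a b) = \<beta> a b"
      unfolding pure_tensor_def using h_coset frag_of_closed \<phi>_of by simp
  qed
qed

end


section \<open>Slices of tensors and the extension of an ideal of \<open>A\<close>\<close>

context tensor begin

text \<open>\<open>\<psi>\<close> is the identity of \<open>A\<close> tensored with
  \<open>l\<close>. Additivity and the values on pure tensors determine it on
  \<open>carrier T\<close>.\<close>

definition slice :: "('b \<Rightarrow> 'k) \<Rightarrow> ((('a \<times> 'b) \<Rightarrow>\<^sub>0 int) set \<Rightarrow> 'a) \<Rightarrow> bool"
  where "slice l \<psi> \<longleftrightarrow> linear_functional k B l \<and> \<psi> \<in> carrier T \<rightarrow> carrier A
      \<and> (\<forall>v\<in>carrier T. \<forall>w\<in>carrier T. \<psi> (v \<oplus>\<^bsub>T\<^esub> w) = \<psi> v \<oplus>\<^bsub>A\<^esub> \<psi> w)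
      \<and> (\<forall>a\<in>carrier A. \<forall>b\<in>carrier B. \<psi> (pt a b) = l b \<odot>\<^bsub>A\<^esub> a)"

text \<open>For an ideal \<open>p\<close> this is the ideal of \<open>T\<close> generated by the
  image of \<open>p\<close>, described by functionals so that membership can be tested inside
  \<open>A\<close>.\<close>

definition slice_ideal :: "'a set \<Rightarrow> (('a \<times> 'b) \<Rightarrow>\<^sub>0 int) set set"
  where "slice_ideal p = {w \<in> carrier T. \<forall>l \<psi>. slice l \<psi> \<longrightarrow> \<psi> w \<in> p}"

lemma mem_slice_ideal_iff:
  "w \<in> slice_ideal p \<longleftrightarrow> w \<in> carrier T \<and> (\<forall>l \<psi>. slice l \<psi> \<longrightarrow> \<psi> w \<in> p)"
  unfolding slice_ideal_def by blast

lemma slice_idealD: "\<lbrakk>w \<in> slice_ideal p; slice l \<psi>\<rbrakk> \<Longrightarrow> \<psi> w \<in> p"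
  unfolding mem_slice_ideal_iff by blast

lemma sliceD:
  assumes "slice l \<psi>"
  shows "linear_functional k B l" "v \<in> carrier T \<Longrightarrow> \<psi> v \<in> carrier A"
    "\<lbrakk>v \<in> carrier T; w \<in> carrier T\<rbrakk> \<Longrightarrow> \<psi> (v \<oplus>\<^bsub>T\<^esub> w) = \<psi> v \<oplus>\<^bsub>A\<^esub> \<psi> w"
    "\<lbrakk>a \<in> carrier A; b \<in> carrier B\<rbrakk> \<Longrightarrow> \<psi> (pt a b) = l b \<odot>\<^bsub>A\<^esub> a"
  using assms unfolding slice_def by auto

lemma slice_exists:
  assumes l: "linear_functional k B l"
  obtains \<psi> where "slice l \<psi>"
proof -
  note lf = linear_functionalD[OF l]
  have "\<exists>\<psi>. \<psi> \<in> carrier T \<rightarrow> carrier A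
    \<and> (\<forall>v\<in>carrier T. \<forall>w\<in>carrier T. \<psi> (v \<oplus>\<^bsub>T\<^esub> w) = \<psi> v \<oplus>\<^bsub>A\<^esub> \<psi> w)
    \<and> (\<forall>a\<in>carrier A. \<forall>b\<in>carrier B. \<psi> (pt a b) = l b \<odot>\<^bsub>A\<^esub> a)"
    by (rule tensor_biadditive)
      (simp_all add: lf A.abelian_group_axioms A.smult_r_distr A.smult_l_distr k.m_comm
        A.smult_assoc1[symmetric])
  then show thesis using that l unfolding slice_def by blast
qed

lemma slice_zero: "slice l \<psi> \<Longrightarrow> \<psi> \<zero>\<^bsub>T\<^esub> = \<zero>\<^bsub>A\<^esub>"
  using sliceD(2)[of l \<psi> "\<zero>\<^bsub>T\<^esub>"] sliceD(3)[of l \<psi> "\<zero>\<^bsub>T\<^esub>" "\<zero>\<^bsub>T\<^esub>"] by simp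

text \<open>Multiplication by \<open>b\<close> on the right factor moves into the functional. So the
  slices of a multiple of \<open>w\<close> by a pure tensor are multiples of other slices of
  \<open>w\<close>, which makes \<open>slice_ideal p\<close> an ideal.\<close>

lemma slice_mult:
  assumes \<psi>: "slice l \<psi>" and b: "b \<in> carrier B" and \<psi>': "slice (\<lambda>y. l (b \<otimes>\<^bsub>B\<^esub> y)) \<psi>'"
    and a: "a \<in> carrier A" and w: "w \<in> carrier T"
  shows "\<psi> (pt a b \<otimes>\<^bsub>T\<^esub> w) = a \<otimes>\<^bsub>A\<^esub> \<psi>' w"
  using w
proof (induction w rule: tensor_induct)
  case zero
  then show ?case using a b by (simp add: slice_zero[OF \<psi>] slice_zero[OF \<psi>'])
next
  case (pure x y)
  then have "l (b \<otimes>\<^bsub>B\<^esub> y) \<in> carrier k"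
    using linear_functionalD(1)[OF sliceD(1)[OF \<psi>]] b by simp
  then show ?case
    using pure a b A.smult_assoc2[of "l (b \<otimes>\<^bsub>B\<^esub> y)" x a]
    by (simp add: pt_mult sliceD(4)[OF \<psi>] sliceD(4)[OF \<psi>'] A.m_comm)
next
  case (add v w)
  then show ?case
    using a b by (simp add: T.r_distr sliceD[OF \<psi>] sliceD[OF \<psi>'] A.r_distr)
qed

lemma linear_functional_mult:
  assumes l: "linear_functional k B l" and b: "b \<in> carrier B"
  shows "linear_functional k B (\<lambda>y. l (b \<otimes>\<^bsub>B\<^esub> y))"
proof -
  note lf = linear_functionalD[OF l]
  have "b \<otimes>\<^bsub>B\<^esub> (c \<odot>\<^bsub>B\<^esub> y) = c \<odot>\<^bsub>B\<^esub> (b \<otimes>\<^bsub>B\<^esub> y)" if "c \<in> carrier k" "y \<in> carrier B" for c y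
    using B.smult_assoc2[of c y b] that b by (simp add: B.m_comm)
  then show ?thesis
    using b lf by (auto simp: linear_functional_def B.r_distr)
qed

lemma ideal_slice_ideal:
  assumes p: "ideal p A"
  shows "ideal (slice_ideal p) T"
proof (rule T.cring_idealI)
  interpret p: ideal p A by fact
  show "slice_ideal p \<subseteq> carrier T" by (auto simp: mem_slice_ideal_iff)
  show "\<zero>\<^bsub>T\<^esub> \<in> slice_ideal p" by (auto simp: mem_slice_ideal_iff slice_zero)
  show add: "v \<oplus>\<^bsub>T\<^esub> w \<in> slice_ideal p" if "v \<in> slice_ideal p" "w \<in> slice_ideal p" for v w
    using that by (auto simp: mem_slice_ideal_iff sliceD)
  show "x \<otimes>\<^bsub>T\<^esub> w \<in> slice_ideal p" if w: "w \<in> slice_ideal p" and "x \<in> carrier T" for w x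
    using that(2)
  proof (induction x rule: tensor_induct)
    case zero
    then show ?case using w by (auto simp: mem_slice_ideal_iff slice_zero)
  next
    case (pure a b)
    have "\<psi> (pt a b \<otimes>\<^bsub>T\<^esub> w) \<in> p" if \<psi>: "slice l \<psi>" for l \<psi>
    proof -
      obtain \<psi>' where \<psi>': "slice (\<lambda>y. l (b \<otimes>\<^bsub>B\<^esub> y)) \<psi>'"
        using slice_exists linear_functional_mult[OF sliceD(1)[OF \<psi>] pure(2)] by blast
      then show ?thesis
        using slice_mult[OF \<psi> pure(2) \<psi>' pure(1)] w pure(1) p.I_l_closed
        by (auto simp: mem_slice_ideal_iff)
    qed
    then show ?case using pure w by (auto simp: mem_slice_ideal_iff)
  next
    case (add v v')
    then show ?case using w \<open>\<And>w v. \<lbrakk>v \<in> slice_ideal p; w \<in> slice_ideal p\<rbrakk> \<Longrightarrow> v \<oplus>\<^bsub>T\<^esub> w \<in> slice_ideal p\<close>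
      by (auto simp: mem_slice_ideal_iff T.l_distr sliceD)
  qed
qed

lemma slice_inA_mult:
  assumes \<psi>: "slice l \<psi>" and "a \<in> carrier A" "w \<in> carrier T"
  shows "\<psi> (inA a \<otimes>\<^bsub>T\<^esub> w) = a \<otimes>\<^bsub>A\<^esub> \<psi> w"
  using assms(3)
proof (induction w rule: tensor_induct)
  case zero
  then show ?case using assms by (simp add: slice_zero[OF \<psi>])
next
  case (pure x y)
  then have "l y \<in> carrier k" using linear_functionalD(1)[OF sliceD(1)[OF \<psi>]] by simp
  then show ?case
    using pure assms(2) A.smult_assoc2[of "l y" x a]
    by (simp add: pt_mult sliceD(4)[OF \<psi>] A.m_comm)
next
  case (add v w)
  then show ?case using assms(2) by (simp add: T.r_distr sliceD[OF \<psi>] A.r_distr)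
qed

lemma inA_mem_slice_ideal:
  assumes "ideal p A" "a \<in> p"
  shows "inA a \<in> slice_ideal p"
proof -
  interpret p: ideal p A by fact
  have a: "a \<in> carrier A" using p.a_Hcarr assms(2) by blast
  have "\<psi> (inA a) \<in> p" if \<psi>: "slice l \<psi>" for l \<psi>
    using slice_inA_mult[OF \<psi> a T.one_closed] a sliceD(2)[OF \<psi>] p.I_r_closed[OF assms(2)] by simp
  then show ?thesis using a by (simp add: mem_slice_ideal_iff)
qed

text \<open>Slices are \<open>A\<close>-linear and \<open>p\<close> is prime. The result says that
  \<open>T\<close> modulo the extension of \<open>p\<close> has no torsion over \<open>A/p\<close>,
  which is the form in which flatness is used below.\<close>

lemma slice_ideal_cancel:
  assumes p: "primeideal p A" and "a \<in> carrier A" "a \<notin> p" "w \<in> carrier T"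
    and "inA a \<otimes>\<^bsub>T\<^esub> w \<in> slice_ideal p"
  shows "w \<in> slice_ideal p"
proof -
  interpret p: primeideal p A by fact
  have "\<psi> w \<in> p" if \<psi>: "slice l \<psi>" for l \<psi>
    using slice_inA_mult[OF \<psi> assms(2,4)] slice_idealD[OF assms(5) \<psi>] assms(3)
      p.I_prime[OF assms(2) sliceD(2)[OF \<psi> assms(4)]] by auto
  then show ?thesis using assms(4) by (simp add: mem_slice_ideal_iff)
qed

text \<open>A functional with value one at the identity of \<open>B\<close> yields a slice that
  sends the identity of \<open>T\<close> to the identity of \<open>A\<close>.\<close>

lemma one_notin_slice_ideal:
  assumes "primeideal p A" "\<one>\<^bsub>B\<^esub> \<noteq> \<zero>\<^bsub>B\<^esub>"
  shows "\<one>\<^bsub>T\<^esub> \<notin> slice_ideal p"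
proof
  assume one: "\<one>\<^bsub>T\<^esub> \<in> slice_ideal p"
  have "submodule {\<zero>\<^bsub>B\<^esub>} k B" by (rule B.submodule_memI) auto
  then obtain l where l: "linear_functional k B l" "l \<one>\<^bsub>B\<^esub> = \<one>\<^bsub>k\<^esub>"
    using linear_functional_separates[OF field_k B.module_axioms, of "{\<zero>\<^bsub>B\<^esub>}" "\<one>\<^bsub>B\<^esub>"] assms(2)
    by auto
  obtain \<psi> where \<psi>: "slice l \<psi>" using slice_exists[OF l(1)] by blast
  have "\<psi> \<one>\<^bsub>T\<^esub> \<in> p" "\<psi> \<one>\<^bsub>T\<^esub> = \<one>\<^bsub>A\<^esub>"
    using l(2) slice_idealD[OF one \<psi>] sliceD(4)[OF \<psi>, of "\<one>\<^bsub>A\<^esub>" "\<one>\<^bsub>B\<^esub>"] by (simp_all add: pt_one)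
  then show False using primeideal.one_notin[OF assms(1)] by simp
qed

fun sum_pt :: "('a \<times> 'b) list \<Rightarrow> (('a \<times> 'b) \<Rightarrow>\<^sub>0 int) set"
  where "sum_pt [] = \<zero>\<^bsub>T\<^esub>" | "sum_pt ((a, b) # ps) = pt a b \<oplus>\<^bsub>T\<^esub> sum_pt ps"

lemma sum_pt_closed: "set ps \<subseteq> carrier A \<times> carrier B \<Longrightarrow> sum_pt ps \<in> carrier T"
  by (induction ps) auto

lemma sum_pt_append:
  "\<lbrakk>set ps \<subseteq> carrier A \<times> carrier B; set qs \<subseteq> carrier A \<times> carrier B\<rbrakk>
    \<Longrightarrow> sum_pt (ps @ qs) = sum_pt ps \<oplus>\<^bsub>T\<^esub> sum_pt qs"
  by (induction ps) (auto simp: sum_pt_closed T.a_assoc)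

lemma sum_pt_surj:
  assumes "w \<in> carrier T"
  obtains ps where "set ps \<subseteq> carrier A \<times> carrier B" "w = sum_pt ps"
proof -
  have "\<exists>ps. set ps \<subseteq> carrier A \<times> carrier B \<and> w = sum_pt ps"
    using assms
  proof (induction w rule: tensor_induct)
    case zero
    show ?case by (rule exI[of _ "[]"]) simp
  next
    case (pure a b)
    then show ?case by (intro exI[of _ "[(a, b)]"]) simp
  next
    case (add v w)
    then obtain ps qs where "set ps \<subseteq> carrier A \<times> carrier B" "v = sum_pt ps"
      "set qs \<subseteq> carrier A \<times> carrier B" "w = sum_pt qs" by blast
    then show ?case by (intro exI[of _ "ps @ qs"]) (simp add: sum_pt_append)
  qed
  then show thesis using that by blast
qed

fun list_span :: "'b list \<Rightarrow> 'b set"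
  where "list_span [] = {\<zero>\<^bsub>B\<^esub>}"
  | "list_span (b # bs) = {c \<odot>\<^bsub>B\<^esub> b \<oplus>\<^bsub>B\<^esub> v | c v. c \<in> carrier k \<and> v \<in> list_span bs}"

lemma submodule_list_span: "set bs \<subseteq> carrier B \<Longrightarrow> submodule (list_span bs) k B \<and> set bs \<subseteq> list_span bs"
proof (induction bs)
  case Nil
  show ?case by (auto intro: B.submodule_memI)
next
  case (Cons b bs)
  then have b: "b \<in> carrier B" and W: "submodule (list_span bs) k B" "set bs \<subseteq> list_span bs" by auto
  note Wc = subsetD[OF B.submoduleE(1)[OF W(1)]]
  have "submodule (list_span (b # bs)) k B"
  proof (rule B.submodule_memI)
    show "list_span (b # bs) \<subseteq> carrier B" using b Wc by auto
    have "\<zero>\<^bsub>B\<^esub> = \<zero>\<^bsub>k\<^esub> \<odot>\<^bsub>B\<^esub> b \<oplus>\<^bsub>B\<^esub> \<zero>\<^bsub>B\<^esub>" using b by simp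
    then show "\<zero>\<^bsub>B\<^esub> \<in> list_span (b # bs)"
      using B.submodule_zero[OF W(1)] unfolding list_span.simps by blast
  next
    fix x y assume "x \<in> list_span (b # bs)" "y \<in> list_span (b # bs)"
    then obtain c v c' v' where e: "x = c \<odot>\<^bsub>B\<^esub> b \<oplus>\<^bsub>B\<^esub> v" "y = c' \<odot>\<^bsub>B\<^esub> b \<oplus>\<^bsub>B\<^esub> v'"
      "v \<in> list_span bs" "v' \<in> list_span bs" "c \<in> carrier k" "c' \<in> carrier k" by auto
    then have "x \<oplus>\<^bsub>B\<^esub> y = (c \<oplus>\<^bsub>k\<^esub> c') \<odot>\<^bsub>B\<^esub> b \<oplus>\<^bsub>B\<^esub> (v \<oplus>\<^bsub>B\<^esub> v')"
      using b Wc by (simp add: B.smult_l_distr B.M.a_ac)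
    then show "x \<oplus>\<^bsub>B\<^esub> y \<in> list_span (b # bs)"
      using e B.submoduleE(5)[OF W(1)] unfolding list_span.simps by blast
  next
    fix d x assume d: "d \<in> carrier k" and "x \<in> list_span (b # bs)"
    then obtain c v where e: "x = c \<odot>\<^bsub>B\<^esub> b \<oplus>\<^bsub>B\<^esub> v" "v \<in> list_span bs" "c \<in> carrier k" by auto
    then have "d \<odot>\<^bsub>B\<^esub> x = (d \<otimes>\<^bsub>k\<^esub> c) \<odot>\<^bsub>B\<^esub> b \<oplus>\<^bsub>B\<^esub> d \<odot>\<^bsub>B\<^esub> v"
      using b d Wc by (simp add: B.smult_r_distr B.smult_assoc1)
    then show "d \<odot>\<^bsub>B\<^esub> x \<in> list_span (b # bs)"
      using e d B.submoduleE(4)[OF W(1)] unfolding list_span.simps by blast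
  qed
  moreover have "b \<in> list_span (b # bs)"
  proof -
    have "b = \<one>\<^bsub>k\<^esub> \<odot>\<^bsub>B\<^esub> b \<oplus>\<^bsub>B\<^esub> \<zero>\<^bsub>B\<^esub>" using b by simp
    then show ?thesis using B.submodule_zero[OF W(1)] unfolding list_span.simps by blast
  qed
  moreover have "v \<in> list_span (b # bs)" if "v \<in> list_span bs" for v
  proof -
    have "v = \<zero>\<^bsub>k\<^esub> \<odot>\<^bsub>B\<^esub> b \<oplus>\<^bsub>B\<^esub> v" using b Wc that by simp
    then show ?thesis using that unfolding list_span.simps by blast
  qed
  ultimately show ?case using W(2) by auto
qed

text \<open>If \<open>b\<close> is a combination of the right components, the scalars are moved
  across the tensor sign and added to the left components, so no new summand arises.\<close>

lemma sum_pt_absorb: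
  assumes "set ps \<subseteq> carrier A \<times> carrier B" "a \<in> carrier A" "b \<in> list_span (map snd ps)"
  obtains qs where "set qs \<subseteq> carrier A \<times> carrier B" "length qs = length ps"
    "pt a b \<oplus>\<^bsub>T\<^esub> sum_pt ps = sum_pt qs"
proof -
  have "\<exists>qs. set qs \<subseteq> carrier A \<times> carrier B \<and> length qs = length ps \<and>
    pt a b \<oplus>\<^bsub>T\<^esub> sum_pt ps = sum_pt qs"
    using assms(1,3)
  proof (induction ps arbitrary: b)
    case Nil
    then have "pt a b = \<zero>\<^bsub>T\<^esub>"
      using assms(2) pt_split[of a b] inB.hom_zero by simp
    then show ?case by simp
  next
    case (Cons q ps)
    obtain a0 b0 where q: "q = (a0, b0)" "a0 \<in> carrier A" "b0 \<in> carrier B" using Cons.prems by auto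
    obtain c v where e: "b = c \<odot>\<^bsub>B\<^esub> b0 \<oplus>\<^bsub>B\<^esub> v" "c \<in> carrier k" "v \<in> list_span (map snd ps)"
      using Cons.prems q by auto
    have ps: "set ps \<subseteq> carrier A \<times> carrier B" using Cons.prems by auto
    have v: "v \<in> carrier B"
    proof -
      have "set (map snd ps) \<subseteq> carrier B" using ps by auto
      then show ?thesis using submodule_list_span B.submoduleE(1) e(3) by blast
    qed
    obtain qs where qs: "set qs \<subseteq> carrier A \<times> carrier B" "length qs = length ps"
      "pt a v \<oplus>\<^bsub>T\<^esub> sum_pt ps = sum_pt qs" using Cons.IH[OF ps e(3)] by blast
    have "pt a b = pt (c \<odot>\<^bsub>A\<^esub> a) b0 \<oplus>\<^bsub>T\<^esub> pt a v"
      using assms(2) e q v by (simp add: pt_add_right pt_smult)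
    then have "pt a b \<oplus>\<^bsub>T\<^esub> sum_pt (q # ps)
        = (pt (c \<odot>\<^bsub>A\<^esub> a) b0 \<oplus>\<^bsub>T\<^esub> pt a0 b0) \<oplus>\<^bsub>T\<^esub> (pt a v \<oplus>\<^bsub>T\<^esub> sum_pt ps)"
      using assms(2) e(2) q v sum_pt_closed[OF ps] by (simp add: T.a_ac)
    also have "\<dots> = sum_pt ((c \<odot>\<^bsub>A\<^esub> a \<oplus>\<^bsub>A\<^esub> a0, b0) # qs)"
      unfolding qs(3) using assms(2) e(2) q by (simp add: pt_add_left)
    finally show ?case
      using qs assms(2) e(2) q by (intro exI[of _ "(c \<odot>\<^bsub>A\<^esub> a \<oplus>\<^bsub>A\<^esub> a0, b0) # qs"]) auto
  qed
  then show thesis using that by blast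
qed

lemma slice_sum_pt_zero:
  assumes \<psi>: "slice l \<psi>" and "set ps \<subseteq> carrier A \<times> carrier B"
    and "\<And>b. b \<in> set (map snd ps) \<Longrightarrow> l b = \<zero>\<^bsub>k\<^esub>"
  shows "\<psi> (sum_pt ps) = \<zero>\<^bsub>A\<^esub>"
  using assms(2,3)
  by (induction ps) (auto simp: slice_zero[OF \<psi>] sliceD[OF \<psi>] sum_pt_closed)

text \<open>The slice ideal is the extension of \<open>p\<close>: shorten a representation of \<open>w\<close> until its
  \<open>B\<close>-components are linearly independent, and read off the \<open>A\<close>-components by functionals.\<close>

lemma slice_ideal_subset:
  assumes I: "ideal I T" and p: "ideal p A" and sub: "\<And>a. a \<in> p \<Longrightarrow> inA a \<in> I"
  shows "slice_ideal p \<subseteq> I"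
proof
  interpret I: ideal I T by fact
  interpret sl: ideal "slice_ideal p" T by (rule ideal_slice_ideal[OF p])
  interpret p: ideal p A by fact
  fix w assume w: "w \<in> slice_ideal p"
  have "sum_pt ps \<in> I" if "set ps \<subseteq> carrier A \<times> carrier B" "sum_pt ps \<in> slice_ideal p" for ps
    using that
  proof (induction ps rule: length_induct)
    case (1 ps)
    show ?case
    proof (cases ps)
      case Nil
      then show ?thesis using I.zero_closed by simp
    next
      case (Cons q qs)
      obtain a b where q: "q = (a, b)" "a \<in> carrier A" "b \<in> carrier B" using Cons 1 by auto
      have qs: "set qs \<subseteq> carrier A \<times> carrier B" "set (map snd qs) \<subseteq> carrier B" using Cons 1 by auto
      have sub: "submodule (list_span (map snd qs)) k B" "set (map snd qs) \<subseteq> list_span (map snd qs)"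
        using submodule_list_span[OF qs(2)] by auto
      show ?thesis
      proof (cases "b \<in> list_span (map snd qs)")
        case True
        then obtain rs where "set rs \<subseteq> carrier A \<times> carrier B" "length rs = length qs"
          "pt a b \<oplus>\<^bsub>T\<^esub> sum_pt qs = sum_pt rs" using sum_pt_absorb[OF qs(1) q(2)] by blast
        then show ?thesis using 1 Cons q(1) by simp
      next
        case False
        then obtain l where l: "linear_functional k B l" "l b = \<one>\<^bsub>k\<^esub>"
          "\<And>v. v \<in> list_span (map snd qs) \<Longrightarrow> l v = \<zero>\<^bsub>k\<^esub>"
          using linear_functional_separates[OF field_k B.module_axioms sub(1) q(3)] by blast
        obtain \<psi> where \<psi>: "slice l \<psi>" using slice_exists[OF l(1)] by blast
        have "\<psi> (sum_pt ps) = a"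
          using Cons q l(2,3) sub(2) slice_sum_pt_zero[OF \<psi> qs(1)] sum_pt_closed[OF qs(1)]
          by (simp add: sliceD[OF \<psi>] subset_iff)
        then have a: "a \<in> p" using slice_idealD[OF 1(3) \<psi>] by simp
        have ab: "pt a b \<in> I" "pt a b \<in> slice_ideal p"
          using pt_split[OF q(2,3)] assms(3)[OF a] inA_mem_slice_ideal[OF p a] q(3)
            I.I_r_closed sl.I_r_closed by simp_all
        \<comment> \<open>The first summand lies in both ideals, so it can be subtracted, and the
          induction applies to the shorter list.\<close>
        have eq: "sum_pt qs = \<ominus>\<^bsub>T\<^esub> pt a b \<oplus>\<^bsub>T\<^esub> sum_pt ps"
          using Cons q sum_pt_closed[OF qs(1)] by (simp add: T.r_neg1)
        have "sum_pt qs \<in> slice_ideal p"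
          unfolding eq using 1 ab sl.a_closed sl.a_inv_closed by blast
        then have "sum_pt qs \<in> I" using 1 Cons qs by simp
        then show ?thesis using Cons q ab I.a_closed by simp
      qed
    qed
  qed
  moreover obtain ps where "set ps \<subseteq> carrier A \<times> carrier B" "w = sum_pt ps"
    using sum_pt_surj w by (auto simp: mem_slice_ideal_iff)
  ultimately show "w \<in> I" using w by blast
qed

section \<open>Lying over, going down, and descent of local finite-dimensionality to a
  factor\<close>

abbreviation contrA where "contrA Q \<equiv> {a \<in> carrier A. inA a \<in> Q}"
abbreviation contrB where "contrB Q \<equiv> {b \<in> carrier B. inB b \<in> Q}"

text \<open>The images of elements outside \<open>p\<close> avoid the extension of \<open>p\<close>:
  cancelling such an element would leave the identity in it. A prime that contains the extension and
  avoids these images contracts to exactly \<open>p\<close>.\<close>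

lemma lying_over:
  assumes p: "primeideal p A" and "\<one>\<^bsub>B\<^esub> \<noteq> \<zero>\<^bsub>B\<^esub>"
  obtains Q where "primeideal Q T" "contrA Q = p"
proof -
  interpret p: primeideal p A by fact
  let ?S = "(\<lambda>a. inA a) ` (carrier A - p)"
  have "submonoid ?S T"
  proof (rule submonoid.intro)
    show "\<one>\<^bsub>T\<^esub> \<in> ?S" using p.one_notin pt_one by (intro image_eqI[of _ _ "\<one>\<^bsub>A\<^esub>"]) auto
    fix x y assume "x \<in> ?S" "y \<in> ?S"
    then obtain a b where ab: "a \<in> carrier A - p" "b \<in> carrier A - p" "x = inA a" "y = inA b" by blast
    then show "x \<otimes>\<^bsub>T\<^esub> y \<in> ?S"
      using p.mult_notin by (intro image_eqI[of _ _ "a \<otimes>\<^bsub>A\<^esub> b"]) auto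
  qed auto
  moreover have "slice_ideal p \<inter> ?S = {}"
  proof (rule ccontr)
    assume "slice_ideal p \<inter> ?S \<noteq> {}"
    then obtain a where a: "a \<in> carrier A" "a \<notin> p" "inA a \<in> slice_ideal p" by blast
    then have "inA a \<otimes>\<^bsub>T\<^esub> \<one>\<^bsub>T\<^esub> \<in> slice_ideal p" by simp
    then show False
      using slice_ideal_cancel[OF p a(1,2) T.one_closed] one_notin_slice_ideal[OF assms] by simp
  qed
  ultimately obtain Q where Q: "primeideal Q T" "slice_ideal p \<subseteq> Q" "Q \<inter> ?S = {}"
    using T.primeideal_extends_ideal[OF ideal_slice_ideal[OF p.is_ideal]] by blast
  have "contrA Q = p"
    using Q(2,3) inA_mem_slice_ideal[OF p.is_ideal] p.a_Hcarr by blast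
  then show thesis using that Q(1) by blast
qed

text \<open>The multiplicative set of products of an image of \<open>A - p\<close> with an element
  outside \<open>Q\<close> does two things at once: taking \<open>a\<close> to be one keeps the new
  prime inside \<open>Q\<close>, and taking \<open>u\<close> to be one keeps its contraction inside
  \<open>p\<close>. It misses the extension of \<open>p\<close> because cancelling \<open>a\<close>
  would put \<open>u\<close> into \<open>Q\<close>.\<close>

lemma going_down:
  assumes p: "primeideal p A" and Q: "primeideal Q T" and "p \<subseteq> contrA Q"
  obtains Q' where "primeideal Q' T" "Q' \<subseteq> Q" "contrA Q' = p"
proof -
  interpret p: primeideal p A by fact
  interpret Q: primeideal Q T by fact
  let ?S = "{inA a \<otimes>\<^bsub>T\<^esub> u | a u. a \<in> carrier A - p \<and> u \<in> carrier T - Q}"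
  have "submonoid ?S T"
  proof (rule submonoid.intro)
    show "?S \<subseteq> carrier T" by auto
    have "\<one>\<^bsub>T\<^esub> = inA \<one>\<^bsub>A\<^esub> \<otimes>\<^bsub>T\<^esub> \<one>\<^bsub>T\<^esub>" by (simp add: pt_one)
    then show "\<one>\<^bsub>T\<^esub> \<in> ?S" using p.one_notin Q.one_notin by blast
    fix x y assume "x \<in> ?S" "y \<in> ?S"
    then obtain a u a' u' where e: "x = inA a \<otimes>\<^bsub>T\<^esub> u" "y = inA a' \<otimes>\<^bsub>T\<^esub> u'" "a \<in> carrier A - p"
      "a' \<in> carrier A - p" "u \<in> carrier T - Q" "u' \<in> carrier T - Q" by blast
    then have "x \<otimes>\<^bsub>T\<^esub> y = inA (a \<otimes>\<^bsub>A\<^esub> a') \<otimes>\<^bsub>T\<^esub> (u \<otimes>\<^bsub>T\<^esub> u')"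
      by (simp add: T.m_ac)
    moreover have "a \<otimes>\<^bsub>A\<^esub> a' \<in> carrier A - p" "u \<otimes>\<^bsub>T\<^esub> u' \<in> carrier T - Q"
      using e p.mult_notin Q.mult_notin by auto
    ultimately show "x \<otimes>\<^bsub>T\<^esub> y \<in> ?S" by blast
  qed
  moreover have "slice_ideal p \<inter> ?S = {}"
  proof (rule ccontr)
    assume "slice_ideal p \<inter> ?S \<noteq> {}"
    then obtain a u where au: "a \<in> carrier A" "a \<notin> p" "u \<in> carrier T" "u \<notin> Q"
      "inA a \<otimes>\<^bsub>T\<^esub> u \<in> slice_ideal p" by blast
    have "slice_ideal p \<subseteq> Q"
      using slice_ideal_subset[OF Q.is_ideal p.is_ideal] assms(3) by blast
    then show False using slice_ideal_cancel[OF p au(1-3,5)] au(4) by blast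
  qed
  ultimately obtain Q' where Q': "primeideal Q' T" "slice_ideal p \<subseteq> Q'" "Q' \<inter> ?S = {}"
    using T.primeideal_extends_ideal[OF ideal_slice_ideal[OF p.is_ideal]] by blast
  have "u \<in> Q" if "u \<in> Q'" for u
  proof (rule ccontr)
    assume "u \<notin> Q"
    have u: "u \<in> carrier T" using that primeideal_subset[OF Q'(1)] by blast
    then have "u = inA \<one>\<^bsub>A\<^esub> \<otimes>\<^bsub>T\<^esub> u" by (simp add: pt_one)
    then show False using that u \<open>u \<notin> Q\<close> Q'(3) p.one_notin by blast
  qed
  moreover have "a \<in> p" if "a \<in> carrier A" "inA a \<in> Q'" for a
  proof (rule ccontr)
    assume "a \<notin> p"
    have "inA a = inA a \<otimes>\<^bsub>T\<^esub> \<one>\<^bsub>T\<^esub>" using that by simp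
    then show False using that \<open>a \<notin> p\<close> Q'(3) Q.one_notin by blast
  qed
  ultimately show thesis
    using that[OF Q'(1)] Q'(2) inA_mem_slice_ideal[OF p.is_ideal] p.a_Hcarr by blast
qed

lemma LFD_left:
  assumes "LFD T" "\<one>\<^bsub>B\<^esub> \<noteq> \<zero>\<^bsub>B\<^esub>"
  shows "LFD A"
  unfolding A.LFD_iff_ht_le
proof (intro allI impI)
  fix P assume P: "primeideal P A"
  obtain Q where Q: "primeideal Q T" "contrA Q = P" using lying_over[OF P assms(2)] by blast
  obtain N where N: "ht_le T Q N" using assms(1) Q(1) unfolding T.LFD_iff_ht_le by blast
  have "n \<le> N" if p: "\<forall>i\<le>n. primeideal (p i) A" "\<forall>i<n. p i \<subset> p (Suc i)" "p n \<subseteq> P" for n p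
  proof -
    \<comment> \<open>Going down builds the chain from the top, so \<open>q i\<close> lies over
      \<open>p (n - i)\<close> and the family is decreasing; the order is reversed again when the
      height bound is applied.\<close>
    have chain: "\<exists>q. \<forall>i\<le>m. primeideal (q i) T \<and> q i \<subseteq> Q \<and> contrA (q i) = p (n - i)
        \<and> (0 < i \<longrightarrow> q i \<subseteq> q (i - 1))" if "m \<le> n" for m
      using that
    proof (induction m)
      case 0
      obtain Q' where "primeideal Q' T" "Q' \<subseteq> Q" "contrA Q' = p n"
        using going_down[of "p n" Q] p Q by auto
      then show ?case by (intro exI[of _ "\<lambda>_. Q'"]) auto
    next
      case (Suc m)
      then obtain q where q: "\<And>i. i \<le> m \<Longrightarrow> primeideal (q i) T \<and> q i \<subseteq> Q \<and>
        contrA (q i) = p (n - i) \<and> (0 < i \<longrightarrow> q i \<subseteq> q (i - 1))" by auto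
      have "p (n - Suc m) \<subseteq> p (n - m)" using p(2)[rule_format, of "n - Suc m"] Suc.prems
        by (simp add: Suc_diff_Suc psubset_imp_subset)
      then obtain Q' where Q': "primeideal Q' T" "Q' \<subseteq> q m" "contrA Q' = p (n - Suc m)"
        using going_down[of "p (n - Suc m)" "q m"] p(1) q[of m] by auto
      show ?case
      proof (intro exI[of _ "q(Suc m := Q')"] allI impI)
        fix i assume "i \<le> Suc m"
        then consider "i \<le> m" | "i = Suc m" by linarith
        then show "primeideal ((q(Suc m := Q')) i) T \<and> (q(Suc m := Q')) i \<subseteq> Q \<and>
          contrA ((q(Suc m := Q')) i) = p (n - i) \<and>
          (0 < i \<longrightarrow> (q(Suc m := Q')) i \<subseteq> (q(Suc m := Q')) (i - 1))"
        proof cases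
          case 1
          then have "i \<noteq> Suc m" "i - 1 \<noteq> Suc m" by auto
          then show ?thesis using q[OF 1] by simp
        next
          case 2
          then show ?thesis using Q' q[of m] by auto
        qed
      qed
    qed
    obtain q where q': "\<forall>i\<le>n. primeideal (q i) T \<and> q i \<subseteq> Q \<and>
        contrA (q i) = p (n - i) \<and> (0 < i \<longrightarrow> q i \<subseteq> q (i - 1))" using chain[OF order_refl] ..
    note q = q'[rule_format]
    show "n \<le> N"
    proof (rule ht_leD[OF N, of n "\<lambda>i. q (n - i)"])
      fix i assume i: "i < n"
      have "contrA (q (n - i)) = p i" "contrA (q (n - Suc i)) = p (Suc i)"
        using q[of "n - i"] q[of "n - Suc i"] i by (simp_all add: Suc_leI)
      then have "q (n - i) \<noteq> q (n - Suc i)" using p(2) i by auto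
      moreover have "q (n - i) \<subseteq> q (n - Suc i)" using q[of "n - i"] i by simp
      ultimately show "q (n - i) \<subset> q (n - Suc i)" by blast
    qed (use q in auto)
  qed
  then show "\<exists>N. ht_le A P N" unfolding ht_le_def by blast
qed

end

text \<open>A surjective homomorphism is dense with all denominators equal to one, so surjectivity
  of the swap is enough to transfer LFD. In this way statements about the left factor are carried
  over to the right one.\<close>

lemma tensor_swap_dense_hom:
  assumes "tensor k A B"
  obtains h where "dense_hom (tensor_product k A B) (tensor_product k B A) h"
proof -
  interpret L: tensor k A B by fact
  interpret R: tensor k B A by (rule tensor.intro) (rule L.field_k L.alg_B L.alg_A)+
  obtain h where h: "h \<in> ring_hom L.T R.T"
    and pure: "\<And>a b. \<lbrakk>a \<in> carrier A; b \<in> carrier B\<rbrakk> \<Longrightarrow> h (L.pt a b) = R.inB a \<otimes>\<^bsub>R.T\<^esub> R.inA b"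
    using tensor_product_universal[OF L.alg_A L.alg_B R.T.is_cring R.inB_hom R.inA_hom]
      R.inA_smult_one by metis
  interpret h: ring_hom_cring L.T R.T h by unfold_locales (rule h)
  have surj: "\<exists>v\<in>carrier L.T. h v = w" if "w \<in> carrier R.T" for w
    using that
  proof (induction w rule: R.tensor_induct)
    case zero
    then show ?case using h.hom_zero by blast
  next
    case (pure b a)
    then have "h (L.pt a b) = R.pt b a"
      using \<open>\<And>b a. \<lbrakk>a \<in> carrier A; b \<in> carrier B\<rbrakk> \<Longrightarrow> h (L.pt a b) = R.inB a \<otimes>\<^bsub>R.T\<^esub> R.inA b\<close>
        R.pt_split[of b a] R.T.m_comm by simp
    then show ?case using pure L.pt_closed by blast
  next
    case (add v w)
    then show ?case using h.hom_add L.T.a_closed by metis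
  qed
  have "dense_hom L.T R.T h"
    unfolding dense_hom_def
  proof (intro conjI ballI h)
    fix w assume w: "w \<in> carrier R.T"
    then obtain v where "v \<in> carrier L.T" "h v = w" using surj by blast
    then show "\<exists>s\<in>carrier L.T. \<exists>r\<in>carrier L.T. h s \<in> Units R.T \<and> h s \<otimes>\<^bsub>R.T\<^esub> w = h r"
      using w by (intro bexI[of _ "\<one>\<^bsub>L.T\<^esub>"] bexI[of _ v]) auto
  qed
  then show thesis by (rule that)
qed

lemma LFD_tensor_swap:
  assumes "tensor k A B" "LFD (tensor_product k A B)"
  shows "LFD (tensor_product k B A)"
proof -
  interpret L: tensor k A B by fact
  interpret R: tensor k B A by (rule tensor.intro) (rule L.field_k L.alg_B L.alg_A)+
  obtain h where "dense_hom L.T R.T h" using tensor_swap_dense_hom[OF assms(1)] .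
  then show ?thesis
    using LFD_dense_hom[OF L.T.is_cring R.T.is_cring] assms(2) by blast
qed

lemma (in tensor) LFD_right:
  assumes "LFD T" "\<one>\<^bsub>A\<^esub> \<noteq> \<zero>\<^bsub>A\<^esub>"
  shows "LFD B"
proof -
  interpret R: tensor k B A by (rule tensor.intro) (rule field_k alg_B alg_A)+
  show ?thesis
    using R.LFD_left LFD_tensor_swap[OF tensor_axioms assms(1)] assms(2) by blast
qed


section \<open>Polynomial growth\<close>

text \<open>Finite sums, built one summand at a time. Negatives are not adjoined; where they matter,
  they come from the coefficients.\<close>

inductive_set addcl :: "('a, 'm) ring_scheme \<Rightarrow> 'a set \<Rightarrow> 'a set" for R S where
  zero: "\<zero>\<^bsub>R\<^esub> \<in> addcl R S"
| step: "s \<in> S \<Longrightarrow> u \<in> addcl R S \<Longrightarrow> s \<oplus>\<^bsub>R\<^esub> u \<in> addcl R S"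

definition lspan :: "('a, 'm) ring_scheme \<Rightarrow> 'a set \<Rightarrow> 'a set \<Rightarrow> 'a set"
  where "lspan R F E = addcl R {c \<otimes>\<^bsub>R\<^esub> e | c e. c \<in> F \<and> e \<in> E}"

text \<open>The index belongs to an expression, not to the element: \<open>n\<close> is an upper
  bound for the degree of some polynomial expression of the element in \<open>Y\<close> over
  \<open>F\<close>, and one element may have many.\<close>

inductive polyle :: "('a, 'm) ring_scheme \<Rightarrow> 'a set \<Rightarrow> 'a set \<Rightarrow> nat \<Rightarrow> 'a \<Rightarrow> bool" for R F Y where
  const: "c \<in> F \<Longrightarrow> polyle R F Y n c"
| add: "polyle R F Y n u \<Longrightarrow> polyle R F Y n v \<Longrightarrow> polyle R F Y n (u \<oplus>\<^bsub>R\<^esub> v)"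
| mult: "polyle R F Y n u \<Longrightarrow> y \<in> Y \<Longrightarrow> polyle R F Y (Suc n) (y \<otimes>\<^bsub>R\<^esub> u)"

definition lower_powers :: "('a, 'm) ring_scheme \<Rightarrow> 'a set \<Rightarrow> 'a set \<Rightarrow> 'a \<Rightarrow> nat \<Rightarrow> nat \<Rightarrow> 'a set"
  where "lower_powers R F Y y r n = addcl R {w \<otimes>\<^bsub>R\<^esub> y [^]\<^bsub>R\<^esub> i | w i. polyle R F Y n w \<and> i < r}"

text \<open>Algebraicity of \<open>y\<close> over \<open>F[Y]\<close>, with a leading coefficient
  \<open>c\<close> that is not normalized to one because no division is available. The case
  \<open>r = 0\<close> excludes itself: \<open>lower_powers\<close> then contains only zero, while
  \<open>c\<close> is non-zero.\<close>

definition alg_over :: "('a, 'm) ring_scheme \<Rightarrow> 'a set \<Rightarrow> 'a set \<Rightarrow> 'a \<Rightarrow> bool"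
  where "alg_over R F Y y \<longleftrightarrow> (\<exists>r n c. c \<noteq> \<zero>\<^bsub>R\<^esub> \<and> polyle R F Y n c \<and>
    c \<otimes>\<^bsub>R\<^esub> y [^]\<^bsub>R\<^esub> r \<in> lower_powers R F Y y r n)"

text \<open>The power of \<open>g\<close> clears denominators: \<open>growth R F e Y\<close> says that over the quotient field of
  \<open>F\<close> the polynomials of degree at most \<open>n\<close> in \<open>Y\<close> span a space of dimension \<open>O(n^e)\<close>.\<close>

definition growth :: "('a, 'm) ring_scheme \<Rightarrow> 'a set \<Rightarrow> nat \<Rightarrow> 'a set \<Rightarrow> bool"
  where "growth R F e Y \<longleftrightarrow> (\<exists>C g. g \<in> carrier R \<and> g \<noteq> \<zero>\<^bsub>R\<^esub> \<and>
    (\<forall>n. \<exists>E. finite E \<and> E \<subseteq> carrier R \<and> card E \<le> C * Suc n ^ e \<and>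
      (\<forall>u. polyle R F Y n u \<longrightarrow> g [^]\<^bsub>R\<^esub> n \<otimes>\<^bsub>R\<^esub> u \<in> lspan R F E)))"

context cring begin

lemma addcl_closed: "S \<subseteq> carrier R \<Longrightarrow> u \<in> addcl R S \<Longrightarrow> u \<in> carrier R"
  by (erule addcl.induct) auto

lemma addcl_add:
  assumes "S \<subseteq> carrier R" "u \<in> addcl R S" "v \<in> addcl R S"
  shows "u \<oplus> v \<in> addcl R S"
  using assms(2)
proof induction
  case zero
  then show ?case using assms addcl_closed by simp
next
  case (step s u)
  then have "s \<oplus> u \<oplus> v = s \<oplus> (u \<oplus> v)"
    using assms addcl_closed by (intro a_assoc) auto
  then show ?case using addcl.step step by metis
qed

lemma addcl_base: "S \<subseteq> carrier R \<Longrightarrow> s \<in> S \<Longrightarrow> s \<in> addcl R S"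
  using addcl.step[OF _ addcl.zero, of s S R] by auto

lemma addcl_mult:
  assumes "S \<subseteq> carrier R" "S' \<subseteq> carrier R" "a \<in> carrier R"
    and "\<And>s. s \<in> S \<Longrightarrow> a \<otimes> s \<in> addcl R S'" and "u \<in> addcl R S"
  shows "a \<otimes> u \<in> addcl R S'"
  using assms(5)
proof induction
  case zero
  then show ?case using assms(3) addcl.zero by simp
next
  case (step s u)
  then have "a \<otimes> (s \<oplus> u) = a \<otimes> s \<oplus> a \<otimes> u"
    using assms addcl_closed by (intro r_distr) auto
  then show ?case using addcl_add[OF assms(2)] assms(4) step by metis
qed

lemma addcl_mono:
  assumes "S \<subseteq> S'" "u \<in> addcl R S"
  shows "u \<in> addcl R S'"
  using assms(2) by induction (use assms(1) in \<open>auto intro: addcl.intros\<close>)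

lemma finsum_mem_addcl:
  assumes "S \<subseteq> carrier R" "finite I" "\<And>i. i \<in> I \<Longrightarrow> f i \<in> addcl R S"
  shows "(\<Oplus>i\<in>I. f i) \<in> addcl R S"
  using assms(2,3)
proof (induction I)
  case empty
  then show ?case by (simp add: addcl.zero)
next
  case (insert i I)
  then have "f \<in> insert i I \<rightarrow> carrier R" using addcl_closed[OF assms(1)] by blast
  then have "(\<Oplus>i\<in>insert i I. f i) = f i \<oplus> (\<Oplus>i\<in>I. f i)"
    using insert by (intro finsum_insert) auto
  then show ?case using insert addcl_add[OF assms(1)] by simp
qed

lemma finsum_mem_subring:
  assumes F: "subring F R" and "finite I" "\<And>i. i \<in> I \<Longrightarrow> f i \<in> F"
  shows "(\<Oplus>i\<in>I. f i) \<in> F"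
  using assms(2,3)
proof (induction I)
  case (insert i I)
  then have "f \<in> insert i I \<rightarrow> carrier R" using subringE(1)[OF F] by blast
  then have "(\<Oplus>i\<in>insert i I. f i) = f i \<oplus> (\<Oplus>i\<in>I. f i)"
    using insert by (intro finsum_insert) auto
  then show ?case using insert subringE(7)[OF F] by simp
qed (simp add: subringE(2)[OF F])

lemma lspan_gens_closed: "F \<subseteq> carrier R \<Longrightarrow> E \<subseteq> carrier R \<Longrightarrow> {c \<otimes> e | c e. c \<in> F \<and> e \<in> E} \<subseteq> carrier R"
  by auto

lemma lspan_closed: "F \<subseteq> carrier R \<Longrightarrow> E \<subseteq> carrier R \<Longrightarrow> u \<in> lspan R F E \<Longrightarrow> u \<in> carrier R"
  unfolding lspan_def using addcl_closed lspan_gens_closed by blast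

lemma lspan_add:
  "\<lbrakk>F \<subseteq> carrier R; E \<subseteq> carrier R; u \<in> lspan R F E; v \<in> lspan R F E\<rbrakk> \<Longrightarrow> u \<oplus> v \<in> lspan R F E"
  unfolding lspan_def using addcl_add[OF lspan_gens_closed] by blast

lemma lspan_smult:
  assumes F: "subring F R" and E: "E \<subseteq> carrier R" and "a \<in> F" "u \<in> lspan R F E"
  shows "a \<otimes> u \<in> lspan R F E"
proof -
  note Fc = subringE(1)[OF F]
  show ?thesis
    using assms(4) unfolding lspan_def
  proof (rule addcl_mult[OF lspan_gens_closed[OF Fc E] lspan_gens_closed[OF Fc E], rotated 2])
    fix s assume "s \<in> {c \<otimes> e | c e. c \<in> F \<and> e \<in> E}"
    then obtain c e where e: "s = c \<otimes> e" "c \<in> F" "e \<in> E" by blast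
    have "a \<otimes> s = (a \<otimes> c) \<otimes> e" using subsetD[OF Fc e(2)] subsetD[OF E e(3)] subsetD[OF Fc assms(3)] e(1) by (simp add: m_assoc)
    then show "a \<otimes> s \<in> addcl R {c \<otimes> e | c e. c \<in> F \<and> e \<in> E}"
      using e subringE(6)[OF F assms(3) e(2)] by (intro addcl_base lspan_gens_closed Fc E) blast
  qed (use assms(3) Fc in auto)
qed

lemma lspan_insert:
  assumes F: "subring F R" and E: "insert e E \<subseteq> carrier R" and u: "u \<in> lspan R F (insert e E)"
  shows "\<exists>d\<in>F. \<exists>w\<in>lspan R F E. u = d \<otimes> e \<oplus> w"
proof -
  note Fc = subringE(1)[OF F]
  have Ec: "e \<in> carrier R" "E \<subseteq> carrier R" using E by auto
  show ?thesis
    using u unfolding lspan_def[of _ _ "insert e E"]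
  proof induction
    case zero
    have "\<zero> = \<zero> \<otimes> e \<oplus> \<zero>" using Ec by simp
    moreover have "\<zero> \<in> lspan R F E" unfolding lspan_def by (rule addcl.zero)
    ultimately show ?case using subringE(2)[OF F] by blast
  next
    case (step s u)
    then obtain d w c e' where e: "d \<in> F" "w \<in> lspan R F E" "u = d \<otimes> e \<oplus> w"
      "s = c \<otimes> e'" "c \<in> F" "e' \<in> insert e E" by blast
    note cl = lspan_closed[OF Fc Ec(2) e(2)] subsetD[OF Fc e(1)] subsetD[OF Fc e(5)]
    show ?case
    proof (cases "e' = e")
      case True
      then have "s \<oplus> u = (c \<oplus> d) \<otimes> e \<oplus> w" using e cl Ec by (simp add: l_distr a_assoc)
      then show ?thesis using e subringE(7)[OF F] by blast
    next
      case False
      then have e': "e' \<in> E" "e' \<in> carrier R" using e Ec by auto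
      then have "s \<oplus> u = d \<otimes> e \<oplus> (c \<otimes> e' \<oplus> w)" using e cl Ec by (simp add: a_ac)
      moreover have "c \<otimes> e' \<oplus> w \<in> lspan R F E"
        using e e' unfolding lspan_def by (intro addcl.step) auto
      ultimately show ?thesis using e by blast
    qed
  qed
qed

end

text \<open>Gaussian elimination without division, by induction on the generators: with
  \<open>d j0\<close> a non-zero coefficient of \<open>e\<close>, subtracting \<open>d j\<close>
  times \<open>v j0\<close> from \<open>d j0\<close> times \<open>v j\<close> removes
  \<open>e\<close>. In a domain a non-trivial relation among the results stays non-trivial for the
  original vectors.\<close>

lemma (in domain) lspan_dependent:
  assumes F: "subring F R" and "finite E" "E \<subseteq> carrier R" "finite J" "card E < card J"
    and "v \<in> J \<rightarrow> lspan R F E"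
  shows "\<exists>c\<in>J \<rightarrow> F. (\<exists>j\<in>J. c j \<noteq> \<zero>) \<and> (\<Oplus>j\<in>J. c j \<otimes> v j) = \<zero>"
  using assms(2-)
proof (induction E arbitrary: J v)
  case empty
  have "{c \<otimes> e | c e. c \<in> F \<and> e \<in> ({} :: 'a set)} = {}" by blast
  then have v: "v j = \<zero>" if "j \<in> J" for j
    using that empty.prems(4) by (auto simp: lspan_def Pi_iff elim: addcl.cases)
  have "(\<Oplus>j\<in>J. \<one> \<otimes> v j) = \<zero>"
    by (rule add.finprod_one_eqI) (simp add: v)
  then show ?case
    using empty.prems subringE(3)[OF F]
    by (intro bexI[of _ "\<lambda>_. \<one>"]) (auto simp: card_gt_0_iff)
next
  case (insert e E)
  note Fc = subringE(1)[OF F]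
  have Ec: "e \<in> carrier R" "E \<subseteq> carrier R" using insert.prems by auto
  have "\<forall>j\<in>J. \<exists>d w. d \<in> F \<and> w \<in> lspan R F E \<and> v j = d \<otimes> e \<oplus> w"
    using lspan_insert[OF F insert.prems(1)] insert.prems(4) by blast
  then obtain d w where dw: "\<And>j. j \<in> J \<Longrightarrow> d j \<in> F" "\<And>j. j \<in> J \<Longrightarrow> w j \<in> lspan R F E"
    "\<And>j. j \<in> J \<Longrightarrow> v j = d j \<otimes> e \<oplus> w j" by metis
  note dc = subsetD[OF Fc dw(1)] and wc = lspan_closed[OF Fc Ec(2) dw(2)]
  show ?case
  proof (cases "\<exists>j0\<in>J. d j0 \<noteq> \<zero>")
    case False
    then have "v \<in> J \<rightarrow> lspan R F E" using dw wc Ec by auto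
    then show ?thesis using insert.IH[OF Ec(2) insert.prems(2)] insert.hyps insert.prems(3) by simp
  next
    case True
    then obtain j0 where j0: "j0 \<in> J" "d j0 \<noteq> \<zero>" by blast
    define J' where "J' = J - {j0}"
    have J': "finite J'" "J = insert j0 J'" "j0 \<notin> J'" using insert.prems(2) j0 by (auto simp: J'_def)
    define v' where "v' j = (\<ominus> d j) \<otimes> w j0 \<oplus> d j0 \<otimes> w j" for j
    have "v' j \<in> lspan R F E" if "j \<in> J'" for j
      unfolding v'_def using that J' j0 dw subringE(5)[OF F]
      by (intro lspan_add lspan_smult F Fc Ec) auto
    then have v': "v' \<in> J' \<rightarrow> lspan R F E" by blast
    have "card E < card J'" using insert.prems(2,3) insert.hyps j0 by (simp add: J'_def)
    then obtain c where c: "c \<in> J' \<rightarrow> F" "\<exists>j\<in>J'. c j \<noteq> \<zero>" "(\<Oplus>j\<in>J'. c j \<otimes> v' j) = \<zero>"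
      using insert.IH[OF Ec(2) J'(1) _ v'] by blast
    have cc: "c j \<in> carrier R" "c j \<in> F" if "j \<in> J'" for j using c(1) that Fc by auto
    \<comment> \<open>The relation among the \<open>v' j\<close> is expanded in terms of the
      \<open>v j\<close>: the vector \<open>v j0\<close> collects the coefficients
      \<open>c i \<otimes> (\<ominus> d i)\<close>, and every other coefficient is scaled by
      \<open>d j0\<close>.\<close>
    define b where "b = (\<lambda>j. if j = j0 then \<Oplus>i\<in>J'. c i \<otimes> (\<ominus> d i) else c j \<otimes> d j0)"
    have bF: "b \<in> J \<rightarrow> F"
    proof
      fix j assume "j \<in> J"
      then show "b j \<in> F"
        unfolding b_def using J' cc dw j0 subringE(5,6)[OF F] by (auto intro!: finsum_mem_subring[OF F])
    qed
    have "\<exists>j\<in>J. b j \<noteq> \<zero>"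
    proof -
      obtain j where "j \<in> J'" "c j \<noteq> \<zero>" using c(2) by blast
      then have "b j \<noteq> \<zero>" using J' cc dc j0 by (auto simp: b_def integral_iff)
      then show ?thesis using \<open>j \<in> J'\<close> J' by blast
    qed
    moreover have "(\<Oplus>j\<in>J. b j \<otimes> v j) = \<zero>"
    proof -
      have vc: "v j \<in> carrier R" if "j \<in> J" for j using that dw(3) dc wc Ec by simp
      have "(\<Oplus>j\<in>J. b j \<otimes> v j) = b j0 \<otimes> v j0 \<oplus> (\<Oplus>j\<in>J'. b j \<otimes> v j)"
        unfolding J'(2) using J' vc bF Fc by (intro finsum_insert) auto
      also have "b j0 \<otimes> v j0 = (\<Oplus>i\<in>J'. c i \<otimes> (\<ominus> d i) \<otimes> v j0)"
        unfolding b_def using J' cc dc vc[OF j0(1)] by (simp add: finsum_ldistr)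
      also have "\<dots> \<oplus> (\<Oplus>j\<in>J'. b j \<otimes> v j)
          = (\<Oplus>j\<in>J'. c j \<otimes> (\<ominus> d j) \<otimes> v j0 \<oplus> b j \<otimes> v j)"
        using J' cc dc vc bF Fc by (intro finsum_addf[symmetric]) auto
      also have "\<dots> = (\<Oplus>j\<in>J'. c j \<otimes> v' j)"
      proof (rule finsum_cong')
        show "(\<lambda>j. c j \<otimes> v' j) \<in> J' \<rightarrow> carrier R"
          using cc v' lspan_closed[OF Fc Ec(2)] by blast
        fix j assume j: "j \<in> J'"
        then have jJ: "j \<in> J" "j \<noteq> j0" using J' by auto
        note C = cc(1)[OF j] dc[OF jJ(1)] wc[OF jJ(1)] dc[OF j0(1)] wc[OF j0(1)] Ec(1)
        have "(\<ominus> d j) \<otimes> v j0 \<oplus> d j0 \<otimes> v j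
            = ((\<ominus> d j) \<otimes> (d j0 \<otimes> e) \<oplus> d j0 \<otimes> (d j \<otimes> e)) \<oplus> v' j"
          unfolding dw(3)[OF jJ(1)] dw(3)[OF j0(1)] v'_def using C by (simp add: r_distr a_ac)
        also have "(\<ominus> d j) \<otimes> (d j0 \<otimes> e) \<oplus> d j0 \<otimes> (d j \<otimes> e) = \<zero>"
          using C by (simp add: l_minus r_minus l_neg m_lcomm)
        finally have eq: "(\<ominus> d j) \<otimes> v j0 \<oplus> d j0 \<otimes> v j = v' j"
          using C by (simp add: v'_def)
        have "c j \<otimes> (\<ominus> d j) \<otimes> v j0 \<oplus> b j \<otimes> v j = c j \<otimes> ((\<ominus> d j) \<otimes> v j0 \<oplus> d j0 \<otimes> v j)"
          using C vc[OF jJ(1)] vc[OF j0(1)] jJ(2) by (simp add: b_def r_distr m_assoc)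
        then show "c j \<otimes> (\<ominus> d j) \<otimes> v j0 \<oplus> b j \<otimes> v j = c j \<otimes> v' j" by (simp only: eq)
      qed simp
      finally show ?thesis using c(3) by simp
    qed
    ultimately show ?thesis using bF by blast
  qed
qed

section \<open>Polynomial expressions of bounded degree and the effect of adjoining an
  element\<close>

context cring begin

context
  fixes F Y
  assumes F: "subring F R" and Y: "Y \<subseteq> carrier R"
begin

lemma polyle_closed: "polyle R F Y n u \<Longrightarrow> u \<in> carrier R"
  by (induction rule: polyle.induct) (use Y subringE(1)[OF F] in auto)

lemma polyle_Suc: "polyle R F Y n u \<Longrightarrow> polyle R F Y (Suc n) u"
  by (induction rule: polyle.induct) (auto intro: polyle.intros)

lemma polyle_le: "polyle R F Y n u \<Longrightarrow> n \<le> m \<Longrightarrow> polyle R F Y m u"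
proof (induction m)
  case (Suc m)
  then show ?case by (cases "n = Suc m") (auto intro: polyle_Suc)
qed simp

lemma polyle_smult: "polyle R F Y n u \<Longrightarrow> c \<in> F \<Longrightarrow> polyle R F Y n (c \<otimes> u)"
proof (induction rule: polyle.induct)
  case (const a n)
  then show ?case using subringE(6)[OF F, of c a] by (simp add: polyle.const)
next
  case (add n u v)
  then show ?case
    using polyle_closed[of n u] polyle_closed[of n v] subsetD[OF subringE(1)[OF F], of c]
    by (simp add: r_distr polyle.add)
next
  case (mult n u y)
  then have "c \<otimes> (y \<otimes> u) = y \<otimes> (c \<otimes> u)"
    using polyle_closed[of n u] subsetD[OF subringE(1)[OF F], of c] Y by (intro m_lcomm) auto
  then show ?case using mult by (simp add: polyle.mult)
qed

lemma polyle_minus: "polyle R F Y n u \<Longrightarrow> polyle R F Y n (\<ominus> u)"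
  using polyle_smult[of n u "\<ominus> \<one>"] subringE(3,5)[OF F] polyle_closed by (auto simp: l_minus)

lemma polyle_mult: "polyle R F Y m u \<Longrightarrow> polyle R F Y n v \<Longrightarrow> polyle R F Y (m + n) (u \<otimes> v)"
proof (induction rule: polyle.induct)
  case (const c m)
  then show ?case by (auto intro: polyle_le polyle_smult)
next
  case (add m u u')
  then show ?case
    using polyle_closed[of m u] polyle_closed[of m u'] polyle_closed[of n v]
    by (simp add: l_distr polyle.add)
next
  case (mult m u y)
  then have "(y \<otimes> u) \<otimes> v = y \<otimes> (u \<otimes> v)"
    using polyle_closed[of m u] polyle_closed[of n v] Y by (intro m_assoc) auto
  then show ?case using mult by (simp add: polyle.mult)
qed

lemma polyle_one: "polyle R F Y n \<one>"
  by (rule polyle.const[OF subringE(3)[OF F]])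

lemma polyle_zero: "polyle R F Y n \<zero>"
  by (rule polyle.const[OF subringE(2)[OF F]])

lemma polyle_pow: "polyle R F Y n u \<Longrightarrow> polyle R F Y (n * i) (u [^] i)"
proof (induction i)
  case (Suc i)
  then show ?case using polyle_mult[of "n * i" "u [^] i" n u] by (simp add: add.commute)
qed (simp add: polyle_one)

lemma polyle_base: "y \<in> Y \<Longrightarrow> polyle R F Y (Suc n) y"
  using polyle.mult[OF polyle_one, of y n] Y by auto

lemma polyle_finsum:
  assumes "finite I" "\<And>i. i \<in> I \<Longrightarrow> polyle R F Y n (f i)"
  shows "polyle R F Y n (\<Oplus>i\<in>I. f i)"
  using assms
proof (induction I)
  case empty
  then show ?case by (simp add: polyle_zero)
next
  case (insert i I)
  then have "f \<in> insert i I \<rightarrow> carrier R" using polyle_closed[of n] by blast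
  then have "(\<Oplus>i\<in>insert i I. f i) = f i \<oplus> (\<Oplus>i\<in>I. f i)"
    using insert by (intro finsum_insert) auto
  then show ?case using insert by (simp add: polyle.add)
qed

lemma lower_gens_closed:
  "y \<in> carrier R \<Longrightarrow> {w \<otimes> y [^] i | w i. polyle R F Y n w \<and> i < (r::nat)} \<subseteq> carrier R"
proof
  fix s assume y: "y \<in> carrier R" and "s \<in> {w \<otimes> y [^] i | w i. polyle R F Y n w \<and> i < r}"
  then obtain w and i :: nat where "s = w \<otimes> y [^] i" "polyle R F Y n w" by blast
  then show "s \<in> carrier R" using y polyle_closed[of n w] by simp
qed

lemma lower_powersI:
  "\<lbrakk>y \<in> carrier R; polyle R F Y n w; i < r\<rbrakk> \<Longrightarrow> w \<otimes> y [^] i \<in> lower_powers R F Y y r n"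
  unfolding lower_powers_def by (rule addcl_base[OF lower_gens_closed]) auto

lemma lower_powers_add:
  "\<lbrakk>y \<in> carrier R; u \<in> lower_powers R F Y y r n; v \<in> lower_powers R F Y y r n\<rbrakk>
    \<Longrightarrow> u \<oplus> v \<in> lower_powers R F Y y r n"
  unfolding lower_powers_def by (rule addcl_add[OF lower_gens_closed])

lemma lower_powers_mult:
  assumes "y \<in> carrier R" "a \<in> carrier R" "u \<in> lower_powers R F Y y r n"
    and "\<And>w i. polyle R F Y n w \<Longrightarrow> i < r \<Longrightarrow> a \<otimes> (w \<otimes> y [^] i) \<in> lower_powers R F Y y r' n'"
  shows "a \<otimes> u \<in> lower_powers R F Y y r' n'"
  using assms(3) unfolding lower_powers_def
  by (rule addcl_mult[OF lower_gens_closed lower_gens_closed, rotated 4])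
    (use assms in \<open>auto simp: lower_powers_def\<close>)

lemma lower_powers_polyle_mult:
  assumes "y \<in> carrier R" "polyle R F Y m a" "u \<in> lower_powers R F Y y r n"
  shows "a \<otimes> u \<in> lower_powers R F Y y r (m + n)"
proof (rule lower_powers_mult[OF assms(1) polyle_closed[OF assms(2)] assms(3)])
  fix w i assume w: "polyle R F Y n w" "i < r"
  have "a \<otimes> (w \<otimes> y [^] i) = (a \<otimes> w) \<otimes> y [^] i"
    using polyle_closed[OF w(1)] polyle_closed[OF assms(2)] assms(1) by (simp add: m_assoc)
  then show "a \<otimes> (w \<otimes> y [^] i) \<in> lower_powers R F Y y r (m + n)"
    using lower_powersI[OF assms(1) polyle_mult[OF assms(2) w(1)] w(2)] by simp
qed

lemma lower_powers_le:
  assumes "u \<in> lower_powers R F Y y r n" "n \<le> n'" "r \<le> r'"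
  shows "u \<in> lower_powers R F Y y r' n'"
  using assms(1) unfolding lower_powers_def
proof (rule addcl_mono[rotated])
  show "{w \<otimes> y [^] i | w i. polyle R F Y n w \<and> i < r} \<subseteq> {w \<otimes> y [^] i | w i. polyle R F Y n' w \<and> i < r'}"
    using polyle_le[OF _ assms(2)] assms(3) by fastforce
qed

lemma polyle_insert_powers:
  assumes y: "y \<in> carrier R" and "polyle R F (insert y Y) n u"
  shows "u \<in> lower_powers R F Y y (Suc n) n"
  using assms(2)
proof (induction rule: polyle.induct)
  case (const c n)
  then have "c = c \<otimes> y [^] (0::nat)" using subringE(1)[OF F] by auto
  then show ?case using lower_powersI[OF y polyle.const[of c F R Y n], of 0 "Suc n"] const by simp
next
  case (add n u v)
  then show ?case using lower_powers_add[OF y] by blast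
next
  case (mult n u z)
  show ?case
  proof (cases "z = y")
    case True
    show ?thesis
      unfolding True
    proof (rule lower_powers_mult[OF y y mult.IH])
      fix w i assume w: "polyle R F Y n w" "i < Suc n"
      have "y \<otimes> (w \<otimes> y [^] i) = w \<otimes> y [^] Suc i"
        using polyle_closed[OF w(1)] y by (simp add: m_ac)
      then show "y \<otimes> (w \<otimes> y [^] i) \<in> lower_powers R F Y y (Suc (Suc n)) (Suc n)"
        using lower_powersI[OF y polyle_Suc[OF w(1)], of "Suc i" "Suc (Suc n)"] w(2) by simp
    qed
  next
    case False
    then have "polyle R F Y 1 z" using mult(2) polyle_base[of z 0] by simp
    then show ?thesis
      using lower_powers_le[OF lower_powers_polyle_mult[OF y _ mult.IH], of 1 z] by simp
  qed
qed

lemma lspan_lower_powers: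
  assumes y: "y \<in> carrier R" and g: "g \<in> carrier R" and E: "E \<subseteq> carrier R"
    and span: "\<And>w. polyle R F Y n w \<Longrightarrow> g \<otimes> w \<in> lspan R F E"
    and u: "u \<in> lower_powers R F Y y r n"
  shows "g \<otimes> u \<in> lspan R F ((\<lambda>(e, i). e \<otimes> y [^] i) ` (E \<times> {..<r}))"
proof -
  note Fc = subringE(1)[OF F]
  let ?E = "(\<lambda>(e, i). e \<otimes> y [^] i) ` (E \<times> {..<r})"
  have E': "?E \<subseteq> carrier R" using E y by auto
  show ?thesis
    using u unfolding lower_powers_def lspan_def
  proof (rule addcl_mult[OF lower_gens_closed[OF y] lspan_gens_closed[OF Fc E'] g, rotated])
    fix s assume "s \<in> {w \<otimes> y [^] i | w i. polyle R F Y n w \<and> i < r}"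
    then obtain w i where w: "s = w \<otimes> y [^] i" "polyle R F Y n w" "i < r" by blast
    have "y [^] i \<otimes> (g \<otimes> w) \<in> addcl R {c \<otimes> e | c e. c \<in> F \<and> e \<in> ?E}"
      using span[OF w(2)] unfolding lspan_def
    proof (rule addcl_mult[OF lspan_gens_closed[OF Fc E] lspan_gens_closed[OF Fc E'], rotated 2])
      fix s assume "s \<in> {c \<otimes> e | c e. c \<in> F \<and> e \<in> E}"
      then obtain c e where e: "s = c \<otimes> e" "c \<in> F" "e \<in> E" by blast
      then have "y [^] i \<otimes> s = c \<otimes> (e \<otimes> y [^] i)"
        using y subsetD[OF E e(3)] subsetD[OF Fc e(2)] by (simp add: m_ac)
      moreover have "e \<otimes> y [^] i \<in> ?E" using e w(3) by auto
      ultimately show "y [^] i \<otimes> s \<in> addcl R {c \<otimes> e | c e. c \<in> F \<and> e \<in> ?E}"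
        using e(2) by (intro addcl_base lspan_gens_closed Fc E') blast
    qed (use y in auto)
    moreover have "g \<otimes> s = y [^] i \<otimes> (g \<otimes> w)"
      using w(1) y g polyle_closed[OF w(2)] by (simp add: m_ac)
    ultimately show "g \<otimes> s \<in> addcl R {c \<otimes> e | c e. c \<in> F \<and> e \<in> ?E}" by simp
  qed
qed

text \<open>A polynomial of degree at most \<open>n\<close> uses only the powers of \<open>y\<close>
  with exponents from \<open>0\<close> to \<open>n\<close>, so the spanning set grows at most by the
  factor \<open>Suc n\<close>. The denominator \<open>g\<close> is unchanged.\<close>

lemma growth_insert:
  assumes "growth R F e Y" "y \<in> carrier R"
  shows "growth R F (Suc e) (insert y Y)"
proof -
  obtain C g where g: "g \<in> carrier R" "g \<noteq> \<zero>" and gr: "\<And>n. \<exists>E. finite E \<and> E \<subseteq> carrier R \<and>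
      card E \<le> C * Suc n ^ e \<and> (\<forall>u. polyle R F Y n u \<longrightarrow> g [^] n \<otimes> u \<in> lspan R F E)"
    using assms(1) unfolding growth_def by blast
  have "\<exists>E. finite E \<and> E \<subseteq> carrier R \<and> card E \<le> C * Suc n ^ Suc e \<and>
      (\<forall>u. polyle R F (insert y Y) n u \<longrightarrow> g [^] n \<otimes> u \<in> lspan R F E)" for n
  proof -
    obtain E where E: "finite E" "E \<subseteq> carrier R" "card E \<le> C * Suc n ^ e"
      "\<And>u. polyle R F Y n u \<Longrightarrow> g [^] n \<otimes> u \<in> lspan R F E" using gr by blast
    let ?E = "(\<lambda>(e, i). e \<otimes> y [^] i) ` (E \<times> {..<Suc n})"
    have "card ?E \<le> card (E \<times> {..<Suc n})" by (rule card_image_le) (use E in auto)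
    also have "\<dots> \<le> C * Suc n ^ Suc e"
      using mult_le_mono1[OF E(3), of "Suc n"] by (simp add: card_cartesian_product mult_ac)
    finally have "card ?E \<le> C * Suc n ^ Suc e" .
    moreover have "g [^] n \<otimes> u \<in> lspan R F ?E" if "polyle R F (insert y Y) n u" for u
      using lspan_lower_powers[OF assms(2) nat_pow_closed[OF g(1)] E(2) E(4)
          polyle_insert_powers[OF assms(2) that]] by blast
    moreover have "finite ?E" "?E \<subseteq> carrier R" using E assms(2) by auto
    ultimately show ?thesis by blast
  qed
  then show ?thesis unfolding growth_def using g by blast
qed

end

end

lemma (in domain) pow_nonzero: "\<lbrakk>a \<in> carrier R; a \<noteq> \<zero>\<rbrakk> \<Longrightarrow> a [^] (n::nat) \<noteq> \<zero>"
  using primeideal.pow_notin[OF zeroprimeideal] by blast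

text \<open>High powers of \<open>y\<close> are rewritten by powers below the fixed number
  \<open>r\<close>, at the price of a factor \<open>c\<close> for each step and of a linear increase
  of the degree in \<open>Y\<close>. Both affect only the denominator and the constant, not the
  exponent \<open>e\<close>.\<close>

lemma (in domain) growth_alg:
  assumes F: "subring F R" and Y: "Y \<subseteq> carrier R"
    and gr: "growth R F e Y" and y: "y \<in> carrier R" and alg: "alg_over R F Y y"
  shows "growth R F e (insert y Y)"
proof -
  obtain C g where g: "g \<in> carrier R" "g \<noteq> \<zero>" and gr: "\<And>n. \<exists>E. finite E \<and> E \<subseteq> carrier R \<and>
      card E \<le> C * Suc n ^ e \<and> (\<forall>u. polyle R F Y n u \<longrightarrow> g [^] n \<otimes> u \<in> lspan R F E)"
    using gr unfolding growth_def by blast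
  obtain r D c where c: "c \<noteq> \<zero>" "polyle R F Y D c" "c \<otimes> y [^] r \<in> lower_powers R F Y y r D"
    using alg unfolding alg_over_def by blast
  note pc = polyle_closed[OF F Y] and lpI = lower_powersI[OF F Y y]
  have cc: "c \<in> carrier R" using c(2) by (rule pc)
  have r: "0 < r"
  proof (rule ccontr)
    assume "\<not> 0 < r"
    then have r0: "r = 0" by simp
    then have "c \<in> lower_powers R F Y y 0 D" using c(3) cc by simp
    then have "c = \<zero>" unfolding lower_powers_def by (auto elim: addcl.cases)
    then show False using c(1) by simp
  qed
  \<comment> \<open>One factor \<open>c\<close> is spent per degree: if multiplication by
    \<open>y\<close> produces \<open>y [^] r\<close>, that factor turns it into lower powers;
    otherwise it is just a coefficient. Each step raises the degree in \<open>Y\<close> by at most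
    \<open>D\<close>, and by one more if the new factor comes from \<open>Y\<close>.\<close>
  have reduce: "c [^] n \<otimes> u \<in> lower_powers R F Y y r (Suc D * n)" if "polyle R F (insert y Y) n u" for n u
    using that
  proof (induction rule: polyle.induct)
    case (const a n)
    then have a: "a \<in> carrier R" using subringE(1)[OF F] by blast
    have "polyle R F Y (Suc D * n) (c [^] n \<otimes> a)"
      using polyle_le[OF F Y polyle_mult[OF F Y polyle_pow[OF F Y c(2), of n]
            polyle.const[OF const, of R Y 0]]] by simp
    from lpI[OF this r] show ?case using a cc by simp
  next
    case (add n u v)
    have "insert y Y \<subseteq> carrier R" using y Y by simp
    then have "u \<in> carrier R" "v \<in> carrier R" using polyle_closed[OF F] add by blast+
    then show ?case using lower_powers_add[OF F Y y] add.IH cc by (simp add: r_distr)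
  next
    case (mult n u z)
    have "insert y Y \<subseteq> carrier R" using y Y by simp
    then have zu: "u \<in> carrier R" "z \<in> carrier R" using polyle_closed[OF F] mult by blast+
    have eq: "c [^] Suc n \<otimes> (z \<otimes> u) = (c \<otimes> z) \<otimes> (c [^] n \<otimes> u)"
      using zu cc by (simp add: m_ac)
    show ?case
    proof (cases "z = y")
      case True
      show ?thesis
        unfolding eq
      proof (rule lower_powers_mult[OF F Y y _ mult.IH])
        fix w i assume w: "polyle R F Y (Suc D * n) w" "i < r"
        show "(c \<otimes> z) \<otimes> (w \<otimes> y [^] i) \<in> lower_powers R F Y y r (Suc D * Suc n)"
        proof (cases "Suc i = r")
          case True
          have "w \<otimes> (c \<otimes> y [^] r) \<in> lower_powers R F Y y r (Suc D * n + D)"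
            by (rule lower_powers_polyle_mult[OF F Y y w(1) c(3)])
          moreover have "(c \<otimes> z) \<otimes> (w \<otimes> y [^] i) = w \<otimes> (c \<otimes> y [^] r)"
            unfolding \<open>z = y\<close> using cc y pc[OF w(1)] by (simp add: m_ac flip: True)
          ultimately show ?thesis using lower_powers_le[OF F Y] by simp
        next
          case False
          have "polyle R F Y (Suc D * Suc n) (c \<otimes> w)"
            using polyle_le[OF F Y polyle_mult[OF F Y c(2) w(1)]] by simp
          moreover have "Suc i < r" using False w(2) by simp
          ultimately have "(c \<otimes> w) \<otimes> y [^] Suc i \<in> lower_powers R F Y y r (Suc D * Suc n)"
            by (rule lpI)
          moreover have "(c \<otimes> z) \<otimes> (w \<otimes> y [^] i) = (c \<otimes> w) \<otimes> y [^] Suc i"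
            unfolding \<open>z = y\<close> using cc y pc[OF w(1)] by (simp add: m_ac)
          ultimately show ?thesis by simp
        qed
      qed (use cc zu in simp)
    next
      case False
      then have cz: "polyle R F Y (Suc D) (c \<otimes> z)"
        using mult(2) polyle_mult[OF F Y c(2) polyle_base[OF F Y, of z 0]] by simp
      then show ?thesis
        unfolding eq using lower_powers_polyle_mult[OF F Y y cz mult.IH] by simp
    qed
  qed
  \<comment> \<open>The reduced coefficients have degree at most \<open>Suc D * n\<close>, which
    requires that power of \<open>g\<close>, and the reduction itself requires
    \<open>c [^] n\<close>; the \<open>n\<close>-th power of \<open>g'\<close> supplies
    both.\<close>
  define g' where "g' = g [^] Suc D \<otimes> c"
  have g': "g' \<in> carrier R" "g' \<noteq> \<zero>"
    using g cc c(1) by (auto simp: g'_def integral_iff pow_nonzero simp del: nat_pow_Suc)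
  \<comment> \<open>The constant comes from \<open>Suc (Suc D * n) \<le> Suc D * Suc n\<close> and
    from one copy of the spanning set for each of the \<open>r\<close> powers of
    \<open>y\<close>.\<close>
  have "\<exists>E. finite E \<and> E \<subseteq> carrier R \<and> card E \<le> C * Suc D ^ e * r * Suc n ^ e \<and>
      (\<forall>u. polyle R F (insert y Y) n u \<longrightarrow> g' [^] n \<otimes> u \<in> lspan R F E)" for n
  proof -
    obtain E where E: "finite E" "E \<subseteq> carrier R" "card E \<le> C * Suc (Suc D * n) ^ e"
      "\<And>u. polyle R F Y (Suc D * n) u \<Longrightarrow> g [^] (Suc D * n) \<otimes> u \<in> lspan R F E" using gr by blast
    let ?E = "(\<lambda>(e, i). e \<otimes> y [^] i) ` (E \<times> {..<r})"
    have "card ?E \<le> card (E \<times> {..<r})" by (rule card_image_le) (use E in auto)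
    also have "\<dots> = card E * r" by (simp add: card_cartesian_product)
    also have "\<dots> \<le> C * (Suc D * Suc n) ^ e * r"
      by (rule mult_le_mono1[OF order_trans[OF E(3) mult_le_mono2[OF power_mono]]]) simp_all
    also have "\<dots> = C * Suc D ^ e * r * Suc n ^ e" by (simp only: power_mult_distrib mult_ac)
    finally have "card ?E \<le> C * Suc D ^ e * r * Suc n ^ e" .
    moreover have "g' [^] n \<otimes> u \<in> lspan R F ?E" if u: "polyle R F (insert y Y) n u" for u
    proof -
      have "insert y Y \<subseteq> carrier R" using y Y by simp
      then have uc: "u \<in> carrier R" using polyle_closed[OF F _ u] by blast
      have "g' [^] n = g [^] (Suc D * n) \<otimes> c [^] n"
        unfolding g'_def using g(1) cc by (simp only: nat_pow_distrib nat_pow_closed nat_pow_pow)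
      then have "g' [^] n \<otimes> u = g [^] (Suc D * n) \<otimes> (c [^] n \<otimes> u)"
        using g(1) cc uc by (simp only: m_assoc nat_pow_closed)
      also have "\<dots> \<in> lspan R F ?E"
        by (rule lspan_lower_powers[OF F Y y nat_pow_closed[OF g(1)] E(2) E(4) reduce[OF u]])
      finally show ?thesis .
    qed
    moreover have "finite ?E" "?E \<subseteq> carrier R" using E y by auto
    ultimately show ?thesis by blast
  qed
  then show ?thesis unfolding growth_def using g' by blast
qed


section \<open>Algebraic independence\<close>

context cring begin

lemma mset_monomial_empty [simp]: "mset_monomial R {#} = \<one>"
  by (simp add: mset_monomial_def)

lemma mset_monomial_closed [intro]: "set_mset m \<subseteq> carrier R \<Longrightarrow> mset_monomial R m \<in> carrier R"
  unfolding mset_monomial_def by (rule finprod_closed) auto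

lemma mset_monomial_add_mset:
  assumes x: "x \<in> carrier R" and m: "set_mset m \<subseteq> carrier R"
  shows "mset_monomial R (add_mset x m) = x \<otimes> mset_monomial R m"
proof -
  let ?A = "set_mset m - {x}"
  let ?f = "\<lambda>m y. y [^] count m y"
  have cl: "?f m' \<in> ?A \<rightarrow> carrier R" for m' using m by auto
  have eq: "finprod R (?f (add_mset x m)) ?A = finprod R (?f m) ?A"
    by (rule finprod_cong') (use cl in auto)
  have ins: "finprod R (?f m') (insert x ?A) = x [^] count m' x \<otimes> finprod R (?f m') ?A" for m'
    by (rule finprod_insert) (use cl x in auto)
  have "mset_monomial R (add_mset x m) = finprod R (?f (add_mset x m)) (insert x ?A)"
    unfolding mset_monomial_def by (simp add: insert_Diff_single)
  also have "\<dots> = x [^] count (add_mset x m) x \<otimes> finprod R (?f (add_mset x m)) ?A"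
    by (rule ins)
  also have "\<dots> = x [^] Suc (count m x) \<otimes> finprod R (?f m) ?A"
    unfolding eq by simp
  also have "\<dots> = x \<otimes> (x [^] count m x \<otimes> finprod R (?f m) ?A)"
    using x cl by (simp add: m_ac)
  also have "x [^] count m x \<otimes> finprod R (?f m) ?A = mset_monomial R m"
  proof (cases "x \<in># m")
    case True
    then have "mset_monomial R m = finprod R (?f m) (insert x ?A)"
      unfolding mset_monomial_def by (simp add: insert_absorb)
    also have "\<dots> = x [^] count m x \<otimes> finprod R (?f m) ?A"
      by (rule ins)
    finally show ?thesis ..
  next
    case False
    then have "count m x = 0" "?A = set_mset m" by (auto simp: not_in_iff)
    then show ?thesis using cl[of m] unfolding mset_monomial_def by simp
  qed
  finally show ?thesis .
qed

lemma mset_monomial_single: "x \<in> carrier R \<Longrightarrow> mset_monomial R {#x#} = x"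
  using mset_monomial_add_mset[of x "{#}"] by simp

lemma mset_monomial_union:
  assumes "set_mset m \<subseteq> carrier R" "set_mset m' \<subseteq> carrier R"
  shows "mset_monomial R (m + m') = mset_monomial R m \<otimes> mset_monomial R m'"
  using assms
proof (induction m)
  case empty
  then show ?case using mset_monomial_closed by simp
next
  case (add x m)
  then show ?case
    using mset_monomial_closed[of m] mset_monomial_closed[of m']
    by (simp add: mset_monomial_add_mset m_assoc)
qed

lemma mset_monomial_replicate: "x \<in> carrier R \<Longrightarrow> mset_monomial R (replicate_mset n x) = x [^] n"
proof (induction n)
  case (Suc n)
  then have "set_mset (replicate_mset n x) \<subseteq> carrier R" by (auto simp: in_replicate_mset)
  then show ?case using Suc by (simp add: mset_monomial_add_mset m_comm)
qed simp

lemma mset_monomial_split: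
  assumes "x \<in> carrier R" "set_mset m \<subseteq> carrier R"
  shows "mset_monomial R m = mset_monomial R {#y \<in># m. y \<noteq> x#} \<otimes> x [^] count m x"
proof -
  have "m = {#y \<in># m. y \<noteq> x#} + replicate_mset (count m x) x"
    by (rule multiset_eqI) auto
  then have "mset_monomial R m
      = mset_monomial R ({#y \<in># m. y \<noteq> x#} + replicate_mset (count m x) x)" by simp
  also have "\<dots> = mset_monomial R {#y \<in># m. y \<noteq> x#} \<otimes> x [^] count m x"
    using assms mset_monomial_replicate[OF assms(1)]
    by (subst mset_monomial_union) (auto simp: in_replicate_mset)
  finally show ?thesis .
qed

lemma polyle_mset_monomial:
  assumes F: "subring F R" and Y: "Y \<subseteq> carrier R" and "\<And>z. z \<in># m \<Longrightarrow> polyle R F Y t z"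
  shows "polyle R F Y (t * size m) (mset_monomial R m)"
  using assms(3)
proof (induction m)
  case empty
  then show ?case by (simp add: polyle_one[OF F Y])
next
  case (add x m)
  have "set_mset (add_mset x m) \<subseteq> carrier R" using polyle_closed[OF F Y add.prems] by blast
  then have "mset_monomial R (add_mset x m) = x \<otimes> mset_monomial R m"
    using mset_monomial_add_mset by simp
  then show ?case using polyle_mult[OF F Y, of t x "t * size m" "mset_monomial R m"] add by simp
qed

end

lemma (in ring_hom_cring) hom_mset_monomial:
  "set_mset m \<subseteq> carrier R \<Longrightarrow> h (mset_monomial R m) = mset_monomial S (image_mset h m)"
proof (induction m)
  case (add x m)
  then have "set_mset (image_mset h m) \<subseteq> carrier S" by auto
  then show ?case
    using add R.mset_monomial_closed[of m]
    by (simp add: R.mset_monomial_add_mset S.mset_monomial_add_mset)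
qed simp

text \<open>Algebraic independence of residue classes modulo \<open>P\<close>, stated for
  representatives in \<open>R\<close>. The variables are elements of \<open>S\<close>, not classes,
  so for a subring \<open>F\<close> and a proper ideal \<open>P\<close> two distinct congruent
  elements already violate it through their difference.\<close>

definition indep_mod :: "('a, 'm) ring_scheme \<Rightarrow> 'a set \<Rightarrow> 'a set \<Rightarrow> 'a set \<Rightarrow> bool"
  where "indep_mod R P F S \<longleftrightarrow> S \<subseteq> carrier R \<and>
    (\<forall>M c. finite M \<and> (\<forall>m\<in>M. set_mset m \<subseteq> S) \<and> c \<in> M \<rightarrow> F \<and>
       (\<Oplus>\<^bsub>R\<^esub>m\<in>M. c m \<otimes>\<^bsub>R\<^esub> mset_monomial R m) \<in> P \<longrightarrow> (\<forall>m\<in>M. c m \<in> P))"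

lemma algebraically_indep_iff: "algebraically_indep R F S \<longleftrightarrow> indep_mod R {\<zero>\<^bsub>R\<^esub>} F S"
  unfolding algebraically_indep_def indep_mod_def by simp

lemma indep_modD:
  assumes "indep_mod R P F S" "finite M" "\<And>m. m \<in> M \<Longrightarrow> set_mset m \<subseteq> S" "\<And>m. m \<in> M \<Longrightarrow> c m \<in> F"
    "(\<Oplus>\<^bsub>R\<^esub>m\<in>M. c m \<otimes>\<^bsub>R\<^esub> mset_monomial R m) \<in> P" "m \<in> M"
  shows "c m \<in> P"
  using assms(1) assms(2-) unfolding indep_mod_def by blast

lemma indep_mod_closed: "indep_mod R P F S \<Longrightarrow> S \<subseteq> carrier R"
  unfolding indep_mod_def by blast

lemma indep_mod_subset: "indep_mod R P F S \<Longrightarrow> S' \<subseteq> S \<Longrightarrow> indep_mod R P F S'"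
  unfolding indep_mod_def by (meson order_trans)

lemma (in cring) indep_mod_empty:
  assumes "F \<subseteq> carrier R"
  shows "indep_mod R P F {}"
  unfolding indep_mod_def
proof (intro conjI allI impI ballI)
  fix M c m assume a: "finite M \<and> (\<forall>m\<in>M. set_mset m \<subseteq> {}) \<and> c \<in> M \<rightarrow> F \<and>
    (\<Oplus>m\<in>M. c m \<otimes> mset_monomial R m) \<in> P" and m: "m \<in> M"
  then have "M = {{#}}" by auto
  moreover have "c {#} \<in> carrier R" using a m assms \<open>M = {{#}}\<close> by auto
  ultimately show "c m \<in> P" using a m by simp
qed simp

lemma (in ring_hom_cring) hom_finsum_monomials:
  assumes "finite M" "\<And>m. m \<in> M \<Longrightarrow> set_mset m \<subseteq> carrier R" "\<And>m. m \<in> M \<Longrightarrow> c m \<in> carrier R"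
  shows "h (\<Oplus>m\<in>M. c m \<otimes> mset_monomial R m)
    = (\<Oplus>\<^bsub>S\<^esub>m\<in>M. h (c m) \<otimes>\<^bsub>S\<^esub> mset_monomial S (image_mset h m))"
proof -
  have cl: "(\<lambda>m. c m \<otimes> mset_monomial R m) \<in> M \<rightarrow> carrier R"
    using assms R.mset_monomial_closed by blast
  have "h (\<Oplus>m\<in>M. c m \<otimes> mset_monomial R m)
      = (\<Oplus>\<^bsub>S\<^esub>m\<in>M. (h \<circ> (\<lambda>m. c m \<otimes> mset_monomial R m)) m)"
    using hom_finsum[OF cl] by (simp add: comp_def)
  also have "\<dots> = (\<Oplus>\<^bsub>S\<^esub>m\<in>M. h (c m) \<otimes>\<^bsub>S\<^esub> mset_monomial S (image_mset h m))"
  proof (rule S.finsum_cong')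
    show "(\<lambda>m. h (c m) \<otimes>\<^bsub>S\<^esub> mset_monomial S (image_mset h m)) \<in> M \<rightarrow> carrier S"
    proof
      fix m assume m: "m \<in> M"
      have "set_mset (image_mset h m) \<subseteq> carrier S" using assms(2)[OF m] by auto
      then show "h (c m) \<otimes>\<^bsub>S\<^esub> mset_monomial S (image_mset h m) \<in> carrier S"
        using assms(3)[OF m] S.mset_monomial_closed by simp
    qed
    fix m assume m: "m \<in> M"
    then show "(h \<circ> (\<lambda>m. c m \<otimes> mset_monomial R m)) m
        = h (c m) \<otimes>\<^bsub>S\<^esub> mset_monomial S (image_mset h m)"
      using assms R.mset_monomial_closed[OF assms(2)[OF m]] by (simp add: hom_mset_monomial)
  qed simp
  finally show ?thesis .
qed

text \<open>Injectivity on \<open>Y\<close> comes from the relation \<open>x - y\<close>: if it lay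
  in the kernel, so would its coefficient one. Given injectivity, \<open>image_mset h\<close>
  matches the monomials on both sides, and coefficients are lifted along \<open>h\<close>.\<close>

lemma (in ring_hom_cring) indep_mod_iff_image:
  assumes F: "subring F R" and one: "\<one>\<^bsub>S\<^esub> \<noteq> \<zero>\<^bsub>S\<^esub>" and Y: "Y \<subseteq> carrier R"
  shows "indep_mod R {r \<in> carrier R. h r = \<zero>\<^bsub>S\<^esub>} F Y
    \<longleftrightarrow> inj_on h Y \<and> algebraically_indep S (h ` F) (h ` Y)" (is "?L \<longleftrightarrow> ?R")
proof
  note Fc = subsetD[OF subringE(1)[OF F]]
  let ?P = "{r \<in> carrier R. h r = \<zero>\<^bsub>S\<^esub>}"
  assume L: ?L
  have inj: "inj_on h Y"
  proof (rule inj_onI, rule ccontr)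
    fix x y assume xy: "x \<in> Y" "y \<in> Y" "h x = h y" "x \<noteq> y"
    have c: "x \<in> carrier R" "y \<in> carrier R" using xy Y by auto
    let ?c = "\<lambda>m. if m = {#x#} then \<one> else \<ominus> \<one>"
    have "(\<Oplus>m\<in>{{#x#}, {#y#}}. ?c m \<otimes> mset_monomial R m) = x \<oplus> (\<ominus> \<one>) \<otimes> y"
      using c xy(4) by (subst R.finsum_insert) (auto simp: R.mset_monomial_single)
    then have "h (\<Oplus>m\<in>{{#x#}, {#y#}}. ?c m \<otimes> mset_monomial R m) = \<zero>\<^bsub>S\<^esub>"
      using c xy(3) by (simp add: R.l_minus S.r_neg)
    then have "(\<Oplus>m\<in>{{#x#}, {#y#}}. ?c m \<otimes> mset_monomial R m) \<in> ?P"
      using c R.mset_monomial_single by (auto intro!: R.finsum_closed)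
    then have "?c {#x#} \<in> ?P"
      using xy(1,2) subringE(3,5)[OF F] by (intro indep_modD[OF L]) auto
    then show False using one by simp
  qed
  moreover have "algebraically_indep S (h ` F) (h ` Y)"
    unfolding algebraically_indep_iff indep_mod_def
  proof (intro conjI allI impI ballI)
    show "h ` Y \<subseteq> carrier S" using Y by auto
    fix M c m0 assume a: "finite M \<and> (\<forall>m\<in>M. set_mset m \<subseteq> h ` Y) \<and> c \<in> M \<rightarrow> h ` F \<and>
      (\<Oplus>\<^bsub>S\<^esub>m\<in>M. c m \<otimes>\<^bsub>S\<^esub> mset_monomial S m) \<in> {\<zero>\<^bsub>S\<^esub>}" and m0: "m0 \<in> M"
    let ?g = "image_mset (inv_into Y h)"
    have hg: "image_mset h (?g m) = m" if "m \<in> M" for m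
    proof -
      have "set_mset m \<subseteq> h ` Y" using a that by blast
      then have "image_mset h (?g m) = image_mset (\<lambda>x. x) m"
        unfolding image_mset.compositionality comp_def
        by (intro image_mset_cong) (auto simp: f_inv_into_f)
      then show ?thesis by simp
    qed
    have gY: "set_mset (?g m) \<subseteq> Y" if "m \<in> M" for m
    proof -
      have "set_mset m \<subseteq> h ` Y" using a that by blast
      then show ?thesis using inv_into_into[of _ h Y] by auto
    qed
    have inj_g: "inj_on ?g M" using hg by (metis inj_onI)
    have "\<forall>m\<in>M. \<exists>d\<in>F. h d = c m"
    proof
      fix m assume "m \<in> M"
      then have "c m \<in> h ` F" using a by blast
      then show "\<exists>d\<in>F. h d = c m" by auto
    qed
    then obtain d where d: "\<And>m. m \<in> M \<Longrightarrow> d m \<in> F" "\<And>m. m \<in> M \<Longrightarrow> h (d m) = c m" by metis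
    let ?M = "?g ` M" and ?c = "\<lambda>m. d (image_mset h m)"
    have cM: "?c m \<in> F" if "m \<in> ?M" for m using that hg d(1) by auto
    have MY: "set_mset m \<subseteq> Y" if "m \<in> ?M" for m using that gY by blast
    have clM: "(\<lambda>m. h (?c m) \<otimes>\<^bsub>S\<^esub> mset_monomial S (image_mset h m)) \<in> ?M \<rightarrow> carrier S"
    proof
      fix m assume m: "m \<in> ?M"
      have "set_mset (image_mset h m) \<subseteq> carrier S" using MY[OF m] Y by auto
      then show "h (?c m) \<otimes>\<^bsub>S\<^esub> mset_monomial S (image_mset h m) \<in> carrier S"
        using S.mset_monomial_closed hom_closed[OF Fc[OF cM[OF m]]] by blast
    qed
    have "h (\<Oplus>m\<in>?M. ?c m \<otimes> mset_monomial R m)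
        = (\<Oplus>\<^bsub>S\<^esub>m\<in>?M. h (?c m) \<otimes>\<^bsub>S\<^esub> mset_monomial S (image_mset h m))"
      using a MY Y Fc[OF cM] by (intro hom_finsum_monomials) auto
    also have "\<dots> = (\<Oplus>\<^bsub>S\<^esub>m\<in>M. h (?c (?g m)) \<otimes>\<^bsub>S\<^esub> mset_monomial S (image_mset h (?g m)))"
      by (rule S.finsum_reindex[OF clM inj_g])
    also have "\<dots> = (\<Oplus>\<^bsub>S\<^esub>m\<in>M. c m \<otimes>\<^bsub>S\<^esub> mset_monomial S m)"
    proof (rule S.finsum_cong')
      show "(\<lambda>m. c m \<otimes>\<^bsub>S\<^esub> mset_monomial S m) \<in> M \<rightarrow> carrier S"
      proof
        fix m assume m: "m \<in> M"
        have "h ` Y \<subseteq> carrier S" using Y by auto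
        then have "set_mset m \<subseteq> carrier S" using a m by blast
        moreover have "c m \<in> carrier S" using d[OF m] Fc by (metis hom_closed)
        ultimately show "c m \<otimes>\<^bsub>S\<^esub> mset_monomial S m \<in> carrier S"
          using S.mset_monomial_closed by simp
      qed
    qed (use hg d in auto)
    finally have "h (\<Oplus>m\<in>?M. ?c m \<otimes> mset_monomial R m) = \<zero>\<^bsub>S\<^esub>" using a by simp
    moreover have "(\<Oplus>m\<in>?M. ?c m \<otimes> mset_monomial R m) \<in> carrier R"
      using MY Y Fc[OF cM] R.mset_monomial_closed by (intro R.finsum_closed) blast
    ultimately have "?c (?g m0) \<in> ?P"
      using a m0 MY cM by (intro indep_modD[OF L, of ?M ?c]) auto
    then show "c m0 \<in> {\<zero>\<^bsub>S\<^esub>}" using hg[OF m0] d(2)[OF m0] by simp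
  qed
  ultimately show ?R by blast
next
  note Fc = subsetD[OF subringE(1)[OF F]]
  assume R: ?R
  then have inj: "inj_on h Y" and ind: "algebraically_indep S (h ` F) (h ` Y)" by auto
  show ?L
    unfolding indep_mod_def
  proof (intro conjI allI impI ballI Y)
    fix M c m0 assume a: "finite M \<and> (\<forall>m\<in>M. set_mset m \<subseteq> Y) \<and> c \<in> M \<rightarrow> F \<and>
      (\<Oplus>m\<in>M. c m \<otimes> mset_monomial R m) \<in> {r \<in> carrier R. h r = \<zero>\<^bsub>S\<^esub>}" and m0: "m0 \<in> M"
    let ?g = "image_mset (inv_into Y h)"
    have gh: "?g (image_mset h m) = m" if "m \<in> M" for m
    proof -
      have "set_mset m \<subseteq> Y" using a that by blast
      then have "?g (image_mset h m) = image_mset (\<lambda>x. x) m"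
        unfolding image_mset.compositionality comp_def
        by (intro image_mset_cong) (auto simp: inv_into_f_f[OF inj])
      then show ?thesis by simp
    qed
    have inj_h: "inj_on (image_mset h) M" using gh by (metis inj_onI)
    let ?M = "image_mset h ` M" and ?c = "\<lambda>m. h (c (?g m))"
    have cF: "c m \<in> F" if "m \<in> M" for m using a that by blast
    have clM: "(\<lambda>m. ?c m \<otimes>\<^bsub>S\<^esub> mset_monomial S m) \<in> ?M \<rightarrow> carrier S"
    proof
      fix m' assume "m' \<in> ?M"
      then obtain m where m: "m \<in> M" "m' = image_mset h m" by blast
      have "set_mset m' \<subseteq> carrier S" using a m Y by auto
      then show "?c m' \<otimes>\<^bsub>S\<^esub> mset_monomial S m' \<in> carrier S"
        using S.mset_monomial_closed hom_closed[OF Fc[OF cF[OF m(1)]]] m gh by auto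
    qed
    have "\<zero>\<^bsub>S\<^esub> = (\<Oplus>\<^bsub>S\<^esub>m\<in>M. h (c m) \<otimes>\<^bsub>S\<^esub> mset_monomial S (image_mset h m))"
      using a Y Fc[OF cF] by (subst hom_finsum_monomials[symmetric]) auto
    also have "\<dots> = (\<Oplus>\<^bsub>S\<^esub>m\<in>M. ?c (image_mset h m) \<otimes>\<^bsub>S\<^esub> mset_monomial S (image_mset h m))"
    proof (rule S.finsum_cong')
      show "(\<lambda>m. ?c (image_mset h m) \<otimes>\<^bsub>S\<^esub> mset_monomial S (image_mset h m)) \<in> M \<rightarrow> carrier S"
        using clM by blast
    qed (use gh in auto)
    also have "\<dots> = (\<Oplus>\<^bsub>S\<^esub>m\<in>?M. ?c m \<otimes>\<^bsub>S\<^esub> mset_monomial S m)"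
      by (rule S.finsum_reindex[OF clM inj_h, symmetric])
    finally have eq: "(\<Oplus>\<^bsub>S\<^esub>m\<in>?M. ?c m \<otimes>\<^bsub>S\<^esub> mset_monomial S m) \<in> {\<zero>\<^bsub>S\<^esub>}" by simp
    have hM: "set_mset m' \<subseteq> h ` Y" if m': "m' \<in> ?M" for m'
    proof -
      obtain m where m: "m \<in> M" "m' = image_mset h m" using m' by blast
      then have "set_mset m \<subseteq> Y" using a by blast
      then show ?thesis using m(2) by (simp add: image_mono)
    qed
    have cM: "?c m' \<in> h ` F" if "m' \<in> ?M" for m'
      using that gh cF by auto
    have "?c (image_mset h m0) \<in> {\<zero>\<^bsub>S\<^esub>}"
      by (rule indep_modD[OF ind[unfolded algebraically_indep_iff] _ _ _ eq])
        (use a m0 hM cM in auto)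
    then show "c m0 \<in> {r \<in> carrier R. h r = \<zero>\<^bsub>S\<^esub>}" using gh[OF m0] Fc[OF cF[OF m0]] by simp
  qed
qed

lemma (in cring) polyle_normal_form:
  assumes F: "subring F R" and Y: "Y \<subseteq> carrier R" and "polyle R F Y n u"
  shows "\<exists>M c. finite M \<and> (\<forall>m\<in>M. set_mset m \<subseteq> Y) \<and> c \<in> M \<rightarrow> F \<and>
    u = (\<Oplus>m\<in>M. c m \<otimes> mset_monomial R m)"
  using assms(3)
proof (induction rule: polyle.induct)
  case (const a n)
  then show ?case
    using subringE(1)[OF F] by (intro exI[of _ "{{#}}"] exI[of _ "\<lambda>_. a"]) auto
next
  case (add n u v)
  note Fc = subsetD[OF subringE(1)[OF F]]
  obtain M c where M: "finite M" "\<And>m. m \<in> M \<Longrightarrow> set_mset m \<subseteq> Y" "\<And>m. m \<in> M \<Longrightarrow> c m \<in> F"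
    "u = (\<Oplus>m\<in>M. c m \<otimes> mset_monomial R m)" using add.IH(1) by blast
  obtain N d where N: "finite N" "\<And>m. m \<in> N \<Longrightarrow> set_mset m \<subseteq> Y" "\<And>m. m \<in> N \<Longrightarrow> d m \<in> F"
    "v = (\<Oplus>m\<in>N. d m \<otimes> mset_monomial R m)" using add.IH(2) by blast
  define c' where "c' m = (if m \<in> M then c m else \<zero>)" for m
  define d' where "d' m = (if m \<in> N then d m else \<zero>)" for m
  have mono: "mset_monomial R m \<in> carrier R" if "m \<in> M \<union> N" for m
    using that M(2) N(2) Y by (intro mset_monomial_closed) blast
  have cd: "c' m \<in> F" "d' m \<in> F" for m using M(3) N(3) subringE(2)[OF F] by (auto simp: c'_def d'_def)
  have "u = (\<Oplus>m\<in>M \<union> N. c' m \<otimes> mset_monomial R m)"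
    unfolding M(4) using M(1) N(1) mono Fc[OF cd(1)]
    by (intro add.finprod_mono_neutral_cong_left) (auto simp: c'_def d'_def)
  moreover have "v = (\<Oplus>m\<in>M \<union> N. d' m \<otimes> mset_monomial R m)"
    unfolding N(4) using M(1) N(1) mono Fc[OF cd(2)]
    by (intro add.finprod_mono_neutral_cong_left) (auto simp: c'_def d'_def)
  ultimately have "u \<oplus> v = (\<Oplus>m\<in>M \<union> N. c' m \<otimes> mset_monomial R m \<oplus> d' m \<otimes> mset_monomial R m)"
    using mono Fc[OF cd(1)] Fc[OF cd(2)] by (subst finsum_addf) auto
  also have "\<dots> = (\<Oplus>m\<in>M \<union> N. (c' m \<oplus> d' m) \<otimes> mset_monomial R m)"
    using mono Fc[OF cd(1)] Fc[OF cd(2)] by (intro finsum_cong') (auto simp: l_distr)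
  finally show ?case
    using M N cd subringE(7)[OF F] by (intro exI[of _ "M \<union> N"] exI[of _ "\<lambda>m. c' m \<oplus> d' m"]) auto
next
  case (mult n u y)
  note Fc = subsetD[OF subringE(1)[OF F]]
  obtain M c where M: "finite M" "\<And>m. m \<in> M \<Longrightarrow> set_mset m \<subseteq> Y" "\<And>m. m \<in> M \<Longrightarrow> c m \<in> F"
    "u = (\<Oplus>m\<in>M. c m \<otimes> mset_monomial R m)" using mult.IH by blast
  have y: "y \<in> carrier R" using mult.hyps Y by blast
  have MY: "set_mset m \<subseteq> carrier R" if "m \<in> M" for m using M(2)[OF that] Y by blast
  let ?c = "\<lambda>m. c (m - {#y#})"
  have cl: "(\<lambda>m. ?c m \<otimes> mset_monomial R m) \<in> add_mset y ` M \<rightarrow> carrier R"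
  proof
    fix m assume "m \<in> add_mset y ` M"
    then obtain m' where "m' \<in> M" "m = add_mset y m'" by blast
    then show "?c m \<otimes> mset_monomial R m \<in> carrier R"
      using mset_monomial_closed[of m] MY y Fc[OF M(3)] by auto
  qed
  have "y \<otimes> u = (\<Oplus>m\<in>M. y \<otimes> (c m \<otimes> mset_monomial R m))"
    unfolding M(4) using M(1) y Fc[OF M(3)] mset_monomial_closed[OF MY]
    by (intro finsum_rdistr) auto
  also have "\<dots> = (\<Oplus>m\<in>M. ?c (add_mset y m) \<otimes> mset_monomial R (add_mset y m))"
    using y Fc[OF M(3)] mset_monomial_closed[OF MY] mset_monomial_add_mset[OF y MY]
    by (intro finsum_cong') (auto simp: m_lcomm)
  also have "\<dots> = (\<Oplus>m\<in>add_mset y ` M. ?c m \<otimes> mset_monomial R m)"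
    by (rule finsum_reindex[OF cl, symmetric]) (auto intro: inj_onI)
  finally show ?case
    using M mult.hyps by (intro exI[of _ "add_mset y ` M"] exI[of _ ?c]) auto
qed

text \<open>A relation is sorted by powers of \<open>y\<close>. The coefficient \<open>a\<close> of
  the highest power is a combination of monomials in \<open>Y\<close> with non-zero coefficients,
  hence non-zero as \<open>Y\<close> is independent; the remaining terms have smaller powers of
  \<open>y\<close>.\<close>

lemma (in cring) dependent_alg_over:
  assumes F: "subring F R" and ind: "algebraically_indep R F Y" and y: "y \<in> carrier R"
    and dep: "\<not> algebraically_indep R F (insert y Y)"
  shows "alg_over R F Y y"
proof -
  note Fc = subsetD[OF subringE(1)[OF F]]
  have Y: "Y \<subseteq> carrier R" using ind by (simp add: algebraically_indep_def)
  have "insert y Y \<subseteq> carrier R" using Y y by simp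
  then obtain M0 c where M0': "finite M0 \<and> (\<forall>m\<in>M0. set_mset m \<subseteq> insert y Y) \<and> c \<in> M0 \<rightarrow> F \<and>
      (\<Oplus>m\<in>M0. c m \<otimes> mset_monomial R m) = \<zero>" and nz: "\<not> (\<forall>m\<in>M0. c m = \<zero>)"
    using dep unfolding algebraically_indep_def by blast
  have M0: "finite M0" "\<And>m. m \<in> M0 \<Longrightarrow> set_mset m \<subseteq> insert y Y" "\<And>m. m \<in> M0 \<Longrightarrow> c m \<in> F"
    "(\<Oplus>m\<in>M0. c m \<otimes> mset_monomial R m) = \<zero>" "\<exists>m\<in>M0. c m \<noteq> \<zero>"
    using M0' nz by auto
  \<comment> \<open>Only terms with non-zero coefficient are kept, so that the top power
    \<open>r\<close> of \<open>y\<close> really occurs.\<close>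
  define M where "M = {m \<in> M0. c m \<noteq> \<zero>}"
  have M: "finite M" "M \<noteq> {}" "\<And>m. m \<in> M \<Longrightarrow> set_mset m \<subseteq> insert y Y"
    "\<And>m. m \<in> M \<Longrightarrow> c m \<in> F" "\<And>m. m \<in> M \<Longrightarrow> c m \<noteq> \<zero>"
    using M0 by (auto simp: M_def)
  have M0c: "mset_monomial R m \<in> carrier R" if "m \<in> M0" for m
    using M0(2)[OF that] y Y by (intro mset_monomial_closed) blast
  have sumM: "(\<Oplus>m\<in>M. c m \<otimes> mset_monomial R m) = \<zero>"
    unfolding M0(4)[symmetric] using M0 M0c Fc[OF M0(3)]
    by (intro add.finprod_mono_neutral_cong_left) (auto simp: M_def)
  define r where "r = Max ((\<lambda>m. count m y) ` M)"
  define Mr where "Mr = {m \<in> M. count m y = r}"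
  define Ml where "Ml = {m \<in> M. count m y < r}"
  have le_r: "count m y \<le> r" if "m \<in> M" for m unfolding r_def using M(1) that by simp
  have sub: "Mr \<subseteq> M" "Ml \<subseteq> M" by (auto simp: Mr_def Ml_def)
  have Mc: "mset_monomial R m \<in> carrier R" if "m \<in> M" for m using M0c that by (simp add: M_def)
  have MM: "M = Mr \<union> Ml" "Mr \<inter> Ml = {}" "finite Mr" "finite Ml"
    using le_r M(1) by (auto simp: Mr_def Ml_def order_le_less)
  have "r \<in> (\<lambda>m. count m y) ` M" unfolding r_def using M(1,2) by (intro Max_in) auto
  then have Mr_ne: "Mr \<noteq> {}" by (auto simp: Mr_def)
  define del where "del = filter_mset (\<lambda>x. x \<noteq> y)"
  have del: "set_mset (del m) \<subseteq> Y" if "m \<in> M" for m using M(3)[OF that] by (auto simp: del_def)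
  have delc: "mset_monomial R (del m) \<in> carrier R" if "m \<in> M" for m
    using del[OF that] Y by (intro mset_monomial_closed) blast
  have mono: "mset_monomial R m = mset_monomial R (del m) \<otimes> y [^] count m y" if "m \<in> M" for m
    unfolding del_def using M(3)[OF that] Y y by (intro mset_monomial_split) auto
  have cM: "c m \<in> carrier R" if "m \<in> M" for m using Fc[OF M(4)[OF that]] .
  define D where "D = (\<Sum>m\<in>M. size (del m))"
  have pol: "polyle R F Y D (c m \<otimes> mset_monomial R (del m))" if "m \<in> M" for m
  proof -
    have "polyle R F Y (1 * size (del m)) (mset_monomial R (del m))"
      using del[OF that] polyle_base[OF F Y, of _ 0] by (intro polyle_mset_monomial[OF F Y]) auto
    moreover have "size (del m) \<le> D" unfolding D_def using M(1) that by (intro member_le_sum) auto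
    ultimately show ?thesis
      using polyle_smult[OF F Y polyle_le[OF F Y] M(4)[OF that]] by simp
  qed
  define a where "a = (\<Oplus>m\<in>Mr. c m \<otimes> mset_monomial R (del m))"
  have a_pol: "polyle R F Y D a"
    unfolding a_def using MM pol by (intro polyle_finsum[OF F Y]) auto
  have "a \<noteq> \<zero>"
  proof
    assume a0: "a = \<zero>"
    \<comment> \<open>Removing \<open>y\<close> keeps these monomials distinct because each of them
      contains it exactly \<open>r\<close> times.\<close>
    have inj: "inj_on del Mr"
    proof (rule inj_onI)
      fix m m' assume mm: "m \<in> Mr" "m' \<in> Mr" "del m = del m'"
      have e: "m = del m + replicate_mset (count m y) y" for m
        unfolding del_def by (rule multiset_eqI) auto
      show "m = m'" using e[of m] e[of m'] mm by (simp add: Mr_def)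
    qed
    let ?c = "\<lambda>n. c (inv_into Mr del n)"
    have inv: "inv_into Mr del (del m) = m" if "m \<in> Mr" for m using inv_into_f_f[OF inj that] .
    have Mrc: "c m \<in> carrier R" "mset_monomial R (del m) \<in> carrier R" if "m \<in> Mr" for m
      using that MM cM delc by auto
    have cl: "(\<lambda>n. ?c n \<otimes> mset_monomial R n) \<in> del ` Mr \<rightarrow> carrier R"
      using inv Mrc by auto
    have "(\<Oplus>n\<in>del ` Mr. ?c n \<otimes> mset_monomial R n) = (\<Oplus>m\<in>Mr. ?c (del m) \<otimes> mset_monomial R (del m))"
      by (rule finsum_reindex[OF cl inj])
    also have "\<dots> = a" unfolding a_def using inv Mrc by (intro finsum_cong') auto
    finally have eq: "(\<Oplus>n\<in>del ` Mr. ?c n \<otimes> mset_monomial R n) \<in> {\<zero>}" using a0 by simp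
    obtain m where m: "m \<in> Mr" using Mr_ne by blast
    have "?c (del m) \<in> {\<zero>}"
      by (rule indep_modD[OF ind[unfolded algebraically_indep_iff] _ _ _ eq])
        (use MM del M(4) m inv in auto)
    then show False using inv[OF m] M(5) m MM by auto
  qed
  moreover have "a \<otimes> y [^] r \<in> lower_powers R F Y y r D"
  proof -
    have "\<zero> = (\<Oplus>m\<in>Mr. c m \<otimes> mset_monomial R m) \<oplus> (\<Oplus>m\<in>Ml. c m \<otimes> mset_monomial R m)"
      unfolding sumM[symmetric] MM(1) using MM(2-4) Mc cM sub
      by (intro finsum_Un_disjoint) blast+
    moreover have "(\<Oplus>m\<in>Mr. c m \<otimes> mset_monomial R m) = a \<otimes> y [^] r"
    proof -
      have "a \<otimes> y [^] r = (\<Oplus>m\<in>Mr. c m \<otimes> mset_monomial R (del m) \<otimes> y [^] r)"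
        unfolding a_def using MM y cM delc by (intro finsum_ldistr) auto
      also have "\<dots> = (\<Oplus>m\<in>Mr. c m \<otimes> mset_monomial R m)"
      proof (rule finsum_cong')
        show "(\<lambda>m. c m \<otimes> mset_monomial R m) \<in> Mr \<rightarrow> carrier R"
          using Mc cM sub by blast
        fix m assume "m \<in> Mr"
        then have m: "m \<in> M" "count m y = r" by (auto simp: Mr_def)
        show "c m \<otimes> mset_monomial R (del m) \<otimes> y [^] r = c m \<otimes> mset_monomial R m"
          unfolding mono[OF m(1)] m(2) using cM[OF m(1)] delc[OF m(1)] y by (simp add: m_assoc)
      qed simp
      finally show ?thesis by simp
    qed
    moreover have low: "(\<Oplus>m\<in>Ml. c m \<otimes> mset_monomial R m) \<in> lower_powers R F Y y r D"
      unfolding lower_powers_def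
    proof (rule finsum_mem_addcl[OF lower_gens_closed[OF F Y y] MM(4)])
      fix m assume "m \<in> Ml"
      then have m: "m \<in> M" "count m y < r" by (auto simp: Ml_def)
      have "c m \<otimes> mset_monomial R m = c m \<otimes> mset_monomial R (del m) \<otimes> y [^] count m y"
        unfolding mono[OF m(1)] using cM[OF m(1)] delc[OF m(1)] y by (simp add: m_assoc)
      then show "c m \<otimes> mset_monomial R m \<in> addcl R {w \<otimes> y [^] i | w i. polyle R F Y D w \<and> i < r}"
        using lower_powersI[OF F Y y pol[OF m(1)] m(2)] by (simp add: lower_powers_def)
    qed
    moreover have ac: "a \<otimes> y [^] r \<in> carrier R" using polyle_closed[OF F Y a_pol] y by simp
    moreover have bc: "(\<Oplus>m\<in>Ml. c m \<otimes> mset_monomial R m) \<in> carrier R"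
      using low addcl_closed[OF lower_gens_closed[OF F Y y]] unfolding lower_powers_def by blast
    ultimately have "a \<otimes> y [^] r = \<ominus> \<one> \<otimes> (\<Oplus>m\<in>Ml. c m \<otimes> mset_monomial R m)"
      using minus_equality[of "a \<otimes> y [^] r" "\<Oplus>m\<in>Ml. c m \<otimes> mset_monomial R m"] by (simp add: l_minus)
    moreover have "polyle R F Y 0 (\<ominus> \<one>)"
      using subringE(3,5)[OF F] by (intro polyle.const) auto
    ultimately show ?thesis
      using lower_powers_polyle_mult[OF F Y y _ low, of 0 "\<ominus> \<one>"] by simp
  qed
  ultimately show ?thesis unfolding alg_over_def using a_pol by blast
qed

lemma (in cring) polyle_mono:
  assumes "polyle R F Y n u" "F \<subseteq> F'" "Y \<subseteq> Y'"
  shows "polyle R F' Y' n u"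
  using assms(1) by (induction rule: polyle.induct) (use assms(2,3) in \<open>auto intro: polyle.intros\<close>)

lemma (in cring) alg_over_mono:
  assumes "alg_over R F Y y" "F \<subseteq> F'" "Y \<subseteq> Y'"
  shows "alg_over R F' Y' y"
proof -
  obtain r n c where c: "c \<noteq> \<zero>" "polyle R F Y n c" "c \<otimes> y [^] r \<in> lower_powers R F Y y r n"
    using assms(1) unfolding alg_over_def by blast
  have "c \<otimes> y [^] r \<in> lower_powers R F' Y' y r n"
    using c(3) unfolding lower_powers_def
    by (rule addcl_mono[rotated]) (use polyle_mono[OF _ assms(2,3)] in blast)
  then show ?thesis
    unfolding alg_over_def using c(1) polyle_mono[OF c(2) assms(2,3)] by blast
qed

lemma (in domain) growth_finite:
  assumes F: "subring F R" and "finite Y" "Y \<subseteq> carrier R"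
  shows "growth R F (card Y) Y"
  using assms(2,3)
proof (induction Y)
  case empty
  have "u \<in> lspan R F {\<one>}" if "polyle R F {} n u" for n u
  proof -
    have "u \<in> F" using that
      by (induction rule: polyle.induct) (use subringE(7)[OF F] in auto)
    then have "u \<otimes> \<one> \<in> lspan R F {\<one>}"
      unfolding lspan_def using subringE(1)[OF F] by (intro addcl_base) auto
    then show ?thesis using \<open>u \<in> F\<close> subsetD[OF subringE(1)[OF F]] by simp
  qed
  moreover have "u \<in> carrier R" if "polyle R F {} n u" for n u
    using polyle_closed[OF F _ that] by simp
  ultimately show ?case
    unfolding growth_def
    by (intro exI[of _ 1] exI[of _ \<one>] conjI allI exI[of _ "{\<one>}"] impI) auto
next
  case (insert y Y)
  then show ?case using growth_insert[OF F, of Y "card Y" y] by simp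
qed

lemma (in domain) growth_alg_union:
  assumes F: "subring F R" and Y: "Y \<subseteq> carrier R" and "growth R F e Y"
    and "finite Z" "Z \<subseteq> carrier R" "\<And>z. z \<in> Z \<Longrightarrow> alg_over R F Y z"
  shows "growth R F e (Y \<union> Z)"
  using assms(4-)
proof (induction Z)
  case (insert z Z)
  have "alg_over R F (Y \<union> Z) z"
    using alg_over_mono[of F Y z F "Y \<union> Z"] insert.prems by blast
  then show ?case
    using growth_alg[OF F, of "Y \<union> Z" e z] insert Y by simp
qed (simp add: assms(3))

text \<open>The monomials in \<open>Z\<close> with all exponents at most \<open>n\<close> number
  \<open>Suc n ^ card Z\<close> and are independent over \<open>F\<close>. Their degree in
  \<open>Y\<close> is at most \<open>t * n * card Z\<close>, where growth leaves room for only a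
  multiple of \<open>Suc n ^ e\<close>; for large \<open>n\<close> this is a contradiction unless
  \<open>card Z \<le> e\<close>.\<close>

lemma (in domain) growth_bounds_indep:
  assumes F: "subring F R" and Y: "Y \<subseteq> carrier R" and gr: "growth R F e Y"
    and Z: "finite Z" "\<And>z. z \<in> Z \<Longrightarrow> polyle R F Y t z" and ind: "algebraically_indep R F Z"
  shows "card Z \<le> e"
proof (rule ccontr)
  assume "\<not> card Z \<le> e"
  then have eZ: "Suc e \<le> card Z" by simp
  note Fc = subringE(1)[OF F]
  have Zc: "Z \<subseteq> carrier R" using polyle_closed[OF F Y Z(2)] by blast
  obtain C g where g: "g \<in> carrier R" "g \<noteq> \<zero>" and gr: "\<And>n. \<exists>E. finite E \<and> E \<subseteq> carrier R \<and>
      card E \<le> C * Suc n ^ e \<and> (\<forall>u. polyle R F Y n u \<longrightarrow> g [^] n \<otimes> u \<in> lspan R F E)"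
    using gr unfolding growth_def by blast
  define K where "K = card Z"
  \<comment> \<open>This choice absorbs the constant: since
    \<open>Suc N \<le> Suc (t * K) * Suc n\<close>, the spanning set has at most
    \<open>n * Suc n ^ e\<close> elements, fewer than \<open>Suc n ^ Suc e\<close>.\<close>
  define n where "n = C * Suc (t * K) ^ e"
  define N where "N = t * (n * K)"
  define ms where "ms = (\<lambda>f. \<Sum>z\<in>Z. replicate_mset (f z) z)"
  define J where "J = ms ` (Z \<rightarrow>\<^sub>E {..n})"
  have count_ms: "count (ms f) x = (if x \<in> Z then f x else 0)" for f x
    unfolding ms_def count_sum using Z(1) by (simp add: if_distrib cong: if_cong)
  have "inj_on ms (Z \<rightarrow>\<^sub>E {..n})"
  proof (rule inj_onI)
    fix f f' assume f: "f \<in> Z \<rightarrow>\<^sub>E {..n}" "f' \<in> Z \<rightarrow>\<^sub>E {..n}" "ms f = ms f'"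
    show "f = f'"
    proof (rule PiE_ext[OF f(1,2)])
      fix x assume "x \<in> Z"
      then show "f x = f' x" using count_ms[of f x] count_ms[of f' x] f(3) by simp
    qed
  qed
  then have cardJ: "card J = Suc n ^ K"
    unfolding J_def K_def using Z(1) by (simp add: card_image card_PiE)
  have finJ: "finite J" unfolding J_def using Z(1) by (intro finite_imageI finite_PiE) auto
  have setJ: "set_mset m \<subseteq> Z" "size m \<le> n * K" if m: "m \<in> J" for m
  proof -
    obtain f where f: "f \<in> Z \<rightarrow>\<^sub>E {..n}" "m = ms f" using m unfolding J_def by blast
    show "set_mset m \<subseteq> Z"
      using count_ms[of f] f(2) by (auto simp: set_mset_def split: if_splits)
    have "size m = (\<Sum>z\<in>Z. f z)" unfolding f(2) ms_def by (simp add: size_multiset_sum)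
    also have "\<dots> \<le> (\<Sum>z\<in>Z. n)" using f(1) by (intro sum_mono) auto
    finally show "size m \<le> n * K" by (simp add: K_def mult.commute)
  qed
  have polJ: "polyle R F Y N (mset_monomial R m)" if "m \<in> J" for m
  proof (rule polyle_le[OF F Y])
    show "polyle R F Y (t * size m) (mset_monomial R m)"
      using setJ(1)[OF that] Z(2) by (intro polyle_mset_monomial[OF F Y]) blast
    show "t * size m \<le> N" unfolding N_def using setJ(2)[OF that] by simp
  qed
  obtain E where E: "finite E" "E \<subseteq> carrier R" "card E \<le> C * Suc N ^ e"
    "\<And>u. polyle R F Y N u \<Longrightarrow> g [^] N \<otimes> u \<in> lspan R F E" using gr by blast
  have "Suc N \<le> Suc (t * K) * Suc n" by (simp add: N_def algebra_simps)
  then have "C * Suc N ^ e \<le> C * (Suc (t * K) * Suc n) ^ e" by (intro mult_le_mono2 power_mono) simp_all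
  also have "\<dots> = n * Suc n ^ e" by (simp only: n_def power_mult_distrib mult_ac)
  also have "\<dots> < Suc n ^ Suc e" by simp
  also have "\<dots> \<le> Suc n ^ K" unfolding K_def using eZ by (intro power_increasing) auto
  finally have "card E < card J" using E(3) cardJ by simp
  moreover have "(\<lambda>m. g [^] N \<otimes> mset_monomial R m) \<in> J \<rightarrow> lspan R F E" using E(4) polJ by blast
  ultimately obtain c where c: "c \<in> J \<rightarrow> F" "\<exists>m\<in>J. c m \<noteq> \<zero>"
    "(\<Oplus>m\<in>J. c m \<otimes> (g [^] N \<otimes> mset_monomial R m)) = \<zero>"
    using lspan_dependent[OF F E(1,2) finJ] by blast
  have cc: "c m \<in> carrier R" "mset_monomial R m \<in> carrier R" if "m \<in> J" for m
    using that c(1) Fc polyle_closed[OF F Y polJ[OF that]] by auto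
  have "g [^] N \<otimes> (\<Oplus>m\<in>J. c m \<otimes> mset_monomial R m) = (\<Oplus>m\<in>J. g [^] N \<otimes> (c m \<otimes> mset_monomial R m))"
    using finJ g cc by (intro finsum_rdistr) auto
  also have "\<dots> = \<zero>"
    unfolding c(3)[symmetric] using cc g by (intro finsum_cong') (auto simp: m_lcomm)
  finally have "(\<Oplus>m\<in>J. c m \<otimes> mset_monomial R m) = \<zero>"
    using pow_nonzero[OF g] g(1) cc integral[of "g [^] N" "\<Oplus>m\<in>J. c m \<otimes> mset_monomial R m"]
    by (auto intro!: finsum_closed)
  then have "\<forall>m\<in>J. c m = \<zero>"
    using ind finJ setJ(1) c(1) unfolding algebraically_indep_def by blast
  then show False using c(2) by blast
qed


lemma (in domain) indep_alg_over:
  assumes F: "subring F R" and ind: "algebraically_indep R F Y" and y: "y \<in> carrier R"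
    and dep: "y \<in> Y \<or> \<not> algebraically_indep R F (insert y Y)"
  shows "alg_over R F Y y"
proof (cases "y \<in> Y")
  case True
  have Y: "Y \<subseteq> carrier R" using ind by (simp add: algebraically_indep_def)
  \<comment> \<open>An element of \<open>Y\<close> is a root of a linear equation with leading
    coefficient one and constant term in \<open>Y\<close>, hence \<open>r = 1\<close> and degree
    one.\<close>
  have "y \<otimes> y [^] (0::nat) \<in> lower_powers R F Y y 1 1"
    using polyle_base[OF F Y True, of 0] by (intro lower_powersI[OF F Y y]) auto
  then have "\<one> \<otimes> y [^] (1::nat) \<in> lower_powers R F Y y 1 1" using y by simp
  then show ?thesis
    unfolding alg_over_def using one_not_zero polyle_one[OF F Y] by blast
qed (use dependent_alg_over[OF F ind y] dep in blast)

lemma algebraically_indep_subset: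
  "algebraically_indep R F S \<Longrightarrow> S' \<subseteq> S \<Longrightarrow> algebraically_indep R F S'"
  unfolding algebraically_indep_iff by (rule indep_mod_subset)

text \<open>Finitely many elements of the span involve only a finite \<open>Y \<subseteq> A\<close>.
  A maximal subset \<open>S\<close> of \<open>Y\<close> independent over \<open>F'\<close> makes
  every element of \<open>Y\<close> algebraic over it, and these relations remain valid over the
  larger ring \<open>F\<close>. So \<open>Y\<close> has growth exponent \<open>card S\<close> over
  \<open>F\<close>.\<close>

lemma (in domain) indep_span_bound:
  assumes F': "subring F' R" and F: "subring F R" and FF: "F' \<subseteq> F" and A: "A \<subseteq> carrier R"
    and bound: "\<And>S. \<lbrakk>finite S; S \<subseteq> A; algebraically_indep R F' S\<rbrakk> \<Longrightarrow> card S \<le> d"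
    and Z: "finite Z" "\<And>z. z \<in> Z \<Longrightarrow> z \<in> addcl R {b \<otimes> a | b a. b \<in> F \<and> a \<in> A}"
    and ind: "algebraically_indep R F Z"
  shows "card Z \<le> d"
proof -
  have fin: "\<exists>Y. finite Y \<and> Y \<subseteq> A \<and> polyle R F Y 1 z"
    if "z \<in> addcl R {b \<otimes> a | b a. b \<in> F \<and> a \<in> A}" for z
    using that
  proof induction
    case zero
    then show ?case using polyle_zero[OF F, of "{}"] by (intro exI[of _ "{}"]) auto
  next
    case (step s u)
    then obtain b a Y where e: "s = b \<otimes> a" "b \<in> F" "a \<in> A" "finite Y" "Y \<subseteq> A" "polyle R F Y 1 u"
      by blast
    have Yc: "insert a Y \<subseteq> carrier R" using e A by blast
    have "polyle R F (insert a Y) 1 (b \<otimes> a)"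
      using polyle_smult[OF F Yc polyle_base[OF F Yc, of a 0] e(2)] by simp
    moreover have "polyle R F (insert a Y) 1 u"
      by (rule polyle_mono[OF e(6)]) auto
    ultimately have "polyle R F (insert a Y) 1 (s \<oplus> u)" unfolding e(1) by (rule polyle.add)
    then show ?case using e by (intro exI[of _ "insert a Y"]) auto
  qed
  have "\<exists>Y. finite Y \<and> Y \<subseteq> A \<and> (\<forall>z\<in>Z. polyle R F Y 1 z)"
    using Z
  proof (induction Z)
    case empty
    then show ?case by blast
  next
    case (insert z Z)
    then obtain Y Y' where Y: "finite Y" "Y \<subseteq> A" "\<forall>z\<in>Z. polyle R F Y 1 z"
      "finite Y'" "Y' \<subseteq> A" "polyle R F Y' 1 z" using fin[of z] by auto
    have "polyle R F (Y \<union> Y') 1 x" if "x \<in> insert z Z" for x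
      using that polyle_mono[of F Y 1 x F "Y \<union> Y'"] polyle_mono[of F Y' 1 x F "Y \<union> Y'"] Y by auto
    then show ?case using Y by (intro exI[of _ "Y \<union> Y'"]) auto
  qed
  then obtain Y where Y: "finite Y" "Y \<subseteq> A" "\<And>z. z \<in> Z \<Longrightarrow> polyle R F Y 1 z" by blast
  have Yc: "Y \<subseteq> carrier R" using Y(2) A by blast
  let ?I = "{S. S \<subseteq> Y \<and> algebraically_indep R F' S}"
  have "{} \<in> ?I" using indep_mod_empty[OF subringE(1)[OF F']] by (simp add: algebraically_indep_iff)
  then obtain S where S: "S \<in> ?I" and max: "\<And>S'. S' \<in> ?I \<Longrightarrow> S \<subseteq> S' \<Longrightarrow> S' = S"
    using finite_has_maximal[of ?I] Y(1) by (metis (no_types, lifting) empty_iff finite_Pow_iff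
        finite_subset Pow_iff mem_Collect_eq subsetI)
  have Sf: "finite S" "S \<subseteq> Y" using S Y(1) finite_subset by auto
  have "alg_over R F S y" if "y \<in> Y" for y
  proof (rule alg_over_mono[OF indep_alg_over[OF F'] FF order_refl])
    show "y \<in> S \<or> \<not> algebraically_indep R F' (insert y S)"
      using max[of "insert y S"] that Sf(2) by blast
  qed (use S that Yc in auto)
  then have "growth R F (card S) (S \<union> Y)"
    using growth_alg_union[OF F _ growth_finite[OF F Sf(1)] Y(1) Yc] Sf(2) Yc by blast
  moreover have "S \<union> Y = Y" using Sf(2) by blast
  ultimately have "card Z \<le> card S"
    using growth_bounds_indep[OF F Yc _ Z(1) Y(3) ind] by simp
  also have "\<dots> \<le> d" using bound[of S] S Sf Y(2) by blast
  finally show ?thesis .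
qed

text \<open>An element \<open>z\<close> with \<open>s \<otimes> z = a\<close> satisfies a linear
  equation over \<open>D\<close>, whose elements are algebraic over \<open>Y\<close>. Adjoining to
  \<open>Y\<close> first the numerators and denominators and then the fractions therefore leaves the
  growth exponent at \<open>card Y\<close>.\<close>

lemma (in domain) indep_fractions_bound:
  assumes F: "subring F R" and D: "D \<subseteq> carrier R"
    and frac: "\<And>z. z \<in> carrier R \<Longrightarrow> \<exists>s\<in>D. \<exists>a\<in>D. s \<noteq> \<zero> \<and> s \<otimes> z = a"
    and Y: "finite Y" "Y \<subseteq> D" "algebraically_indep R F Y"
    and max: "\<And>y. y \<in> D \<Longrightarrow> y \<notin> Y \<Longrightarrow> \<not> algebraically_indep R F (insert y Y)"
    and ind: "algebraically_indep R F Z"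
  shows "finite Z \<and> card Z \<le> card Y"
proof -
  have Zc: "Z \<subseteq> carrier R" using ind by (simp add: algebraically_indep_def)
  have Yc: "Y \<subseteq> carrier R" using Y(2) D by blast
  have le: "card Z' \<le> card Y" if Z': "finite Z'" "Z' \<subseteq> Z" for Z'
  proof -
    have "\<forall>z\<in>Z'. \<exists>s. s \<in> D \<and> s \<otimes> z \<in> D \<and> s \<noteq> \<zero>" using frac Z'(2) Zc by blast
    from bchoice[OF this] obtain s where
      s: "\<forall>z\<in>Z'. s z \<in> D \<and> s z \<otimes> z \<in> D \<and> s z \<noteq> \<zero>" ..
    define a where "a z = s z \<otimes> z" for z
    have sa: "s z \<in> D" "a z \<in> D" "s z \<noteq> \<zero>" "s z \<otimes> z = a z" if "z \<in> Z'" for z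
      using s that by (auto simp: a_def)
    define W where "W = Y \<union> (s ` Z' \<union> a ` Z')"
    have W: "W \<subseteq> D" "W \<subseteq> carrier R" using sa Y(2) D by (auto simp: W_def)
    have "alg_over R F Y y" if "y \<in> D" for y
      using indep_alg_over[OF F Y(3)] max[OF that] that D by blast
    then have "growth R F (card Y) W"
      unfolding W_def using W Z'(1)
      by (intro growth_alg_union[OF F Yc growth_finite[OF F Y(1) Yc]]) (auto simp: W_def)
    moreover have "alg_over R F W z" if z: "z \<in> Z'" for z
    proof -
      have zc: "z \<in> carrier R" using z Z'(2) Zc by blast
      have sw: "s z \<in> W" "a z \<in> W" using z by (auto simp: W_def)
      have "a z \<otimes> z [^] (0::nat) \<in> lower_powers R F W z 1 1"
        using polyle_base[OF F W(2) sw(2), of 0] by (intro lower_powersI[OF F W(2) zc]) auto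
      moreover have "a z \<otimes> z [^] (0::nat) = s z \<otimes> z [^] (1::nat)"
        using sa(4)[OF z] sw W(2) zc by auto
      ultimately have "s z \<otimes> z [^] (1::nat) \<in> lower_powers R F W z 1 1" by simp
      moreover have "polyle R F W 1 (s z)" using polyle_base[OF F W(2) sw(1), of 0] by simp
      ultimately show ?thesis unfolding alg_over_def using sa(3)[OF z] by blast
    qed
    ultimately have "growth R F (card Y) (W \<union> Z')"
      using growth_alg_union[OF F W(2)] Z' Zc by blast
    moreover have "W \<union> Z' \<subseteq> carrier R" using W(2) Z'(2) Zc by blast
    moreover have "polyle R F (W \<union> Z') 1 z" if "z \<in> Z'" for z
      using polyle_base[OF F \<open>W \<union> Z' \<subseteq> carrier R\<close>, of z 0] that by simp
    ultimately show ?thesis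
      using growth_bounds_indep[OF F, of "W \<union> Z'" "card Y" Z' 1] Z'
        algebraically_indep_subset[OF ind Z'(2)] by blast
  qed
  moreover have "finite Z"
  proof (rule ccontr)
    assume "infinite Z"
    then obtain Z' where "Z' \<subseteq> Z" "finite Z'" "card Z' = Suc (card Y)"
      using infinite_arbitrarily_large by blast
    then show False using le[of Z'] by simp
  qed
  ultimately show ?thesis by blast
qed

lemma (in ideal) finsum_mem:
  assumes "finite J" "\<And>j. j \<in> J \<Longrightarrow> f j \<in> I"
  shows "(\<Oplus>j\<in>J. f j) \<in> I"
  using assms
proof (induction J)
  case empty
  then show ?case by (simp add: zero_closed)
next
  case (insert j J)
  then have "f \<in> insert j J \<rightarrow> carrier R" using a_Hcarr by blast
  then have "(\<Oplus>j\<in>insert j J. f j) = f j \<oplus> (\<Oplus>j\<in>J. f j)"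
    using insert by (intro finsum_insert) auto
  then show ?case using insert a_closed by simp
qed

lemma (in ideal) add_mem_cancel:
  assumes "x \<oplus> y \<in> I" "y \<in> I" "x \<in> carrier R"
  shows "x \<in> I"
proof -
  have "x = (x \<oplus> y) \<oplus> \<ominus> y" using assms a_Hcarr by (simp add: a_assoc r_neg)
  then show ?thesis using additive_subgroup.a_closed[OF is_additive_subgroup assms(1)
      additive_subgroup.a_inv_closed[OF is_additive_subgroup assms(2)]] by simp
qed

lemma (in cring) indep_mod_reindex:
  assumes ind: "indep_mod R P F S" and F: "F \<subseteq> carrier R" and I: "finite I" "inj_on f I"
    and f: "\<And>i. i \<in> I \<Longrightarrow> set_mset (f i) \<subseteq> S" and c: "\<And>i. i \<in> I \<Longrightarrow> c i \<in> F"
    and sum: "(\<Oplus>i\<in>I. c i \<otimes> mset_monomial R (f i)) \<in> P" and i: "i \<in> I"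
  shows "c i \<in> P"
proof -
  let ?c = "\<lambda>m. c (inv_into I f m)"
  have inv: "inv_into I f (f i) = i" if "i \<in> I" for i using inv_into_f_f[OF I(2) that] .
  have S: "S \<subseteq> carrier R" using indep_mod_closed[OF ind] .
  have cl: "c i \<in> carrier R" "mset_monomial R (f i) \<in> carrier R" if "i \<in> I" for i
    using c[OF that] F f[OF that] S by (auto intro!: mset_monomial_closed)
  have clf: "(\<lambda>m. ?c m \<otimes> mset_monomial R m) \<in> f ` I \<rightarrow> carrier R"
    using inv cl by auto
  have "(\<Oplus>m\<in>f ` I. ?c m \<otimes> mset_monomial R m) = (\<Oplus>i\<in>I. ?c (f i) \<otimes> mset_monomial R (f i))"
    by (rule finsum_reindex[OF clf I(2)])
  also have "\<dots> = (\<Oplus>i\<in>I. c i \<otimes> mset_monomial R (f i))"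
    using inv cl by (intro finsum_cong') auto
  finally have "(\<Oplus>m\<in>f ` I. ?c m \<otimes> mset_monomial R m) \<in> P" using sum by simp
  then have "?c (f i) \<in> P"
  proof (rule indep_modD[OF ind, rotated 3])
    show "?c m \<in> F" if m: "m \<in> f ` I" for m using m inv c by auto
    show "set_mset m \<subseteq> S" if m: "m \<in> f ` I" for m using m f by blast
  qed (use I i in auto)
  then show ?thesis using inv[OF i] by simp
qed

text \<open>In a chain of primes whose members meet \<open>F\<close> equally, elements witnessing the strictness of the
  inclusions are independent over \<open>F\<close>: divide a relation by the largest power of the first
  witness, and reduce modulo the second prime.\<close>

lemma (in cring) primeideal_chain_indep:
  assumes "\<And>i. i \<le> N \<Longrightarrow> primeideal (P i) R" "\<And>i. i < N \<Longrightarrow> P i \<subseteq> P (Suc i)"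
    and "\<And>i. i < N \<Longrightarrow> z i \<in> P (Suc i) - P i" and F: "F \<subseteq> carrier R" and "F \<inter> P N \<subseteq> P 0"
  shows "indep_mod R (P 0) F (z ` {..<N})"
  using assms(1-3,5)
proof (induction N arbitrary: P z)
  case 0
  then show ?case using indep_mod_empty[OF F] by simp
next
  case (Suc N)
  interpret P0: primeideal "P 0" R using Suc.prems(1)[of 0] by simp
  interpret P1: primeideal "P 1" R using Suc.prems(1)[of 1] by simp
  have P01: "P 0 \<subseteq> P 1" using Suc.prems(2)[of 0] by simp
  have P1N: "P 1 \<subseteq> P (Suc N)"
  proof -
    have "P 1 \<subseteq> P (Suc j)" if "j \<le> N" for j
      using that
    proof (induction j)
      case (Suc j)
      then show ?case using Suc.prems \<open>\<And>i. i < Suc N \<Longrightarrow> P i \<subseteq> P (Suc i)\<close>[of "Suc j"] by auto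
    qed simp
    then show ?thesis by blast
  qed
  define S where "S = (z \<circ> Suc) ` {..<N}"
  have IH: "indep_mod R (P 1) F S"
    using Suc.IH[of "P \<circ> Suc" "z \<circ> Suc"] Suc.prems P01 unfolding S_def comp_def
    by (simp add: subset_iff)
  have Sc: "S \<subseteq> carrier R" using indep_mod_closed[OF IH] .
  define y where "y = z 0"
  have y: "y \<in> P 1" "y \<notin> P 0" "y \<in> carrier R"
    using Suc.prems(3)[of 0] P1.a_Hcarr by (auto simp: y_def)
  have zS: "z ` {..<Suc N} = insert y S"
    unfolding S_def y_def lessThan_Suc_eq_insert_0 by (simp add: image_image)
  show ?case
    unfolding indep_mod_def zS
  proof (intro conjI allI impI)
    show "insert y S \<subseteq> carrier R" using y Sc by simp
    fix M c
    assume a: "finite M \<and> (\<forall>m\<in>M. set_mset m \<subseteq> insert y S) \<and> c \<in> M \<rightarrow> F \<and>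
      (\<Oplus>m\<in>M. c m \<otimes> mset_monomial R m) \<in> P 0"
    have cM: "c m \<in> carrier R" "c m \<in> F" if "m \<in> M" for m using a F that by auto
    have mM: "set_mset m \<subseteq> carrier R" if "m \<in> M" for m using a that y Sc by blast
    \<comment> \<open>Terms whose coefficient already lies in \<open>P 0\<close> are split off, so
      that the power of \<open>y\<close> divided out below is determined by the terms that
      matter.\<close>
    define M' where "M' = {m \<in> M. c m \<notin> P 0}"
    have M': "finite M'" "M' \<subseteq> M" using a by (auto simp: M'_def)
    have cl: "c m \<otimes> mset_monomial R m \<in> carrier R" if "m \<in> M" for m
      using cM[OF that] mset_monomial_closed[OF mM[OF that]] by simp
    have eq: "(\<Oplus>m\<in>M. c m \<otimes> mset_monomial R m)
        = (\<Oplus>m\<in>M'. c m \<otimes> mset_monomial R m) \<oplus> (\<Oplus>m\<in>M - M'. c m \<otimes> mset_monomial R m)"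
      using finsum_Un_disjoint[of M' "M - M'" "\<lambda>m. c m \<otimes> mset_monomial R m"] a M' cl
      by (simp add: Un_absorb1 Pi_iff subset_iff)
    have s2: "(\<Oplus>m\<in>M - M'. c m \<otimes> mset_monomial R m) \<in> P 0"
      using a mM by (intro P0.finsum_mem) (auto simp: M'_def intro!: P0.I_r_closed)
    have "(\<Oplus>m\<in>M'. c m \<otimes> mset_monomial R m) \<in> carrier R"
      using cl M'(2) by (intro finsum_closed) blast
    then have sum0: "(\<Oplus>m\<in>M'. c m \<otimes> mset_monomial R m) \<in> P 0"
      using P0.add_mem_cancel[OF _ s2] a unfolding eq by blast
    show "\<forall>m\<in>M. c m \<in> P 0"
    proof (rule ccontr)
      assume "\<not> ?thesis"
      then have ne: "M' \<noteq> {}" by (auto simp: M'_def)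
      define r where "r = Min ((\<lambda>m. count m y) ` M')"
      have r_le: "r \<le> count m y" if "m \<in> M'" for m unfolding r_def using M'(1) that by simp
      have "r \<in> (\<lambda>m. count m y) ` M'" unfolding r_def using M'(1) ne by (intro Min_in) auto
      then obtain m0 where m0: "m0 \<in> M'" "count m0 y = r" by auto
      define f where "f m = m - replicate_mset r y" for m
      have fm: "m = f m + replicate_mset r y" if "m \<in> M'" for m
        unfolding f_def using r_le[OF that]
        by (intro multiset_eqI) auto
      have fc: "set_mset (f m) \<subseteq> carrier R" if "m \<in> M'" for m
        unfolding f_def using mM[of m] M'(2) that by (meson in_diffD subset_iff)
      have mono: "mset_monomial R m = mset_monomial R (f m) \<otimes> y [^] r" if "m \<in> M'" for m
      proof -
        have "mset_monomial R m = mset_monomial R (f m + replicate_mset r y)"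
          using fm[OF that] by simp
        then show ?thesis
          using fc[OF that] y(3) mset_monomial_replicate[OF y(3), of r]
          by (simp add: mset_monomial_union in_replicate_mset subset_iff)
      qed
      have cl': "c m \<in> carrier R" "mset_monomial R (f m) \<in> carrier R" if "m \<in> M'" for m
        using cM M'(2) that mset_monomial_closed[OF fc] by auto
      define w where "w = (\<Oplus>m\<in>M'. c m \<otimes> mset_monomial R (f m))"
      have wc: "w \<in> carrier R" unfolding w_def using cl' by (intro finsum_closed) auto
      have "w \<otimes> y [^] r = (\<Oplus>m\<in>M'. c m \<otimes> mset_monomial R (f m) \<otimes> y [^] r)"
        unfolding w_def using M'(1) y cl' by (intro finsum_ldistr) auto
      also have "\<dots> = (\<Oplus>m\<in>M'. c m \<otimes> mset_monomial R m)"
      proof (rule finsum_cong')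
        show "(\<lambda>m. c m \<otimes> mset_monomial R m) \<in> M' \<rightarrow> carrier R" using cl M'(2) by blast
        show "c m \<otimes> mset_monomial R (f m) \<otimes> y [^] r = c m \<otimes> mset_monomial R m" if "m \<in> M'" for m
          unfolding mono[OF that] using cl'[OF that] y by (simp add: m_assoc)
      qed simp
      finally have "w \<otimes> y [^] r \<in> P 0" using sum0 by simp
      then have "w \<in> P 0"
        using P0.I_prime[OF wc, of "y [^] r"] P0.pow_notin[OF y(3,2)] y(3) by blast
      then have w1: "w \<in> P 1" using P01 by blast
      define M1 where "M1 = {m \<in> M'. count m y = r}"
      define M2 where "M2 = {m \<in> M'. r < count m y}"
      have MM: "M' = M1 \<union> M2" "M1 \<inter> M2 = {}" "finite M1" "finite M2" "M1 \<subseteq> M'" "M2 \<subseteq> M'"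
        using r_le M'(1) by (auto simp: M1_def M2_def order_le_less)
      \<comment> \<open>Terms still divisible by \<open>y\<close> vanish modulo \<open>P 1\<close>;
        the others involve only the later witnesses, so the induction hypothesis applies to
        them.\<close>
      have "c m \<otimes> mset_monomial R (f m) \<in> P 1" if "m \<in> M2" for m
      proof -
        have "0 < count (f m) y" using that by (simp add: M2_def f_def)
        then have m: "m \<in> M'" "y \<in># f m" using that by (simp_all add: M2_def)
        then obtain n where n: "f m = add_mset y n" by (meson multi_member_split)
        then have "mset_monomial R (f m) = y \<otimes> mset_monomial R n" "mset_monomial R n \<in> carrier R"
          using fc[OF m(1)] mset_monomial_add_mset[OF y(3), of n] mset_monomial_closed[of n] by auto
        then show ?thesis using cl'[OF m(1)] P1.I_r_closed[OF y(1)] P1.I_l_closed by simp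
      qed
      then have "(\<Oplus>m\<in>M2. c m \<otimes> mset_monomial R (f m)) \<in> P 1"
        using MM(4) by (intro P1.finsum_mem)
      moreover have "w = (\<Oplus>m\<in>M1. c m \<otimes> mset_monomial R (f m)) \<oplus> (\<Oplus>m\<in>M2. c m \<otimes> mset_monomial R (f m))"
        unfolding w_def MM(1) using MM cl' by (intro finsum_Un_disjoint) blast+
      moreover have "(\<Oplus>m\<in>M1. c m \<otimes> mset_monomial R (f m)) \<in> carrier R"
        using MM(5) cl' by (intro finsum_closed) blast
      ultimately have sum1: "(\<Oplus>m\<in>M1. c m \<otimes> mset_monomial R (f m)) \<in> P 1"
        using w1 P1.add_mem_cancel by simp
      have "c m0 \<in> P 1"
      proof (rule indep_mod_reindex[OF IH F MM(3) _ _ _ sum1])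
        show "inj_on f M1"
          using fm MM(5) by (intro inj_onI) (metis subsetD)
        show "set_mset (f m) \<subseteq> S" if "m \<in> M1" for m
        proof
          fix x assume x: "x \<in># f m"
          have "count (f m) y = 0" using that by (auto simp: M1_def f_def)
          then have "x \<noteq> y" using x by (metis not_in_iff)
          moreover have "x \<in># m" using x unfolding f_def by (rule in_diffD)
          ultimately show "x \<in> S" using a that MM(5) M'(2) by blast
        qed
        show "c m \<in> F" if "m \<in> M1" for m using cM that MM(5) M'(2) by blast
        show "m0 \<in> M1" using m0 by (simp add: M1_def)
      qed
      \<comment> \<open>The induction only gives membership in \<open>P 1\<close>. As the
        coefficient lies in \<open>F\<close>, and \<open>F\<close> meets the top prime only inside
        \<open>P 0\<close>, this suffices.\<close>
      then have "c m0 \<in> P 0" using Suc.prems(4) P1N cM(2) m0(1) M'(2) by blast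
      then show False using m0(1) by (simp add: M'_def)
    qed
  qed
qed


section \<open>Transcendence degree of algebras\<close>

definition scalars :: "('k, 'u) ring_scheme \<Rightarrow> ('k, 'a, 'm) module_scheme \<Rightarrow> 'a set"
  where "scalars k A = (\<lambda>c. c \<odot>\<^bsub>A\<^esub> \<one>\<^bsub>A\<^esub>) ` carrier k"

text \<open>A bound on the transcendence degree of \<open>A/p\<close>, tested on elements of
  \<open>A\<close> itself; for prime \<open>p\<close> both directions of the equivalence with
  \<open>quot_trdeg\<close> are proved in \<open>algebra_prime\<close>.\<close>

definition trdeg_le :: "('k, 'u) ring_scheme \<Rightarrow> ('k, 'a, 'm) module_scheme \<Rightarrow> 'a set \<Rightarrow> nat \<Rightarrow> bool"
  where "trdeg_le k A p d \<longleftrightarrow> (\<forall>S. finite S \<and> indep_mod A p (scalars k A) S \<longrightarrow> card S \<le> d)"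

definition residue_map :: "('a, 'm) ring_scheme \<Rightarrow> 'a set \<Rightarrow> 'a \<Rightarrow> ('a set \<times> 'a set) set"
  where "residue_map A p a = quotient_field_embed (A Quot p) (p +>\<^bsub>A\<^esub> a)"

lemma (in algebra) scalars_hom: "(\<lambda>c. c \<odot>\<^bsub>M\<^esub> \<one>\<^bsub>M\<^esub>) \<in> ring_hom R M"
proof (rule ring_hom_memI)
  fix x y assume xy: "x \<in> carrier R" "y \<in> carrier R"
  show "(x \<otimes> y) \<odot>\<^bsub>M\<^esub> \<one>\<^bsub>M\<^esub> = (x \<odot>\<^bsub>M\<^esub> \<one>\<^bsub>M\<^esub>) \<otimes>\<^bsub>M\<^esub> (y \<odot>\<^bsub>M\<^esub> \<one>\<^bsub>M\<^esub>)"
    using xy smult_assoc2[of x "\<one>\<^bsub>M\<^esub>" "y \<odot>\<^bsub>M\<^esub> \<one>\<^bsub>M\<^esub>"] by (simp add: smult_assoc1)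
qed (simp_all add: smult_l_distr)

lemma (in ring_hom_cring) subring_image:
  assumes "subring F R"
  shows "subring (h ` F) S"
proof (rule S.subringI)
  note Fc = subsetD[OF subringE(1)[OF assms]]
  show "h ` F \<subseteq> carrier S" using Fc by auto
  show "\<one>\<^bsub>S\<^esub> \<in> h ` F" using subringE(3)[OF assms] hom_one by force
  show "\<ominus>\<^bsub>S\<^esub> u \<in> h ` F" if "u \<in> h ` F" for u
  proof -
    obtain a where "a \<in> F" "u = h a" using \<open>u \<in> h ` F\<close> by blast
    then show ?thesis using subringE(5)[OF assms, of a] Fc by (intro image_eqI[of _ _ "\<ominus> a"]) auto
  qed
  fix u v assume "u \<in> h ` F" "v \<in> h ` F"
  then obtain a b where ab: "a \<in> F" "u = h a" "b \<in> F" "v = h b" by blast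
  show "u \<otimes>\<^bsub>S\<^esub> v \<in> h ` F"
    using ab subringE(6)[OF assms, of a b] Fc by (intro image_eqI[of _ _ "a \<otimes> b"]) auto
  show "u \<oplus>\<^bsub>S\<^esub> v \<in> h ` F"
    using ab subringE(7)[OF assms, of a b] Fc by (intro image_eqI[of _ _ "a \<oplus> b"]) auto
qed

lemma (in algebra) subring_scalars: "subring (scalars R M) M"
proof -
  interpret h: ring_hom_cring R M "\<lambda>c. c \<odot>\<^bsub>M\<^esub> \<one>\<^bsub>M\<^esub>" by unfold_locales (rule scalars_hom)
  show ?thesis unfolding scalars_def by (rule h.subring_image[OF R.carrier_is_subring])
qed

lemma (in primeideal) coset_eq_zero_iff:
  assumes "x \<in> carrier R"
  shows "I +> x = \<zero>\<^bsub>R Quot I\<^esub> \<longleftrightarrow> x \<in> I"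
proof -
  have "x \<ominus> \<zero> = x" using assms by (simp add: a_minus_def)
  then have "x \<in> I \<longleftrightarrow> I +> x = I +> \<zero>"
    using quotient_eq_iff_same_a_r_cos[OF is_ideal assms zero_closed] by simp
  moreover have "I +> \<zero> = \<zero>\<^bsub>R Quot I\<^esub>"
    using ring_hom_cring.hom_zero[OF rcos_ring_hom_cring] .
  ultimately show ?thesis by simp
qed

context primeideal begin

lemma residue_field: "field (quotient_field (R Quot I))"
  using domain.quotient_field_is_field[OF quotient_is_domain] .

lemma residue_submonoid: "submonoid (carrier (R Quot I) - {\<zero>\<^bsub>R Quot I\<^esub>}) (R Quot I)"
proof -
  interpret D: domain "R Quot I" by (rule quotient_is_domain)
  show ?thesis by (rule submonoid.intro) (auto simp: D.integral_iff)
qed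

lemma residue_map_hom: "residue_map R I \<in> ring_hom R (quotient_field (R Quot I))"
proof -
  interpret D: domain "R Quot I" by (rule quotient_is_domain)
  have "(\<lambda>a. frac_of (R Quot I) (carrier (R Quot I) - {\<zero>\<^bsub>R Quot I\<^esub>}) a \<one>\<^bsub>R Quot I\<^esub>) \<circ> (+>) I
      \<in> ring_hom R (quotient_field (R Quot I))"
    unfolding quotient_field_def
    by (rule ring_hom_trans[OF rcos_ring_hom D.frac_of_hom[OF residue_submonoid]])
  then show ?thesis
    by (simp add: residue_map_def[abs_def] quotient_field_embed_def comp_def)
qed

lemma residue_map_eq_zero_iff:
  assumes "x \<in> carrier R"
  shows "residue_map R I x = \<zero>\<^bsub>quotient_field (R Quot I)\<^esub> \<longleftrightarrow> x \<in> I"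
proof -
  interpret D: domain "R Quot I" by (rule quotient_is_domain)
  note S = residue_submonoid
  have c: "I +> x \<in> carrier (R Quot I)" using assms rcos_ring_hom by (rule ring_hom_closed[rotated])
  have "\<zero>\<^bsub>quotient_field (R Quot I)\<^esub>
      = frac_of (R Quot I) (carrier (R Quot I) - {\<zero>\<^bsub>R Quot I\<^esub>}) \<zero>\<^bsub>R Quot I\<^esub> \<one>\<^bsub>R Quot I\<^esub>"
    by (simp add: quotient_field_def ring_of_fracs_def)
  then have "residue_map R I x = \<zero>\<^bsub>quotient_field (R Quot I)\<^esub> \<longleftrightarrow> I +> x = \<zero>\<^bsub>R Quot I\<^esub>"
    unfolding residue_map_def quotient_field_embed_def
    using c by (auto simp: D.frac_of_eq_iff[OF S] D.integral_iff)
  then show ?thesis using coset_eq_zero_iff[OF assms] by simp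
qed

lemma residue_map_frac:
  assumes "z \<in> carrier (quotient_field (R Quot I))"
  obtains s a where "s \<in> carrier R" "a \<in> carrier R" "s \<notin> I"
    "residue_map R I s \<otimes>\<^bsub>quotient_field (R Quot I)\<^esub> z = residue_map R I a"
proof -
  interpret D: domain "R Quot I" by (rule quotient_is_domain)
  note S = residue_submonoid
  let ?S = "carrier (R Quot I) - {\<zero>\<^bsub>R Quot I\<^esub>}"
  obtain a' s' where e: "z = frac_of (R Quot I) ?S a' s'" "a' \<in> carrier (R Quot I)" "s' \<in> ?S"
    using assms unfolding quotient_field_def D.ring_of_fracs_carrier[OF S] by blast
  have surj: "\<exists>a\<in>carrier R. w = I +> a" if "w \<in> carrier (R Quot I)" for w
    using that by (auto simp: FactRing_def A_RCOSETS_def')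
  obtain a s where as: "a \<in> carrier R" "a' = I +> a" "s \<in> carrier R" "s' = I +> s"
    using surj[of a'] surj[of s'] e by blast
  have "s \<notin> I" using e(3) as coset_eq_zero_iff by auto
  moreover have "residue_map R I s \<otimes>\<^bsub>quotient_field (R Quot I)\<^esub> z = residue_map R I a"
    unfolding residue_map_def quotient_field_embed_def quotient_field_def e(1) as(2,4)[symmetric]
    by (rule D.frac_of_split[OF S e(2,3)])
  ultimately show thesis using that as by blast
qed

end

locale algebra_prime = algebra k A + primeideal p A
  for k :: "('k, 'u) ring_scheme" and A :: "('k, 'a, 'm) module_scheme" and p
begin

abbreviation \<kappa> where "\<kappa> \<equiv> quotient_field (A Quot p)"
abbreviation \<rho> where "\<rho> \<equiv> residue_map A p"

sublocale \<kappa>: field \<kappa> by (rule residue_field)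
sublocale \<rho>: ring_hom_cring A \<kappa> \<rho> by unfold_locales (rule residue_map_hom)

lemma kernel_residue: "{a \<in> carrier A. \<rho> a = \<zero>\<^bsub>\<kappa>\<^esub>} = p"
  using residue_map_eq_zero_iff a_Hcarr by blast

lemma quot_trdeg_eq: "quot_trdeg k A p = field_trdeg \<kappa> (\<rho> ` scalars k A)"
  by (simp add: quot_trdeg_def domain_trdeg_def scalars_def residue_map_def image_image)

lemma indep_mod_iff_residue:
  assumes "Y \<subseteq> carrier A"
  shows "indep_mod A p (scalars k A) Y
    \<longleftrightarrow> inj_on \<rho> Y \<and> algebraically_indep \<kappa> (\<rho> ` scalars k A) (\<rho> ` Y)"
  using \<rho>.indep_mod_iff_image[OF subring_scalars _ assms] kernel_residue \<kappa>.one_not_zero by simp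

lemma quot_trdeg_le_imp_trdeg_le:
  assumes "quot_trdeg k A p \<le> enat d"
  shows "trdeg_le k A p d"
  unfolding trdeg_le_def
proof (intro allI impI, elim conjE)
  fix S assume S: "finite S" "indep_mod A p (scalars k A) S"
  then have ind: "inj_on \<rho> S" "algebraically_indep \<kappa> (\<rho> ` scalars k A) (\<rho> ` S)"
    using indep_mod_iff_residue indep_mod_closed by blast+
  have "enat (card (\<rho> ` S)) \<le> field_trdeg \<kappa> (\<rho> ` scalars k A)"
    unfolding field_trdeg_def
    by (rule SUP_upper2[of "\<rho> ` S"]) (use ind S(1) in auto)
  then have "enat (card S) \<le> enat d"
    using assms card_image[OF ind(1)] order_trans unfolding quot_trdeg_eq by fastforce
  then show "card S \<le> d" by simp
qed

text \<open>Maximality is assumed only among elements of \<open>A\<close>, while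
  \<open>quot_trdeg\<close> ranges over the whole quotient field of \<open>A/p\<close>;
  \<open>indep_fractions_bound\<close> closes the gap.\<close>

lemma quot_trdeg_le_card_maximal:
  assumes S: "finite S" "indep_mod A p (scalars k A) S"
    and max: "\<And>y. y \<in> carrier A \<Longrightarrow> y \<notin> S \<Longrightarrow> \<not> indep_mod A p (scalars k A) (insert y S)"
  shows "quot_trdeg k A p \<le> enat (card S)"
proof -
  have Sc: "S \<subseteq> carrier A" using indep_mod_closed[OF S(2)] .
  have ind: "inj_on \<rho> S" "algebraically_indep \<kappa> (\<rho> ` scalars k A) (\<rho> ` S)"
    using indep_mod_iff_residue[OF Sc] S(2) by blast+
  have "finite Z \<and> card Z \<le> card (\<rho> ` S)"
    if Z: "algebraically_indep \<kappa> (\<rho> ` scalars k A) Z" for Z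
  proof (rule \<kappa>.indep_fractions_bound[OF \<rho>.subring_image[OF subring_scalars], of "\<rho> ` carrier A"])
    show "\<exists>s\<in>\<rho> ` carrier A. \<exists>a\<in>\<rho> ` carrier A. s \<noteq> \<zero>\<^bsub>\<kappa>\<^esub> \<and> s \<otimes>\<^bsub>\<kappa>\<^esub> z = a" if z: "z \<in> carrier \<kappa>" for z
    proof -
      obtain s a where sa: "s \<in> carrier A" "a \<in> carrier A" "s \<notin> p" "\<rho> s \<otimes>\<^bsub>\<kappa>\<^esub> z = \<rho> a"
        using residue_map_frac[OF z] .
      then have "\<rho> s \<noteq> \<zero>\<^bsub>\<kappa>\<^esub>" using residue_map_eq_zero_iff[OF sa(1)] by simp
      then show ?thesis
        by (intro bexI[OF _ imageI[OF sa(1)]] bexI[OF _ imageI[OF sa(2)]] conjI sa(4))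
    qed
    show "\<not> algebraically_indep \<kappa> (\<rho> ` scalars k A) (insert y (\<rho> ` S))"
      if y: "y \<in> \<rho> ` carrier A" "y \<notin> \<rho> ` S" for y
    proof
      assume a: "algebraically_indep \<kappa> (\<rho> ` scalars k A) (insert y (\<rho> ` S))"
      obtain x where x: "x \<in> carrier A" "y = \<rho> x" using y(1) by blast
      then have "x \<notin> S" "inj_on \<rho> (insert x S)" using y(2) ind(1) by auto
      moreover have "algebraically_indep \<kappa> (\<rho> ` scalars k A) (\<rho> ` insert x S)" using a x(2) by simp
      ultimately show False
        using max[OF x(1)] indep_mod_iff_residue[of "insert x S"] x(1) Sc by simp
    qed
  qed (use Sc S(1) ind Z in auto)
  then show ?thesis
    unfolding quot_trdeg_eq field_trdeg_def
    using card_image[OF ind(1)] by (auto intro!: SUP_least)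
qed

lemma trdeg_le_imp_quot_trdeg_le:
  assumes "trdeg_le k A p d"
  shows "quot_trdeg k A p \<le> enat d"
proof -
  let ?P = "\<lambda>n. \<exists>S. finite S \<and> indep_mod A p (scalars k A) S \<and> card S = n"
  have "?P 0"
    using indep_mod_empty[OF subringE(1)[OF subring_scalars]] by (intro exI[of _ "{}"]) simp
  moreover have bound: "\<forall>n. ?P n \<longrightarrow> n \<le> d" using assms unfolding trdeg_le_def by blast
  \<comment> \<open>A finite independent set of greatest size exists because of the bound, and it
    cannot be enlarged.\<close>
  ultimately have "?P (Greatest ?P)" using GreatestI_nat[of ?P 0 d] by blast
  then obtain S where S: "finite S" "indep_mod A p (scalars k A) S" "card S = Greatest ?P" by blast
  have "quot_trdeg k A p \<le> enat (card S)"
  proof (rule quot_trdeg_le_card_maximal[OF S(1,2)], rule notI)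
    fix y assume y: "y \<in> carrier A" "y \<notin> S" "indep_mod A p (scalars k A) (insert y S)"
    then have "?P (Suc (card S))" using S(1) by (intro exI[of _ "insert y S"]) simp
    then have "Suc (card S) \<le> Greatest ?P" using Greatest_le_nat[of ?P _ d] bound by blast
    then show False using S(3) by simp
  qed
  also have "card S \<le> d" using assms S(1,2) unfolding trdeg_le_def by blast
  then have "enat (card S) \<le> enat d" by simp
  finally show ?thesis .
qed

end

text \<open>Non-zero scalars act as units, so a scalar lying in \<open>p\<close> is zero. A relation
  that holds in the algebra also holds modulo \<open>p\<close>; hence independence modulo
  \<open>p\<close> implies independence outright.\<close>

lemma (in algebra) trdeg_le_zero_imp:
  assumes k: "field R" and p: "primeideal p M" and "trdeg_le R M {\<zero>\<^bsub>M\<^esub>} d"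
  shows "trdeg_le R M p d"
proof -
  interpret k: field R by (rule k)
  interpret p: primeideal p M by (rule p)
  have "indep_mod M {\<zero>\<^bsub>M\<^esub>} (scalars R M) S" if ind: "indep_mod M p (scalars R M) S" for S
    unfolding indep_mod_def
  proof (intro conjI indep_mod_closed[OF ind] allI impI ballI)
    fix N c m
    assume a: "finite N \<and> (\<forall>m\<in>N. set_mset m \<subseteq> S) \<and> c \<in> N \<rightarrow> scalars R M \<and>
      (\<Oplus>\<^bsub>M\<^esub>m\<in>N. c m \<otimes>\<^bsub>M\<^esub> mset_monomial M m) \<in> {\<zero>\<^bsub>M\<^esub>}" and m: "m \<in> N"
    have "c m \<in> p"
      using a m p.zero_closed by (intro indep_modD[OF ind, of N c]) auto
    moreover obtain x where x: "x \<in> carrier R" "c m = x \<odot>\<^bsub>M\<^esub> \<one>\<^bsub>M\<^esub>"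
      using a m unfolding scalars_def by blast
    have "x = \<zero>"
    proof (rule ccontr)
      assume "x \<noteq> \<zero>"
      then have i: "inv x \<in> carrier R" "inv x \<otimes> x = \<one>" using x k.field_Units by auto
      have "(inv x \<odot>\<^bsub>M\<^esub> \<one>\<^bsub>M\<^esub>) \<otimes>\<^bsub>M\<^esub> c m \<in> p"
        using \<open>c m \<in> p\<close> i(1) by (intro p.I_l_closed) auto
      moreover have "(inv x \<odot>\<^bsub>M\<^esub> \<one>\<^bsub>M\<^esub>) \<otimes>\<^bsub>M\<^esub> c m = \<one>\<^bsub>M\<^esub>"
        unfolding x(2) using ring_hom_mult[OF scalars_hom i(1) x(1)] i(2) by simp
      ultimately show False using p.one_notin by simp
    qed
    then show "c m \<in> {\<zero>\<^bsub>M\<^esub>}" using x(2) by simp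
  qed
  then show ?thesis using assms(3) unfolding trdeg_le_def by blast
qed

section \<open>Chains of primes with constant contractions and the resulting height bound\<close>

context tensor begin

lemma contr_primes:
  assumes "primeideal Q T"
  shows "primeideal (contrA Q) A" "primeideal (contrB Q) B"
  using primeideal_vimage[OF A.M_cring T.is_cring inA_hom assms]
    primeideal_vimage[OF B.M_cring T.is_cring inB_hom assms] by auto

lemma fibre_chain_bound:
  assumes Q: "\<And>i. i \<le> N \<Longrightarrow> primeideal (Q i) T" "\<And>i. i < N \<Longrightarrow> Q i \<subset> Q (Suc i)"
    and cA: "contrA (Q 0) = contrA (Q N)" and cB: "contrB (Q 0) = contrB (Q N)"
    and d: "trdeg_le k A (contrA (Q 0)) d"
  shows "N \<le> d"
proof -
  interpret Q0: primeideal "Q 0" T using Q(1) by simp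
  let ?\<Omega> = "T Quot Q 0" and ?\<pi> = "(+>\<^bsub>T\<^esub>) (Q 0)"
  interpret \<Omega>: domain ?\<Omega> by (rule Q0.quotient_is_domain)
  interpret \<pi>: ring_hom_cring T ?\<Omega> ?\<pi> by (rule Q0.rcos_ring_hom_cring)
  interpret \<alpha>: ring_hom_cring A ?\<Omega> "\<lambda>a. ?\<pi> (inA a)"
    using ring_hom_trans[OF inA_hom \<pi>.homh] by unfold_locales (simp add: comp_def)
  have ker\<pi>: "{t \<in> carrier T. ?\<pi> t = \<zero>\<^bsub>?\<Omega>\<^esub>} = Q 0"
    using Q0.coset_eq_zero_iff Q0.a_Hcarr by blast
  have ker\<alpha>: "{a \<in> carrier A. ?\<pi> (inA a) = \<zero>\<^bsub>?\<Omega>\<^esub>} = contrA (Q 0)"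
    by (rule Collect_cong, rule conj_cong[OF refl], rule Q0.coset_eq_zero_iff) (rule inA.hom_closed)
  define F where "F = (\<lambda>b. inB b) ` carrier B"
  have F: "subring F T" unfolding F_def by (rule inB.subring_image[OF B.carrier_is_subring])
  have "\<forall>i\<in>{..<N}. \<exists>z. z \<in> Q (Suc i) - Q i" using Q(2) by blast
  from bchoice[OF this] obtain z where z: "\<And>i. i < N \<Longrightarrow> z i \<in> Q (Suc i) - Q i" by auto
  have mono: "Q i \<subseteq> Q j" if "i \<le> j" "j \<le> N" for i j
    using that
  proof (induction j)
    case (Suc j)
    then show ?case using Q(2)[of j] by (cases "i = Suc j") auto
  qed simp
  \<comment> \<open>Constancy of the contraction to \<open>B\<close> is what lets
    \<open>primeideal_chain_indep\<close> apply with coefficients from \<open>B\<close>.\<close>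
  have "F \<inter> Q N \<subseteq> Q 0" using cB unfolding F_def by blast
  then have "indep_mod T (Q 0) F (z ` {..<N})"
    using T.primeideal_chain_indep[of N Q z F] Q z subringE(1)[OF F] by blast
  moreover have "z ` {..<N} \<subseteq> carrier T" using indep_mod_closed[OF calculation] .
  ultimately have ind: "inj_on ?\<pi> (z ` {..<N})"
    "algebraically_indep ?\<Omega> (?\<pi> ` F) (?\<pi> ` z ` {..<N})"
    using \<pi>.indep_mod_iff_image[OF F \<Omega>.one_not_zero, of "z ` {..<N}"] unfolding ker\<pi> by blast+
  have "inj_on z {..<N}"
  proof (rule linorder_inj_onI')
    fix i j assume ij: "i \<in> {..<N}" "j \<in> {..<N}" "i < j"
    then have "z i \<in> Q j" using z[of i] mono[of "Suc i" j] by auto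
    then show "z i \<noteq> z j" using z[of j] ij by auto
  qed
  then have "card (?\<pi> ` z ` {..<N}) = N" using ind(1) by (simp add: card_image)
  moreover have "card (?\<pi> ` z ` {..<N}) \<le> d"
  proof (rule \<Omega>.indep_span_bound[OF \<alpha>.subring_image[OF A.subring_scalars] \<pi>.subring_image[OF F]
        _ _ _ _ _ ind(2)])
    show "(\<lambda>a. ?\<pi> (inA a)) ` scalars k A \<subseteq> ?\<pi> ` F"
      using inA_smult_one unfolding scalars_def F_def by (auto simp: image_image)
    show "(\<lambda>a. ?\<pi> (inA a)) ` carrier A \<subseteq> carrier ?\<Omega>" by auto
    \<comment> \<open>A finite set in the image of \<open>A\<close> is lifted to representatives in
      \<open>A\<close>. The kernel of the map from \<open>A\<close> is the contraction of
      \<open>Q 0\<close>, so the bound \<open>d\<close> applies.\<close>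
    show "card S \<le> d" if S: "finite S" "S \<subseteq> (\<lambda>a. ?\<pi> (inA a)) ` carrier A"
      "algebraically_indep ?\<Omega> ((\<lambda>a. ?\<pi> (inA a)) ` scalars k A) S" for S
    proof -
      obtain Y where Y: "Y \<subseteq> carrier A" "inj_on (\<lambda>a. ?\<pi> (inA a)) Y" "S = (\<lambda>a. ?\<pi> (inA a)) ` Y"
        using S(2) unfolding subset_image_inj by blast
      have "indep_mod A (contrA (Q 0)) (scalars k A) Y"
        by (rule iffD2[OF \<alpha>.indep_mod_iff_image[OF A.subring_scalars \<Omega>.one_not_zero Y(1), unfolded ker\<alpha>]])
          (use Y(2) S(3) in \<open>simp add: Y(3)\<close>)
      moreover have "finite Y" using S(1) Y finite_imageD by blast
      ultimately show "card S \<le> d" using d card_image[OF Y(2)] Y(3) unfolding trdeg_le_def by simp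
    qed
    show "finite (?\<pi> ` z ` {..<N})" by simp
    \<comment> \<open>Every tensor is a sum of products of an element of \<open>B\<close> with one
      of \<open>A\<close>, so the witnesses are linear in the image of \<open>A\<close> over that of
      \<open>B\<close>.\<close>
    let ?G = "{b \<otimes>\<^bsub>?\<Omega>\<^esub> a | b a. b \<in> ?\<pi> ` F \<and> a \<in> (\<lambda>a. ?\<pi> (inA a)) ` carrier A}"
    have G: "?G \<subseteq> carrier ?\<Omega>" using subringE(1)[OF \<pi>.subring_image[OF F]] by auto
    have "?\<pi> w \<in> addcl ?\<Omega> ?G" if "w \<in> carrier T" for w
      using that
    proof (induction w rule: tensor_induct)
      case zero
      then show ?case using addcl.zero[of ?\<Omega>] by (simp only: \<pi>.hom_zero)
    next
      case (pure a b)
      have c: "inA a \<in> carrier T" "inB b \<in> carrier T" using pure by simp_all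
      have eq: "pt a b = inB b \<otimes>\<^bsub>T\<^esub> inA a"
        unfolding pt_split[OF pure] by (rule T.m_comm[OF c])
      have "?\<pi> (pt a b) = ?\<pi> (inB b) \<otimes>\<^bsub>?\<Omega>\<^esub> ?\<pi> (inA a)"
        unfolding eq by (rule \<pi>.hom_mult[OF c(2,1)])
      moreover have "?\<pi> (inB b) \<in> ?\<pi> ` F" "?\<pi> (inA a) \<in> (\<lambda>a. ?\<pi> (inA a)) ` carrier A"
        unfolding F_def using pure by blast+
      ultimately have "?\<pi> (pt a b) \<in> ?G" by blast
      then show ?case by (rule \<Omega>.addcl_base[OF G])
    next
      case (add v w)
      then show ?case using \<Omega>.addcl_add[OF G] by (simp only: \<pi>.hom_add)
    qed
    then show "x \<in> addcl ?\<Omega> ?G" if "x \<in> ?\<pi> ` z ` {..<N}" for x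
      using that \<open>z ` {..<N} \<subseteq> carrier T\<close> by auto
  qed
  ultimately show "N \<le> d" by simp
qed

end

text \<open>Contracting a strict chain may create repetitions; deleting them leaves a strict chain
  with one inclusion for each jump.\<close>

lemma ht_le_card_jumps:
  assumes ht: "ht_le R P N" and p: "\<And>i. i \<le> n \<Longrightarrow> primeideal (p i) R"
    "\<And>i. i < n \<Longrightarrow> p i \<subseteq> p (Suc i)" "p n \<subseteq> P"
  shows "card {j. j < n \<and> p j \<noteq> p (Suc j)} \<le> N"
proof -
  have "\<exists>q. (\<forall>i\<le>card {j. j < m \<and> p j \<noteq> p (Suc j)}. primeideal (q i) R)
      \<and> (\<forall>i<card {j. j < m \<and> p j \<noteq> p (Suc j)}. q i \<subset> q (Suc i))
      \<and> q (card {j. j < m \<and> p j \<noteq> p (Suc j)}) = p m" if "m \<le> n" for m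
    using that
  proof (induction m)
    case 0
    then show ?case using p(1)[of 0] by (intro exI[of _ "\<lambda>_. p 0"]) auto
  next
    case (Suc m)
    let ?J = "\<lambda>m. {j. j < m \<and> p j \<noteq> p (Suc j)}"
    obtain q where q: "\<forall>i\<le>card (?J m). primeideal (q i) R" "\<forall>i<card (?J m). q i \<subset> q (Suc i)"
      "q (card (?J m)) = p m" using Suc by auto
    show ?case
    proof (cases "p m = p (Suc m)")
      case True
      then have "?J (Suc m) = ?J m" by (auto simp: less_Suc_eq)
      then show ?thesis using q True by auto
    next
      case False
      then have J: "?J (Suc m) = insert m (?J m)" by (auto simp: less_Suc_eq)
      then have c: "card (?J (Suc m)) = Suc (card (?J m))" by simp
      have "p m \<subset> p (Suc m)" using False p(2)[of m] Suc.prems by auto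
      then show ?thesis
        unfolding c using q p(1)[OF Suc.prems]
        by (intro exI[of _ "q(Suc (card (?J m)) := p (Suc m))"]) (auto simp: le_Suc_eq less_Suc_eq)
    qed
  qed
  from this[OF order_refl] obtain q where
    "\<forall>i\<le>card {j. j < n \<and> p j \<noteq> p (Suc j)}. primeideal (q i) R"
    "\<forall>i<card {j. j < n \<and> p j \<noteq> p (Suc j)}. q i \<subset> q (Suc i)"
    "q (card {j. j < n \<and> p j \<noteq> p (Suc j)}) = p n" by blast
  then show ?thesis
    using ht_leD[OF ht, of "card {j. j < n \<and> p j \<noteq> p (Suc j)}" q] p(3) by simp
qed

text \<open>Among \<open>d + 1\<close> consecutive inclusions in a chain of primes of \<open>T\<close>, one is strict after contraction
  to \<open>A\<close> or to \<open>B\<close>.\<close>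

lemma (in tensor) LFD_tensor_product:
  assumes "LFD A" "LFD B" and d: "\<And>p. primeideal p A \<Longrightarrow> trdeg_le k A p d"
  shows "LFD T"
  unfolding T.LFD_iff_ht_le
proof (intro allI impI)
  fix P assume P: "primeideal P T"
  obtain N M where NM: "ht_le A (contrA P) N" "ht_le B (contrB P) M"
    using assms(1,2) contr_primes[OF P] unfolding A.LFD_iff_ht_le B.LFD_iff_ht_le by blast
  \<comment> \<open>The contractions jump at most \<open>N + M\<close> times in all, and each full
    block of \<open>d + 1\<close> consecutive inclusions contains a jump. So there are at most
    \<open>N + M\<close> full blocks; one more covers the remainder.\<close>
  have "n \<le> (N + M + 1) * (d + 1)" if Q: "\<And>i. i \<le> n \<Longrightarrow> primeideal (Q i) T"
    "\<And>i. i < n \<Longrightarrow> Q i \<subset> Q (Suc i)" "Q n \<subseteq> P" for n Q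
  proof -
    let ?a = "\<lambda>i. contrA (Q i)" and ?b = "\<lambda>i. contrB (Q i)"
    let ?JA = "{j. j < n \<and> ?a j \<noteq> ?a (Suc j)}" and ?JB = "{j. j < n \<and> ?b j \<noteq> ?b (Suc j)}"
    have "card ?JA \<le> N"
      by (rule ht_le_card_jumps[OF NM(1)]) (use Q contr_primes in auto)
    moreover have "card ?JB \<le> M"
      by (rule ht_le_card_jumps[OF NM(2)]) (use Q contr_primes in auto)
    ultimately have cJ: "card (?JA \<union> ?JB) \<le> N + M" using card_Un_le[of ?JA ?JB] by linarith
    have window: "\<exists>j\<in>?JA \<union> ?JB. j div (d + 1) = i" if i: "i < n div (d + 1)" for i
    proof (rule ccontr)
      assume no: "\<not> ?thesis"
      have top: "i * (d + 1) + (d + 1) \<le> n"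
      proof -
        have "Suc i * (d + 1) \<le> n div (d + 1) * (d + 1)" using i by (intro mult_le_mono1) simp
        also have "\<dots> \<le> n" by (rule div_times_less_eq_dividend)
        finally show ?thesis by simp
      qed
      have eq: "?a (i * (d + 1)) = ?a (i * (d + 1) + e) \<and> ?b (i * (d + 1)) = ?b (i * (d + 1) + e)"
        if "e \<le> d + 1" for e
        using that
      proof (induction e)
        case (Suc e)
        have "(i * (d + 1) + e) div (d + 1) = i"
          by (rule div_nat_eqI) (use Suc.prems in \<open>simp_all add: algebra_simps\<close>)
        then have "i * (d + 1) + e \<notin> ?JA \<union> ?JB" using no by blast
        moreover have "i * (d + 1) + e < n" using Suc.prems top by linarith
        ultimately show ?case using Suc by auto
      qed simp
      \<comment> \<open>A block without a jump would be a chain of \<open>d + 1\<close> inclusions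
        with constant contractions.\<close>
      have "d + 1 \<le> d"
        by (rule fibre_chain_bound[of "d + 1" "\<lambda>e. Q (i * (d + 1) + e)"])
          (use Q top eq[of "d + 1"] d contr_primes(1) in auto)
      then show False by simp
    qed
    then have "{..<n div (d + 1)} \<subseteq> (\<lambda>j. j div (d + 1)) ` (?JA \<union> ?JB)" by blast
    then have "n div (d + 1) \<le> card ((\<lambda>j. j div (d + 1)) ` (?JA \<union> ?JB))"
      using card_mono[of "(\<lambda>j. j div (d + 1)) ` (?JA \<union> ?JB)" "{..<n div (d + 1)}"] by simp
    also have "\<dots> \<le> N + M" using card_image_le[of "?JA \<union> ?JB" "\<lambda>j. j div (d + 1)"] cJ by simp
    finally have "n div (d + 1) < N + M + 1" by simp
    then have "n < (N + M + 1) * (d + 1)" by (simp add: div_less_iff_less_mult)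
    then show ?thesis by simp
  qed
  then show "\<exists>N. ht_le T P N" unfolding ht_le_def by blast
qed


section \<open>A local ring with a prime of infinite height\<close>

definition polys :: "('a, 'm) ring_scheme \<Rightarrow> 'a set \<Rightarrow> 'a set \<Rightarrow> 'a set"
  where "polys R F Y = {u. \<exists>n. polyle R F Y n u}"

lemma (in cring) subring_polys:
  assumes F: "subring F R" and Y: "Y \<subseteq> carrier R"
  shows "subring (polys R F Y) R"
proof (rule subringI)
  show "polys R F Y \<subseteq> carrier R" unfolding polys_def using polyle_closed[OF F Y] by blast
  show "\<one> \<in> polys R F Y" unfolding polys_def using polyle_one[OF F Y] by blast
  show "\<ominus> u \<in> polys R F Y" if "u \<in> polys R F Y" for u
    using that polyle_minus[OF F Y] unfolding polys_def by blast
  fix u v assume "u \<in> polys R F Y" "v \<in> polys R F Y"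
  then obtain m n where mn: "polyle R F Y m u" "polyle R F Y n v" unfolding polys_def by blast
  show "u \<otimes> v \<in> polys R F Y" unfolding polys_def using polyle_mult[OF F Y mn] by blast
  have "polyle R F Y (m + n) (u \<oplus> v)"
    by (intro polyle.add polyle_le[OF F Y mn(1)] polyle_le[OF F Y mn(2)]) simp_all
  then show "u \<oplus> v \<in> polys R F Y" unfolding polys_def by blast
qed

lemma (in cring) polys_base:
  assumes F: "subring F R" and Y: "Y \<subseteq> carrier R"
  shows "F \<subseteq> polys R F Y" "Y \<subseteq> polys R F Y"
  using polyle.const[of _ F R Y] polyle_base[OF F Y] unfolding polys_def by blast+

lemma (in cring) cring_subring:
  assumes "subring H R"
  shows "cring (R\<lparr>carrier := H\<rparr>)"
  using subcring_iff[OF subringE(1)[OF assms]] subcringI'[OF assms] by simp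

text \<open>With \<open>u\<close> written as a combination of monomials in \<open>Y\<close>,
  independence of the image puts every coefficient into the kernel of \<open>h\<close>, which is
  trivial on \<open>F\<close>.\<close>

lemma (in ring_hom_cring) polys_hom_eq_zeroD:
  assumes F: "subring F R" and Y: "Y \<subseteq> carrier R" and one: "\<one>\<^bsub>S\<^esub> \<noteq> \<zero>\<^bsub>S\<^esub>"
    and inj: "\<And>c. c \<in> F \<Longrightarrow> h c = \<zero>\<^bsub>S\<^esub> \<Longrightarrow> c = \<zero>"
    and ind: "inj_on h Y" "algebraically_indep S (h ` F) (h ` Y)"
    and u: "u \<in> polys R F Y" "h u = \<zero>\<^bsub>S\<^esub>"
  shows "u = \<zero>"
proof -
  have ind': "indep_mod R {r \<in> carrier R. h r = \<zero>\<^bsub>S\<^esub>} F Y"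
    using indep_mod_iff_image[OF F one Y] ind by blast
  have uc: "u \<in> carrier R" using u(1) subringE(1)[OF R.subring_polys[OF F Y]] by blast
  obtain n where pu: "polyle R F Y n u" using u(1) unfolding polys_def by blast
  from R.polyle_normal_form[OF F Y pu]
  obtain M c where M': "finite M \<and> (\<forall>m\<in>M. set_mset m \<subseteq> Y) \<and> c \<in> M \<rightarrow> F \<and>
    u = (\<Oplus>m\<in>M. c m \<otimes> mset_monomial R m)" by (elim exE)
  then have M: "finite M" "\<And>m. m \<in> M \<Longrightarrow> set_mset m \<subseteq> Y" "\<And>m. m \<in> M \<Longrightarrow> c m \<in> F"
    "u = (\<Oplus>m\<in>M. c m \<otimes> mset_monomial R m)" by auto
  have sum: "(\<Oplus>m\<in>M. c m \<otimes> mset_monomial R m) \<in> {r \<in> carrier R. h r = \<zero>\<^bsub>S\<^esub>}"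
    using u(2) uc unfolding M(4)[symmetric] by simp
  have "c m \<in> {r \<in> carrier R. h r = \<zero>\<^bsub>S\<^esub>}" if "m \<in> M" for m
    by (rule indep_modD[OF ind' M(1) M(2,3) sum that])
  then have c0: "c m = \<zero>" if "m \<in> M" for m using inj[OF M(3)[OF that]] that by simp
  have "c m \<otimes> mset_monomial R m = \<zero>" if "m \<in> M" for m
    using c0[OF that] R.mset_monomial_closed[of m] M(2)[OF that] Y by auto
  then show ?thesis unfolding M(4) by (rule R.add.finprod_one_eqI)
qed

text \<open>Polynomials in infinitely many variables will be represented by the functions that they
  define, so that evaluation and restriction to lines need no construction. Primality of vanishing
  ideals then relies on \<open>L\<close> being infinite.\<close>

definition fun_ring :: "('l, 'm) ring_scheme \<Rightarrow> ((nat \<Rightarrow> 'l) \<Rightarrow> 'l) ring"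
  where "fun_ring L = \<lparr>carrier = {f. \<forall>v. f v \<in> carrier L},
     monoid.mult = (\<lambda>f g v. f v \<otimes>\<^bsub>L\<^esub> g v),
     one = (\<lambda>v. \<one>\<^bsub>L\<^esub>),
     ring.zero = (\<lambda>v. \<zero>\<^bsub>L\<^esub>),
     add = (\<lambda>f g v. f v \<oplus>\<^bsub>L\<^esub> g v)\<rparr>"

text \<open>Coordinates are cut off outside \<open>carrier L\<close>, so that all functions are total.\<close>

definition coord :: "('l, 'm) ring_scheme \<Rightarrow> nat \<Rightarrow> (nat \<Rightarrow> 'l) \<Rightarrow> 'l"
  where "coord L i v = (if v i \<in> carrier L then v i else \<zero>\<^bsub>L\<^esub>)"

definition constf :: "'l \<Rightarrow> (nat \<Rightarrow> 'l) \<Rightarrow> 'l"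
  where "constf c v = c"

definition pfuns :: "('l, 'm) ring_scheme \<Rightarrow> ((nat \<Rightarrow> 'l) \<Rightarrow> 'l) set"
  where "pfuns L = polys (fun_ring L) (constf ` carrier L) (range (coord L))"

definition pfun_ring :: "('l, 'm) ring_scheme \<Rightarrow> ((nat \<Rightarrow> 'l) \<Rightarrow> 'l) ring"
  where "pfun_ring L = (fun_ring L)\<lparr>carrier := pfuns L\<rparr>"

lemma fun_ring_simps:
  "f \<in> carrier (fun_ring L) \<longleftrightarrow> (\<forall>v. f v \<in> carrier L)"
  "f \<otimes>\<^bsub>fun_ring L\<^esub> g = (\<lambda>v. f v \<otimes>\<^bsub>L\<^esub> g v)"
  "f \<oplus>\<^bsub>fun_ring L\<^esub> g = (\<lambda>v. f v \<oplus>\<^bsub>L\<^esub> g v)"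
  "\<one>\<^bsub>fun_ring L\<^esub> = (\<lambda>v. \<one>\<^bsub>L\<^esub>)"
  "\<zero>\<^bsub>fun_ring L\<^esub> = (\<lambda>v. \<zero>\<^bsub>L\<^esub>)"
  by (simp_all add: fun_ring_def)

lemma pfun_ring_simps:
  "carrier (pfun_ring L) = pfuns L"
  "f \<otimes>\<^bsub>pfun_ring L\<^esub> g = (\<lambda>v. f v \<otimes>\<^bsub>L\<^esub> g v)"
  "f \<oplus>\<^bsub>pfun_ring L\<^esub> g = (\<lambda>v. f v \<oplus>\<^bsub>L\<^esub> g v)"
  "\<one>\<^bsub>pfun_ring L\<^esub> = (\<lambda>v. \<one>\<^bsub>L\<^esub>)"
  "\<zero>\<^bsub>pfun_ring L\<^esub> = (\<lambda>v. \<zero>\<^bsub>L\<^esub>)"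
  by (simp_all add: pfun_ring_def fun_ring_simps)

lemma (in cring) cring_fun_ring: "cring (fun_ring R)"
proof (rule cringI)
  show "abelian_group (fun_ring R)"
  proof (rule abelian_groupI)
    fix f assume f: "f \<in> carrier (fun_ring R)"
    then show "\<exists>g\<in>carrier (fun_ring R). g \<oplus>\<^bsub>fun_ring R\<^esub> f = \<zero>\<^bsub>fun_ring R\<^esub>"
      by (intro bexI[of _ "\<lambda>v. \<ominus> f v"]) (auto simp: fun_ring_simps l_neg)
  qed (auto simp: fun_ring_simps a_ac)
  show "comm_monoid (fun_ring R)"
    by (rule comm_monoidI) (auto simp: fun_ring_simps m_ac)
qed (auto simp: fun_ring_simps l_distr)

lemma (in cring) constf_hom: "constf \<in> ring_hom R (fun_ring R)"
  by (rule ring_hom_memI) (auto simp: fun_ring_simps constf_def[abs_def])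

lemma (in cring) subring_constf: "subring (constf ` carrier R) (fun_ring R)"
proof -
  interpret h: ring_hom_cring R "fun_ring R" constf
    by (intro ring_hom_cring.intro is_cring cring_fun_ring ring_hom_cring_axioms.intro constf_hom)
  show ?thesis by (rule h.subring_image[OF carrier_is_subring])
qed

lemma (in cring) coord_closed: "range (coord R) \<subseteq> carrier (fun_ring R)"
  by (auto simp: fun_ring_simps coord_def)

lemma (in cring) subring_pfuns: "subring (pfuns R) (fun_ring R)"
  unfolding pfuns_def by (rule cring.subring_polys[OF cring_fun_ring subring_constf coord_closed])

lemma (in cring) cring_pfun_ring: "cring (pfun_ring R)"
  unfolding pfun_ring_def by (rule cring.cring_subring[OF cring_fun_ring subring_pfuns])

lemma (in cring) pfuns_closed: "f \<in> pfuns R \<Longrightarrow> f v \<in> carrier R"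
  using subringE(1)[OF subring_pfuns] fun_ring_simps(1)[of f R] by blast

lemma (in cring) constf_mem: "c \<in> carrier R \<Longrightarrow> constf c \<in> pfuns R"
  unfolding pfuns_def using cring.polys_base(1)[OF cring_fun_ring subring_constf coord_closed] by blast

lemma (in cring) coord_mem: "coord R i \<in> pfuns R"
  unfolding pfuns_def using cring.polys_base(2)[OF cring_fun_ring subring_constf coord_closed] by blast

lemma (in cring) pfuns_induct [consumes 1, case_names const coord add mult]:
  assumes "f \<in> pfuns R"
    and const: "\<And>c. c \<in> carrier R \<Longrightarrow> P (constf c)"
    and coord: "\<And>i. P (coord R i)"
    and add: "\<And>f g. \<lbrakk>f \<in> pfuns R; g \<in> pfuns R; P f; P g\<rbrakk> \<Longrightarrow> P (\<lambda>v. f v \<oplus> g v)"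
    and mult: "\<And>f g. \<lbrakk>f \<in> pfuns R; g \<in> pfuns R; P f; P g\<rbrakk> \<Longrightarrow> P (\<lambda>v. f v \<otimes> g v)"
  shows "P f"
proof -
  obtain n where "polyle (fun_ring R) (constf ` carrier R) (range (coord R)) n f"
    using assms(1) unfolding pfuns_def polys_def by blast
  then have "f \<in> pfuns R \<and> P f"
  proof (induction rule: polyle.induct)
    case (const f n)
    then show ?case using constf_mem assms(2) by blast
  next
    case (add n f g)
    then have "f \<oplus>\<^bsub>fun_ring R\<^esub> g \<in> pfuns R" using subringE(7)[OF subring_pfuns] by blast
    then show ?case using add assms(4) by (simp add: fun_ring_simps)
  next
    case (mult n f g)
    then obtain i where g: "g = coord R i" by blast
    then have "g \<otimes>\<^bsub>fun_ring R\<^esub> f \<in> pfuns R" using mult subringE(6)[OF subring_pfuns] coord_mem by blast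
    then show ?case using mult g assms(3,5) coord_mem by (simp add: fun_ring_simps)
  qed
  then show ?thesis by blast
qed

text \<open>The affine line that passes through \<open>v\<close> at parameter zero and through
  \<open>w\<close> at parameter one.\<close>

definition line :: "('l, 'm) ring_scheme \<Rightarrow> (nat \<Rightarrow> 'l) \<Rightarrow> (nat \<Rightarrow> 'l) \<Rightarrow> 'l \<Rightarrow> nat \<Rightarrow> 'l"
  where "line L v w s i = (w i \<ominus>\<^bsub>L\<^esub> v i) \<otimes>\<^bsub>L\<^esub> s \<oplus>\<^bsub>L\<^esub> v i"

definition vanishing :: "('l, 'm) ring_scheme \<Rightarrow> (nat \<Rightarrow> 'l) set \<Rightarrow> ((nat \<Rightarrow> 'l) \<Rightarrow> 'l) set"
  where "vanishing L V = {f \<in> pfuns L. \<forall>v\<in>V. f v = \<zero>\<^bsub>L\<^esub>}"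

context field begin

text \<open>Each coordinate is affine linear along the line, and evaluation of univariate
  polynomials is a ring homomorphism. Zeros on a line are thereby reduced to roots in one
  variable.\<close>

lemma pfun_on_line:
  assumes "f \<in> pfuns R" and v: "\<And>i. v i \<in> carrier R" and w: "\<And>i. w i \<in> carrier R"
  shows "\<exists>p\<in>carrier (poly_ring R). \<forall>s\<in>carrier R. f (line R v w s) = eval p s"
  using assms(1)
proof (induction f rule: pfuns_induct)
  have linear: "\<exists>p\<in>carrier (poly_ring R). \<forall>s\<in>carrier R. a \<otimes> s \<oplus> b = eval p s"
    if "a \<in> carrier R" "b \<in> carrier R" for a b
  proof (intro bexI[of _ "normalize [a, b]"] ballI)
    show "normalize [a, b] \<in> carrier (poly_ring R)"
      unfolding univ_poly_carrier[symmetric] using that by (intro normalize_gives_polynomial) auto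
    show "a \<otimes> s \<oplus> b = eval (normalize [a, b]) s" if s: "s \<in> carrier R" for s
      using eval_normalize[of "[a, b]" s] s \<open>a \<in> carrier R\<close> \<open>b \<in> carrier R\<close> by simp
  qed
  {
    case (const c)
    then show ?case using linear[of \<zero> c] by (simp add: constf_def)
  next
    case (coord i)
    have "coord R i (line R v w s) = (w i \<ominus> v i) \<otimes> s \<oplus> v i" if "s \<in> carrier R" for s
      using that v w by (simp add: coord_def line_def)
    then show ?case using linear[of "w i \<ominus> v i" "v i"] v w by simp
  next
    case (add f g)
    then obtain p q where pq: "p \<in> carrier (poly_ring R)" "q \<in> carrier (poly_ring R)"
      "\<And>s. s \<in> carrier R \<Longrightarrow> f (line R v w s) = eval p s"
      "\<And>s. s \<in> carrier R \<Longrightarrow> g (line R v w s) = eval q s" by blast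
    show ?case
    proof (intro bexI[of _ "p \<oplus>\<^bsub>poly_ring R\<^esub> q"] ballI)
      show "p \<oplus>\<^bsub>poly_ring R\<^esub> q \<in> carrier (poly_ring R)"
        using pq(1,2) ring.ring_simprules(1)[OF univ_poly_is_ring[OF carrier_is_subring]] by blast
      show "f (line R v w s) \<oplus> g (line R v w s) = eval (p \<oplus>\<^bsub>poly_ring R\<^esub> q) s"
        if "s \<in> carrier R" for s
        using ring_hom_add[OF eval_is_hom[OF carrier_is_subring that] pq(1,2)] pq(3,4) that by simp
    qed
  next
    case (mult f g)
    then obtain p q where pq: "p \<in> carrier (poly_ring R)" "q \<in> carrier (poly_ring R)"
      "\<And>s. s \<in> carrier R \<Longrightarrow> f (line R v w s) = eval p s"
      "\<And>s. s \<in> carrier R \<Longrightarrow> g (line R v w s) = eval q s" by blast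
    show ?case
    proof (intro bexI[of _ "p \<otimes>\<^bsub>poly_ring R\<^esub> q"] ballI)
      show "p \<otimes>\<^bsub>poly_ring R\<^esub> q \<in> carrier (poly_ring R)"
        using pq(1,2) ring.ring_simprules(5)[OF univ_poly_is_ring[OF carrier_is_subring]] by blast
      show "f (line R v w s) \<otimes> g (line R v w s) = eval (p \<otimes>\<^bsub>poly_ring R\<^esub> q) s"
        if "s \<in> carrier R" for s
        using ring_hom_mult[OF eval_is_hom[OF carrier_is_subring that] pq(1,2)] pq(3,4) that by simp
    qed
  }
qed

lemma finite_zeros_on_line:
  assumes f: "f \<in> pfuns R" and v: "\<And>i. v i \<in> carrier R" and w: "\<And>i. w i \<in> carrier R"
    and s0: "s0 \<in> carrier R" "f (line R v w s0) \<noteq> \<zero>"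
  shows "finite {s \<in> carrier R. f (line R v w s) = \<zero>}"
proof -
  have "\<exists>p\<in>carrier (poly_ring R). \<forall>s\<in>carrier R. f (line R v w s) = eval p s"
    by (rule pfun_on_line[OF f]) (rule v, rule w)
  then obtain p where p: "p \<in> carrier (poly_ring R)" "\<And>s. s \<in> carrier R \<Longrightarrow> f (line R v w s) = eval p s"
    by blast
  have "p \<noteq> []" using p(2)[OF s0(1)] s0(2) by auto
  then have "{s \<in> carrier R. f (line R v w s) = \<zero>} \<subseteq> {x. is_root p x}"
    using p(2) by (auto simp: is_root_def)
  then show ?thesis using finite_number_of_roots[OF p(1)] finite_subset by blast
qed

text \<open>Two functions that do not vanish on \<open>V\<close> have a common non-zero on a line inside \<open>V\<close>.\<close>

lemma primeideal_vanishing: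
  assumes inf: "infinite (carrier R)" and V: "V \<noteq> {}" "\<And>v i. v \<in> V \<Longrightarrow> v i \<in> carrier R"
    and conv: "\<And>v w s. \<lbrakk>v \<in> V; w \<in> V; s \<in> carrier R\<rbrakk> \<Longrightarrow> line R v w s \<in> V"
  shows "primeideal (vanishing R V) (pfun_ring R)"
proof -
  interpret C: cring "pfun_ring R" by (rule cring_pfun_ring)
  show ?thesis
  proof (rule C.cring_primeidealI[OF C.cring_idealI])
    show "vanishing R V \<subseteq> carrier (pfun_ring R)" by (auto simp: vanishing_def pfun_ring_simps)
    show "\<zero>\<^bsub>pfun_ring R\<^esub> \<in> vanishing R V"
      using C.zero_closed by (simp add: vanishing_def pfun_ring_simps)
    show "\<one>\<^bsub>pfun_ring R\<^esub> \<notin> vanishing R V"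
      using V(1) by (auto simp: vanishing_def pfun_ring_simps)
    show "f \<oplus>\<^bsub>pfun_ring R\<^esub> g \<in> vanishing R V" if "f \<in> vanishing R V" "g \<in> vanishing R V" for f g
      using that C.a_closed[of f g] by (simp add: vanishing_def pfun_ring_simps)
    show "g \<otimes>\<^bsub>pfun_ring R\<^esub> f \<in> vanishing R V" if "f \<in> vanishing R V" "g \<in> carrier (pfun_ring R)" for f g
      using that C.m_closed[of g f] by (simp add: vanishing_def pfun_ring_simps pfuns_closed)
    fix f g assume fg: "f \<in> carrier (pfun_ring R)" "g \<in> carrier (pfun_ring R)"
      "f \<otimes>\<^bsub>pfun_ring R\<^esub> g \<in> vanishing R V"
    show "f \<in> vanishing R V \<or> g \<in> vanishing R V"
    proof (rule ccontr)
      assume "\<not> ?thesis"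
      then obtain v w where vw: "v \<in> V" "f v \<noteq> \<zero>" "w \<in> V" "g w \<noteq> \<zero>"
        using fg by (auto simp: vanishing_def pfun_ring_simps)
      have l0: "line R v w \<zero> = v" and l1: "line R v w \<one> = w"
        using V(2)[OF vw(1)] V(2)[OF vw(3)]
        by (auto simp: line_def a_minus_def a_assoc l_neg)
      have "finite ({s \<in> carrier R. f (line R v w s) = \<zero>} \<union> {s \<in> carrier R. g (line R v w s) = \<zero>})"
        using finite_zeros_on_line[of f v w \<zero>] finite_zeros_on_line[of g v w \<one>] fg vw V(2) l0 l1
        by (auto simp: pfun_ring_simps)
      then have "\<not> carrier R \<subseteq> {s \<in> carrier R. f (line R v w s) = \<zero>} \<union> {s \<in> carrier R. g (line R v w s) = \<zero>}"
        using inf finite_subset by fast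
      then obtain s where s: "s \<in> carrier R" "f (line R v w s) \<noteq> \<zero>" "g (line R v w s) \<noteq> \<zero>"
        by blast
      have "f (line R v w s) \<otimes> g (line R v w s) = \<zero>"
        using fg(3) conv[OF vw(1,3) s(1)] by (simp add: vanishing_def pfun_ring_simps)
      then show False
        using s fg(1,2) integral[OF _ pfuns_closed[of f] pfuns_closed[of g]] by (auto simp: pfun_ring_simps)
    qed
  qed
qed

abbreviation origin_ideal where "origin_ideal \<equiv> vanishing R {\<lambda>_. \<zero>}"

definition local_pfuns where "local_pfuns = localization_at (pfun_ring R) origin_ideal"

lemma primeideal_origin_ideal:
  assumes "infinite (carrier R)"
  shows "primeideal origin_ideal (pfun_ring R)"
  by (rule primeideal_vanishing[OF assms]) (auto simp: line_def fun_eq_iff a_minus_def)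

text \<open>The subspaces \<open>V n\<close> where the first \<open>n\<close> coordinates vanish
  decrease and all contain the origin, so their vanishing ideals form an infinite ascending chain of
  primes inside the origin ideal. The coordinate of index \<open>n\<close> shows strictness.\<close>

lemma not_LFD_local_pfuns:
  assumes inf: "infinite (carrier R)"
  shows "\<not> LFD local_pfuns"
proof
  interpret C: cring "pfun_ring R" by (rule cring_pfun_ring)
  interpret O: primeideal origin_ideal "pfun_ring R" by (rule primeideal_origin_ideal[OF inf])
  let ?S = "carrier (pfun_ring R) - origin_ideal"
  have S: "submonoid ?S (pfun_ring R)" by (rule O.compl_submonoid)
  define V where "V n = {v :: nat \<Rightarrow> 'a. (\<forall>i. v i \<in> carrier R) \<and> (\<forall>i<n. v i = \<zero>)}" for n
  have prime: "primeideal (vanishing R (V n)) (pfun_ring R)" for n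
  proof (rule primeideal_vanishing[OF inf])
    have "(\<lambda>_. \<zero>) \<in> V n" by (simp add: V_def)
    then show "V n \<noteq> {}" by blast
  qed (auto simp: V_def line_def a_minus_def)
  have sub: "vanishing R (V n) \<subseteq> origin_ideal" for n by (auto simp: vanishing_def V_def)
  have strict: "vanishing R (V n) \<subset> vanishing R (V (Suc n))" for n
  proof -
    have "coord R n \<in> vanishing R (V (Suc n))"
      using coord_mem by (auto simp: vanishing_def V_def coord_def)
    moreover have "coord R n \<notin> vanishing R (V n)"
    proof
      assume "coord R n \<in> vanishing R (V n)"
      moreover have "(\<lambda>i. if i = n then \<one> else \<zero>) \<in> V n" by (simp add: V_def)
      ultimately have "coord R n (\<lambda>i. if i = n then \<one> else \<zero>) = \<zero>" by (auto simp: vanishing_def)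
      then show False by (simp add: coord_def)
    qed
    moreover have "vanishing R (V n) \<subseteq> vanishing R (V (Suc n))"
      by (auto simp: vanishing_def V_def)
    ultimately show ?thesis by blast
  qed
  have disj: "origin_ideal \<inter> ?S = {}" "vanishing R (V n) \<inter> ?S = {}" for n using sub[of n] by auto
  assume "LFD local_pfuns"
  then obtain N where N: "ht_le local_pfuns (frac_ideal (pfun_ring R) ?S origin_ideal) N"
    using cring.LFD_iff_ht_le[OF C.cring_ring_of_fracs[OF S]]
      C.primeideal_frac_ideal[OF S O.primeideal_axioms disj(1)]
    unfolding local_pfuns_def localization_at_def by blast
  have "Suc N \<le> N"
  proof (rule ht_leD[OF N, of "Suc N" "\<lambda>n. frac_ideal (pfun_ring R) ?S (vanishing R (V n))"])
    show "primeideal (frac_ideal (pfun_ring R) ?S (vanishing R (V i))) local_pfuns" for i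
      unfolding local_pfuns_def localization_at_def
      by (rule C.primeideal_frac_ideal[OF S prime disj(2)])
    show "frac_ideal (pfun_ring R) ?S (vanishing R (V i))
        \<subset> frac_ideal (pfun_ring R) ?S (vanishing R (V (Suc i)))" for i
      by (rule C.frac_ideal_strict_mono[OF S prime disj(2) prime disj(2) strict])
    show "frac_ideal (pfun_ring R) ?S (vanishing R (V (Suc N)))
        \<subseteq> frac_ideal (pfun_ring R) ?S origin_ideal"
      using sub unfolding frac_ideal_def by blast
  qed
  then show False by simp
qed

end


section \<open>Tensor products of algebras of infinite transcendence degree\<close>

lemma (in ring_hom_cring) frac_universal:
  assumes D: "submonoid D R" and units: "\<And>s. s \<in> D \<Longrightarrow> h s \<in> Units S"
  obtains \<eta> where "\<eta> \<in> ring_hom (ring_of_fracs R D) S"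
    "\<And>a. a \<in> carrier R \<Longrightarrow> \<eta> (frac_of R D a \<one>) = h a"
proof -
  let ?Q = "ring_of_fracs R D"
  note C = R.denom_carrier[OF D] R.denom_mult[OF D] R.denom_one[OF D]
  \<comment> \<open>The value on a fraction is a solution \<open>t\<close> of the equation
    \<open>t \<otimes> h s = h a\<close> for some representation; invertibility of
    \<open>h s\<close> makes it the same for every representation.\<close>
  define \<eta> where "\<eta> w = (SOME t. t \<in> carrier S \<and> (\<exists>a\<in>carrier R. \<exists>s\<in>D.
    w = frac_of R D a s \<and> t \<otimes>\<^bsub>S\<^esub> h s = h a))" for w
  have key: "\<eta> (frac_of R D a s) \<in> carrier S" "\<eta> (frac_of R D a s) \<otimes>\<^bsub>S\<^esub> h s = h a"
    if a: "a \<in> carrier R" and s: "s \<in> D" for a s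
  proof -
    let ?P = "\<lambda>t. t \<in> carrier S \<and> (\<exists>a'\<in>carrier R. \<exists>s'\<in>D.
      frac_of R D a s = frac_of R D a' s' \<and> t \<otimes>\<^bsub>S\<^esub> h s' = h a')"
    have "h a \<otimes>\<^bsub>S\<^esub> inv\<^bsub>S\<^esub> (h s) \<otimes>\<^bsub>S\<^esub> h s = h a"
      using a units[OF s] by (simp add: S.m_assoc S.Units_l_inv S.Units_inv_closed S.Units_closed)
    then have "?P (h a \<otimes>\<^bsub>S\<^esub> inv\<^bsub>S\<^esub> (h s))"
      using a s units[OF s] by (auto intro!: S.m_closed S.Units_inv_closed)
    then have P: "?P (\<eta> (frac_of R D a s))" unfolding \<eta>_def by (rule someI)
    then show cl: "\<eta> (frac_of R D a s) \<in> carrier S" by blast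
    obtain a' s' where e: "a' \<in> carrier R" "s' \<in> D" "frac_of R D a s = frac_of R D a' s'"
      "\<eta> (frac_of R D a s) \<otimes>\<^bsub>S\<^esub> h s' = h a'" using P by blast
    obtain u where u: "u \<in> D" "u \<otimes> (a \<otimes> s') = u \<otimes> (a' \<otimes> s)"
      using e(3) R.frac_of_eq_iff[OF D a s e(1,2)] by blast
    note c = C(1)[OF s] C(1)[OF e(2)] C(1)[OF u(1)]
    have "h u \<otimes>\<^bsub>S\<^esub> (h a \<otimes>\<^bsub>S\<^esub> h s') = h u \<otimes>\<^bsub>S\<^esub> (h a' \<otimes>\<^bsub>S\<^esub> h s)"
      using arg_cong[OF u(2), of h] a e(1) c by simp
    then have "h a \<otimes>\<^bsub>S\<^esub> h s' = h a' \<otimes>\<^bsub>S\<^esub> h s"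
      using S.Units_l_cancel[OF units[OF u(1)]] a e(1) c by simp
    then have "h s' \<otimes>\<^bsub>S\<^esub> h a = h s' \<otimes>\<^bsub>S\<^esub> (\<eta> (frac_of R D a s) \<otimes>\<^bsub>S\<^esub> h s)"
      unfolding e(4)[symmetric] using a c cl by (simp add: S.m_ac)
    then show "\<eta> (frac_of R D a s) \<otimes>\<^bsub>S\<^esub> h s = h a"
      using S.Units_l_cancel[OF units[OF e(2)]] a c cl by simp
  qed
  have uniq: "t = \<eta> (frac_of R D a s)"
    if "a \<in> carrier R" "s \<in> D" "t \<in> carrier S" "t \<otimes>\<^bsub>S\<^esub> h s = h a" for a s t
  proof -
    have "h s \<otimes>\<^bsub>S\<^esub> t = h s \<otimes>\<^bsub>S\<^esub> \<eta> (frac_of R D a s)"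
      using that key[OF that(1,2)] C(1)[OF that(2)] by (simp add: S.m_comm)
    then show ?thesis using S.Units_l_cancel[OF units[OF that(2)]] that key[OF that(1,2)] by simp
  qed
  have base: "\<eta> (frac_of R D a \<one>) = h a" if "a \<in> carrier R" for a
    using uniq[of a \<one> "h a"] that C(3) by simp
  have "\<eta> \<in> ring_hom ?Q S"
  proof (rule ring_hom_memI)
    fix w z assume "w \<in> carrier ?Q" "z \<in> carrier ?Q"
    then obtain a s b t where e: "w = frac_of R D a s" "z = frac_of R D b t" and
      m: "a \<in> carrier R" "s \<in> D" "b \<in> carrier R" "t \<in> D"
      unfolding R.ring_of_fracs_carrier[OF D] by blast
    note cs = C(1)[OF m(2)] C(1)[OF m(4)]
    note ks = key[OF m(1,2), folded e(1)] and kt = key[OF m(3,4), folded e(2)]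
    show "\<eta> w \<in> carrier S" by (rule ks(1))
    have "(\<eta> w \<otimes>\<^bsub>S\<^esub> \<eta> z) \<otimes>\<^bsub>S\<^esub> h (s \<otimes> t) = (\<eta> w \<otimes>\<^bsub>S\<^esub> h s) \<otimes>\<^bsub>S\<^esub> (\<eta> z \<otimes>\<^bsub>S\<^esub> h t)"
      using ks(1) kt(1) cs by (simp add: S.m_ac)
    then have "(\<eta> w \<otimes>\<^bsub>S\<^esub> \<eta> z) \<otimes>\<^bsub>S\<^esub> h (s \<otimes> t) = h (a \<otimes> b)"
      unfolding ks(2) kt(2) using m by simp
    then show "\<eta> (w \<otimes>\<^bsub>?Q\<^esub> z) = \<eta> w \<otimes>\<^bsub>S\<^esub> \<eta> z"
      using uniq[of "a \<otimes> b" "s \<otimes> t" "\<eta> w \<otimes>\<^bsub>S\<^esub> \<eta> z"] ks(1) kt(1) m C(2)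
      by (simp add: e R.ring_of_fracs_mult[OF D])
    have "(\<eta> w \<oplus>\<^bsub>S\<^esub> \<eta> z) \<otimes>\<^bsub>S\<^esub> h (s \<otimes> t)
        = (\<eta> w \<otimes>\<^bsub>S\<^esub> h s) \<otimes>\<^bsub>S\<^esub> h t \<oplus>\<^bsub>S\<^esub> (\<eta> z \<otimes>\<^bsub>S\<^esub> h t) \<otimes>\<^bsub>S\<^esub> h s"
      using ks(1) kt(1) cs by (simp add: S.l_distr) (simp add: S.m_ac)
    then have "(\<eta> w \<oplus>\<^bsub>S\<^esub> \<eta> z) \<otimes>\<^bsub>S\<^esub> h (s \<otimes> t) = h (a \<otimes> t \<oplus> b \<otimes> s)"
      unfolding ks(2) kt(2) using m cs by simp
    then show "\<eta> (w \<oplus>\<^bsub>?Q\<^esub> z) = \<eta> w \<oplus>\<^bsub>S\<^esub> \<eta> z"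
      using uniq[of "a \<otimes> t \<oplus> b \<otimes> s" "s \<otimes> t" "\<eta> w \<oplus>\<^bsub>S\<^esub> \<eta> z"] ks(1) kt(1) m C(2) cs
      by (simp add: e R.ring_of_fracs_add[OF D])
  next
    have "\<one>\<^bsub>?Q\<^esub> = frac_of R D \<one> \<one>" by (simp add: ring_of_fracs_def)
    then show "\<eta> \<one>\<^bsub>?Q\<^esub> = \<one>\<^bsub>S\<^esub>" using base[of \<one>] by simp
  qed
  then show thesis using that base by blast
qed

lemma (in ring_hom_cring) field_hom_eq_zeroD:
  assumes "field R" "\<one>\<^bsub>S\<^esub> \<noteq> \<zero>\<^bsub>S\<^esub>" "c \<in> carrier R" "h c = \<zero>\<^bsub>S\<^esub>"
  shows "c = \<zero>"
proof (rule ccontr)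
  interpret R: field R by fact
  assume "c \<noteq> \<zero>"
  then have i: "inv c \<in> carrier R" "inv c \<otimes> c = \<one>" using assms(3) R.field_Units by auto
  then have "h (inv c) \<otimes>\<^bsub>S\<^esub> h c = \<one>\<^bsub>S\<^esub>" using hom_mult[OF i(1) assms(3)] by simp
  then show False using assms(2,4) i(1) by simp
qed

text \<open>Tensor products are formed from module records, which quotient fields and rings of
  fractions are not; this adds a scalar action through \<open>\<eta>\<close> and keeps the
  ring.\<close>

definition hom_algebra :: "('b, 'm) ring_scheme \<Rightarrow> ('k \<Rightarrow> 'b) \<Rightarrow> ('k, 'b) module"
  where "hom_algebra S \<eta> = \<lparr>carrier = carrier S, monoid.mult = monoid.mult S, one = one S,
    ring.zero = ring.zero S, add = add S, smult = (\<lambda>c x. \<eta> c \<otimes>\<^bsub>S\<^esub> x)\<rparr>"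

lemma hom_algebra_simps [simp]:
  "carrier (hom_algebra S \<eta>) = carrier S" "monoid.mult (hom_algebra S \<eta>) = monoid.mult S"
  "one (hom_algebra S \<eta>) = one S" "ring.zero (hom_algebra S \<eta>) = ring.zero S"
  "add (hom_algebra S \<eta>) = add S" "c \<odot>\<^bsub>hom_algebra S \<eta>\<^esub> x = \<eta> c \<otimes>\<^bsub>S\<^esub> x"
  by (simp_all add: hom_algebra_def)

lemma ring_hom_hom_algebra:
  "ring_hom R (hom_algebra S \<eta>) = ring_hom R S" "ring_hom (hom_algebra S \<eta>) R = ring_hom S R"
  by (simp_all add: ring_hom_def)

lemma cring_hom_algebra:
  assumes "cring S"
  shows "cring (hom_algebra S \<eta>)"
proof -
  interpret S: cring S by fact
  show ?thesis
  proof (rule cringI)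
    show "abelian_group (hom_algebra S \<eta>)"
    proof (rule abelian_groupI)
      show "\<exists>y\<in>carrier (hom_algebra S \<eta>). y \<oplus>\<^bsub>hom_algebra S \<eta>\<^esub> x = \<zero>\<^bsub>hom_algebra S \<eta>\<^esub>"
        if "x \<in> carrier (hom_algebra S \<eta>)" for x
        using that by (intro bexI[of _ "\<ominus>\<^bsub>S\<^esub> x"]) (auto simp: S.l_neg)
    qed (auto simp: S.a_ac)
    show "comm_monoid (hom_algebra S \<eta>)" by (rule comm_monoidI) (auto simp: S.m_ac)
  qed (auto simp: S.l_distr)
qed

lemma algebra_hom_algebra:
  assumes "cring K" "cring S" "\<eta> \<in> ring_hom K S"
  shows "algebra K (hom_algebra S \<eta>)"
proof -
  interpret \<eta>: ring_hom_cring K S \<eta>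
    by (intro ring_hom_cring.intro assms ring_hom_cring_axioms.intro)
  show ?thesis
    by (rule algebraI)
      (auto simp: assms cring_hom_algebra \<eta>.S.l_distr \<eta>.S.r_distr \<eta>.S.m_assoc)
qed

context algebra_prime begin

text \<open>By \<open>quot_trdeg_le_card_maximal\<close> no finite independent set is maximal, so
  such sets can be extended forever. A relation involves finitely many elements and therefore lives
  in one finite stage.\<close>

lemma infinite_indep_sequence:
  assumes inf: "quot_trdeg k A p = \<infinity>"
  obtains x :: "nat \<Rightarrow> 'a" where "inj x" "indep_mod A p (scalars k A) (range x)"
proof -
  let ?I = "indep_mod A p (scalars k A)"
  have "\<forall>S. \<exists>y. finite S \<and> ?I S \<longrightarrow> y \<notin> S \<and> ?I (insert y S)"
  proof
    fix S
    show "\<exists>y. finite S \<and> ?I S \<longrightarrow> y \<notin> S \<and> ?I (insert y S)"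
      using quot_trdeg_le_card_maximal[of S] inf by fastforce
  qed
  from choice[OF this] obtain f
    where f: "\<And>S. finite S \<Longrightarrow> ?I S \<Longrightarrow> f S \<notin> S \<and> ?I (insert (f S) S)" by blast
  define T where "T n = ((\<lambda>S. insert (f S) S) ^^ n) {}" for n
  have T0: "T 0 = {}" and TSuc: "T (Suc n) = insert (f (T n)) (T n)" for n by (simp_all add: T_def)
  have T: "finite (T n) \<and> ?I (T n)" for n
  proof (induction n)
    case 0
    then show ?case using indep_mod_empty[OF subringE(1)[OF subring_scalars]] by (simp add: T0)
  qed (use f in \<open>simp add: TSuc\<close>)
  define x where "x n = f (T n)" for n
  have Tx: "T n = x ` {..<n}" for n
    by (induction n) (simp_all add: T0 TSuc x_def lessThan_Suc)
  have "inj x"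
  proof (rule linorder_injI)
    fix m n :: nat assume "m < n"
    then have "x m \<in> T n" unfolding Tx by blast
    then show "x m \<noteq> x n" using f T by (auto simp: x_def)
  qed
  moreover have "?I (range x)"
    unfolding indep_mod_def
  proof (intro conjI allI impI)
    show "range x \<subseteq> carrier A"
    proof
      fix y assume "y \<in> range x"
      then obtain n where "y \<in> T (Suc n)" by (auto simp: TSuc x_def)
      then show "y \<in> carrier A" using indep_mod_closed T by blast
    qed
    fix M c assume a: "finite M \<and> (\<forall>m\<in>M. set_mset m \<subseteq> range x) \<and> c \<in> M \<rightarrow> scalars k A \<and>
      (\<Oplus>\<^bsub>A\<^esub>m\<in>M. c m \<otimes>\<^bsub>A\<^esub> mset_monomial A m) \<in> p"
    then have "finite (\<Union>m\<in>M. set_mset m)" "(\<Union>m\<in>M. set_mset m) \<subseteq> x ` UNIV" by auto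
    then obtain N where N: "finite N" "(\<Union>m\<in>M. set_mset m) = x ` N"
      by (metis finite_subset_image)
    then obtain n where "N \<subseteq> {..<n}" using finite_nat_iff_bounded by blast
    then have "\<forall>m\<in>M. set_mset m \<subseteq> T n" using N(2) unfolding Tx by blast
    moreover have "?I (T n)" using T by blast
    ultimately show "\<forall>m\<in>M. c m \<in> p" using a unfolding indep_mod_def by blast
  qed
  ultimately show thesis by (rule that)
qed

end

lemma RDirProd_simps:
  "carrier (RDirProd R S) = carrier R \<times> carrier S"
  "(a, b) \<otimes>\<^bsub>RDirProd R S\<^esub> (c, d) = (a \<otimes>\<^bsub>R\<^esub> c, b \<otimes>\<^bsub>S\<^esub> d)"
  "(a, b) \<oplus>\<^bsub>RDirProd R S\<^esub> (c, d) = (a \<oplus>\<^bsub>R\<^esub> c, b \<oplus>\<^bsub>S\<^esub> d)"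
  "\<one>\<^bsub>RDirProd R S\<^esub> = (\<one>\<^bsub>R\<^esub>, \<one>\<^bsub>S\<^esub>)" "\<zero>\<^bsub>RDirProd R S\<^esub> = (\<zero>\<^bsub>R\<^esub>, \<zero>\<^bsub>S\<^esub>)"
  by (auto simp: RDirProd_def DirProd_def monoid.defs)

lemma cring_RDirProd:
  assumes "cring R" "cring S"
  shows "cring (RDirProd R S)"
proof -
  interpret R: cring R by fact
  interpret S: cring S by fact
  interpret ring "RDirProd R S" by (rule RDirProd_ring) (rule R.ring_axioms S.ring_axioms)+
  show ?thesis
    by unfold_locales (auto simp: RDirProd_simps R.m_comm S.m_comm)
qed


text \<open>The local ring \<open>C\<close> of the origin in the ring of polynomial functions over \<open>L\<close> receives
  \<open>k[x\<^sub>0, x\<^sub>1, \<dots>]\<close> by sending \<open>x\<^sub>i\<close> to \<open>z\<^sub>i\<close>, the \<open>i\<close>-th coordinate shifted by \<open>y\<^sub>i\<close>. Its graph \<open>\<Gamma>\<close> in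
  \<open>K \<times> C0\<close> maps injectively to \<open>K\<close> because the \<open>x\<^sub>i\<close> are independent, and injectively to \<open>L\<close> by
  evaluation at the origin because the \<open>y\<^sub>i\<close> are. So the quotient field of \<open>\<Gamma>\<close> maps to \<open>K\<close> and to \<open>C\<close>.\<close>

locale generic_pair = k: field k + K: field K + L: field L
  for k :: "('k, 'u) ring_scheme"
    and K :: "('a, 'm) ring_scheme"
    and L :: "('b, 'n) ring_scheme" +
  fixes \<alpha> and \<beta> and x :: "nat \<Rightarrow> 'a" and y :: "nat \<Rightarrow> 'b"
  assumes \<alpha>: "\<alpha> \<in> ring_hom k K" and \<beta>: "\<beta> \<in> ring_hom k L"
    and inj_x: "inj x" and indep_x: "algebraically_indep K (\<alpha> ` carrier k) (range x)"
    and inj_y: "inj y" and indep_y: "algebraically_indep L (\<beta> ` carrier k) (range y)"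
begin

abbreviation C0 where "C0 \<equiv> pfun_ring L"
abbreviation S0 where "S0 \<equiv> carrier C0 - vanishing L {\<lambda>_. \<zero>\<^bsub>L\<^esub>}"
abbreviation C where "C \<equiv> ring_of_fracs C0 S0"
abbreviation W where "W \<equiv> RDirProd K C0"

lemma x_closed: "x i \<in> carrier K" and y_closed: "y i \<in> carrier L"
  using indep_x indep_y unfolding algebraically_indep_def by auto

lemma infinite_L: "infinite (carrier L)"
proof
  assume "finite (carrier L)"
  moreover have "range y \<subseteq> carrier L" using y_closed by auto
  ultimately show False using inj_y range_inj_infinite finite_subset by blast
qed

lemma cring_C0: "cring C0" by (rule L.cring_pfun_ring)

lemma S0_submonoid: "submonoid S0 C0"
  by (rule primeideal.compl_submonoid[OF L.primeideal_origin_ideal[OF infinite_L]])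

lemma cring_C: "cring C"
  by (rule cring.cring_ring_of_fracs[OF cring_C0 S0_submonoid])

lemma not_LFD_C: "\<not> LFD C"
  using L.not_LFD_local_pfuns[OF infinite_L] by (simp add: L.local_pfuns_def localization_at_def)

lemma cring_W: "cring W" by (rule cring_RDirProd[OF K.is_cring cring_C0])

definition \<delta> where "\<delta> c = (\<alpha> c, constf (\<beta> c))"

definition z where "z i = (\<lambda>v. coord L i v \<oplus>\<^bsub>L\<^esub> y i)"

definition u where "u i = (x i, z i)"

definition \<Gamma> where "\<Gamma> = W\<lparr>carrier := polys W (\<delta> ` carrier k) (range u)\<rparr>"

lemma constf_C0: "c \<in> carrier L \<Longrightarrow> constf c \<in> carrier C0"
  using L.constf_mem by (simp add: pfun_ring_simps)

lemma z_eq: "z i = coord L i \<oplus>\<^bsub>C0\<^esub> constf (y i)"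
  by (simp add: z_def pfun_ring_simps constf_def)

lemma coord_C0: "coord L i \<in> carrier C0"
  using L.coord_mem by (simp add: pfun_ring_simps)

lemma z_C0: "z i \<in> carrier C0"
  unfolding z_eq using coord_C0 constf_C0[OF y_closed] by (rule cring_C0[THEN cring.axioms(1), THEN ring.ring_simprules(1)])

lemma u_closed: "range u \<subseteq> carrier W"
  using x_closed z_C0 by (auto simp: u_def RDirProd_simps)

lemma \<delta>_hom: "\<delta> \<in> ring_hom k W"
  using ring_hom_closed[OF \<alpha>] ring_hom_closed[OF \<beta>] ring_hom_mult[OF \<alpha>] ring_hom_mult[OF \<beta>]
    ring_hom_add[OF \<alpha>] ring_hom_add[OF \<beta>] ring_hom_one[OF \<alpha>] ring_hom_one[OF \<beta>]
  by (intro ring_hom_memI)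
    (simp_all add: \<delta>_def RDirProd_simps constf_C0, simp_all add: pfun_ring_simps constf_def[abs_def])

lemma \<delta>_cring_hom: "ring_hom_cring k W \<delta>"
  by (intro ring_hom_cring.intro k.is_cring cring_W ring_hom_cring_axioms.intro \<delta>_hom)

lemma subring_\<delta>: "subring (\<delta> ` carrier k) W"
  by (rule ring_hom_cring.subring_image[OF \<delta>_cring_hom k.carrier_is_subring])

lemma subring_\<Gamma>: "subring (carrier \<Gamma>) W"
  unfolding \<Gamma>_def using cring.subring_polys[OF cring_W subring_\<delta> u_closed] by simp

lemma \<Gamma>_simps [simp]:
  "monoid.mult \<Gamma> = monoid.mult W" "add \<Gamma> = add W" "one \<Gamma> = one W" "ring.zero \<Gamma> = ring.zero W"
  by (simp_all add: \<Gamma>_def)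

lemma cring_\<Gamma>: "cring \<Gamma>"
  using cring.cring_subring[OF cring_W subring_\<Gamma>] by (simp add: \<Gamma>_def)

lemma \<Gamma>_closed: "g \<in> carrier \<Gamma> \<Longrightarrow> g \<in> carrier W"
  using subringE(1)[OF subring_\<Gamma>] by blast

lemma \<delta>_\<Gamma>: "c \<in> carrier k \<Longrightarrow> \<delta> c \<in> carrier \<Gamma>" and u_\<Gamma>: "u i \<in> carrier \<Gamma>"
  using cring.polys_base[OF cring_W subring_\<delta> u_closed] by (auto simp: \<Gamma>_def)

lemma fst_hom: "fst \<in> ring_hom W K"
  by (rule ring_hom_memI) (auto simp: RDirProd_simps)

lemma snd_hom: "snd \<in> ring_hom W C0"
  by (rule ring_hom_memI) (auto simp: RDirProd_simps)

lemma ev_hom: "(\<lambda>g. snd g (\<lambda>_. \<zero>\<^bsub>L\<^esub>)) \<in> ring_hom W L"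
  by (rule ring_hom_memI) (auto simp: RDirProd_simps pfun_ring_simps L.pfuns_closed)

lemma \<Gamma>_fst_eq_zeroD:
  assumes "g \<in> carrier \<Gamma>" "fst g = \<zero>\<^bsub>K\<^esub>"
  shows "g = \<zero>\<^bsub>W\<^esub>"
proof -
  interpret f: ring_hom_cring W K fst
    by (intro ring_hom_cring.intro cring_W K.is_cring ring_hom_cring_axioms.intro fst_hom)
  interpret fk: ring_hom_cring k K \<alpha>
    by (intro ring_hom_cring.intro k.is_cring K.is_cring ring_hom_cring_axioms.intro \<alpha>)
  have img: "fst ` \<delta> ` carrier k = \<alpha> ` carrier k" "fst ` range u = range x"
    by (simp_all add: image_image \<delta>_def u_def)
  show ?thesis
  proof (rule f.polys_hom_eq_zeroD[OF subring_\<delta> u_closed K.one_not_zero])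
    show "c = \<zero>\<^bsub>W\<^esub>" if "c \<in> \<delta> ` carrier k" "fst c = \<zero>\<^bsub>K\<^esub>" for c
      using that fk.field_hom_eq_zeroD[OF k.field_axioms K.one_not_zero]
        ring_hom_cring.hom_zero[OF \<delta>_cring_hom] by (auto simp: \<delta>_def)
    show "inj_on fst (range u)"
      using inj_x by (auto simp: inj_on_def u_def)
    show "algebraically_indep K (fst ` \<delta> ` carrier k) (fst ` range u)"
      unfolding img by (rule indep_x)
  qed (use assms in \<open>simp_all add: \<Gamma>_def\<close>)
qed

lemma \<Gamma>_ev_eq_zeroD:
  assumes "g \<in> carrier \<Gamma>" "snd g (\<lambda>_. \<zero>\<^bsub>L\<^esub>) = \<zero>\<^bsub>L\<^esub>"
  shows "g = \<zero>\<^bsub>W\<^esub>"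
proof -
  let ?ev = "\<lambda>g. snd g (\<lambda>_. \<zero>\<^bsub>L\<^esub>)"
  interpret f: ring_hom_cring W L ?ev
    by (intro ring_hom_cring.intro cring_W L.is_cring ring_hom_cring_axioms.intro ev_hom)
  interpret fk: ring_hom_cring k L \<beta>
    by (intro ring_hom_cring.intro k.is_cring L.is_cring ring_hom_cring_axioms.intro \<beta>)
  have ev_u: "?ev (u i) = y i" for i
    using y_closed by (simp add: u_def z_def coord_def)
  have img: "?ev ` \<delta> ` carrier k = \<beta> ` carrier k" "?ev ` range u = range y"
    by (simp_all add: image_image ev_u) (simp add: \<delta>_def constf_def)
  show ?thesis
  proof (rule f.polys_hom_eq_zeroD[OF subring_\<delta> u_closed L.one_not_zero])
    show "c = \<zero>\<^bsub>W\<^esub>" if "c \<in> \<delta> ` carrier k" "?ev c = \<zero>\<^bsub>L\<^esub>" for c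
      using that fk.field_hom_eq_zeroD[OF k.field_axioms L.one_not_zero]
        ring_hom_cring.hom_zero[OF \<delta>_cring_hom] by (auto simp: \<delta>_def constf_def)
    show "inj_on ?ev (range u)"
      using inj_y by (auto simp: inj_on_def ev_u)
    show "algebraically_indep L (?ev ` \<delta> ` carrier k) (?ev ` range u)"
      unfolding img by (rule indep_y)
  qed (use assms in \<open>simp_all add: \<Gamma>_def\<close>)
qed

text \<open>The ambient product ring has zero divisors, but an element of \<open>\<Gamma>\<close> is
  zero as soon as its first component is, and first components multiply in the field
  \<open>K\<close>.\<close>

lemma domain_\<Gamma>: "domain \<Gamma>"
proof (intro domain.intro cring_\<Gamma> domain_axioms.intro)
  show "\<one>\<^bsub>\<Gamma>\<^esub> \<noteq> \<zero>\<^bsub>\<Gamma>\<^esub>" by (simp add: RDirProd_simps)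
  fix g h assume gh: "g \<otimes>\<^bsub>\<Gamma>\<^esub> h = \<zero>\<^bsub>\<Gamma>\<^esub>" "g \<in> carrier \<Gamma>" "h \<in> carrier \<Gamma>"
  have "fst g \<otimes>\<^bsub>K\<^esub> fst h = \<zero>\<^bsub>K\<^esub>"
    using gh(1) ring_hom_mult[OF fst_hom \<Gamma>_closed[OF gh(2)] \<Gamma>_closed[OF gh(3)]]
    by (simp add: RDirProd_simps)
  moreover have "fst g \<in> carrier K" "fst h \<in> carrier K"
    using ring_hom_closed[OF fst_hom \<Gamma>_closed] gh by blast+
  ultimately have "fst g = \<zero>\<^bsub>K\<^esub> \<or> fst h = \<zero>\<^bsub>K\<^esub>" using K.integral by blast
  then show "g = \<zero>\<^bsub>\<Gamma>\<^esub> \<or> h = \<zero>\<^bsub>\<Gamma>\<^esub>" using \<Gamma>_fst_eq_zeroD[OF gh(2)] \<Gamma>_fst_eq_zeroD[OF gh(3)] by auto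
qed

abbreviation k1 where "k1 \<equiv> quotient_field \<Gamma>"
abbreviation N where "N \<equiv> carrier \<Gamma> - {\<zero>\<^bsub>\<Gamma>\<^esub>}"

lemma N_submonoid: "submonoid N \<Gamma>"
proof -
  interpret \<Gamma>: domain \<Gamma> by (rule domain_\<Gamma>)
  show ?thesis
    by (rule submonoid.intro) (use \<Gamma>.integral \<Gamma>.one_not_zero in \<open>auto simp del: \<Gamma>_simps\<close>)
qed

lemma ring_hom_\<Gamma>: "h \<in> ring_hom W R \<Longrightarrow> h \<in> ring_hom \<Gamma> R"
  using \<Gamma>_closed unfolding ring_hom_def by auto

definition inC where "inC f = frac_of C0 S0 f \<one>\<^bsub>C0\<^esub>"

lemma inC_hom: "inC \<in> ring_hom C0 C"
  unfolding inC_def[abs_def] by (rule cring.frac_of_hom[OF cring_C0 S0_submonoid])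

lemma inC_Units: "f \<in> S0 \<Longrightarrow> inC f \<in> Units C"
  unfolding inC_def
  by (rule cring.frac_of_mem_Units[OF cring_C0 S0_submonoid]) (use submonoid.one_closed[OF S0_submonoid] in auto)

lemma ex_\<eta>K: "\<exists>\<eta>. \<eta> \<in> ring_hom k1 K \<and> (\<forall>g\<in>carrier \<Gamma>. \<eta> (frac_of \<Gamma> N g \<one>\<^bsub>\<Gamma>\<^esub>) = fst g)"
proof -
  interpret f: ring_hom_cring \<Gamma> K fst
    by (intro ring_hom_cring.intro cring_\<Gamma> K.is_cring ring_hom_cring_axioms.intro ring_hom_\<Gamma>[OF fst_hom])
  have "fst g \<in> Units K" if "g \<in> N" for g
    using that \<Gamma>_fst_eq_zeroD[of g] f.hom_closed[of g] by (auto simp: K.field_Units)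
  then show ?thesis
    using f.frac_universal[OF N_submonoid] unfolding quotient_field_def[of \<Gamma>] by metis
qed

text \<open>A non-zero element of \<open>\<Gamma>\<close> has a non-zero value at the origin, so its
  second component is outside the origin ideal and becomes invertible in \<open>C\<close>. This is
  the purpose of shifting the coordinates by \<open>y i\<close>.\<close>

lemma ex_\<eta>C: "\<exists>\<eta>. \<eta> \<in> ring_hom k1 C \<and> (\<forall>g\<in>carrier \<Gamma>. \<eta> (frac_of \<Gamma> N g \<one>\<^bsub>\<Gamma>\<^esub>) = inC (snd g))"
proof -
  interpret f: ring_hom_cring \<Gamma> C "inC \<circ> snd"
    by (intro ring_hom_cring.intro cring_\<Gamma> cring_C ring_hom_cring_axioms.intro
        ring_hom_\<Gamma>[OF ring_hom_trans[OF snd_hom inC_hom]])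
  have "(inC \<circ> snd) g \<in> Units C" if "g \<in> N" for g
  proof -
    have "snd g \<in> carrier C0" using that ring_hom_closed[OF snd_hom \<Gamma>_closed] by blast
    moreover have "snd g (\<lambda>_. \<zero>\<^bsub>L\<^esub>) \<noteq> \<zero>\<^bsub>L\<^esub>" using that \<Gamma>_ev_eq_zeroD[of g] by auto
    ultimately show ?thesis using inC_Units[of "snd g"] by (simp add: vanishing_def)
  qed
  then show ?thesis
    using f.frac_universal[OF N_submonoid] unfolding quotient_field_def[of \<Gamma>] comp_def by metis
qed

lemma frac_\<Gamma>_closed: "g \<in> carrier \<Gamma> \<Longrightarrow> frac_of \<Gamma> N g \<one>\<^bsub>\<Gamma>\<^esub> \<in> carrier k1"
  using ring_hom_closed[OF cring.frac_of_hom[OF cring_\<Gamma> N_submonoid]] by (simp add: quotient_field_def)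

text \<open>In a tensor product over \<open>k1\<close>, the images of \<open>x i\<close> from
  \<open>K\<close> and of \<open>z i\<close> from \<open>C\<close> become equal, and likewise those
  of scalars from \<open>k\<close>. The former lets coordinates be reached from \<open>K\<close>;
  the latter permits a map out of the tensor product over \<open>k\<close>.\<close>

lemma common_subfield:
  "\<exists>\<eta>K \<eta>C. field k1 \<and> \<eta>K \<in> ring_hom k1 K \<and> \<eta>C \<in> ring_hom k1 C
    \<and> (\<forall>c\<in>carrier k. \<exists>g\<in>carrier k1. \<eta>K g = \<alpha> c \<and> \<eta>C g = inC (constf (\<beta> c)))
    \<and> (\<forall>i. \<exists>g\<in>carrier k1. \<eta>K g = x i \<and> \<eta>C g = inC (z i))"
proof -
  obtain \<eta>K where K: "\<eta>K \<in> ring_hom k1 K" "\<And>g. g \<in> carrier \<Gamma> \<Longrightarrow> \<eta>K (frac_of \<Gamma> N g \<one>\<^bsub>\<Gamma>\<^esub>) = fst g"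
    using ex_\<eta>K by blast
  obtain \<eta>C where C: "\<eta>C \<in> ring_hom k1 C" "\<And>g. g \<in> carrier \<Gamma> \<Longrightarrow> \<eta>C (frac_of \<Gamma> N g \<one>\<^bsub>\<Gamma>\<^esub>) = inC (snd g)"
    using ex_\<eta>C by blast
  show ?thesis
  proof (intro exI[of _ \<eta>K] exI[of _ \<eta>C] conjI ballI allI K(1) C(1)
      domain.quotient_field_is_field[OF domain_\<Gamma>])
    show "\<exists>g\<in>carrier k1. \<eta>K g = \<alpha> c \<and> \<eta>C g = inC (constf (\<beta> c))" if c: "c \<in> carrier k" for c
      using K(2)[OF \<delta>_\<Gamma>[OF c]] C(2)[OF \<delta>_\<Gamma>[OF c]]
      by (intro bexI[OF _ frac_\<Gamma>_closed[OF \<delta>_\<Gamma>[OF c]]]) (simp add: \<delta>_def)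
    show "\<exists>g\<in>carrier k1. \<eta>K g = x i \<and> \<eta>C g = inC (z i)" for i
      using K(2)[OF u_\<Gamma>] C(2)[OF u_\<Gamma>]
      by (intro bexI[OF _ frac_\<Gamma>_closed[OF u_\<Gamma>[of i]]]) (simp add: u_def)
  qed
qed

end


text \<open>The elements for which the condition in \<open>dense_hom\<close> holds. They are closed
  under sums, products and division by units, so density can be checked on generators.\<close>

definition frac_image :: "('a, 'm) ring_scheme \<Rightarrow> ('b, 'n) ring_scheme \<Rightarrow> ('a \<Rightarrow> 'b) \<Rightarrow> 'b set"
  where "frac_image R S h = {w \<in> carrier S. \<exists>s\<in>carrier R. \<exists>r\<in>carrier R.
    h s \<in> Units S \<and> h s \<otimes>\<^bsub>S\<^esub> w = h r}"

context ring_hom_cring begin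

lemma dense_homI: "carrier S \<subseteq> frac_image R S h \<Longrightarrow> dense_hom R S h"
  unfolding dense_hom_def frac_image_def by blast

lemma frac_imageI:
  "\<lbrakk>w \<in> carrier S; s \<in> carrier R; r \<in> carrier R; h s \<in> Units S; h s \<otimes>\<^bsub>S\<^esub> w = h r\<rbrakk>
    \<Longrightarrow> w \<in> frac_image R S h"
  unfolding frac_image_def by blast

lemma frac_imageE:
  assumes "w \<in> frac_image R S h"
  obtains s r where "w \<in> carrier S" "s \<in> carrier R" "r \<in> carrier R" "h s \<in> Units S"
    "h s \<otimes>\<^bsub>S\<^esub> w = h r"
  using assms unfolding frac_image_def by blast

lemma hom_mem_frac_image: "r \<in> carrier R \<Longrightarrow> h r \<in> frac_image R S h"
  by (rule frac_imageI[of _ \<one> r]) auto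

lemma frac_image_mult:
  assumes "w \<in> frac_image R S h" "w' \<in> frac_image R S h"
  shows "w \<otimes>\<^bsub>S\<^esub> w' \<in> frac_image R S h"
proof -
  obtain s r where 1: "w \<in> carrier S" "s \<in> carrier R" "r \<in> carrier R" "h s \<in> Units S"
    "h s \<otimes>\<^bsub>S\<^esub> w = h r" using assms(1) by (rule frac_imageE)
  obtain s' r' where 2: "w' \<in> carrier S" "s' \<in> carrier R" "r' \<in> carrier R" "h s' \<in> Units S"
    "h s' \<otimes>\<^bsub>S\<^esub> w' = h r'" using assms(2) by (rule frac_imageE)
  show ?thesis
  proof (rule frac_imageI[of _ "s \<otimes> s'" "r \<otimes> r'"])
    have "h (s \<otimes> s') \<otimes>\<^bsub>S\<^esub> (w \<otimes>\<^bsub>S\<^esub> w') = (h s \<otimes>\<^bsub>S\<^esub> w) \<otimes>\<^bsub>S\<^esub> (h s' \<otimes>\<^bsub>S\<^esub> w')"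
      using 1(1-3) 2(1-3) by (simp add: S.m_ac)
    then show "h (s \<otimes> s') \<otimes>\<^bsub>S\<^esub> (w \<otimes>\<^bsub>S\<^esub> w') = h (r \<otimes> r')"
      unfolding 1(5) 2(5) using 1(3) 2(3) by simp
  qed (use 1 2 in auto)
qed

lemma frac_image_add:
  assumes "w \<in> frac_image R S h" "w' \<in> frac_image R S h"
  shows "w \<oplus>\<^bsub>S\<^esub> w' \<in> frac_image R S h"
proof -
  obtain s r where 1: "w \<in> carrier S" "s \<in> carrier R" "r \<in> carrier R" "h s \<in> Units S"
    "h s \<otimes>\<^bsub>S\<^esub> w = h r" using assms(1) by (rule frac_imageE)
  obtain s' r' where 2: "w' \<in> carrier S" "s' \<in> carrier R" "r' \<in> carrier R" "h s' \<in> Units S"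
    "h s' \<otimes>\<^bsub>S\<^esub> w' = h r'" using assms(2) by (rule frac_imageE)
  show ?thesis
  proof (rule frac_imageI[of _ "s \<otimes> s'" "s' \<otimes> r \<oplus> s \<otimes> r'"])
    have "h (s \<otimes> s') \<otimes>\<^bsub>S\<^esub> (w \<oplus>\<^bsub>S\<^esub> w')
        = h s' \<otimes>\<^bsub>S\<^esub> (h s \<otimes>\<^bsub>S\<^esub> w) \<oplus>\<^bsub>S\<^esub> h s \<otimes>\<^bsub>S\<^esub> (h s' \<otimes>\<^bsub>S\<^esub> w')"
      using 1(1-3) 2(1-3) by (simp add: S.r_distr) (simp add: S.m_ac)
    then show "h (s \<otimes> s') \<otimes>\<^bsub>S\<^esub> (w \<oplus>\<^bsub>S\<^esub> w') = h (s' \<otimes> r \<oplus> s \<otimes> r')"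
      unfolding 1(5) 2(5) using 1(2,3) 2(2,3) by simp
  qed (use 1 2 in auto)
qed

text \<open>The numerator \<open>r\<close> of \<open>e\<close> becomes part of the new denominator:
  its image is a unit, being \<open>h s\<close> times the unit \<open>e\<close>.\<close>

lemma frac_image_divide:
  assumes w: "w \<in> carrier S" and e: "e \<in> frac_image R S h" "e \<in> Units S"
    and e': "e \<otimes>\<^bsub>S\<^esub> w \<in> frac_image R S h"
  shows "w \<in> frac_image R S h"
proof -
  obtain s r where 1: "e \<in> carrier S" "s \<in> carrier R" "r \<in> carrier R" "h s \<in> Units S"
    "h s \<otimes>\<^bsub>S\<^esub> e = h r" using e(1) by (rule frac_imageE)
  obtain s' r' where 2: "e \<otimes>\<^bsub>S\<^esub> w \<in> carrier S" "s' \<in> carrier R" "r' \<in> carrier R" "h s' \<in> Units S"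
    "h s' \<otimes>\<^bsub>S\<^esub> (e \<otimes>\<^bsub>S\<^esub> w) = h r'" using e' by (rule frac_imageE)
  show ?thesis
  proof (rule frac_imageI[of _ "s' \<otimes> r" "s \<otimes> r'"])
    have "h r \<in> Units S" unfolding 1(5)[symmetric] using 1(4) e(2) by auto
    then show "h (s' \<otimes> r) \<in> Units S" using 1 2 by auto
    have "(h s' \<otimes>\<^bsub>S\<^esub> (h s \<otimes>\<^bsub>S\<^esub> e)) \<otimes>\<^bsub>S\<^esub> w = h s \<otimes>\<^bsub>S\<^esub> (h s' \<otimes>\<^bsub>S\<^esub> (e \<otimes>\<^bsub>S\<^esub> w))"
      using w 1(1,2) 2(2) by (simp add: S.m_ac)
    then show "h (s' \<otimes> r) \<otimes>\<^bsub>S\<^esub> w = h (s \<otimes> r')"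
      unfolding 1(5) 2(5) using 1(2,3) 2(2,3) by simp
  qed (use w 1 2 in auto)
qed

lemma hom_Units: "a \<in> Units R \<Longrightarrow> h a \<in> Units S"
proof -
  assume a: "a \<in> Units R"
  then have "h (inv a) \<otimes>\<^bsub>S\<^esub> h a = \<one>\<^bsub>S\<^esub>"
    using hom_mult[OF R.Units_inv_closed[OF a] R.Units_closed[OF a]] by simp
  then show ?thesis
    using a S.m_comm[of "h a" "h (inv a)"] R.Units_inv_closed[OF a] R.Units_closed[OF a]
    unfolding Units_def by auto
qed

end

lemma (in tensor) not_LFD_infinite_trdeg:
  assumes p: "primeideal p A" and q: "primeideal q B"
    and inf: "quot_trdeg k A p = \<infinity>" "quot_trdeg k B q = \<infinity>"
  shows "\<not> LFD T"
proof
  assume LFD: "LFD T"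
  interpret P: algebra_prime k A p by (rule algebra_prime.intro[OF alg_A p])
  interpret Q: algebra_prime k B q by (rule algebra_prime.intro[OF alg_B q])
  obtain x :: "nat \<Rightarrow> 'a" where x: "inj x" "indep_mod A p (scalars k A) (range x)"
    using P.infinite_indep_sequence[OF inf(1)] .
  obtain y :: "nat \<Rightarrow> 'b" where y: "inj y" "indep_mod B q (scalars k B) (range y)"
    using Q.infinite_indep_sequence[OF inf(2)] .
  have xc: "x i \<in> carrier A" and yc: "y i \<in> carrier B" for i
    using indep_mod_closed[OF x(2)] indep_mod_closed[OF y(2)] by auto
  define \<alpha> where "\<alpha> = (\<lambda>c. P.\<rho> (c \<odot>\<^bsub>A\<^esub> \<one>\<^bsub>A\<^esub>))"
  define \<beta> where "\<beta> = (\<lambda>c. Q.\<rho> (c \<odot>\<^bsub>B\<^esub> \<one>\<^bsub>B\<^esub>))"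
  have rx: "inj_on P.\<rho> (range x)" "algebraically_indep P.\<kappa> (\<alpha> ` carrier k) (P.\<rho> ` range x)"
    using P.indep_mod_iff_residue[OF indep_mod_closed[OF x(2)]] x(2)
    by (simp_all add: \<alpha>_def scalars_def image_image)
  have ry: "inj_on Q.\<rho> (range y)" "algebraically_indep Q.\<kappa> (\<beta> ` carrier k) (Q.\<rho> ` range y)"
    using Q.indep_mod_iff_residue[OF indep_mod_closed[OF y(2)]] y(2)
    by (simp_all add: \<beta>_def scalars_def image_image)
  interpret G: generic_pair k P.\<kappa> Q.\<kappa> \<alpha> \<beta> "\<lambda>i. P.\<rho> (x i)" "\<lambda>i. Q.\<rho> (y i)"
  proof (intro generic_pair.intro generic_pair_axioms.intro)
    show "field k" "field P.\<kappa>" "field Q.\<kappa>" by (rule field_k P.residue_field Q.residue_field)+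
    show "\<alpha> \<in> ring_hom k P.\<kappa>"
      using ring_hom_trans[OF A.scalars_hom P.residue_map_hom] by (simp add: \<alpha>_def comp_def)
    show "\<beta> \<in> ring_hom k Q.\<kappa>"
      using ring_hom_trans[OF B.scalars_hom Q.residue_map_hom] by (simp add: \<beta>_def comp_def)
    show "inj (\<lambda>i. P.\<rho> (x i))" using comp_inj_on[OF x(1) rx(1)] by (simp add: comp_def)
    show "inj (\<lambda>i. Q.\<rho> (y i))" using comp_inj_on[OF y(1) ry(1)] by (simp add: comp_def)
    show "algebraically_indep P.\<kappa> (\<alpha> ` carrier k) (range (\<lambda>i. P.\<rho> (x i)))"
      using rx(2) by (simp add: image_image)
    show "algebraically_indep Q.\<kappa> (\<beta> ` carrier k) (range (\<lambda>i. Q.\<rho> (y i)))"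
      using ry(2) by (simp add: image_image)
  qed
  let ?C = G.C
  from G.common_subfield obtain \<eta>K \<eta>C where
    *: "field G.k1 \<and> \<eta>K \<in> ring_hom G.k1 P.\<kappa> \<and> \<eta>C \<in> ring_hom G.k1 ?C
    \<and> (\<forall>c\<in>carrier k. \<exists>g\<in>carrier G.k1. \<eta>K g = \<alpha> c \<and> \<eta>C g = G.inC (constf (\<beta> c)))
    \<and> (\<forall>i. \<exists>g\<in>carrier G.k1. \<eta>K g = P.\<rho> (x i) \<and> \<eta>C g = G.inC (G.z i))"
    by (elim exE)
  then have k1: "field G.k1" and \<eta>K: "\<eta>K \<in> ring_hom G.k1 P.\<kappa>" and \<eta>C: "\<eta>C \<in> ring_hom G.k1 ?C"
    and \<eta>_scalar: "\<And>c. c \<in> carrier k \<Longrightarrow> \<exists>g\<in>carrier G.k1. \<eta>K g = \<alpha> c \<and> \<eta>C g = G.inC (constf (\<beta> c))"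
    and \<eta>_x: "\<And>i. \<exists>g\<in>carrier G.k1. \<eta>K g = P.\<rho> (x i) \<and> \<eta>C g = G.inC (G.z i)"
    by simp_all
  interpret C: cring ?C by (rule G.cring_C)
  interpret C0: cring G.C0 by (rule G.cring_C0)
  interpret inC: ring_hom_cring G.C0 ?C G.inC
    by (intro ring_hom_cring.intro G.cring_C0 G.cring_C ring_hom_cring_axioms.intro G.inC_hom)
  let ?K' = "hom_algebra P.\<kappa> \<eta>K" and ?C' = "hom_algebra ?C \<eta>C"
  have cring_k1: "cring G.k1" using k1 by (simp add: field_def domain_def)
  \<comment> \<open>Scalars now come from the common field, acting through the quotient field of
    \<open>A/p\<close> on the left and through the local ring on the right.\<close>
  interpret T': tensor G.k1 ?K' ?C'
    by (rule tensor.intro[OF k1 algebra_hom_algebra[OF cring_k1 P.\<kappa>.is_cring \<eta>K]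
          algebra_hom_algebra[OF cring_k1 G.cring_C \<eta>C]])
  interpret iK: ring_hom_cring P.\<kappa> T'.T "\<lambda>a. T'.inA a"
    by (intro ring_hom_cring.intro P.\<kappa>.is_cring T'.T.is_cring ring_hom_cring_axioms.intro)
      (use T'.inA_hom in \<open>simp add: ring_hom_hom_algebra\<close>)
  interpret iC: ring_hom_cring ?C T'.T "\<lambda>c. T'.inB c"
    by (intro ring_hom_cring.intro G.cring_C T'.T.is_cring ring_hom_cring_axioms.intro)
      (use T'.inB_hom in \<open>simp add: ring_hom_hom_algebra\<close>)
  \<comment> \<open>Elements of the two factors that come from the same element of the common field
    are identified.\<close>
  have balanced: "T'.inA a = T'.inB c"
    if "g \<in> carrier G.k1" "\<eta>K g = a" "\<eta>C g = c" for g a c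
    using T'.inA_smult_one[OF that(1)] that ring_hom_closed[OF \<eta>K that(1)] ring_hom_closed[OF \<eta>C that(1)]
    by simp
  let ?E = "\<lambda>f. T'.inB (G.inC f)"
  have E_hom: "(\<lambda>f. ?E f) \<in> ring_hom G.C0 T'.T"
    using ring_hom_trans[OF G.inC_hom iC.homh] by (simp add: comp_def)
  have constf_hom: "constf \<in> ring_hom Q.\<kappa> G.C0"
    by (rule ring_hom_memI) (auto simp: G.constf_C0, auto simp: pfun_ring_simps constf_def[abs_def])
  have f: "(\<lambda>a. T'.inA (P.\<rho> a)) \<in> ring_hom A T'.T"
    using ring_hom_trans[OF P.residue_map_hom iK.homh] by (simp add: comp_def)
  have g: "(\<lambda>b. ?E (constf (Q.\<rho> b))) \<in> ring_hom B T'.T"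
    using ring_hom_trans[OF ring_hom_trans[OF Q.residue_map_hom constf_hom]
        E_hom] by (simp add: comp_def)
  have agree: "T'.inA (P.\<rho> (c \<odot>\<^bsub>A\<^esub> \<one>\<^bsub>A\<^esub>)) = ?E (constf (Q.\<rho> (c \<odot>\<^bsub>B\<^esub> \<one>\<^bsub>B\<^esub>)))"
    if "c \<in> carrier k" for c
    using \<eta>_scalar[OF that] balanced unfolding \<alpha>_def \<beta>_def by blast
  have "\<exists>h. h \<in> ring_hom T T'.T \<and> (\<forall>a\<in>carrier A. \<forall>b\<in>carrier B.
    h (pt a b) = T'.inA (P.\<rho> a) \<otimes>\<^bsub>T'.T\<^esub> ?E (constf (Q.\<rho> b)))"
  proof (rule tensor_product_universal[OF alg_A alg_B T'.T.is_cring f g agree])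
    fix h
    assume h: "h \<in> ring_hom T T'.T" and pt: "\<And>a b. \<lbrakk>a \<in> carrier A; b \<in> carrier B\<rbrakk>
      \<Longrightarrow> h (pt a b) = T'.inA (P.\<rho> a) \<otimes>\<^bsub>T'.T\<^esub> ?E (constf (Q.\<rho> b))"
    show "\<exists>h. h \<in> ring_hom T T'.T \<and> (\<forall>a\<in>carrier A. \<forall>b\<in>carrier B.
      h (pt a b) = T'.inA (P.\<rho> a) \<otimes>\<^bsub>T'.T\<^esub> ?E (constf (Q.\<rho> b)))"
      by (intro exI[of _ h] conjI ballI h pt)
  qed
  then obtain h where h': "h \<in> ring_hom T T'.T \<and> (\<forall>a\<in>carrier A. \<forall>b\<in>carrier B.
    h (pt a b) = T'.inA (P.\<rho> a) \<otimes>\<^bsub>T'.T\<^esub> ?E (constf (Q.\<rho> b)))" ..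
  then have h: "h \<in> ring_hom T T'.T"
    and h_pt: "\<And>a b. \<lbrakk>a \<in> carrier A; b \<in> carrier B\<rbrakk>
      \<Longrightarrow> h (pt a b) = T'.inA (P.\<rho> a) \<otimes>\<^bsub>T'.T\<^esub> ?E (constf (Q.\<rho> b))"
    by simp_all
  interpret h: ring_hom_cring T T'.T h
    by (intro ring_hom_cring.intro T.is_cring T'.T.is_cring ring_hom_cring_axioms.intro h)
  have hA: "h (inA a) = T'.inA (P.\<rho> a)" if "a \<in> carrier A" for a
    using h_pt[OF that B.one_closed] ring_hom_one[OF g] ring_hom_closed[OF f that] by simp
  have hB: "h (inB b) = ?E (constf (Q.\<rho> b))" if "b \<in> carrier B" for b
    using h_pt[OF A.one_closed that] ring_hom_one[OF f] ring_hom_closed[OF g that] by simp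
  let ?D = "frac_image T T'.T h"
  have D_K: "T'.inA a \<in> ?D" if a: "a \<in> carrier P.\<kappa>" for a
  proof -
    obtain s r where sr: "s \<in> carrier A" "r \<in> carrier A" "s \<notin> p" "P.\<rho> s \<otimes>\<^bsub>P.\<kappa>\<^esub> a = P.\<rho> r"
      using P.residue_map_frac[OF a] .
    have "P.\<rho> s \<in> Units P.\<kappa>"
      using sr(1,3) P.residue_map_eq_zero_iff[OF sr(1)] by (simp add: P.\<kappa>.field_Units)
    then have "T'.inA (P.\<rho> s) \<in> Units T'.T" by (rule iK.hom_Units)
    moreover have "T'.inA (P.\<rho> s) \<otimes>\<^bsub>T'.T\<^esub> T'.inA a = T'.inA (P.\<rho> r)"
      using iK.hom_mult[OF P.\<rho>.hom_closed[OF sr(1)] a] sr(4) by simp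
    ultimately show ?thesis
      using sr(1,2) a hA by (intro h.frac_imageI[of _ "inA s" "inA r"]) auto
  qed
  have D_const: "?E (constf l) \<in> ?D" if l: "l \<in> carrier Q.\<kappa>" for l
  proof -
    obtain s r where sr: "s \<in> carrier B" "r \<in> carrier B" "s \<notin> q" "Q.\<rho> s \<otimes>\<^bsub>Q.\<kappa>\<^esub> l = Q.\<rho> r"
      using Q.residue_map_frac[OF l] .
    note c = Q.\<rho>.hom_closed[OF sr(1)]
    have "Q.\<rho> s \<noteq> \<zero>\<^bsub>Q.\<kappa>\<^esub>" using sr(1,3) Q.residue_map_eq_zero_iff[OF sr(1)] by simp
    then have "constf (Q.\<rho> s) \<in> G.S0" using G.constf_C0[OF c] by (simp add: vanishing_def constf_def)
    then have "?E (constf (Q.\<rho> s)) \<in> Units T'.T" by (intro iC.hom_Units G.inC_Units)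
    moreover have "?E (constf (Q.\<rho> s)) \<otimes>\<^bsub>T'.T\<^esub> ?E (constf l) = ?E (constf (Q.\<rho> r))"
      using ring_hom_mult[OF ring_hom_trans[OF constf_hom E_hom] c l] sr(4)
      by simp
    moreover have "?E (constf l) \<in> carrier T'.T"
      using G.constf_C0[OF l] by simp
    ultimately show ?thesis
      using sr(1,2) hB by (intro h.frac_imageI[of _ "inB s" "inB r"]) auto
  qed
  have D_pfun: "?E f \<in> ?D" if "f \<in> pfuns Q.\<kappa>" for f
    using that
  proof (induction f rule: Q.\<kappa>.pfuns_induct)
    case (const c)
    then show ?case by (rule D_const)
  next
    case (coord i)
    let ?l = "\<ominus>\<^bsub>Q.\<kappa>\<^esub> Q.\<rho> (y i)"
    have l: "?l \<in> carrier Q.\<kappa>" using yc by simp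
    \<comment> \<open>The shift is undone: \<open>G.z i\<close> is identified with the image of
      \<open>x i\<close> from the other tensor factor, and the constant added to it is a fraction of
      elements coming from \<open>B\<close>.\<close>
    have "coord Q.\<kappa> i = G.z i \<oplus>\<^bsub>G.C0\<^esub> constf ?l"
    proof
      fix v
      have "coord Q.\<kappa> i v \<in> carrier Q.\<kappa>" by (simp add: coord_def)
      then show "coord Q.\<kappa> i v = (G.z i \<oplus>\<^bsub>G.C0\<^esub> constf ?l) v"
        using yc[of i] by (simp add: pfun_ring_simps G.z_def constf_def Q.\<kappa>.a_assoc Q.\<kappa>.r_neg)
    qed
    then have "?E (coord Q.\<kappa> i) = ?E (G.z i) \<oplus>\<^bsub>T'.T\<^esub> ?E (constf ?l)"
      using ring_hom_add[OF E_hom G.z_C0 G.constf_C0[OF l]] by simp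
    moreover have "?E (G.z i) = T'.inA (P.\<rho> (x i))" using \<eta>_x[of i] balanced by metis
    ultimately show ?case
      using h.frac_image_add[OF D_K[OF P.\<rho>.hom_closed[OF xc]] D_const[OF l]] by simp
  next
    case (add f g)
    then have "?E (f \<oplus>\<^bsub>G.C0\<^esub> g) = ?E f \<oplus>\<^bsub>T'.T\<^esub> ?E g"
      by (intro ring_hom_add[OF E_hom]) (simp_all add: pfun_ring_simps(1))
    then show ?case using h.frac_image_add[OF add.IH] by (simp add: pfun_ring_simps(3))
  next
    case (mult f g)
    then have "?E (f \<otimes>\<^bsub>G.C0\<^esub> g) = ?E f \<otimes>\<^bsub>T'.T\<^esub> ?E g"
      by (intro ring_hom_mult[OF E_hom]) (simp_all add: pfun_ring_simps(1))
    then show ?case using h.frac_image_mult[OF mult.IH] by (simp add: pfun_ring_simps(2))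
  qed
  have D_C: "T'.inB c \<in> ?D" if c: "c \<in> carrier ?C" for c
  proof -
    obtain f s where fs: "c = frac_of G.C0 G.S0 f s" "f \<in> carrier G.C0" "s \<in> G.S0"
      using c unfolding C0.ring_of_fracs_carrier[OF G.S0_submonoid] by blast
    have "G.inC s \<otimes>\<^bsub>?C\<^esub> c = G.inC f"
      unfolding fs(1) G.inC_def by (rule C0.frac_of_split[OF G.S0_submonoid fs(2,3)])
    then have eq: "?E s \<otimes>\<^bsub>T'.T\<^esub> T'.inB c = ?E f"
      using iC.hom_mult[OF inC.hom_closed c, of s] fs(3) by simp
    have unit: "?E s \<in> Units T'.T" using fs(3) by (intro iC.hom_Units G.inC_Units)
    have sf: "s \<in> pfuns Q.\<kappa>" "f \<in> pfuns Q.\<kappa>" using fs(2,3) by (simp_all add: pfun_ring_simps(1))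
    show ?thesis
      by (rule h.frac_image_divide[OF iC.hom_closed[OF c] D_pfun[OF sf(1)] unit])
        (unfold eq, rule D_pfun[OF sf(2)])
  qed
  have "w \<in> ?D" if "w \<in> carrier T'.T" for w
    using that
  proof (induction w rule: T'.tensor_induct)
    case zero
    show ?case using h.hom_mem_frac_image[OF T.zero_closed] by simp
  next
    case (pure a c)
    then show ?case
      using h.frac_image_mult[OF D_K[of a] D_C[of c]] T'.pt_split[OF pure] by simp
  next
    case (add v w)
    then show ?case using h.frac_image_add by blast
  qed
  then have "dense_hom T T'.T h" by (intro h.dense_homI) blast
  then have "LFD T'.T" using LFD_dense_hom[OF T.is_cring T'.T.is_cring] LFD by blast
  \<comment> \<open>The left factor is a field and so non-zero; thus local finite-dimensionality
    descends to the right factor, the local ring.\<close>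
  moreover have "\<one>\<^bsub>?K'\<^esub> \<noteq> \<zero>\<^bsub>?K'\<^esub>" by simp
  ultimately have "LFD ?C'" by (rule T'.LFD_right)
  moreover have "dense_hom ?C' ?C (\<lambda>c. c)"
    unfolding dense_hom_def
    by (auto simp: ring_hom_hom_algebra ring_hom_def intro!: bexI[of _ "\<one>\<^bsub>?C\<^esub>"])
  ultimately have "LFD ?C"
    using LFD_dense_hom[OF T'.B.M_cring G.cring_C] by blast
  then show False using G.not_LFD_C by blast
qed

lemma trdeg_le_of_algebra_trdeg:
  assumes "algebra k A" "algebra_trdeg k A < \<infinity>"
  shows "\<exists>d. \<forall>p. primeideal p A \<longrightarrow> trdeg_le k A p d"
proof -
  obtain d where d: "algebra_trdeg k A \<le> enat d"
    using assms(2) unfolding enat_less_infinity_iff by blast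
  have "trdeg_le k A p d" if p: "primeideal p A" for p
  proof (rule algebra_prime.quot_trdeg_le_imp_trdeg_le[OF algebra_prime.intro[OF assms(1) p]])
    show "quot_trdeg k A p \<le> enat d"
      using d p unfolding algebra_trdeg_def by (simp add: SUP_le_iff)
  qed
  then show ?thesis by blast
qed

text \<open>In a domain the zero ideal is prime, and by \<open>trdeg_le_zero_imp\<close> a bound on
  the degree there bounds the degree at every prime.\<close>

lemma algebra_trdeg_finite:
  assumes "field k" "algebra k A" "domain A" and td: "\<forall>p. primeideal p A \<longrightarrow> quot_trdeg k A p < \<infinity>"
  shows "algebra_trdeg k A < \<infinity>"
proof -
  have zero: "primeideal {\<zero>\<^bsub>A\<^esub>} A" by (rule domain.zeroprimeideal[OF assms(3)])
  obtain d where "quot_trdeg k A {\<zero>\<^bsub>A\<^esub>} \<le> enat d"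
    using td zero unfolding enat_less_infinity_iff by blast
  then have d: "trdeg_le k A {\<zero>\<^bsub>A\<^esub>} d"
    by (rule algebra_prime.quot_trdeg_le_imp_trdeg_le[OF algebra_prime.intro[OF assms(2) zero]])
  have "quot_trdeg k A p \<le> enat d" if p: "primeideal p A" for p
    by (rule algebra_prime.trdeg_le_imp_quot_trdeg_le[OF algebra_prime.intro[OF assms(2) p]])
      (rule algebra.trdeg_le_zero_imp[OF assms(2,1) p d])
  then have "algebra_trdeg k A \<le> enat d"
    unfolding algebra_trdeg_def by (auto intro!: SUP_least)
  then show ?thesis unfolding enat_less_infinity_iff by blast
qed

theorem proposition4p1:
  fixes k :: "('k, 'u) ring_scheme"
    and A :: "('k, 'a, 'm) module_scheme"
    and B :: "('k, 'b, 'n) module_scheme"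
  assumes "field k"
    and "algebra k A" and "\<one>\<^bsub>A\<^esub> \<noteq> \<zero>\<^bsub>A\<^esub>"
    and "algebra k B" and "\<one>\<^bsub>B\<^esub> \<noteq> \<zero>\<^bsub>B\<^esub>"
  shows
    "(LFD (tensor_product k A B) \<longrightarrow>
        LFD A \<and> LFD B \<and>
        ((\<forall>p. primeideal p A \<longrightarrow> quot_trdeg k A p < \<infinity>) \<or>
         (\<forall>q. primeideal q B \<longrightarrow> quot_trdeg k B q < \<infinity>)))
     \<and>
     (LFD A \<and> LFD B \<and> (algebra_trdeg k A < \<infinity> \<or> algebra_trdeg k B < \<infinity>) \<longrightarrow>
        LFD (tensor_product k A B))
     \<and>
     (domain A \<and> domain B \<and> LFD (tensor_product k A B) \<longrightarrow>
        LFD A \<and> LFD B \<and> (algebra_trdeg k A < \<infinity> \<or> algebra_trdeg k B < \<infinity>))"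
proof -
  interpret tensor k A B by (rule tensor.intro[OF assms(1,2,4)])
  have swapped: "tensor k B A" by (rule tensor.intro[OF assms(1,4,2)])
  \<comment> \<open>The dichotomy is the contrapositive of \<open>not_LFD_infinite_trdeg\<close>:
    primes of infinite degree, one on each side, contradict \<open>LFD T\<close>.\<close>
  have one: "LFD A \<and> LFD B \<and>
        ((\<forall>p. primeideal p A \<longrightarrow> quot_trdeg k A p < \<infinity>) \<or>
         (\<forall>q. primeideal q B \<longrightarrow> quot_trdeg k B q < \<infinity>))" if "LFD T"
    using LFD_left[OF that assms(5)] LFD_right[OF that assms(3)] not_LFD_infinite_trdeg that
    by (metis enat_ord_simps(4))
  have two: "LFD T" if LFD: "LFD A" "LFD B" and td: "algebra_trdeg k A < \<infinity> \<or> algebra_trdeg k B < \<infinity>"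
    using td
  proof
    assume "algebra_trdeg k A < \<infinity>"
    then show ?thesis using trdeg_le_of_algebra_trdeg[OF assms(2)] LFD_tensor_product[OF LFD] by blast
  next
    assume "algebra_trdeg k B < \<infinity>"
    \<comment> \<open>\<open>LFD_tensor_product\<close> asks for the degree bound on the left
      factor, so the factors are exchanged and then exchanged back.\<close>
    then have "LFD (tensor_product k B A)"
      using trdeg_le_of_algebra_trdeg[OF assms(4)] tensor.LFD_tensor_product[OF swapped LFD(2,1)] by blast
    then show ?thesis by (rule LFD_tensor_swap[OF swapped])
  qed
  \<comment> \<open>For domains, finiteness at each prime in \<open>one\<close> upgrades to
    finiteness of the supremum.\<close>
  show ?thesis
    using one two algebra_trdeg_finite[OF assms(1,2)] algebra_trdeg_finite[OF assms(1,4)] by blast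
qed

end
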